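(* There is a natural functor $$\mathbf{DRSp}\simeq \mathbf{RFib}_{/\mathbb{C}}\longrightarrow \mathbf{IesqSesq}$$ which takes a directed restriction species $R:\mathbb{C}^{\mathrm{op}}\to\mathbf{Grpd}$, with associated right fibration $\mathbb{R}\to\mathbb{C}$, to the comma category projection $\mathbb{R}\downarrow\underline{\Delta}\to\underline{\Delta}$. In particular, this projection is an iesq sesquicartesian fibration.
   Context: Conventions: $\mathbf{Grpd}$ denotes groupoids; functors into $\mathbf{Grpd}$ are pseudo-functors and natural transformations are pseudo-natural. A map of posets $f:K\to P$ is convex if for all $a,b\in K$ and $fa\le x\le fb$ in $P$ there is a unique $k\in K$ with $a\le k\le b$ and $fk=x$ (equivalently $f$ is, up to isomorphism, the inclusion of a full subposet closed under taking elements lying between two of its elements). $\mathbb{C}$ is the category of finite posets and convex maps. A directed restriction species is a pseudo-functor $R:\mathbb{C}^{\mathrm{op}}\to\mathbf{Grpd}$ whose values are locally finite groupoids (all automorphism groups finite); morphisms are pseudo-natural transformations; these form $\mathbf{DRSp}$. Via the Grothendieck construction this is equivalent to $\mathbf{RFib}_{/\mathbb{C}}$, right fibrations $\mathbb{R}\to\mathbb{C}$ (cartesian fibrations with groupoid fibres, here locally finite); objects of $\mathbb{R}$ are pairs $(P,X)$ with $X\in R[P]$, and morphisms $(P',X')\to(P,X)$ are pairs of a convex map $P'\to P$ and an isomorphism from $X'$ to the restriction of $X$ to $P'$. $\underline{\Delta}$ is the category with objects the ordered sets $\underline n=\{1,\dots,n\}$, $n\ge 0$, and monotone maps. A map $j$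 in $\underline\Delta$ is convex if $j(x+1)=j(x)+1$ for all $x$ for which this makes sense; pullbacks along convex maps exist and are convex. An identity-extension square is a commutative square in $\underline\Delta$ consisting of $f:\underline n\to\underline k$, $g=\mathrm{id}_a+f+\mathrm{id}_b:\underline a+\underline n+\underline b\to\underline a+\underline k+\underline b$ and the canonical convex inclusions $j:\underline n\to\underline a+\underline n+\underline b$, $i:\underline k\to\underline a+\underline k+\underline b$. The comma category $\mathbb{R}\downarrow\underline\Delta$ is taken over the category of posets: objects are triples of an object $(P,X)$ of $\mathbb{R}$, an object $\underline k$, and a monotone map $P\to\underline k$; morphisms are pairs of a morphism in $\mathbb{R}$ and a morphism in $\underline\Delta$ making the evident square of posets commute. The projection is to $\underline\Delta$. A sesquicartesian fibration is a cocartesian fibration $X\to\underline\Delta$ that is also cartesian over the subcategory of convex maps and satisfies Beck–Chevalley: for each pullback square $\tau\sigma'=\sigma\tau'$ in $\underline\Delta$ with $\tau$ (hence $\tau'$, opposite to it) convex, the comparison map $\sigma'_!\tau'^*\to\tau^*\sigma_!$ is an isomorphism (lower shriek: cocartesian pushforward; upper star: cartesian pullback). It is iesq if for every identity-extension square, consisting of $f:\underline n\to\underline k$, $g=\mathrm{id}_a+f+\mathrm{id}_b:\underline a+\underline n+\underline b\to\underline a+\underline k+\underline b$ and the canonical convex inclusions $j:\underline n\to\underline a+\underline n+\underline b$, $i:\underline k\to\underline a+\underline k+\underline b$, the square $f_!\,j^*\simeq i^*g_!$ of functors $X_{a+n+b}\to X_n\to X_k$, $X_{a+n+b}\to X_{a+k+b}\to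 X_k$ is a homotopy pullback of categories (equivalent to an iso-comma square), where $X_n$ denotes the fibre over $\underline n$. $\mathbf{IesqSesq}$ has as objects iesq sesquicartesian fibrations, and as morphisms functors $c:X\to Y$ over $\underline\Delta$ that preserve cocartesian arrows and cartesian arrows over convex maps, and such that for every $f:\underline n\to\underline k$ in $\underline\Delta$ the square formed by $f_!:X_n\to X_k$, $f_!:Y_n\to Y_k$ and the components $c:X_n\to Y_n$, $c:X_k\to Y_k$ is a homotopy pullback. *)

theory Defs
  imports "HOL-Library.FuncSet" "HOL-Library.Infinite_Typeclass"
begin

section \<open>Categories, functors, equivalences\<close>

text \<open>Composition is written in applicative order: \<open>g \<cdot>\<^bsub>C\<^esub> f\<close> is \<open>f\<close> followed by \<open>g\<close>.\<close>

record ('o, 'm) cat =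
  Obj :: "'o set"
  Arr :: "'m set"
  Dom :: "'m \<Rightarrow> 'o"
  Cod :: "'m \<Rightarrow> 'o"
  Ident :: "'o \<Rightarrow> 'm"
  Comp :: "'m \<Rightarrow> 'm \<Rightarrow> 'm" (infixr "\<cdot>\<index>" 70)

locale category =
  fixes C :: "('o, 'm) cat" (structure)
  assumes Dom_in: "f \<in> Arr C \<Longrightarrow> Dom C f \<in> Obj C"
    and Cod_in: "f \<in> Arr C \<Longrightarrow> Cod C f \<in> Obj C"
    and Ident_in: "x \<in> Obj C \<Longrightarrow> Ident C x \<in> Arr C"
    and Dom_Ident: "x \<in> Obj C \<Longrightarrow> Dom C (Ident C x) = x"
    and Cod_Ident: "x \<in> Obj C \<Longrightarrow> Cod C (Ident C x) = x"
    and Comp_in: "\<lbrakk>f \<in> Arr C; g \<in> Arr C; Cod C f = Dom C g\<rbrakk> \<Longrightarrow> g \<cdot> f \<in> Arr C"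
    and Dom_Comp: "\<lbrakk>f \<in> Arr C; g \<in> Arr C; Cod C f = Dom C g\<rbrakk> \<Longrightarrow> Dom C (g \<cdot> f) = Dom C f"
    and Cod_Comp: "\<lbrakk>f \<in> Arr C; g \<in> Arr C; Cod C f = Dom C g\<rbrakk> \<Longrightarrow> Cod C (g \<cdot> f) = Cod C g"
    and Comp_Ident: "f \<in> Arr C \<Longrightarrow> f \<cdot> Ident C (Dom C f) = f"
    and Ident_Comp: "f \<in> Arr C \<Longrightarrow> Ident C (Cod C f) \<cdot> f = f"
    and Comp_assoc: "\<lbrakk>f \<in> Arr C; g \<in> Arr C; h \<in> Arr C; Cod C f = Dom C g; Cod C g = Dom C h\<rbrakk>
        \<Longrightarrow> (h \<cdot> g) \<cdot> f = h \<cdot> (g \<cdot> f)"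

definition hom :: "('o, 'm) cat \<Rightarrow> 'o \<Rightarrow> 'o \<Rightarrow> 'm set" where
  "hom C x y = {f \<in> Arr C. Dom C f = x \<and> Cod C f = y}"

definition is_iso :: "('o, 'm) cat \<Rightarrow> 'm \<Rightarrow> bool" where
  "is_iso C f \<longleftrightarrow> f \<in> Arr C \<and>
     (\<exists>g \<in> hom C (Cod C f) (Dom C f). g \<cdot>\<^bsub>C\<^esub> f = Ident C (Dom C f) \<and> f \<cdot>\<^bsub>C\<^esub> g = Ident C (Cod C f))"

definition groupoid :: "('o, 'm) cat \<Rightarrow> bool" where
  "groupoid C \<longleftrightarrow> category C \<and> (\<forall>f \<in> Arr C. is_iso C f)"

definition automorphisms :: "('o, 'm) cat \<Rightarrow> 'o \<Rightarrow> 'm set" where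
  "automorphisms C x = {f \<in> hom C x x. is_iso C f}"

definition locally_finite_groupoid :: "('o, 'm) cat \<Rightarrow> bool" where
  "locally_finite_groupoid C \<longleftrightarrow> groupoid C \<and> (\<forall>x \<in> Obj C. finite (automorphisms C x))"

definition pullback_square :: "('o, 'm) cat \<Rightarrow> 'm \<Rightarrow> 'm \<Rightarrow> 'm \<Rightarrow> 'm \<Rightarrow> bool" where
  "pullback_square C \<tau> \<sigma>' \<sigma> \<tau>' \<longleftrightarrow>
     \<tau> \<in> Arr C \<and> \<sigma>' \<in> Arr C \<and> \<sigma> \<in> Arr C \<and> \<tau>' \<in> Arr C \<and>
     Dom C \<sigma>' = Dom C \<tau>' \<and> Cod C \<sigma>' = Dom C \<tau> \<and> Cod C \<tau>' = Dom C \<sigma> \<and> Cod C \<tau> = Cod C \<sigma> \<and>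
     \<tau> \<cdot>\<^bsub>C\<^esub> \<sigma>' = \<sigma> \<cdot>\<^bsub>C\<^esub> \<tau>' \<and>
     (\<forall>u \<in> Arr C. \<forall>v \<in> Arr C. Dom C u = Dom C v \<and> Cod C u = Dom C \<tau> \<and> Cod C v = Dom C \<sigma> \<and>
        \<tau> \<cdot>\<^bsub>C\<^esub> u = \<sigma> \<cdot>\<^bsub>C\<^esub> v \<longrightarrow>
        (\<exists>!w. w \<in> hom C (Dom C u) (Dom C \<sigma>') \<and> \<sigma>' \<cdot>\<^bsub>C\<^esub> w = u \<and> \<tau>' \<cdot>\<^bsub>C\<^esub> w = v))"

text \<open>
  Functors, natural transformations, and so on are required to be undefined (in the sense of
  \<^const>\<open>extensional\<close>) outside their domain, so that HOL equality of the data is equality of functors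
  and the functor categories below are honest categories.
\<close>

record ('o, 'm, 'p, 'n) func =
  FOb :: "'o \<Rightarrow> 'p"
  FAr :: "'m \<Rightarrow> 'n"

definition is_functor :: "('o, 'm) cat \<Rightarrow> ('p, 'n) cat \<Rightarrow> ('o, 'm, 'p, 'n) func \<Rightarrow> bool" where
  "is_functor C D F \<longleftrightarrow> category C \<and> category D \<and>
     FOb F \<in> Obj C \<rightarrow>\<^sub>E Obj D \<and> FAr F \<in> Arr C \<rightarrow>\<^sub>E Arr D \<and>
     (\<forall>f \<in> Arr C. Dom D (FAr F f) = FOb F (Dom C f) \<and> Cod D (FAr F f) = FOb F (Cod C f)) \<and>
     (\<forall>x \<in> Obj C. FAr F (Ident C x) = Ident D (FOb F x)) \<and>
     (\<forall>f \<in> Arr C. \<forall>g \<in> Arr C. Cod C f = Dom C g \<longrightarrow> FAr F (g \<cdot>\<^bsub>C\<^esub> f) = FAr F g \<cdot>\<^bsub>D\<^esub> FAr F f)"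

definition id_func :: "('o, 'm) cat \<Rightarrow> ('o, 'm, 'o, 'm) func" where
  "id_func C = \<lparr>FOb = \<lambda>x\<in>Obj C. x, FAr = \<lambda>f\<in>Arr C. f\<rparr>"

definition comp_func ::
  "('o, 'm) cat \<Rightarrow> ('p, 'n, 'q, 'r) func \<Rightarrow> ('o, 'm, 'p, 'n) func \<Rightarrow> ('o, 'm, 'q, 'r) func" where
  "comp_func C G F = \<lparr>FOb = compose (Obj C) (FOb G) (FOb F), FAr = compose (Arr C) (FAr G) (FAr F)\<rparr>"

definition restrict_func :: "('o, 'm) cat \<Rightarrow> ('o, 'm, 'p, 'n) func \<Rightarrow> ('o, 'm, 'p, 'n) func" where
  "restrict_func C F = \<lparr>FOb = restrict (FOb F) (Obj C), FAr = restrict (FAr F) (Arr C)\<rparr>"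

definition nat_iso :: "('o, 'm) cat \<Rightarrow> ('p, 'n) cat \<Rightarrow> ('o, 'm, 'p, 'n) func \<Rightarrow> ('o, 'm, 'p, 'n) func
    \<Rightarrow> ('o \<Rightarrow> 'n) \<Rightarrow> bool" where
  "nat_iso C D F G t \<longleftrightarrow> is_functor C D F \<and> is_functor C D G \<and> t \<in> extensional (Obj C) \<and>
     (\<forall>x \<in> Obj C. t x \<in> hom D (FOb F x) (FOb G x) \<and> is_iso D (t x)) \<and>
     (\<forall>f \<in> Arr C. t (Cod C f) \<cdot>\<^bsub>D\<^esub> FAr F f = FAr G f \<cdot>\<^bsub>D\<^esub> t (Dom C f))"

definition is_equivalence :: "('o, 'm) cat \<Rightarrow> ('p, 'n) cat \<Rightarrow> ('o, 'm, 'p, 'n) func \<Rightarrow> bool" where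
  "is_equivalence C D F \<longleftrightarrow> is_functor C D F \<and>
     (\<exists>G s t. is_functor D C G \<and> nat_iso C C (comp_func C G F) (id_func C) s \<and>
        nat_iso D D (comp_func D F G) (id_func D) t)"

definition fully_faithful :: "('o, 'm) cat \<Rightarrow> ('p, 'n) cat \<Rightarrow> ('o, 'm, 'p, 'n) func \<Rightarrow> bool" where
  "fully_faithful C D F \<longleftrightarrow>
     (\<forall>x \<in> Obj C. \<forall>y \<in> Obj C. bij_betw (FAr F) (hom C x y) (hom D (FOb F x) (FOb F y)))"


section \<open>Homotopy pullbacks of categories\<close>

type_synonym ('b, 'c, 'w) ic_ob = "'b \<times> 'c \<times> 'w"
type_synonym ('b, 'u, 'c, 'v, 'w) ic_ar = "('b, 'c, 'w) ic_ob \<times> ('b, 'c, 'w) ic_ob \<times> 'u \<times> 'v"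

definition iso_comma :: "('b, 'u) cat \<Rightarrow> ('c, 'v) cat \<Rightarrow> ('d, 'w) cat \<Rightarrow> ('b, 'u, 'd, 'w) func \<Rightarrow>
    ('c, 'v, 'd, 'w) func \<Rightarrow> (('b, 'c, 'w) ic_ob, ('b, 'u, 'c, 'v, 'w) ic_ar) cat" where
  "iso_comma B C D G H =
    (let obs = {(b, c, \<theta>). b \<in> Obj B \<and> c \<in> Obj C \<and> \<theta> \<in> hom D (FOb G b) (FOb H c) \<and> is_iso D \<theta>} in
     \<lparr>Obj = obs,
      Arr = {((b, c, \<theta>), (b', c', \<theta>'), u, v).
               (b, c, \<theta>) \<in> obs \<and> (b', c', \<theta>') \<in> obs \<and> u \<in> hom B b b' \<and> v \<in> hom C c c' \<and>
               \<theta>' \<cdot>\<^bsub>D\<^esub> FAr G u = FAr H v \<cdot>\<^bsub>D\<^esub> \<theta>},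
      Dom = \<lambda>(s, t, u, v). s,
      Cod = \<lambda>(s, t, u, v). t,
      Ident = \<lambda>(b, c, \<theta>). ((b, c, \<theta>), (b, c, \<theta>), Ident B b, Ident C c),
      Comp = \<lambda>(s', t', u', v') (s, t, u, v). (s, t', u' \<cdot>\<^bsub>B\<^esub> u, v' \<cdot>\<^bsub>C\<^esub> v)\<rparr>)"

definition to_iso_comma :: "('a, 'z) cat \<Rightarrow> ('a, 'z, 'b, 'u) func \<Rightarrow> ('a, 'z, 'c, 'v) func \<Rightarrow>
    ('a \<Rightarrow> 'w) \<Rightarrow> ('a, 'z, ('b, 'c, 'w) ic_ob, ('b, 'u, 'c, 'v, 'w) ic_ar) func" where
  "to_iso_comma A P Q \<theta> =
    (let ob = (\<lambda>a. (FOb P a, FOb Q a, \<theta> a)) in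
     \<lparr>FOb = restrict ob (Obj A),
      FAr = \<lambda>z\<in>Arr A. (ob (Dom A z), ob (Cod A z), FAr P z, FAr Q z)\<rparr>)"

text \<open>The square with \<open>P : A \<rightarrow> B\<close>, \<open>Q : A \<rightarrow> C\<close>, \<open>G : B \<rightarrow> D\<close>, \<open>H : C \<rightarrow> D\<close>, commuting up to the
  natural isomorphism \<open>\<theta> : G P \<cong> H Q\<close>.\<close>

definition homotopy_pullback :: "('a, 'z) cat \<Rightarrow> ('b, 'u) cat \<Rightarrow> ('c, 'v) cat \<Rightarrow> ('d, 'w) cat \<Rightarrow>
    ('a, 'z, 'b, 'u) func \<Rightarrow> ('a, 'z, 'c, 'v) func \<Rightarrow> ('b, 'u, 'd, 'w) func \<Rightarrow> ('c, 'v, 'd, 'w) func \<Rightarrow>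
    ('a \<Rightarrow> 'w) \<Rightarrow> bool" where
  "homotopy_pullback A B C D P Q G H \<theta> \<longleftrightarrow>
     is_functor A B P \<and> is_functor A C Q \<and> is_functor B D G \<and> is_functor C D H \<and>
     nat_iso A D (comp_func A G P) (comp_func A H Q) \<theta> \<and>
     is_equivalence A (iso_comma B C D G H) (to_iso_comma A P Q \<theta>)"


section \<open>Categories over a base, cartesian and cocartesian arrows\<close>

definition cartesian ::
  "('o, 'm) cat \<Rightarrow> ('b, 'k) cat \<Rightarrow> ('o, 'm, 'b, 'k) func \<Rightarrow> 'm \<Rightarrow> bool" where
  "cartesian X B p u \<longleftrightarrow> u \<in> Arr X \<and>
     (\<forall>v \<in> Arr X. \<forall>\<rho> \<in> hom B (FOb p (Dom X v)) (FOb p (Dom X u)).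
        Cod X v = Cod X u \<and> FAr p u \<cdot>\<^bsub>B\<^esub> \<rho> = FAr p v \<longrightarrow>
        (\<exists>!w. w \<in> hom X (Dom X v) (Dom X u) \<and> FAr p w = \<rho> \<and> u \<cdot>\<^bsub>X\<^esub> w = v))"

definition cocartesian ::
  "('o, 'm) cat \<Rightarrow> ('b, 'k) cat \<Rightarrow> ('o, 'm, 'b, 'k) func \<Rightarrow> 'm \<Rightarrow> bool" where
  "cocartesian X B p u \<longleftrightarrow> u \<in> Arr X \<and>
     (\<forall>v \<in> Arr X. \<forall>\<rho> \<in> hom B (FOb p (Cod X u)) (FOb p (Cod X v)).
        Dom X v = Dom X u \<and> \<rho> \<cdot>\<^bsub>B\<^esub> FAr p u = FAr p v \<longrightarrow>
        (\<exists>!w. w \<in> hom X (Cod X u) (Cod X v) \<and> FAr p w = \<rho> \<and> w \<cdot>\<^bsub>X\<^esub> u = v))"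

definition is_cart_lift ::
  "('o, 'm) cat \<Rightarrow> ('b, 'k) cat \<Rightarrow> ('o, 'm, 'b, 'k) func \<Rightarrow> 'k \<Rightarrow> 'o \<Rightarrow> 'm \<Rightarrow> bool" where
  "is_cart_lift X B p \<tau> x u \<longleftrightarrow> cartesian X B p u \<and> FAr p u = \<tau> \<and> Cod X u = x"

definition is_cocart_lift ::
  "('o, 'm) cat \<Rightarrow> ('b, 'k) cat \<Rightarrow> ('o, 'm, 'b, 'k) func \<Rightarrow> 'k \<Rightarrow> 'o \<Rightarrow> 'm \<Rightarrow> bool" where
  "is_cocart_lift X B p \<sigma> x u \<longleftrightarrow> cocartesian X B p u \<and> FAr p u = \<sigma> \<and> Dom X u = x"

text \<open>Cartesian lifts are asked for along all arrows of the base satisfying \<open>S\<close>.\<close>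

definition cartesian_fibration_over ::
  "('o, 'm) cat \<Rightarrow> ('b, 'k) cat \<Rightarrow> ('o, 'm, 'b, 'k) func \<Rightarrow> ('k \<Rightarrow> bool) \<Rightarrow> bool" where
  "cartesian_fibration_over X B p S \<longleftrightarrow> is_functor X B p \<and>
     (\<forall>\<tau> \<in> Arr B. \<forall>x \<in> Obj X. S \<tau> \<and> FOb p x = Cod B \<tau> \<longrightarrow> (\<exists>u. is_cart_lift X B p \<tau> x u))"

definition cocartesian_fibration ::
  "('o, 'm) cat \<Rightarrow> ('b, 'k) cat \<Rightarrow> ('o, 'm, 'b, 'k) func \<Rightarrow> bool" where
  "cocartesian_fibration X B p \<longleftrightarrow> is_functor X B p \<and>
     (\<forall>\<sigma> \<in> Arr B. \<forall>x \<in> Obj X. FOb p x = Dom B \<sigma> \<longrightarrow> (\<exists>u. is_cocart_lift X B p \<sigma> x u))"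

definition fibre ::
  "('o, 'm) cat \<Rightarrow> ('b, 'k) cat \<Rightarrow> ('o, 'm, 'b, 'k) func \<Rightarrow> 'b \<Rightarrow> ('o, 'm) cat" where
  "fibre X B p b =
     X\<lparr>Obj := {x \<in> Obj X. FOb p x = b}, Arr := {u \<in> Arr X. FAr p u = Ident B b}\<rparr>"

text \<open>
  Chosen lifts. All notions built from them below are invariant under changing the choice,
  which changes pushforward and pullback functors by canonical natural isomorphisms.
\<close>

definition cart_lift ::
  "('o, 'm) cat \<Rightarrow> ('b, 'k) cat \<Rightarrow> ('o, 'm, 'b, 'k) func \<Rightarrow> 'k \<Rightarrow> 'o \<Rightarrow> 'm" where
  "cart_lift X B p \<tau> x = (SOME u. is_cart_lift X B p \<tau> x u)"

definition cocart_lift ::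
  "('o, 'm) cat \<Rightarrow> ('b, 'k) cat \<Rightarrow> ('o, 'm, 'b, 'k) func \<Rightarrow> 'k \<Rightarrow> 'o \<Rightarrow> 'm" where
  "cocart_lift X B p \<sigma> x = (SOME u. is_cocart_lift X B p \<sigma> x u)"

text \<open>\<open>\<sigma>\<^sub>!\<close>, from the fibre over the domain of \<open>\<sigma>\<close> to the fibre over its codomain.\<close>

definition pushforward ::
  "('o, 'm) cat \<Rightarrow> ('b, 'k) cat \<Rightarrow> ('o, 'm, 'b, 'k) func \<Rightarrow> 'k \<Rightarrow> ('o, 'm, 'o, 'm) func" where
  "pushforward X B p \<sigma> =
    (let F = fibre X B p (Dom B \<sigma>); l = cocart_lift X B p \<sigma> in
     \<lparr>FOb = \<lambda>x\<in>Obj F. Cod X (l x),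
      FAr = \<lambda>u\<in>Arr F. THE w. w \<in> hom X (Cod X (l (Dom X u))) (Cod X (l (Cod X u))) \<and>
              FAr p w = Ident B (Cod B \<sigma>) \<and> w \<cdot>\<^bsub>X\<^esub> l (Dom X u) = l (Cod X u) \<cdot>\<^bsub>X\<^esub> u\<rparr>)"

text \<open>\<open>\<tau>\<^sup>*\<close>, from the fibre over the codomain of \<open>\<tau>\<close> to the fibre over its domain.\<close>

definition pullback ::
  "('o, 'm) cat \<Rightarrow> ('b, 'k) cat \<Rightarrow> ('o, 'm, 'b, 'k) func \<Rightarrow> 'k \<Rightarrow> ('o, 'm, 'o, 'm) func" where
  "pullback X B p \<tau> =
    (let F = fibre X B p (Cod B \<tau>); l = cart_lift X B p \<tau> in
     \<lparr>FOb = \<lambda>x\<in>Obj F. Dom X (l x),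
      FAr = \<lambda>u\<in>Arr F. THE w. w \<in> hom X (Dom X (l (Dom X u))) (Dom X (l (Cod X u))) \<and>
              FAr p w = Ident B (Dom B \<tau>) \<and> l (Cod X u) \<cdot>\<^bsub>X\<^esub> w = u \<cdot>\<^bsub>X\<^esub> l (Dom X u)\<rparr>)"

text \<open>
  For \<open>\<tau> \<sigma>' = \<sigma> \<tau>'\<close> the comparison \<open>\<sigma>'\<^sub>! \<tau>'\<^sup>* x \<rightarrow> \<tau>\<^sup>* \<sigma>\<^sub>! x\<close> is the unique vertical arrow through which
  \<open>\<tau>'\<^sup>* x \<rightarrow> x \<rightarrow> \<sigma>\<^sub>! x\<close> factors along \<open>\<tau>'\<^sup>* x \<rightarrow> \<sigma>'\<^sub>! \<tau>'\<^sup>* x\<close> and \<open>\<tau>\<^sup>* \<sigma>\<^sub>! x \<rightarrow> \<sigma>\<^sub>! x\<close>.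
\<close>

definition bc_comparison :: "('o, 'm) cat \<Rightarrow> ('b, 'k) cat \<Rightarrow> ('o, 'm, 'b, 'k) func \<Rightarrow>
    'k \<Rightarrow> 'k \<Rightarrow> 'k \<Rightarrow> 'k \<Rightarrow> 'o \<Rightarrow> 'm" where
  "bc_comparison X B p \<tau> \<sigma>' \<sigma> \<tau>' =
    (\<lambda>x\<in>Obj (fibre X B p (Dom B \<sigma>)).
       let c = cart_lift X B p \<tau>' x; d = cocart_lift X B p \<sigma> x;
           d' = cocart_lift X B p \<sigma>' (Dom X c); c' = cart_lift X B p \<tau> (Cod X d)
       in THE w. w \<in> hom X (Cod X d') (Dom X c') \<and> FAr p w = Ident B (Cod B \<sigma>') \<and>
            c' \<cdot>\<^bsub>X\<^esub> (w \<cdot>\<^bsub>X\<^esub> d') = d \<cdot>\<^bsub>X\<^esub> c)"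

text \<open>A category over \<open>B\<close> is a pair of a category and a functor to \<open>B\<close>. Functors over \<open>B\<close> commute
  strictly with the projections.\<close>

type_synonym ('o, 'm, 'b, 'k) over = "('o, 'm) cat \<times> ('o, 'm, 'b, 'k) func"
type_synonym ('o, 'm, 'b, 'k) over_ar =
  "('o, 'm, 'b, 'k) over \<times> ('o, 'm, 'b, 'k) over \<times> ('o, 'm, 'o, 'm) func"

definition functor_over :: "('o, 'm, 'b, 'k) over \<Rightarrow> ('o1, 'm1, 'b, 'k) over \<Rightarrow>
    ('o, 'm, 'o1, 'm1) func \<Rightarrow> bool" where
  "functor_over S T c \<longleftrightarrow> is_functor (fst S) (fst T) c \<and> comp_func (fst S) (snd T) c = snd S"

definition isomorphic_over :: "('o, 'm, 'b, 'k) over \<Rightarrow> ('o1, 'm1, 'b, 'k) over \<Rightarrow> bool" where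
  "isomorphic_over S T \<longleftrightarrow> (\<exists>c d. functor_over S T c \<and> functor_over T S d \<and>
     comp_func (fst S) d c = id_func (fst S) \<and> comp_func (fst T) c d = id_func (fst T))"

definition over_category ::
  "('o, 'm, 'b, 'k) over set \<Rightarrow>
   (('o, 'm, 'b, 'k) over \<Rightarrow> ('o, 'm, 'b, 'k) over \<Rightarrow> ('o, 'm, 'o, 'm) func \<Rightarrow> bool) \<Rightarrow>
   (('o, 'm, 'b, 'k) over, ('o, 'm, 'b, 'k) over_ar) cat" where
  "over_category obs mor =
     \<lparr>Obj = obs,
      Arr = {(S, T, c). S \<in> obs \<and> T \<in> obs \<and> functor_over S T c \<and> mor S T c},
      Dom = \<lambda>(S, T, c). S,
      Cod = \<lambda>(S, T, c). T,
      Ident = \<lambda>S. (S, S, id_func (fst S)),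
      Comp = \<lambda>(S', T', c') (S, T, c). (S, T', comp_func (fst S) c' c)\<rparr>"


section \<open>Finite posets and convex maps\<close>

text \<open>Posets are carried by subsets of a type \<open>'a\<close>, assumed infinite so that every finite poset occurs
  up to isomorphism. Maps of posets carry their domain and codomain.\<close>

type_synonym 'a poset = "'a set \<times> 'a rel"
type_synonym 'a poset_map = "'a poset \<times> 'a poset \<times> ('a \<Rightarrow> 'a)"

definition finite_poset :: "'a poset \<Rightarrow> bool" where
  "finite_poset P \<longleftrightarrow> finite (fst P) \<and> partial_order_on (fst P) (snd P)"

definition convex_map :: "'a poset \<Rightarrow> 'a poset \<Rightarrow> ('a \<Rightarrow> 'a) \<Rightarrow> bool" where
  "convex_map K P f \<longleftrightarrow> f \<in> fst K \<rightarrow>\<^sub>E fst P \<and> (\<forall>(a, b) \<in> snd K. (f a, f b) \<in> snd P) \<and>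
     (\<forall>a \<in> fst K. \<forall>b \<in> fst K. \<forall>x \<in> fst P. (f a, x) \<in> snd P \<and> (x, f b) \<in> snd P \<longrightarrow>
        (\<exists>!k. k \<in> fst K \<and> (a, k) \<in> snd K \<and> (k, b) \<in> snd K \<and> f k = x))"

definition CPos :: "('a::infinite poset, 'a poset_map) cat" where
  "CPos = \<lparr>Obj = {P. finite_poset P},
           Arr = {(K, P, f). finite_poset K \<and> finite_poset P \<and> convex_map K P f},
           Dom = \<lambda>(K, P, f). K,
           Cod = \<lambda>(K, P, f). P,
           Ident = \<lambda>P. (P, P, \<lambda>a\<in>fst P. a),
           Comp = \<lambda>(K', P', g) (K, P, f). (K, P', compose (fst K) g f)\<rparr>"


section \<open>Finite ordinals, including the empty one\<close>

text \<open>The object \<open>n\<close> stands for the ordered set \<open>{1..n}\<close>.\<close>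

type_synonym ord_map = "nat \<times> nat \<times> (nat \<Rightarrow> nat)"

definition Ords :: "(nat, ord_map) cat" where
  "Ords = \<lparr>Obj = UNIV,
           Arr = {(n, k, f). f \<in> {1..n} \<rightarrow>\<^sub>E {1..k} \<and> mono_on {1..n} f},
           Dom = \<lambda>(n, k, f). n,
           Cod = \<lambda>(n, k, f). k,
           Ident = \<lambda>n. (n, n, \<lambda>x\<in>{1..n}. x),
           Comp = \<lambda>(n', k', g) (n, k, f). (n, k', compose {1..n} g f)\<rparr>"

definition convex_ord :: "ord_map \<Rightarrow> bool" where
  "convex_ord = (\<lambda>(n, k, j). \<forall>x. x \<in> {1..n} \<and> x + 1 \<in> {1..n} \<longrightarrow> j (x + 1) = j x + 1)"

text \<open>The canonical inclusion of \<open>n\<close> into \<open>a + n + b\<close>, and the map \<open>id\<^sub>a + f + id\<^sub>b\<close>.\<close>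

definition ord_incl :: "nat \<Rightarrow> nat \<Rightarrow> nat \<Rightarrow> ord_map" where
  "ord_incl a n b = (n, a + n + b, \<lambda>x\<in>{1..n}. a + x)"

definition ord_extend :: "nat \<Rightarrow> nat \<Rightarrow> ord_map \<Rightarrow> ord_map" where
  "ord_extend a b = (\<lambda>(n, k, f). (a + n + b, a + k + b,
     \<lambda>x\<in>{1..a + n + b}. if x \<le> a then x else if x \<le> a + n then a + f (x - a) else x - n + k))"


section \<open>Iesq sesquicartesian fibrations\<close>

definition sesquicartesian ::
  "('o, 'm) cat \<Rightarrow> ('o, 'm, nat, ord_map) func \<Rightarrow> bool" where
  "sesquicartesian X p \<longleftrightarrow> cocartesian_fibration X Ords p \<and>
     cartesian_fibration_over X Ords p convex_ord \<and>
     (\<forall>\<tau> \<sigma>' \<sigma> \<tau>'. pullback_square Ords \<tau> \<sigma>' \<sigma> \<tau>' \<and> convex_ord \<tau> \<longrightarrow>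
        (\<forall>x \<in> Obj (fibre X Ords p (Dom Ords \<sigma>)).
           is_iso (fibre X Ords p (Dom Ords \<tau>)) (bc_comparison X Ords p \<tau> \<sigma>' \<sigma> \<tau>' x)))"

definition iesq :: "('o, 'm) cat \<Rightarrow> ('o, 'm, nat, ord_map) func \<Rightarrow> bool" where
  "iesq X p \<longleftrightarrow> (\<forall>a b n k. \<forall>f \<in> hom Ords n k.
     let g = ord_extend a b f; j = ord_incl a n b; i = ord_incl a k b in
     homotopy_pullback
       (fibre X Ords p (a + n + b)) (fibre X Ords p n)
       (fibre X Ords p (a + k + b)) (fibre X Ords p k)
       (pullback X Ords p j) (pushforward X Ords p g)
       (pushforward X Ords p f) (pullback X Ords p i)
       (bc_comparison X Ords p i f g j))"

text \<open>The canonical \<open>f\<^sub>! (c x) \<rightarrow> c (f\<^sub>! x)\<close>, for \<open>c\<close> a functor over the base and \<open>x\<close> over the domain of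
  \<open>f\<close>. It is invertible when \<open>c\<close> preserves cocartesian arrows.\<close>

definition push_comparison :: "('b, 'k) cat \<Rightarrow> ('o, 'm, 'b, 'k) over \<Rightarrow> ('o1, 'm1, 'b, 'k) over \<Rightarrow>
    ('o, 'm, 'o1, 'm1) func \<Rightarrow> 'k \<Rightarrow> 'o \<Rightarrow> 'm1" where
  "push_comparison B = (\<lambda>(X, p) (Y, q) c f.
     \<lambda>x\<in>Obj (fibre X B p (Dom B f)).
       let l = cocart_lift X B p f x; l' = cocart_lift Y B q f (FOb c x)
       in THE w. w \<in> hom Y (Cod Y l') (FOb c (Cod X l)) \<and> FAr q w = Ident B (Cod B f) \<and>
            w \<cdot>\<^bsub>Y\<^esub> l' = FAr c l)"

definition iesq_sesq_morphism :: "('o, 'm, nat, ord_map) over \<Rightarrow> ('o1, 'm1, nat, ord_map) over \<Rightarrow>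
    ('o, 'm, 'o1, 'm1) func \<Rightarrow> bool" where
  "iesq_sesq_morphism = (\<lambda>(X, p) (Y, q) c.
     (\<forall>u. cocartesian X Ords p u \<longrightarrow> cocartesian Y Ords q (FAr c u)) \<and>
     (\<forall>u. cartesian X Ords p u \<and> convex_ord (FAr p u) \<longrightarrow> cartesian Y Ords q (FAr c u)) \<and>
     (\<forall>n k. \<forall>f \<in> hom Ords n k.
        homotopy_pullback
          (fibre X Ords p n) (fibre Y Ords q n) (fibre X Ords p k) (fibre Y Ords q k)
          (restrict_func (fibre X Ords p n) c) (pushforward X Ords p f)
          (pushforward Y Ords q f) (restrict_func (fibre X Ords p k) c)
          (push_comparison Ords (X, p) (Y, q) c f)))"

definition IesqSesq ::
  "(('o, 'm, nat, ord_map) over, ('o, 'm, nat, ord_map) over_ar) cat" where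
  "IesqSesq = over_category {(X, p). sesquicartesian X p \<and> iesq X p} iesq_sesq_morphism"


section \<open>Right fibrations over the category of finite posets and convex maps\<close>

definition right_fibration :: "('o, 'm) cat \<Rightarrow> ('b, 'k) cat \<Rightarrow> ('o, 'm, 'b, 'k) func \<Rightarrow> bool" where
  "right_fibration E B p \<longleftrightarrow> cartesian_fibration_over E B p (\<lambda>_. True) \<and>
     (\<forall>b \<in> Obj B. groupoid (fibre E B p b))"

type_synonym ('a, 'o, 'm) cover = "('o, 'm, 'a poset, 'a poset_map) over"
type_synonym ('a, 'o, 'm) cover_ar = "('o, 'm, 'a poset, 'a poset_map) over_ar"

definition RFib :: "(('a::infinite, 'o, 'm) cover, ('a, 'o, 'm) cover_ar) cat" where
  "RFib = over_category
     {(E, p). right_fibration E CPos p \<and> (\<forall>P \<in> Obj CPos. locally_finite_groupoid (fibre E CPos p P))}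
     (\<lambda>_ _ _. True)"


section \<open>Directed restriction species\<close>

text \<open>
  Pseudo-functors \<open>R : B\<^sup>o\<^sup>p \<rightarrow> Grpd\<close>, and pseudo-natural transformations between them.
  For \<open>f : P' \<rightarrow> P\<close> and \<open>g : P \<rightarrow> Q\<close> in \<open>B\<close>, \<open>RAr R f\<close> is the restriction functor \<open>R[P] \<rightarrow> R[P']\<close>, and
  \<open>RComp R g f X : f\<^sup>* (g\<^sup>* X) \<rightarrow> (g f)\<^sup>* X\<close> and \<open>RUnit R P X : X \<rightarrow> id\<^sup>* X\<close> are the coherence
  isomorphisms. For \<open>\<eta> : R \<rightarrow> S\<close>, \<open>NAr \<eta> f X : \<eta> (f\<^sup>* X) \<rightarrow> f\<^sup>* (\<eta> X)\<close>.
\<close>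

record ('b, 'k, 'o, 'm) pseudo_func =
  ROb :: "'b \<Rightarrow> ('o, 'm) cat"
  RAr :: "'k \<Rightarrow> ('o, 'm, 'o, 'm) func"
  RComp :: "'k \<Rightarrow> 'k \<Rightarrow> 'o \<Rightarrow> 'm"
  RUnit :: "'b \<Rightarrow> 'o \<Rightarrow> 'm"

definition pseudo_functor :: "('b, 'k) cat \<Rightarrow> ('b, 'k, 'o, 'm) pseudo_func \<Rightarrow> bool" where
  "pseudo_functor B R \<longleftrightarrow> category B \<and>
     (\<forall>P \<in> Obj B. groupoid (ROb R P)) \<and>
     (\<forall>f \<in> Arr B. is_functor (ROb R (Cod B f)) (ROb R (Dom B f)) (RAr R f)) \<and>
     (\<forall>f \<in> Arr B. \<forall>g \<in> Arr B. Cod B f = Dom B g \<longrightarrow>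
        nat_iso (ROb R (Cod B g)) (ROb R (Dom B f))
          (comp_func (ROb R (Cod B g)) (RAr R f) (RAr R g)) (RAr R (g \<cdot>\<^bsub>B\<^esub> f)) (RComp R g f)) \<and>
     (\<forall>P \<in> Obj B. nat_iso (ROb R P) (ROb R P) (id_func (ROb R P)) (RAr R (Ident B P)) (RUnit R P)) \<and>
     (\<forall>f \<in> Arr B. \<forall>g \<in> Arr B. \<forall>h \<in> Arr B. Cod B f = Dom B g \<and> Cod B g = Dom B h \<longrightarrow>
        (\<forall>X \<in> Obj (ROb R (Cod B h)).
           RComp R (h \<cdot>\<^bsub>B\<^esub> g) f X \<cdot>\<^bsub>ROb R (Dom B f)\<^esub> FAr (RAr R f) (RComp R h g X) =
           RComp R h (g \<cdot>\<^bsub>B\<^esub> f) X \<cdot>\<^bsub>ROb R (Dom B f)\<^esub> RComp R g f (FOb (RAr R h) X))) \<and>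
     (\<forall>f \<in> Arr B. \<forall>X \<in> Obj (ROb R (Cod B f)).
        RComp R f (Ident B (Dom B f)) X \<cdot>\<^bsub>ROb R (Dom B f)\<^esub> RUnit R (Dom B f) (FOb (RAr R f) X) =
          Ident (ROb R (Dom B f)) (FOb (RAr R f) X) \<and>
        RComp R (Ident B (Cod B f)) f X \<cdot>\<^bsub>ROb R (Dom B f)\<^esub> FAr (RAr R f) (RUnit R (Cod B f) X) =
          Ident (ROb R (Dom B f)) (FOb (RAr R f) X))"

record ('b, 'k, 'o, 'm) pseudo_nat =
  NOb :: "'b \<Rightarrow> ('o, 'm, 'o, 'm) func"
  NAr :: "'k \<Rightarrow> 'o \<Rightarrow> 'm"

definition pseudo_natural :: "('b, 'k) cat \<Rightarrow> ('b, 'k, 'o, 'm) pseudo_func \<Rightarrow>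
    ('b, 'k, 'o, 'm) pseudo_func \<Rightarrow> ('b, 'k, 'o, 'm) pseudo_nat \<Rightarrow> bool" where
  "pseudo_natural B R S \<eta> \<longleftrightarrow>
     NOb \<eta> \<in> extensional (Obj B) \<and> NAr \<eta> \<in> extensional (Arr B) \<and>
     (\<forall>P \<in> Obj B. is_functor (ROb R P) (ROb S P) (NOb \<eta> P)) \<and>
     (\<forall>f \<in> Arr B. nat_iso (ROb R (Cod B f)) (ROb S (Dom B f))
        (comp_func (ROb R (Cod B f)) (NOb \<eta> (Dom B f)) (RAr R f))
        (comp_func (ROb R (Cod B f)) (RAr S f) (NOb \<eta> (Cod B f))) (NAr \<eta> f)) \<and>
     (\<forall>f \<in> Arr B. \<forall>g \<in> Arr B. Cod B f = Dom B g \<longrightarrow>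
        (\<forall>X \<in> Obj (ROb R (Cod B g)).
           NAr \<eta> (g \<cdot>\<^bsub>B\<^esub> f) X \<cdot>\<^bsub>ROb S (Dom B f)\<^esub> FAr (NOb \<eta> (Dom B f)) (RComp R g f X) =
           RComp S g f (FOb (NOb \<eta> (Cod B g)) X) \<cdot>\<^bsub>ROb S (Dom B f)\<^esub>
             (FAr (RAr S f) (NAr \<eta> g X) \<cdot>\<^bsub>ROb S (Dom B f)\<^esub> NAr \<eta> f (FOb (RAr R g) X)))) \<and>
     (\<forall>P \<in> Obj B. \<forall>X \<in> Obj (ROb R P).
        NAr \<eta> (Ident B P) X \<cdot>\<^bsub>ROb S P\<^esub> FAr (NOb \<eta> P) (RUnit R P X) = RUnit S P (FOb (NOb \<eta> P) X))"

type_synonym ('a, 'o, 'm) species = "('a poset, 'a poset_map, 'o, 'm) pseudo_func"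
type_synonym ('a, 'o, 'm) species_ar =
  "('a, 'o, 'm) species \<times> ('a, 'o, 'm) species \<times> ('a poset, 'a poset_map, 'o, 'm) pseudo_nat"

definition directed_restriction_species :: "('a::infinite, 'o, 'm) species \<Rightarrow> bool" where
  "directed_restriction_species R \<longleftrightarrow>
     pseudo_functor CPos R \<and> (\<forall>P \<in> Obj CPos. locally_finite_groupoid (ROb R P))"

definition id_pseudo_nat :: "('b, 'k) cat \<Rightarrow> ('b, 'k, 'o, 'm) pseudo_func \<Rightarrow>
    ('b, 'k, 'o, 'm) pseudo_nat" where
  "id_pseudo_nat B R =
     \<lparr>NOb = \<lambda>P\<in>Obj B. id_func (ROb R P),
      NAr = \<lambda>f\<in>Arr B. \<lambda>X\<in>Obj (ROb R (Cod B f)). Ident (ROb R (Dom B f)) (FOb (RAr R f) X)\<rparr>"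

text \<open>The composite of \<open>\<eta> : R \<rightarrow> S\<close> and \<open>\<theta> : S \<rightarrow> T\<close>, with structure isomorphisms
  \<open>\<theta> \<eta> f\<^sup>* X \<rightarrow> \<theta> f\<^sup>* \<eta> X \<rightarrow> f\<^sup>* \<theta> \<eta> X\<close>.\<close>

definition comp_pseudo_nat :: "('b, 'k) cat \<Rightarrow> ('b, 'k, 'o, 'm) pseudo_func \<Rightarrow>
    ('b, 'k, 'o, 'm) pseudo_func \<Rightarrow> ('b, 'k, 'o, 'm) pseudo_nat \<Rightarrow> ('b, 'k, 'o, 'm) pseudo_nat \<Rightarrow>
    ('b, 'k, 'o, 'm) pseudo_nat" where
  "comp_pseudo_nat B R T \<theta> \<eta> =
     \<lparr>NOb = \<lambda>P\<in>Obj B. comp_func (ROb R P) (NOb \<theta> P) (NOb \<eta> P),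
      NAr = \<lambda>f\<in>Arr B. \<lambda>X\<in>Obj (ROb R (Cod B f)).
        NAr \<theta> f (FOb (NOb \<eta> (Cod B f)) X) \<cdot>\<^bsub>ROb T (Dom B f)\<^esub> FAr (NOb \<theta> (Dom B f)) (NAr \<eta> f X)\<rparr>"

definition DRSp :: "(('a::infinite, 'o, 'm) species, ('a, 'o, 'm) species_ar) cat" where
  "DRSp =
     \<lparr>Obj = {R. directed_restriction_species R},
      Arr = {(R, S, \<eta>). directed_restriction_species R \<and> directed_restriction_species S \<and>
               pseudo_natural CPos R S \<eta>},
      Dom = \<lambda>(R, S, \<eta>). R,
      Cod = \<lambda>(R, S, \<eta>). S,
      Ident = \<lambda>R. (R, R, id_pseudo_nat CPos R),
      Comp = \<lambda>(S, T, \<theta>) (R, S', \<eta>). (R, T, comp_pseudo_nat CPos R T \<theta> \<eta>)\<rparr>"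


section \<open>The Grothendieck construction\<close>

text \<open>An arrow \<open>((P', X'), (P, X), f, \<alpha>)\<close> consists of \<open>f : P' \<rightarrow> P\<close> and \<open>\<alpha> : X' \<cong> f\<^sup>* X\<close> in \<open>R[P']\<close>.\<close>

type_synonym ('b, 'k, 'o, 'm) el_ar = "('b \<times> 'o) \<times> ('b \<times> 'o) \<times> 'k \<times> 'm"

definition elements :: "('b, 'k) cat \<Rightarrow> ('b, 'k, 'o, 'm) pseudo_func \<Rightarrow>
    ('b \<times> 'o, ('b, 'k, 'o, 'm) el_ar) cat" where
  "elements B R =
     \<lparr>Obj = {(P, X). P \<in> Obj B \<and> X \<in> Obj (ROb R P)},
      Arr = {((P', X'), (P, X), f, \<alpha>). P' \<in> Obj B \<and> X' \<in> Obj (ROb R P') \<and>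
               P \<in> Obj B \<and> X \<in> Obj (ROb R P) \<and>
               f \<in> hom B P' P \<and> \<alpha> \<in> hom (ROb R P') X' (FOb (RAr R f) X) \<and> is_iso (ROb R P') \<alpha>},
      Dom = \<lambda>(s, t, f, \<alpha>). s,
      Cod = \<lambda>(s, t, f, \<alpha>). t,
      Ident = \<lambda>(P, X). ((P, X), (P, X), Ident B P, RUnit R P X),
      Comp = \<lambda>(s', (Q, Y), g, \<beta>) ((P, X), t, f, \<alpha>).
        ((P, X), (Q, Y), g \<cdot>\<^bsub>B\<^esub> f,
          RComp R g f Y \<cdot>\<^bsub>ROb R P\<^esub> (FAr (RAr R f) \<beta> \<cdot>\<^bsub>ROb R P\<^esub> \<alpha>))\<rparr>"

definition elements_proj :: "('b, 'k) cat \<Rightarrow> ('b, 'k, 'o, 'm) pseudo_func \<Rightarrow>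
    ('b \<times> 'o, ('b, 'k, 'o, 'm) el_ar, 'b, 'k) func" where
  "elements_proj B R =
     \<lparr>FOb = \<lambda>(P, X)\<in>Obj (elements B R). P, FAr = \<lambda>(s, t, f, \<alpha>)\<in>Arr (elements B R). f\<rparr>"

definition elements_map :: "('b, 'k) cat \<Rightarrow> ('b, 'k, 'o, 'm) pseudo_func \<Rightarrow>
    ('b, 'k, 'o, 'm) pseudo_func \<Rightarrow> ('b, 'k, 'o, 'm) pseudo_nat \<Rightarrow>
    ('b \<times> 'o, ('b, 'k, 'o, 'm) el_ar, 'b \<times> 'o, ('b, 'k, 'o, 'm) el_ar) func" where
  "elements_map B R S \<eta> =
    (let ob = (\<lambda>(P, X). (P, FOb (NOb \<eta> P) X)) in
     \<lparr>FOb = restrict ob (Obj (elements B R)),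
      FAr = \<lambda>((P', X'), (P, X), f, \<alpha>)\<in>Arr (elements B R).
        (ob (P', X'), ob (P, X), f, NAr \<eta> f X \<cdot>\<^bsub>ROb S P'\<^esub> FAr (NOb \<eta> P') \<alpha>)\<rparr>)"

type_synonym ('a, 'o, 'm) cpos_el_ar = "('a poset, 'a poset_map, 'o, 'm) el_ar"

definition grothendieck ::
  "(('a::infinite, 'o, 'm) species, ('a, 'o, 'm) species_ar,
    ('a, 'a poset \<times> 'o, ('a, 'o, 'm) cpos_el_ar) cover,
    ('a, 'a poset \<times> 'o, ('a, 'o, 'm) cpos_el_ar) cover_ar) func" where
  "grothendieck =
    (let ob = (\<lambda>R. (elements CPos R, elements_proj CPos R)) in
     \<lparr>FOb = restrict ob (Obj DRSp),
      FAr = \<lambda>(R, S, \<eta>)\<in>Arr DRSp. (ob R, ob S, elements_map CPos R S \<eta>)\<rparr>)"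


section \<open>The comma category\<close>

text \<open>
  For \<open>p : E \<rightarrow> CPos\<close>, an object \<open>(e, k, \<phi>)\<close> consists of an object \<open>e\<close> of \<open>E\<close> over \<open>P\<close>, an ordinal \<open>k\<close>,
  and a monotone map \<open>\<phi> : P \<rightarrow> {1..k}\<close>.
\<close>

type_synonym ('a, 'o) cm_ob = "'o \<times> nat \<times> ('a \<Rightarrow> nat)"
type_synonym ('a, 'o, 'm) cm_ar = "('a, 'o) cm_ob \<times> ('a, 'o) cm_ob \<times> 'm \<times> ord_map"

definition monotone_to_ord :: "'a poset \<Rightarrow> nat \<Rightarrow> ('a \<Rightarrow> nat) \<Rightarrow> bool" where
  "monotone_to_ord P k \<phi> \<longleftrightarrow> \<phi> \<in> fst P \<rightarrow>\<^sub>E {1..k} \<and> (\<forall>(x, y) \<in> snd P. \<phi> x \<le> \<phi> y)"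

definition comma :: "('a, 'o, 'm) cover \<Rightarrow> (('a, 'o) cm_ob, ('a, 'o, 'm) cm_ar) cat" where
  "comma = (\<lambda>(E, p).
    (let obs = {(e, k, \<phi>). e \<in> Obj E \<and> k \<in> Obj Ords \<and> monotone_to_ord (FOb p e) k \<phi>} in
     \<lparr>Obj = obs,
      Arr = {((e, k, \<phi>), (e', k', \<phi>'), r, m).
               (e, k, \<phi>) \<in> obs \<and> (e', k', \<phi>') \<in> obs \<and> r \<in> hom E e e' \<and> m \<in> hom Ords k k' \<and>
               (\<forall>x \<in> fst (FOb p e). \<phi>' (snd (snd (FAr p r)) x) = snd (snd m) (\<phi> x))},
      Dom = \<lambda>(s, t, r, m). s,
      Cod = \<lambda>(s, t, r, m). t,
      Ident = \<lambda>(e, k, \<phi>). ((e, k, \<phi>), (e, k, \<phi>), Ident E e, Ident Ords k),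
      Comp = \<lambda>(s', t', r', m') (s, t, r, m). (s, t', r' \<cdot>\<^bsub>E\<^esub> r, m' \<cdot>\<^bsub>Ords\<^esub> m)\<rparr>))"

definition comma_proj :: "('a, 'o, 'm) cover \<Rightarrow>
    (('a, 'o) cm_ob, ('a, 'o, 'm) cm_ar, nat, ord_map) func" where
  "comma_proj S =
     \<lparr>FOb = \<lambda>(e, k, \<phi>)\<in>Obj (comma S). k, FAr = \<lambda>(s, t, r, m)\<in>Arr (comma S). m\<rparr>"

definition comma_map :: "('a, 'o, 'm) cover \<Rightarrow> ('o, 'm, 'o, 'm) func \<Rightarrow>
    (('a, 'o) cm_ob, ('a, 'o, 'm) cm_ar, ('a, 'o) cm_ob, ('a, 'o, 'm) cm_ar) func" where
  "comma_map S c =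
    (let ob = (\<lambda>(e, k, \<phi>). (FOb c e, k, \<phi>)) in
     \<lparr>FOb = restrict ob (Obj (comma S)),
      FAr = \<lambda>(s, t, r, m)\<in>Arr (comma S). (ob s, ob t, FAr c r, m)\<rparr>)"

definition comma_functor ::
  "(('a::infinite, 'o, 'm) cover, ('a, 'o, 'm) cover_ar,
    (('a, 'o) cm_ob, ('a, 'o, 'm) cm_ar, nat, ord_map) over,
    (('a, 'o) cm_ob, ('a, 'o, 'm) cm_ar, nat, ord_map) over_ar) func" where
  "comma_functor =
    (let ob = (\<lambda>S. (comma S, comma_proj S)) in
     \<lparr>FOb = restrict ob (Obj RFib),
      FAr = \<lambda>(S, T, c)\<in>Arr RFib. (ob S, ob T, comma_map S c)\<rparr>)"

end

theory Submission
  imports Defs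
begin

text \<open>
  All arrows of a right fibration \<open>p : E \<rightarrow> C\<close> are cartesian, and convex maps are order embeddings with
  convex image; so an arrow of \<open>E\<close> is monic and factors through another one as soon as its image
  does. In the comma category over \<open>E\<close> an arrow \<open>(r, m)\<close> is therefore cocartesian iff \<open>r\<close> is
  invertible, and, for convex \<open>m\<close>, cartesian iff the image of \<open>r\<close> is the preimage of the image of \<open>m\<close>.

  The Beck-Chevalley, iesq and morphism conditions can be restated in terms of arbitrary cartesian and
  cocartesian arrows instead of chosen lifts: for instance, Beck-Chevalley says that a cartesian arrow
  over \<open>\<tau>'\<close> followed by a cocartesian arrow over \<open>\<sigma>\<close> is also a cocartesian arrow over \<open>\<sigma>'\<close> followed by
  a cartesian arrow over \<open>\<tau>\<close>. With the two descriptions above, these conditions become elementary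
  statements about monotone maps to ordinals.

  Species and right fibrations are compared through the arrows of the category of elements: each is a
  vertical arrow followed by a canonical lift \<open>f\<^sup>* X \<rightarrow> X\<close>, and the coherence laws of a pseudo-natural
  transformation say exactly that the induced map on arrows respects composition.
\<close>

section \<open>Categories, functors and equivalences\<close>

text \<open>The fibration functors are built from Hilbert-chosen lifts, about which nothing is known
  except that they are (co)cartesian. The bridge to explicit arrows is that two lifts of one arrow
  at one object differ by an invertible vertical arrow. Homotopy pullbacks are likewise tested by
  full faithfulness and essential surjectivity of the comparison with the iso-comma category, not by
  exhibiting a quasi-inverse.

  The main obstacle is the iesq square. Its map f may collapse points, so agreement of structure
  maps after pushing forward does not give agreement before. Off the middle block it does, because
  id + f + id is injective there; on the middle block agreement comes from the restricted arrow. For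
  essential surjectivity a structure map is glued from three pieces, and its monotonicity inside the
  middle block is invisible in the target: it needs that convex maps reflect the order.

  On the species side, an arrow in a fibre of the category of elements carries a unit isomorphism,
  which has to be inserted or removed whenever this fibre is compared with the groupoid it comes
  from.\<close>

lemma homI: "\<lbrakk>f \<in> Arr C; Dom C f = x; Cod C f = y\<rbrakk> \<Longrightarrow> f \<in> hom C x y"
  by (simp add: hom_def)

lemmas cat_simps = category.Dom_in category.Cod_in category.Ident_in category.Dom_Ident
  category.Cod_Ident category.Comp_in category.Dom_Comp category.Cod_Comp category.Comp_Ident
  category.Ident_Comp category.Comp_assoc

context category
begin

lemmas cat[simp] = Dom_in Cod_in Ident_in Dom_Ident Cod_Ident Comp_in Dom_Comp Cod_Comp
  Comp_Ident Ident_Comp Comp_assoc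

lemma Comp_Ident' [simp]: "\<lbrakk>f \<in> Arr C; Dom C f = x\<rbrakk> \<Longrightarrow> f \<cdot> Ident C x = f"
  using Comp_Ident by blast

lemma Ident_Comp' [simp]: "\<lbrakk>f \<in> Arr C; Cod C f = x\<rbrakk> \<Longrightarrow> Ident C x \<cdot> f = f"
  using Ident_Comp by blast

lemma hom_Obj: "f \<in> hom C x y \<Longrightarrow> x \<in> Obj C \<and> y \<in> Obj C"
  by (auto simp: hom_def)

end

lemmas cat_simps' = cat_simps category.Comp_Ident' category.Ident_Comp'

definition inv_arr :: "('o, 'm) cat \<Rightarrow> 'm \<Rightarrow> 'm" where
  "inv_arr C f = (SOME g. g \<in> hom C (Cod C f) (Dom C f) \<and> g \<cdot>\<^bsub>C\<^esub> f = Ident C (Dom C f) \<and>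
     f \<cdot>\<^bsub>C\<^esub> g = Ident C (Cod C f))"

lemma is_iso_Arr: "is_iso C f \<Longrightarrow> f \<in> Arr C"
  by (simp add: is_iso_def)

lemma inv_arr_spec:
  assumes "is_iso C f"
  shows "inv_arr C f \<in> hom C (Cod C f) (Dom C f) \<and> inv_arr C f \<cdot>\<^bsub>C\<^esub> f = Ident C (Dom C f) \<and>
     f \<cdot>\<^bsub>C\<^esub> inv_arr C f = Ident C (Cod C f)"
  unfolding inv_arr_def by (rule someI_ex) (use assms in \<open>auto simp: is_iso_def\<close>)

lemma inv_arr [simp]:
  assumes "is_iso C f"
  shows "inv_arr C f \<in> Arr C" "Dom C (inv_arr C f) = Cod C f" "Cod C (inv_arr C f) = Dom C f"
    "inv_arr C f \<cdot>\<^bsub>C\<^esub> f = Ident C (Dom C f)" "f \<cdot>\<^bsub>C\<^esub> inv_arr C f = Ident C (Cod C f)"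
  using inv_arr_spec[OF assms] by (auto simp: hom_def)

context category
begin

lemma is_isoI:
  "\<lbrakk>f \<in> Arr C; g \<in> Arr C; Dom C g = Cod C f; Cod C g = Dom C f; g \<cdot> f = Ident C (Dom C f);
    f \<cdot> g = Ident C (Cod C f)\<rbrakk> \<Longrightarrow> is_iso C f"
  unfolding is_iso_def hom_def by auto

lemma inv_arr_cancel [simp]:
  assumes "is_iso C f" "h \<in> Arr C"
  shows "Cod C h = Dom C f \<Longrightarrow> inv_arr C f \<cdot> (f \<cdot> h) = h"
    and "Cod C h = Cod C f \<Longrightarrow> f \<cdot> (inv_arr C f \<cdot> h) = h"
proof -
  have f: "f \<in> Arr C" using assms(1) by (rule is_iso_Arr)
  { assume "Cod C h = Dom C f"
    then have "inv_arr C f \<cdot> (f \<cdot> h) = (inv_arr C f \<cdot> f) \<cdot> h" using assms f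
      by (subst Comp_assoc) auto
    then show "inv_arr C f \<cdot> (f \<cdot> h) = h" using assms \<open>Cod C h = Dom C f\<close> by simp }
  { assume "Cod C h = Cod C f"
    then have "f \<cdot> (inv_arr C f \<cdot> h) = (f \<cdot> inv_arr C f) \<cdot> h" using assms f
      by (subst Comp_assoc) auto
    then show "f \<cdot> (inv_arr C f \<cdot> h) = h" using assms \<open>Cod C h = Cod C f\<close> by simp }
qed

lemma iso_Ident [simp]: "x \<in> Obj C \<Longrightarrow> is_iso C (Ident C x)"
  by (rule is_isoI[where g = "Ident C x"]) auto

lemma iso_Comp [simp]:
  assumes "is_iso C f" "is_iso C g" "Cod C f = Dom C g"
  shows "is_iso C (g \<cdot> f)"
  using assms is_iso_Arr[OF assms(1)] is_iso_Arr[OF assms(2)]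
  by (intro is_isoI[where g = "inv_arr C f \<cdot> inv_arr C g"]) auto

lemma iso_cancel_left:
  assumes "is_iso C f" "u \<in> Arr C" "v \<in> Arr C" "Cod C u = Dom C f" "Cod C v = Dom C f"
    and eq: "f \<cdot> u = f \<cdot> v"
  shows "u = v"
proof -
  have "u = inv_arr C f \<cdot> (f \<cdot> u)" using assms(1-5) by simp
  also have "\<dots> = v" unfolding eq using assms(1-5) by simp
  finally show ?thesis .
qed

lemma iso_cancel_right:
  assumes "is_iso C f" "u \<in> Arr C" "v \<in> Arr C" "Dom C u = Cod C f" "Dom C v = Cod C f"
    and eq: "u \<cdot> f = v \<cdot> f"
  shows "u = v"
proof -
  have f: "f \<in> Arr C" using assms(1) by (rule is_iso_Arr)
  have "u = (u \<cdot> f) \<cdot> inv_arr C f" using assms(1-5) f by simp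
  also have "\<dots> = v" unfolding eq using assms(1-5) f by simp
  finally show ?thesis .
qed

end

lemma is_functorI:
  assumes "category C" "category D"
    and "FOb F \<in> extensional (Obj C)" "FAr F \<in> extensional (Arr C)"
    and "\<And>x. x \<in> Obj C \<Longrightarrow> FOb F x \<in> Obj D"
    and "\<And>f. f \<in> Arr C \<Longrightarrow> FAr F f \<in> Arr D \<and> Dom D (FAr F f) = FOb F (Dom C f) \<and>
           Cod D (FAr F f) = FOb F (Cod C f)"
    and "\<And>x. x \<in> Obj C \<Longrightarrow> FAr F (Ident C x) = Ident D (FOb F x)"
    and "\<And>f g. \<lbrakk>f \<in> Arr C; g \<in> Arr C; Cod C f = Dom C g\<rbrakk> \<Longrightarrow>
           FAr F (g \<cdot>\<^bsub>C\<^esub> f) = FAr F g \<cdot>\<^bsub>D\<^esub> FAr F f"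
  shows "is_functor C D F"
  using assms by (auto simp: is_functor_def PiE_def)

lemma functorD:
  assumes "is_functor C D F"
  shows functor_cat_dom: "category C"
    and functor_cat_cod: "category D"
    and functor_Ob: "\<And>x. x \<in> Obj C \<Longrightarrow> FOb F x \<in> Obj D"
    and functor_Ar: "\<And>f. f \<in> Arr C \<Longrightarrow> FAr F f \<in> Arr D"
    and functor_Dom: "\<And>f. f \<in> Arr C \<Longrightarrow> Dom D (FAr F f) = FOb F (Dom C f)"
    and functor_Cod: "\<And>f. f \<in> Arr C \<Longrightarrow> Cod D (FAr F f) = FOb F (Cod C f)"
    and functor_Ident: "\<And>x. x \<in> Obj C \<Longrightarrow> FAr F (Ident C x) = Ident D (FOb F x)"
    and functor_Comp: "\<And>f g. \<lbrakk>f \<in> Arr C; g \<in> Arr C; Cod C f = Dom C g\<rbrakk> \<Longrightarrow>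
           FAr F (g \<cdot>\<^bsub>C\<^esub> f) = FAr F g \<cdot>\<^bsub>D\<^esub> FAr F f"
    and functor_ext_Ob: "FOb F \<in> extensional (Obj C)"
    and functor_ext_Ar: "FAr F \<in> extensional (Arr C)"
  using assms by (auto simp: is_functor_def PiE_def)

lemmas functor_simps = functor_cat_dom functor_cat_cod functor_Ob functor_Ar functor_Dom
  functor_Cod functor_Ident functor_Comp

lemma functor_hom: "\<lbrakk>is_functor C D F; f \<in> hom C x y\<rbrakk> \<Longrightarrow> FAr F f \<in> hom D (FOb F x) (FOb F y)"
  by (auto simp: hom_def functor_simps)

lemma functor_iso:
  assumes F: "is_functor C D F" and f: "is_iso C f"
  shows "is_iso D (FAr F f)"
proof -
  interpret D: category D using functor_simps[OF F] by simp
  interpret C: category C using functor_simps[OF F] by simp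
  have f': "f \<in> Arr C" using f by (rule is_iso_Arr)
  have "FAr F (inv_arr C f) \<cdot>\<^bsub>D\<^esub> FAr F f = FAr F (inv_arr C f \<cdot>\<^bsub>C\<^esub> f)"
       "FAr F f \<cdot>\<^bsub>D\<^esub> FAr F (inv_arr C f) = FAr F (f \<cdot>\<^bsub>C\<^esub> inv_arr C f)"
    by (rule functor_Comp[OF F, symmetric]; use f f' in simp)+
  then show ?thesis using f f' functor_simps[OF F]
    by (intro D.is_isoI[where g = "FAr F (inv_arr C f)"]) auto
qed

lemma func_eqI:
  assumes "FOb F \<in> extensional A" "FOb G \<in> extensional A"
    and "FAr F \<in> extensional B" "FAr G \<in> extensional B"
    and "\<And>x. x \<in> A \<Longrightarrow> FOb F x = FOb G x" "\<And>f. f \<in> B \<Longrightarrow> FAr F f = FAr G f"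
  shows "F = (G :: ('o, 'm, 'p, 'n) func)"
  by (rule func.equality)
     (auto intro: extensionalityI[OF assms(1,2)] extensionalityI[OF assms(3,4)] simp: assms(5,6))

lemma functor_eqI:
  assumes "is_functor C D F" "is_functor C D' G"
    and "\<And>x. x \<in> Obj C \<Longrightarrow> FOb F x = FOb G x" "\<And>f. f \<in> Arr C \<Longrightarrow> FAr F f = FAr G f"
  shows "F = G"
  using func_eqI[OF functor_ext_Ob[OF assms(1)] functor_ext_Ob[OF assms(2)]
    functor_ext_Ar[OF assms(1)] functor_ext_Ar[OF assms(2)]] assms(3,4) by blast

lemma id_func_simps [simp]:
  "x \<in> Obj C \<Longrightarrow> FOb (id_func C) x = x" "f \<in> Arr C \<Longrightarrow> FAr (id_func C) f = f"
  by (auto simp: id_func_def)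

lemma comp_func_simps [simp]:
  "x \<in> Obj C \<Longrightarrow> FOb (comp_func C G F) x = FOb G (FOb F x)"
  "f \<in> Arr C \<Longrightarrow> FAr (comp_func C G F) f = FAr G (FAr F f)"
  by (auto simp: comp_func_def compose_def)

lemma restrict_func_simps [simp]:
  "x \<in> Obj C \<Longrightarrow> FOb (restrict_func C F) x = FOb F x"
  "f \<in> Arr C \<Longrightarrow> FAr (restrict_func C F) f = FAr F f"
  by (auto simp: restrict_func_def)

lemma func_extensional [simp]:
  "FOb (id_func C) \<in> extensional (Obj C)" "FAr (id_func C) \<in> extensional (Arr C)"
  "FOb (comp_func C G F) \<in> extensional (Obj C)" "FAr (comp_func C G F) \<in> extensional (Arr C)"
  "FOb (restrict_func C H) \<in> extensional (Obj C)" "FAr (restrict_func C H) \<in> extensional (Arr C)"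
  by (auto simp: id_func_def comp_func_def compose_def restrict_func_def)

lemma id_functor: "category C \<Longrightarrow> is_functor C C (id_func C)"
  by (rule is_functorI) (auto simp: cat_simps)

lemma comp_functor:
  assumes F: "is_functor C D F" and G: "is_functor D E G"
  shows "is_functor C E (comp_func C G F)"
  by (rule is_functorI) (auto simp: functor_simps[OF F] functor_simps[OF G] cat_simps)

lemma comp_func_id_left: "is_functor C D F \<Longrightarrow> comp_func C (id_func D) F = F"
  by (rule functor_eqI[where C = C])
     (auto intro: comp_functor[OF _ id_functor] simp: functor_simps)

lemma comp_func_id_right: "is_functor C D F \<Longrightarrow> comp_func C F (id_func C) = F"
  by (rule functor_eqI[where C = C])
     (auto intro: comp_functor[OF id_functor] simp: functor_simps)

lemma comp_func_assoc:
  assumes F: "is_functor C D F" and G: "is_functor D E G" and H: "is_functor E E' H"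
  shows "comp_func C (comp_func D H G) F = comp_func C H (comp_func C G F)"
  by (rule functor_eqI[where C = C])
     (use comp_functor[OF F comp_functor[OF G H]] comp_functor[OF comp_functor[OF F G] H] in
       \<open>auto simp: functor_simps[OF F]\<close>)

lemma nat_isoI:
  assumes "is_functor C D F" "is_functor C D G" "t \<in> extensional (Obj C)"
    and "\<And>x. x \<in> Obj C \<Longrightarrow> t x \<in> hom D (FOb F x) (FOb G x)" "\<And>x. x \<in> Obj C \<Longrightarrow> is_iso D (t x)"
    and "\<And>f. f \<in> Arr C \<Longrightarrow> t (Cod C f) \<cdot>\<^bsub>D\<^esub> FAr F f = FAr G f \<cdot>\<^bsub>D\<^esub> t (Dom C f)"
  shows "nat_iso C D F G t"
  using assms by (auto simp: nat_iso_def)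

lemma nat_isoD:
  assumes "nat_iso C D F G t"
  shows nat_iso_dom: "is_functor C D F" and nat_iso_cod: "is_functor C D G"
    and nat_iso_ext: "t \<in> extensional (Obj C)"
    and nat_iso_Arr: "\<And>x. x \<in> Obj C \<Longrightarrow> t x \<in> Arr D"
    and nat_iso_Dom: "\<And>x. x \<in> Obj C \<Longrightarrow> Dom D (t x) = FOb F x"
    and nat_iso_Cod: "\<And>x. x \<in> Obj C \<Longrightarrow> Cod D (t x) = FOb G x"
    and nat_iso_iso: "\<And>x. x \<in> Obj C \<Longrightarrow> is_iso D (t x)"
    and nat_iso_nat: "\<And>f. f \<in> Arr C \<Longrightarrow> t (Cod C f) \<cdot>\<^bsub>D\<^esub> FAr F f = FAr G f \<cdot>\<^bsub>D\<^esub> t (Dom C f)"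
  using assms by (auto simp: nat_iso_def hom_def)

lemmas nat_iso_simps = nat_iso_Arr nat_iso_Dom nat_iso_Cod nat_iso_iso

text \<open>The quasi-inverse is made by choice: every object \<open>d\<close> receives a preimage
  \<open>ob d\<close> with an isomorphism \<open>t d\<close> onto \<open>d\<close>, and an arrow is
  conjugated by these isomorphisms and lifted along \<open>F\<close>. Faithfulness turns each law
  for \<open>G\<close> into an equation in \<open>D\<close>.\<close>

lemma is_equivalenceI:
  fixes C :: "('o, 'm) cat" and D :: "('p, 'n) cat"
  assumes F: "is_functor C D F"
    and ff: "\<And>x y g. \<lbrakk>x \<in> Obj C; y \<in> Obj C; g \<in> hom D (FOb F x) (FOb F y)\<rbrakk> \<Longrightarrow>
               \<exists>!f. f \<in> hom C x y \<and> FAr F f = g"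
    and es: "\<And>d. d \<in> Obj D \<Longrightarrow> \<exists>x \<in> Obj C. \<exists>t \<in> hom D (FOb F x) d. is_iso D t"
  shows "is_equivalence C D F"
proof -
  note [simp] = functor_simps[OF F]
  interpret C: category C by simp
  interpret D: category D by simp
  define lift where "lift x y g = (THE f. f \<in> hom C x y \<and> FAr F f = g)" for x y g
  have lift: "lift x y g \<in> Arr C" "Dom C (lift x y g) = x" "Cod C (lift x y g) = y" "FAr F (lift x y g) = g"
    if "x \<in> Obj C" "y \<in> Obj C" "g \<in> Arr D" "Dom D g = FOb F x" "Cod D g = FOb F y" for x y g
    using theI'[OF ff[of x y g]] that by (auto simp: lift_def hom_def)
  have faithful: "f = f'" if "f \<in> Arr C" "f' \<in> Arr C" "Dom C f = Dom C f'" "Cod C f = Cod C f'"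
    "FAr F f = FAr F f'" for f f'
    using ff[of "Dom C f" "Cod C f" "FAr F f"] that by (auto simp: hom_def)
  define ob where "ob d = (SOME x. x \<in> Obj C \<and> (\<exists>t \<in> hom D (FOb F x) d. is_iso D t))" for d
  define t where "t d = (SOME t. t \<in> hom D (FOb F (ob d)) d \<and> is_iso D t)" for d
  have ob: "ob d \<in> Obj C \<and> (\<exists>t \<in> hom D (FOb F (ob d)) d. is_iso D t)" if "d \<in> Obj D" for d
    unfolding ob_def by (rule someI_ex) (use es[OF that] in blast)
  have t': "t d \<in> hom D (FOb F (ob d)) d \<and> is_iso D (t d)" if "d \<in> Obj D" for d
    unfolding t_def by (rule someI_ex) (use ob[OF that] in blast)
  have t[simp]: "ob d \<in> Obj C" "t d \<in> Arr D" "Dom D (t d) = FOb F (ob d)" "Cod D (t d) = d" "is_iso D (t d)"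
    if "d \<in> Obj D" for d using t'[OF that] ob[OF that] by (auto simp: hom_def)
  define G :: "('p, 'n, 'o, 'm) func" where "G = \<lparr>FOb = \<lambda>d\<in>Obj D. ob d,
    FAr = \<lambda>g\<in>Arr D. lift (ob (Dom D g)) (ob (Cod D g)) (inv_arr D (t (Cod D g)) \<cdot>\<^bsub>D\<^esub> g \<cdot>\<^bsub>D\<^esub> t (Dom D g))\<rparr>"
  have G1: "FOb G d = ob d" if "d \<in> Obj D" for d using that by (simp add: G_def)
  have G2: "FAr G g \<in> Arr C" "Dom C (FAr G g) = ob (Dom D g)" "Cod C (FAr G g) = ob (Cod D g)"
    "FAr F (FAr G g) = inv_arr D (t (Cod D g)) \<cdot>\<^bsub>D\<^esub> g \<cdot>\<^bsub>D\<^esub> t (Dom D g)" if "g \<in> Arr D" for g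
    using that by (auto simp: G_def lift)
  have G: "is_functor D C G"
  proof (rule is_functorI)
    fix x assume x: "x \<in> Obj D"
    show "FAr G (Ident D x) = Ident C (FOb G x)" using x by (intro faithful) (auto simp: G1 G2)
  next
    fix f g assume fg: "f \<in> Arr D" "g \<in> Arr D" "Cod D f = Dom D g"
    then show "FAr G (g \<cdot>\<^bsub>D\<^esub> f) = FAr G g \<cdot>\<^bsub>C\<^esub> FAr G f" by (intro faithful) (auto simp: G2)
  qed (auto simp: G1 G2, auto simp: G_def)
  \<comment> \<open>The isomorphism \<open>t\<close> at \<open>FOb F x\<close> joins two objects in
    the image of \<open>F\<close>, so it lifts to \<open>C\<close>. So does its inverse, which makes
    \<open>s x\<close> invertible.\<close>
  define s where "s = (\<lambda>x\<in>Obj C. lift (ob (FOb F x)) x (t (FOb F x)))"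
  have s: "s x \<in> Arr C" "Dom C (s x) = ob (FOb F x)" "Cod C (s x) = x" "FAr F (s x) = t (FOb F x)"
    if "x \<in> Obj C" for x using that by (auto simp: s_def lift)
  define s' where "s' x = lift x (ob (FOb F x)) (inv_arr D (t (FOb F x)))" for x
  have s': "s' x \<in> Arr C" "Dom C (s' x) = x" "Cod C (s' x) = ob (FOb F x)"
    "FAr F (s' x) = inv_arr D (t (FOb F x))" if "x \<in> Obj C" for x using that by (auto simp: s'_def lift)
  have "nat_iso C C (comp_func C G F) (id_func C) s"
  proof (rule nat_isoI)
    fix x assume x: "x \<in> Obj C"
    show "s x \<in> hom C (FOb (comp_func C G F) x) (FOb (id_func C) x)" using x by (simp add: hom_def s G1)
    have "s' x \<cdot>\<^bsub>C\<^esub> s x = Ident C (ob (FOb F x))" using x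
      by (intro faithful) (auto simp: s s')
    moreover have "s x \<cdot>\<^bsub>C\<^esub> s' x = Ident C x" using x by (intro faithful) (auto simp: s s')
    ultimately show "is_iso C (s x)" using x by (intro C.is_isoI[where g = "s' x"]) (auto simp: s s')
  next
    fix f assume "f \<in> Arr C"
    then show "s (Cod C f) \<cdot>\<^bsub>C\<^esub> FAr (comp_func C G F) f = FAr (id_func C) f \<cdot>\<^bsub>C\<^esub> s (Dom C f)"
      by (intro faithful) (auto simp: s G2)
  qed (auto intro: comp_functor F G id_functor simp: s_def)
  moreover have "nat_iso D D (comp_func D F G) (id_func D) (restrict t (Obj D))"
    by (rule nat_isoI) (auto intro: comp_functor F G id_functor simp: G1 G2 hom_def)
  ultimately show ?thesis unfolding is_equivalence_def using F G by blast
qed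

text \<open>Faithfulness of \<open>F\<close> comes from naturality of \<open>s\<close>, that of
  \<open>G\<close> from naturality of \<open>t\<close>. Faithfulness of \<open>G\<close> is what
  yields fullness of \<open>F\<close>, since a candidate preimage of \<open>g\<close> can be
  compared with \<open>g\<close> only after applying \<open>G\<close>.\<close>

lemma is_equivalenceD:
  assumes "is_equivalence C D F"
  shows equivalence_functor: "is_functor C D F"
    and equivalence_ff: "\<And>x y g. \<lbrakk>x \<in> Obj C; y \<in> Obj C; g \<in> hom D (FOb F x) (FOb F y)\<rbrakk> \<Longrightarrow>
               \<exists>!f. f \<in> hom C x y \<and> FAr F f = g"
    and equivalence_es: "\<And>d. d \<in> Obj D \<Longrightarrow> \<exists>x \<in> Obj C. \<exists>t \<in> hom D (FOb F x) d. is_iso D t"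
proof -
  from assms obtain G s t where F: "is_functor C D F" and G: "is_functor D C G"
    and s: "nat_iso C C (comp_func C G F) (id_func C) s"
    and t: "nat_iso D D (comp_func D F G) (id_func D) t"
    unfolding is_equivalence_def by blast
  show "is_functor C D F" by (rule F)
  note [simp] = functor_simps[OF F] functor_simps[OF G] nat_iso_simps[OF s] nat_iso_simps[OF t]
  interpret C: category C by simp
  interpret D: category D by simp
  have F_faithful: "f = f'" if f: "f \<in> Arr C" "f' \<in> Arr C" "Dom C f = Dom C f'" "Cod C f = Cod C f'"
    "FAr F f = FAr F f'" for f f'
  proof -
    have "f \<cdot>\<^bsub>C\<^esub> s (Dom C f) = s (Cod C f) \<cdot>\<^bsub>C\<^esub> FAr G (FAr F f)"
      using nat_iso_nat[OF s f(1)] f(1) by simp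
    also have "\<dots> = s (Cod C f') \<cdot>\<^bsub>C\<^esub> FAr G (FAr F f')" by (simp only: f(4,5))
    also have "\<dots> = f' \<cdot>\<^bsub>C\<^esub> s (Dom C f')"
      using nat_iso_nat[OF s f(2)] f(2) by simp
    finally have "f \<cdot>\<^bsub>C\<^esub> s (Dom C f) = f' \<cdot>\<^bsub>C\<^esub> s (Dom C f')" .
    then show ?thesis using f by - (rule C.iso_cancel_right[where f = "s (Dom C f)"]; auto)
  qed
  have G_faithful: "f = f'" if f: "f \<in> Arr D" "f' \<in> Arr D" "Dom D f = Dom D f'" "Cod D f = Cod D f'"
    "FAr G f = FAr G f'" for f f'
  proof -
    have "f \<cdot>\<^bsub>D\<^esub> t (Dom D f) = t (Cod D f) \<cdot>\<^bsub>D\<^esub> FAr F (FAr G f)"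
      using nat_iso_nat[OF t f(1)] f(1) by simp
    also have "\<dots> = t (Cod D f') \<cdot>\<^bsub>D\<^esub> FAr F (FAr G f')" by (simp only: f(4,5))
    also have "\<dots> = f' \<cdot>\<^bsub>D\<^esub> t (Dom D f')"
      using nat_iso_nat[OF t f(2)] f(2) by simp
    finally have "f \<cdot>\<^bsub>D\<^esub> t (Dom D f) = f' \<cdot>\<^bsub>D\<^esub> t (Dom D f')" .
    then show ?thesis using f by - (rule D.iso_cancel_right[where f = "t (Dom D f)"]; auto)
  qed
  show "\<exists>!f. f \<in> hom C x y \<and> FAr F f = g"
    if x: "x \<in> Obj C" and y: "y \<in> Obj C" and "g \<in> hom D (FOb F x) (FOb F y)" for x y g
  proof -
    have g[simp]: "g \<in> Arr D" "Dom D g = FOb F x" "Cod D g = FOb F y" using that by (auto simp: hom_def)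
    note [simp] = x y
    \<comment> \<open>Naturality of \<open>s\<close> leaves this as the only possible preimage of
      \<open>g\<close>.\<close>
    define f where "f = s y \<cdot>\<^bsub>C\<^esub> FAr G g \<cdot>\<^bsub>C\<^esub> inv_arr C (s x)"
    have f[simp]: "f \<in> Arr C" "Dom C f = x" "Cod C f = y" by (auto simp: f_def)
    have "s y \<cdot>\<^bsub>C\<^esub> FAr G (FAr F f) = s y \<cdot>\<^bsub>C\<^esub> FAr G g"
      using nat_iso_nat[OF s f(1)] by (simp add: f_def)
    then have "FAr G (FAr F f) = FAr G g" by - (rule C.iso_cancel_left[where f = "s y"]; auto)
    then have "FAr F f = g" by (intro G_faithful) auto
    then show ?thesis by (intro ex1I[where a = f]) (auto simp: hom_def intro!: F_faithful)
  qed
  show "\<exists>x \<in> Obj C. \<exists>t \<in> hom D (FOb F x) d. is_iso D t" if d: "d \<in> Obj D" for d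
    by (rule bexI[where x = "FOb G d"], rule bexI[where x = "t d"]) (use d in \<open>auto simp: hom_def\<close>)
qed

section \<open>Homotopy pullbacks\<close>

lemma iso_comma_simps [simp]:
  "Obj (iso_comma B C D G H) =
    {(b, c, \<theta>). b \<in> Obj B \<and> c \<in> Obj C \<and> \<theta> \<in> hom D (FOb G b) (FOb H c) \<and> is_iso D \<theta>}"
  "((b, c, \<theta>), (b', c', \<theta>'), u, v) \<in> Arr (iso_comma B C D G H) \<longleftrightarrow>
     (b, c, \<theta>) \<in> Obj (iso_comma B C D G H) \<and> (b', c', \<theta>') \<in> Obj (iso_comma B C D G H) \<and>
     u \<in> hom B b b' \<and> v \<in> hom C c c' \<and> \<theta>' \<cdot>\<^bsub>D\<^esub> FAr G u = FAr H v \<cdot>\<^bsub>D\<^esub> \<theta>"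
  "Dom (iso_comma B C D G H) (s, t, u, v) = s"
  "Cod (iso_comma B C D G H) (s, t, u, v) = t"
  "Ident (iso_comma B C D G H) (b, c, \<theta>) = ((b, c, \<theta>), (b, c, \<theta>), Ident B b, Ident C c)"
  "(s', t', u', v') \<cdot>\<^bsub>iso_comma B C D G H\<^esub> (s, t, u, v) = (s, t', u' \<cdot>\<^bsub>B\<^esub> u, v' \<cdot>\<^bsub>C\<^esub> v)"
  by (auto simp: iso_comma_def Let_def)

lemma iso_comma_category:
  assumes G: "is_functor B D G" and H: "is_functor C D H"
  shows "category (iso_comma B C D G H)"
proof -
  note [simp] = functor_simps[OF G] functor_simps[OF H]
  interpret B: category B by simp
  interpret C: category C by simp
  interpret D: category D by simp
  show ?thesis
  proof
    fix f g
    assume "f \<in> Arr (iso_comma B C D G H)" "g \<in> Arr (iso_comma B C D G H)"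
      "Cod (iso_comma B C D G H) f = Dom (iso_comma B C D G H) g"
    moreover obtain b c \<theta> b' c' \<theta>' u v where f: "f = ((b, c, \<theta>), (b', c', \<theta>'), u, v)" by (metis prod_cases3)
    moreover obtain b1 c1 \<theta>1 b2 c2 \<theta>2 u' v' where g: "g = ((b1, c1, \<theta>1), (b2, c2, \<theta>2), u', v')" by (metis prod_cases3)
    ultimately have fg: "f \<in> Arr (iso_comma B C D G H)" "g \<in> Arr (iso_comma B C D G H)"
      "b1 = b'" "c1 = c'" "\<theta>1 = \<theta>'" by auto
    then have [simp]: "u \<in> Arr B" "Dom B u = b" "Cod B u = b'" "v \<in> Arr C" "Dom C v = c" "Cod C v = c'"
       "u' \<in> Arr B" "Dom B u' = b'" "Cod B u' = b2" "v' \<in> Arr C" "Dom C v' = c'" "Cod C v' = c2"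
       "\<theta> \<in> Arr D" "\<theta>' \<in> Arr D" "\<theta>2 \<in> Arr D" "Dom D \<theta> = FOb G b" "Dom D \<theta>' = FOb G b'" "Dom D \<theta>2 = FOb G b2"
       "Cod D \<theta> = FOb H c" "Cod D \<theta>' = FOb H c'" "Cod D \<theta>2 = FOb H c2"
      by (auto simp: f g hom_def)
    have e: "\<theta>' \<cdot>\<^bsub>D\<^esub> FAr G u = FAr H v \<cdot>\<^bsub>D\<^esub> \<theta>" "\<theta>2 \<cdot>\<^bsub>D\<^esub> FAr G u' = FAr H v' \<cdot>\<^bsub>D\<^esub> \<theta>'"
      using fg by (auto simp: f g)
    \<comment> \<open>The compatibility squares of the two arrows are pasted along
      \<open>\<theta>'\<close>.\<close>
    have "\<theta>2 \<cdot>\<^bsub>D\<^esub> (FAr G u' \<cdot>\<^bsub>D\<^esub> FAr G u) = (FAr H v' \<cdot>\<^bsub>D\<^esub> \<theta>') \<cdot>\<^bsub>D\<^esub> FAr G u"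
      by (simp flip: e)
    also have "\<dots> = FAr H v' \<cdot>\<^bsub>D\<^esub> (FAr H v \<cdot>\<^bsub>D\<^esub> \<theta>)" using e(1) by simp
    finally show "g \<cdot>\<^bsub>iso_comma B C D G H\<^esub> f \<in> Arr (iso_comma B C D G H)"
      using fg by (auto simp: f g hom_def)
  qed (auto simp: hom_def)
qed

text \<open>The inverse has the inverse components; only its compatibility square has to be derived,
  by conjugating the given one.\<close>

lemma iso_comma_isoI:
  assumes G: "is_functor B D G" and H: "is_functor C D H"
    and f: "(s, t, u, v) \<in> Arr (iso_comma B C D G H)" and uv: "is_iso B u" "is_iso C v"
  shows "is_iso (iso_comma B C D G H) (s, t, u, v)"
proof -
  note [simp] = functor_simps[OF G] functor_simps[OF H] uv
  interpret B: category B by simp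
  interpret C: category C by simp
  interpret D: category D by simp
  obtain b c \<theta> b' c' \<theta>' where st: "s = (b, c, \<theta>)" "t = (b', c', \<theta>')" by (metis prod_cases3)
  have [simp]: "u \<in> Arr B" "Dom B u = b" "Cod B u = b'" "v \<in> Arr C" "Dom C v = c" "Cod C v = c'"
    "\<theta> \<in> Arr D" "\<theta>' \<in> Arr D" "Dom D \<theta> = FOb G b" "Dom D \<theta>' = FOb G b'"
    "Cod D \<theta> = FOb H c" "Cod D \<theta>' = FOb H c'" "b \<in> Obj B" "b' \<in> Obj B" "c \<in> Obj C" "c' \<in> Obj C"
    and e: "\<theta>' \<cdot>\<^bsub>D\<^esub> FAr G u = FAr H v \<cdot>\<^bsub>D\<^esub> \<theta>"
    using f by (auto simp: st hom_def)
  have H1: "FAr H (inv_arr C v) \<cdot>\<^bsub>D\<^esub> FAr H v = Ident D (FOb H c)"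
    using functor_Comp[OF H, of v "inv_arr C v"] by simp
  have G1: "FAr G u \<cdot>\<^bsub>D\<^esub> FAr G (inv_arr B u) = Ident D (FOb G b')"
    using functor_Comp[OF G, of "inv_arr B u" u] by simp
  have "FAr H (inv_arr C v) \<cdot>\<^bsub>D\<^esub> \<theta>' = FAr H (inv_arr C v) \<cdot>\<^bsub>D\<^esub> ((\<theta>' \<cdot>\<^bsub>D\<^esub> FAr G u) \<cdot>\<^bsub>D\<^esub> FAr G (inv_arr B u))"
    by (simp add: G1)
  also have "\<dots> = (FAr H (inv_arr C v) \<cdot>\<^bsub>D\<^esub> FAr H v) \<cdot>\<^bsub>D\<^esub> (\<theta> \<cdot>\<^bsub>D\<^esub> FAr G (inv_arr B u))"
    unfolding e by simp
  also have "\<dots> = \<theta> \<cdot>\<^bsub>D\<^esub> FAr G (inv_arr B u)" unfolding H1 by simp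
  finally have "(t, s, inv_arr B u, inv_arr C v) \<in> Arr (iso_comma B C D G H)"
    using f by (auto simp: st hom_def)
  then show ?thesis using f
    by (intro category.is_isoI[OF iso_comma_category[OF G H], where g = "(t, s, inv_arr B u, inv_arr C v)"])
       (auto simp: st)
qed

lemma iso_comma_isoD:
  assumes f: "is_iso (iso_comma B C D G H) (s, t, u, v)"
  shows "is_iso B u" "is_iso C v"
proof -
  obtain b c \<theta> b' c' \<theta>' where st: "s = (b, c, \<theta>)" "t = (b', c', \<theta>')" by (metis prod_cases3)
  obtain s1 t1 u' v' where i: "inv_arr (iso_comma B C D G H) (s, t, u, v) = (s1, t1, u', v')"
    by (metis prod_cases3)
  have [simp]: "s1 = t" "t1 = s" using inv_arr(2,3)[OF f] unfolding i by auto
  show "is_iso B u" "is_iso C v"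
    using is_iso_Arr[OF f] inv_arr(1)[OF f] inv_arr(4,5)[OF f] unfolding i is_iso_def
    by (auto simp: st hom_def)
qed

lemma to_iso_comma_simps [simp]:
  "a \<in> Obj A \<Longrightarrow> FOb (to_iso_comma A P Q \<theta>) a = (FOb P a, FOb Q a, \<theta> a)"
  "z \<in> Arr A \<Longrightarrow> FAr (to_iso_comma A P Q \<theta>) z =
     ((FOb P (Dom A z), FOb Q (Dom A z), \<theta> (Dom A z)),
      (FOb P (Cod A z), FOb Q (Cod A z), \<theta> (Cod A z)), FAr P z, FAr Q z)"
  by (auto simp: to_iso_comma_def)

lemma to_iso_comma_functor:
  assumes P: "is_functor A B P" and Q: "is_functor A C Q" and G: "is_functor B D G"
    and H: "is_functor C D H" and t: "nat_iso A D (comp_func A G P) (comp_func A H Q) \<theta>"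
  shows "is_functor A (iso_comma B C D G H) (to_iso_comma A P Q \<theta>)"
proof -
  note [simp] = functor_simps[OF P] functor_simps[OF Q] functor_simps[OF G] functor_simps[OF H]
    nat_iso_simps[OF t]
  interpret A: category A by simp
  have nt: "\<theta> (Cod A z) \<cdot>\<^bsub>D\<^esub> FAr G (FAr P z) = FAr H (FAr Q z) \<cdot>\<^bsub>D\<^esub> \<theta> (Dom A z)" if "z \<in> Arr A" for z
    using nat_iso_nat[OF t that] that by simp
  show ?thesis
    by (rule is_functorI)
      (auto simp: hom_def nt iso_comma_category[OF G H], auto simp: to_iso_comma_def)
qed

text \<open>Full faithfulness and essential surjectivity of the functor into the iso-comma category,
  written out in components. In \<open>es\<close> it suffices that \<open>u\<close> and
  \<open>v\<close> are invertible, because an arrow of the iso-comma category with invertible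
  components is invertible.\<close>

lemma homotopy_pullbackI:
  assumes P: "is_functor A B P" and Q: "is_functor A C Q" and G: "is_functor B D G"
    and H: "is_functor C D H" and t: "nat_iso A D (comp_func A G P) (comp_func A H Q) \<theta>"
    and ff: "\<And>x x' u v. \<lbrakk>x \<in> Obj A; x' \<in> Obj A; u \<in> hom B (FOb P x) (FOb P x');
        v \<in> hom C (FOb Q x) (FOb Q x'); \<theta> x' \<cdot>\<^bsub>D\<^esub> FAr G u = FAr H v \<cdot>\<^bsub>D\<^esub> \<theta> x\<rbrakk> \<Longrightarrow>
        \<exists>!z. z \<in> hom A x x' \<and> FAr P z = u \<and> FAr Q z = v"
    and es: "\<And>b c w. \<lbrakk>b \<in> Obj B; c \<in> Obj C; w \<in> hom D (FOb G b) (FOb H c); is_iso D w\<rbrakk> \<Longrightarrow>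
        \<exists>x \<in> Obj A. \<exists>u \<in> hom B (FOb P x) b. \<exists>v \<in> hom C (FOb Q x) c.
          is_iso B u \<and> is_iso C v \<and> w \<cdot>\<^bsub>D\<^esub> FAr G u = FAr H v \<cdot>\<^bsub>D\<^esub> \<theta> x"
  shows "homotopy_pullback A B C D P Q G H \<theta>"
proof -
  note [simp] = functor_simps[OF P] functor_simps[OF Q] functor_simps[OF G] functor_simps[OF H]
    nat_iso_simps[OF t]
  have "is_equivalence A (iso_comma B C D G H) (to_iso_comma A P Q \<theta>)"
  proof (rule is_equivalenceI)
    show "is_functor A (iso_comma B C D G H) (to_iso_comma A P Q \<theta>)"
      by (rule to_iso_comma_functor[OF P Q G H t])
  next
    fix x x' g
    assume x: "x \<in> Obj A" "x' \<in> Obj A"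
      and g: "g \<in> hom (iso_comma B C D G H) (FOb (to_iso_comma A P Q \<theta>) x) (FOb (to_iso_comma A P Q \<theta>) x')"
    obtain s t u v where g': "g = (s, t, u, v)" by (metis prod_cases3)
    have "\<exists>!z. z \<in> hom A x x' \<and> FAr P z = u \<and> FAr Q z = v"
      using g x by (intro ff) (auto simp: g' hom_def)
    then show "\<exists>!f. f \<in> hom A x x' \<and> FAr (to_iso_comma A P Q \<theta>) f = g"
      using g x by (auto simp: g' hom_def cong: conj_cong)
  next
    fix d assume d: "d \<in> Obj (iso_comma B C D G H)"
    obtain b c w where d': "d = (b, c, w)" by (metis prod_cases3)
    obtain x u v where xuv: "x \<in> Obj A" "u \<in> hom B (FOb P x) b" "v \<in> hom C (FOb Q x) c" "is_iso B u"
      "is_iso C v" "w \<cdot>\<^bsub>D\<^esub> FAr G u = FAr H v \<cdot>\<^bsub>D\<^esub> \<theta> x" using es[of b c w] d by (auto simp: d')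
    let ?t = "((FOb P x, FOb Q x, \<theta> x), (b, c, w), u, v)"
    have t: "?t \<in> Arr (iso_comma B C D G H)" using xuv d by (auto simp: d' hom_def)
    then show "\<exists>x\<in>Obj A. \<exists>t\<in>hom (iso_comma B C D G H) (FOb (to_iso_comma A P Q \<theta>) x) d.
      is_iso (iso_comma B C D G H) t"
      using xuv iso_comma_isoI[OF G H t]
      by (intro bexI[where x = x] bexI[where x = ?t]) (auto simp: d' intro!: homI)
  qed
  then show ?thesis using assms(1-5) by (simp add: homotopy_pullback_def)
qed

text \<open>The same conditions in the other direction; they are what the pasting of two squares
  consumes.\<close>

lemma homotopy_pullbackD:
  assumes "homotopy_pullback A B C D P Q G H \<theta>"
  shows homotopy_pullback_P: "is_functor A B P" and homotopy_pullback_Q: "is_functor A C Q"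
    and homotopy_pullback_G: "is_functor B D G" and homotopy_pullback_H: "is_functor C D H"
    and homotopy_pullback_nat: "nat_iso A D (comp_func A G P) (comp_func A H Q) \<theta>"
    and homotopy_pullback_ff: "\<And>x x' u v. \<lbrakk>x \<in> Obj A; x' \<in> Obj A; u \<in> hom B (FOb P x) (FOb P x');
        v \<in> hom C (FOb Q x) (FOb Q x'); \<theta> x' \<cdot>\<^bsub>D\<^esub> FAr G u = FAr H v \<cdot>\<^bsub>D\<^esub> \<theta> x\<rbrakk> \<Longrightarrow>
        \<exists>!z. z \<in> hom A x x' \<and> FAr P z = u \<and> FAr Q z = v"
    and homotopy_pullback_es: "\<And>b c w. \<lbrakk>b \<in> Obj B; c \<in> Obj C; w \<in> hom D (FOb G b) (FOb H c); is_iso D w\<rbrakk> \<Longrightarrow>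
        \<exists>x \<in> Obj A. \<exists>u \<in> hom B (FOb P x) b. \<exists>v \<in> hom C (FOb Q x) c.
          is_iso B u \<and> is_iso C v \<and> w \<cdot>\<^bsub>D\<^esub> FAr G u = FAr H v \<cdot>\<^bsub>D\<^esub> \<theta> x"
proof -
  show P: "is_functor A B P" and Q: "is_functor A C Q" and G: "is_functor B D G" and H: "is_functor C D H"
    and t: "nat_iso A D (comp_func A G P) (comp_func A H Q) \<theta>"
    using assms by (auto simp: homotopy_pullback_def)
  have e: "is_equivalence A (iso_comma B C D G H) (to_iso_comma A P Q \<theta>)"
    using assms by (auto simp: homotopy_pullback_def)
  note [simp] = functor_simps[OF P] functor_simps[OF Q] functor_simps[OF G] functor_simps[OF H]
    nat_iso_simps[OF t]
  show "\<exists>!z. z \<in> hom A x x' \<and> FAr P z = u \<and> FAr Q z = v"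
    if "x \<in> Obj A" "x' \<in> Obj A" "u \<in> hom B (FOb P x) (FOb P x')" "v \<in> hom C (FOb Q x) (FOb Q x')"
      "\<theta> x' \<cdot>\<^bsub>D\<^esub> FAr G u = FAr H v \<cdot>\<^bsub>D\<^esub> \<theta> x" for x x' u v
  proof -
    let ?g = "((FOb P x, FOb Q x, \<theta> x), (FOb P x', FOb Q x', \<theta> x'), u, v)"
    have "\<exists>!f. f \<in> hom A x x' \<and> FAr (to_iso_comma A P Q \<theta>) f = ?g"
      using that by (intro equivalence_ff[OF e]) (auto simp: hom_def)
    then show ?thesis by (auto simp: hom_def cong: conj_cong)
  qed
  show "\<exists>x \<in> Obj A. \<exists>u \<in> hom B (FOb P x) b. \<exists>v \<in> hom C (FOb Q x) c.
          is_iso B u \<and> is_iso C v \<and> w \<cdot>\<^bsub>D\<^esub> FAr G u = FAr H v \<cdot>\<^bsub>D\<^esub> \<theta> x"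
    if "b \<in> Obj B" "c \<in> Obj C" "w \<in> hom D (FOb G b) (FOb H c)" "is_iso D w" for b c w
  proof -
    have d: "(b, c, w) \<in> Obj (iso_comma B C D G H)" using that by simp
    obtain x t where x: "x \<in> Obj A" "is_iso (iso_comma B C D G H) t"
      "t \<in> hom (iso_comma B C D G H) (FOb (to_iso_comma A P Q \<theta>) x) (b, c, w)"
      using equivalence_es[OF e d] by blast
    obtain s1 t1 u v where t: "t = (s1, t1, u, v)" by (metis prod_cases3)
    show ?thesis using x iso_comma_isoD[of B C D G H s1 t1 u v] unfolding t
      by (intro bexI[where x = x] bexI[where x = u] bexI[where x = v]) (auto simp: hom_def)
  qed
qed

text \<open>Two squares sharing the side \<open>G\<close> are placed next to each other. This makes
  the pullback condition on morphisms of iesq sesquicartesian fibrations stable under composition.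
  The 2-cell of the outer rectangle is \<open>\<theta>'\<close> at \<open>P x\<close> followed by
  the image of \<open>\<theta> x\<close> under \<open>H'\<close>.\<close>

lemma homotopy_pullback_paste:
  assumes h: "homotopy_pullback A B C D P Q G H \<theta>"
    and h': "homotopy_pullback B B' D D' P' G G' H' \<theta>'"
  shows "homotopy_pullback A B' C D' (comp_func A P' P) Q G' (comp_func C H' H)
    (\<lambda>x\<in>Obj A. FAr H' (\<theta> x) \<cdot>\<^bsub>D'\<^esub> \<theta>' (FOb P x))" (is "homotopy_pullback _ _ _ _ _ _ _ _ ?t")
proof -
  note P = homotopy_pullback_P[OF h] and Q = homotopy_pullback_Q[OF h] and G = homotopy_pullback_G[OF h]
    and H = homotopy_pullback_H[OF h] and t = homotopy_pullback_nat[OF h]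
    and P' = homotopy_pullback_P[OF h'] and G' = homotopy_pullback_G[OF h']
    and H' = homotopy_pullback_H[OF h'] and t' = homotopy_pullback_nat[OF h']
  note [simp] = functor_simps[OF P] functor_simps[OF Q] functor_simps[OF G] functor_simps[OF H]
    functor_simps[OF P'] functor_simps[OF G'] functor_simps[OF H']
    nat_iso_simps[OF t] nat_iso_simps[OF t']
  interpret A: category A by simp
  interpret B: category B by simp
  interpret C: category C by simp
  interpret D: category D by simp
  interpret B': category B' by simp
  interpret D': category D' by simp
  have nt: "\<theta> (Cod A z) \<cdot>\<^bsub>D\<^esub> FAr G (FAr P z) = FAr H (FAr Q z) \<cdot>\<^bsub>D\<^esub> \<theta> (Dom A z)" if "z \<in> Arr A" for z
    using nat_iso_nat[OF t that] that by simp
  have nt': "\<theta>' (Cod B z) \<cdot>\<^bsub>D'\<^esub> FAr G' (FAr P' z) = FAr H' (FAr G z) \<cdot>\<^bsub>D'\<^esub> \<theta>' (Dom B z)" if "z \<in> Arr B" for z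
    using nat_iso_nat[OF t' that] that by simp
  have [simp]: "is_iso D' (FAr H' f)" if "is_iso D f" for f by (rule functor_iso[OF H' that])
  have [simp]: "is_iso B' (FAr P' f)" if "is_iso B f" for f by (rule functor_iso[OF P' that])
  show ?thesis
  proof (rule homotopy_pullbackI)
    show "nat_iso A D' (comp_func A G' (comp_func A P' P)) (comp_func A (comp_func C H' H) Q) ?t"
    proof (rule nat_isoI)
      fix f assume [simp]: "f \<in> Arr A"
      have "FAr H' (\<theta> (Cod A f)) \<cdot>\<^bsub>D'\<^esub> \<theta>' (FOb P (Cod A f)) \<cdot>\<^bsub>D'\<^esub> FAr G' (FAr P' (FAr P f))
        = FAr H' (\<theta> (Cod A f)) \<cdot>\<^bsub>D'\<^esub> FAr H' (FAr G (FAr P f)) \<cdot>\<^bsub>D'\<^esub> \<theta>' (FOb P (Dom A f))"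
        using nt'[of "FAr P f"] by simp
      also have "\<dots> = FAr H' (\<theta> (Cod A f) \<cdot>\<^bsub>D\<^esub> FAr G (FAr P f)) \<cdot>\<^bsub>D'\<^esub> \<theta>' (FOb P (Dom A f))"
        by simp
      also have "\<dots> = FAr H' (FAr H (FAr Q f)) \<cdot>\<^bsub>D'\<^esub> FAr H' (\<theta> (Dom A f)) \<cdot>\<^bsub>D'\<^esub> \<theta>' (FOb P (Dom A f))"
        unfolding nt[OF \<open>f \<in> Arr A\<close>] by simp
      finally show "?t (Cod A f) \<cdot>\<^bsub>D'\<^esub> FAr (comp_func A G' (comp_func A P' P)) f =
        FAr (comp_func A (comp_func C H' H) Q) f \<cdot>\<^bsub>D'\<^esub> ?t (Dom A f)" by simp
    qed (auto intro!: comp_functor[OF P P'] comp_functor[OF comp_functor[OF P P'] G']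
      comp_functor[OF Q comp_functor[OF H H']] homI)
  next
    fix x x' u v
    assume x[simp]: "x \<in> Obj A" "x' \<in> Obj A"
      and u: "u \<in> hom B' (FOb (comp_func A P' P) x) (FOb (comp_func A P' P) x')"
      and v: "v \<in> hom C (FOb Q x) (FOb Q x')"
      and e: "?t x' \<cdot>\<^bsub>D'\<^esub> FAr G' u = FAr (comp_func C H' H) v \<cdot>\<^bsub>D'\<^esub> ?t x"
    have uv[simp]: "u \<in> Arr B'" "Dom B' u = FOb P' (FOb P x)" "Cod B' u = FOb P' (FOb P x')"
      "v \<in> Arr C" "Dom C v = FOb Q x" "Cod C v = FOb Q x'" using u v by (auto simp: hom_def)
    \<comment> \<open>The image of the sought arrow along the shared side \<open>G\<close> is
      forced: \<open>\<theta> x'\<close> is invertible, so \<open>v\<close> determines it. The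
      square of \<open>h'\<close> then supplies \<open>y\<close>, and the square of \<open>h\<close>
      supplies the arrow itself.\<close>
    define w where "w = inv_arr D (\<theta> x') \<cdot>\<^bsub>D\<^esub> FAr H v \<cdot>\<^bsub>D\<^esub> \<theta> x"
    have w[simp]: "w \<in> Arr D" "Dom D w = FOb G (FOb P x)" "Cod D w = FOb G (FOb P x')"
      by (auto simp: w_def)
    have w': "\<theta> x' \<cdot>\<^bsub>D\<^esub> w = FAr H v \<cdot>\<^bsub>D\<^esub> \<theta> x" by (simp add: w_def)
    have "FAr H' (\<theta> x') \<cdot>\<^bsub>D'\<^esub> (\<theta>' (FOb P x') \<cdot>\<^bsub>D'\<^esub> FAr G' u) = FAr H' (FAr H v \<cdot>\<^bsub>D\<^esub> \<theta> x) \<cdot>\<^bsub>D'\<^esub> \<theta>' (FOb P x)"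
      using e by simp
    also have "\<dots> = FAr H' (\<theta> x') \<cdot>\<^bsub>D'\<^esub> (FAr H' w \<cdot>\<^bsub>D'\<^esub> \<theta>' (FOb P x))" unfolding w'[symmetric] by simp
    finally have "\<theta>' (FOb P x') \<cdot>\<^bsub>D'\<^esub> FAr G' u = FAr H' w \<cdot>\<^bsub>D'\<^esub> \<theta>' (FOb P x)"
      by - (rule D'.iso_cancel_left[where f = "FAr H' (\<theta> x')"]; simp)
    then have 1: "\<exists>!y. y \<in> hom B (FOb P x) (FOb P x') \<and> FAr P' y = u \<and> FAr G y = w"
      by (intro homotopy_pullback_ff[OF h']) (auto simp: hom_def)
    then obtain y where y: "y \<in> hom B (FOb P x) (FOb P x')" "FAr P' y = u" "FAr G y = w" by blast
    have 2: "\<exists>!z. z \<in> hom A x x' \<and> FAr P z = y \<and> FAr Q z = v"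
      using y v by (intro homotopy_pullback_ff[OF h]) (auto simp: w')
    \<comment> \<open>A competitor \<open>z\<close> also satisfies
      \<open>FAr G (FAr P z) = w\<close>, so uniqueness in the square of \<open>h'\<close> applies
      to \<open>FAr P z\<close>.\<close>
    have "FAr P z = y" if z: "z \<in> hom A x x'" "FAr P' (FAr P z) = u" "FAr Q z = v" for z
    proof -
      have [simp]: "z \<in> Arr A" "Dom A z = x" "Cod A z = x'" using z by (auto simp: hom_def)
      have "FAr G (FAr P z) = w" using nt[of z] z(3) w'
        by - (rule D.iso_cancel_left[where f = "\<theta> x'"]; simp)
      then show ?thesis using 1 y z(2) by (auto simp: hom_def)
    qed
    then show "\<exists>!z. z \<in> hom A x x' \<and> FAr (comp_func A P' P) z = u \<and> FAr Q z = v"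
      using 2 y(2) by (auto simp: hom_def cong: conj_cong)
  next
    fix b c w
    assume [simp]: "b \<in> Obj B'" "c \<in> Obj C" and w: "w \<in> hom D' (FOb G' b) (FOb (comp_func C H' H) c)"
      and wi: "is_iso D' w"
    \<comment> \<open>Here the square of \<open>h'\<close> is used before the square of
      \<open>h\<close>: it produces the object \<open>y\<close>, which together with
      \<open>c\<close> is an input for the latter.\<close>
    obtain y u v where y[simp]: "y \<in> Obj B" and u: "u \<in> hom B' (FOb P' y) b"
      and v: "v \<in> hom D (FOb G y) (FOb H c)" and i[simp]: "is_iso B' u" "is_iso D v"
      and e: "w \<cdot>\<^bsub>D'\<^esub> FAr G' u = FAr H' v \<cdot>\<^bsub>D'\<^esub> \<theta>' y"
      using homotopy_pullback_es[OF h', of b "FOb H c" w] w wi by auto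
    obtain x u1 v1 where x[simp]: "x \<in> Obj A" and u1: "u1 \<in> hom B (FOb P x) y"
      and v1: "v1 \<in> hom C (FOb Q x) c" and i1[simp]: "is_iso B u1" "is_iso C v1"
      and e1: "v \<cdot>\<^bsub>D\<^esub> FAr G u1 = FAr H v1 \<cdot>\<^bsub>D\<^esub> \<theta> x"
      using homotopy_pullback_es[OF h, of y c v] v by auto
    have [simp]: "u \<in> Arr B'" "Dom B' u = FOb P' y" "Cod B' u = b"
      "u1 \<in> Arr B" "Dom B u1 = FOb P x" "Cod B u1 = y"
      "v \<in> Arr D" "Dom D v = FOb G y" "Cod D v = FOb H c"
      "v1 \<in> Arr C" "Dom C v1 = FOb Q x" "Cod C v1 = c"
      "w \<in> Arr D'" "Dom D' w = FOb G' b" "Cod D' w = FOb H' (FOb H c)"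
      using u u1 v v1 w by (auto simp: hom_def)
    have "w \<cdot>\<^bsub>D'\<^esub> FAr G' (u \<cdot>\<^bsub>B'\<^esub> FAr P' u1) = (w \<cdot>\<^bsub>D'\<^esub> FAr G' u) \<cdot>\<^bsub>D'\<^esub> FAr G' (FAr P' u1)" by simp
    also have "\<dots> = FAr H' v \<cdot>\<^bsub>D'\<^esub> (\<theta>' y \<cdot>\<^bsub>D'\<^esub> FAr G' (FAr P' u1))" unfolding e by simp
    also have "\<dots> = FAr H' (v \<cdot>\<^bsub>D\<^esub> FAr G u1) \<cdot>\<^bsub>D'\<^esub> \<theta>' (FOb P x)" using nt'[of u1] by simp
    also have "\<dots> = FAr (comp_func C H' H) v1 \<cdot>\<^bsub>D'\<^esub> ?t x" unfolding e1 by simp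
    finally show "\<exists>x\<in>Obj A. \<exists>u\<in>hom B' (FOb (comp_func A P' P) x) b. \<exists>v\<in>hom C (FOb Q x) c.
      is_iso B' u \<and> is_iso C v \<and> w \<cdot>\<^bsub>D'\<^esub> FAr G' u = FAr (comp_func C H' H) v \<cdot>\<^bsub>D'\<^esub> ?t x"
      by (intro bexI[where x = x] bexI[where x = "u \<cdot>\<^bsub>B'\<^esub> FAr P' u1"] bexI[where x = v1]) (auto simp: hom_def)
  qed (auto intro: comp_functor P P' H H' Q G')
qed

section \<open>Fibrations\<close>

text \<open>Passing to opposites exchanges cartesian and cocartesian arrows, hence also pullback and
  pushforward, so that one proof serves for a statement and its dual.\<close>

definition op :: "('o, 'm) cat \<Rightarrow> ('o, 'm) cat" where
  "op C = \<lparr>Obj = Obj C, Arr = Arr C, Dom = Cod C, Cod = Dom C, Ident = Ident C,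
     Comp = \<lambda>g f. f \<cdot>\<^bsub>C\<^esub> g\<rparr>"

lemma op_simps [simp]:
  "Obj (op C) = Obj C" "Arr (op C) = Arr C" "Dom (op C) = Cod C" "Cod (op C) = Dom C"
  "Ident (op C) = Ident C" "g \<cdot>\<^bsub>op C\<^esub> f = f \<cdot>\<^bsub>C\<^esub> g" "op (op C) = C"
  by (auto simp: op_def)

lemma op_hom [simp]: "hom (op C) x y = hom C y x"
  by (auto simp: hom_def)

lemma op_category: "category C \<Longrightarrow> category (op C)"
  by unfold_locales (auto simp: cat_simps)

lemma op_iso [simp]: "is_iso (op C) f \<longleftrightarrow> is_iso C f"
  by (auto simp: is_iso_def)

lemma op_functor: "is_functor C D F \<Longrightarrow> is_functor (op C) (op D) F"
  by (auto simp: is_functor_def op_category)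

lemma op_fibre: "fibre (op X) (op B) p b = op (fibre X B p b)"
  by (simp add: fibre_def op_def)

lemma op_cartesian [simp]: "cartesian (op X) (op B) p u \<longleftrightarrow> cocartesian X B p u"
  by (simp add: cartesian_def cocartesian_def)

lemma op_is_cart_lift [simp]: "is_cart_lift (op X) (op B) p \<sigma> x u \<longleftrightarrow> is_cocart_lift X B p \<sigma> x u"
  by (simp add: is_cart_lift_def is_cocart_lift_def)

lemma op_cart_lift [simp]: "cart_lift (op X) (op B) p = cocart_lift X B p"
  by (intro ext) (simp add: cart_lift_def cocart_lift_def)

lemma fibre_simps [simp]:
  "Obj (fibre X B p b) = {x \<in> Obj X. FOb p x = b}"
  "Arr (fibre X B p b) = {u \<in> Arr X. FAr p u = Ident B b}"
  "Dom (fibre X B p b) = Dom X" "Cod (fibre X B p b) = Cod X"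
  "Ident (fibre X B p b) = Ident X" "g \<cdot>\<^bsub>fibre X B p b\<^esub> f = g \<cdot>\<^bsub>X\<^esub> f"
  by (auto simp: fibre_def)

lemma op_pullback: "pullback (op X) (op B) p \<sigma> = pushforward X B p \<sigma>"
  by (simp add: pullback_def pushforward_def Let_def)

locale category_over =
  fixes X :: "('o, 'm) cat" and B :: "('b, 'k) cat" and p :: "('o, 'm, 'b, 'k) func"
  assumes proj: "is_functor X B p"
begin

sublocale X: category X by (rule functor_cat_dom[OF proj])
sublocale B: category B by (rule functor_cat_cod[OF proj])

lemmas proj_simps [simp] = functor_simps[OF proj]

lemma op: "category_over (op X) (op B) p"
  by unfold_locales (rule op_functor[OF proj])

lemma fibre_category: "b \<in> Obj B \<Longrightarrow> category (fibre X B p b)"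
proof unfold_locales
  fix f assume b: "b \<in> Obj B" and f: "f \<in> Arr (fibre X B p b)"
  then show "Dom (fibre X B p b) f \<in> Obj (fibre X B p b)" "Cod (fibre X B p b) f \<in> Obj (fibre X B p b)"
    using functor_Dom[OF proj, of f, symmetric] functor_Cod[OF proj, of f, symmetric] by simp_all
qed auto

text \<open>The inverse of a vertical isomorphism is vertical, as its image is inverse to an
  identity. Invertibility in a fibre may therefore be discussed in the total category.\<close>

lemma fibre_iso:
  assumes b: "b \<in> Obj B"
  shows "is_iso (fibre X B p b) u \<longleftrightarrow> is_iso X u \<and> FAr p u = Ident B b"
proof
  assume "is_iso (fibre X B p b) u"
  then show "is_iso X u \<and> FAr p u = Ident B b" by (auto simp: is_iso_def hom_def)
next
  assume u: "is_iso X u \<and> FAr p u = Ident B b"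
  then have u': "u \<in> Arr X" and [simp]: "is_iso X u" "FAr p u = Ident B b" by (auto dest: is_iso_Arr)
  have [simp]: "FOb p (Dom X u) = b"
    using functor_Dom[OF proj u'] b by simp
  have "FAr p (inv_arr X u) \<cdot>\<^bsub>B\<^esub> FAr p u = Ident B b"
    using functor_Comp[OF proj, of u "inv_arr X u"] u u' by simp
  moreover have "Dom B (FAr p (inv_arr X u)) = b"
    using u functor_Cod[OF proj u'] b by simp
  ultimately have "FAr p (inv_arr X u) = Ident B b" using b by simp
  then show "is_iso (fibre X B p b) u"
    using u u' by (intro category.is_isoI[OF fibre_category[OF b], where g = "inv_arr X u"]) auto
qed

lemma vert_Ob:
  assumes "u \<in> Arr X" "FAr p u = Ident B b" "b \<in> Obj B"
  shows "FOb p (Dom X u) = b" "FOb p (Cod X u) = b"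
  using functor_Dom[OF proj assms(1)] functor_Cod[OF proj assms(1)] assms(2,3) by auto

lemma cartesian_Arr: "cartesian X B p u \<Longrightarrow> u \<in> Arr X"
  by (simp add: cartesian_def)

lemma cartesian_ex1:
  assumes "cartesian X B p u" "v \<in> Arr X" "\<rho> \<in> hom B (FOb p (Dom X v)) (FOb p (Dom X u))"
    "Cod X v = Cod X u \<and> FAr p u \<cdot>\<^bsub>B\<^esub> \<rho> = FAr p v"
  shows "\<exists>!w. w \<in> hom X (Dom X v) (Dom X u) \<and> FAr p w = \<rho> \<and> u \<cdot>\<^bsub>X\<^esub> w = v"
  using assms unfolding cartesian_def by blast

lemma cartesian_fill:
  assumes "cartesian X B p u" "v \<in> Arr X" "\<rho> \<in> Arr B" "Dom B \<rho> = FOb p (Dom X v)"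
    "Cod B \<rho> = FOb p (Dom X u)" "Cod X v = Cod X u" "FAr p u \<cdot>\<^bsub>B\<^esub> \<rho> = FAr p v"
  obtains w where "w \<in> Arr X" "Dom X w = Dom X v" "Cod X w = Dom X u" "FAr p w = \<rho>" "u \<cdot>\<^bsub>X\<^esub> w = v"
proof -
  have "\<exists>!w. w \<in> hom X (Dom X v) (Dom X u) \<and> FAr p w = \<rho> \<and> u \<cdot>\<^bsub>X\<^esub> w = v"
    using assms by (intro cartesian_ex1) (auto simp: hom_def)
  then show ?thesis using that by (auto simp: hom_def)
qed

lemma cartesian_unique:
  assumes "cartesian X B p u" "w \<in> Arr X" "w' \<in> Arr X" "Dom X w = Dom X w'" "Cod X w = Dom X u"
    "Cod X w' = Dom X u" "FAr p w = FAr p w'" "u \<cdot>\<^bsub>X\<^esub> w = u \<cdot>\<^bsub>X\<^esub> w'"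
  shows "w = w'"
proof -
  have u: "u \<in> Arr X" using assms(1) by (rule cartesian_Arr)
  have "\<exists>!z. z \<in> hom X (Dom X (u \<cdot>\<^bsub>X\<^esub> w)) (Dom X u) \<and> FAr p z = FAr p w \<and> u \<cdot>\<^bsub>X\<^esub> z = u \<cdot>\<^bsub>X\<^esub> w"
    using u assms(2-7) by (intro cartesian_ex1[OF assms(1)]) (auto simp: hom_def)
  then show ?thesis using assms u by (auto simp: hom_def)
qed

lemma cartesian_fill_vert:
  assumes "cartesian X B p u" "v \<in> Arr X" "Cod X v = Cod X u" "FAr p v = FAr p u"
  obtains w where "w \<in> Arr X" "Dom X w = Dom X v" "Cod X w = Dom X u"
    "FAr p w = Ident B (FOb p (Dom X u))" "u \<cdot>\<^bsub>X\<^esub> w = v"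
proof -
  have u: "u \<in> Arr X" using assms(1) by (rule cartesian_Arr)
  have "FOb p (Dom X v) = FOb p (Dom X u)"
    using functor_Dom[OF proj u] functor_Dom[OF proj assms(2)] assms(4) by simp
  then show ?thesis
    using cartesian_fill[OF assms(1,2), of "Ident B (FOb p (Dom X u))"] u assms that by auto
qed

text \<open>The isomorphism \<open>w\<close> may lie over any isomorphism of the base. A filler
  through the composite is obtained from a filler \<open>z\<close> through \<open>u\<close> over
  \<open>FAr p w\<close> composed with \<open>\<rho>\<close>, by applying the inverse of
  \<open>w\<close>.\<close>

lemma cartesian_comp_iso:
  assumes u: "cartesian X B p u" and w: "is_iso X w" "Cod X w = Dom X u"
  shows "cartesian X B p (u \<cdot>\<^bsub>X\<^esub> w)"
  unfolding cartesian_def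
proof (intro conjI ballI impI)
  have [simp]: "u \<in> Arr X" "w \<in> Arr X" "is_iso X w" "Cod X w = Dom X u" "is_iso B (FAr p w)"
    using cartesian_Arr[OF u] is_iso_Arr[OF w(1)] w functor_iso[OF proj w(1)] by auto
  show "u \<cdot>\<^bsub>X\<^esub> w \<in> Arr X" by simp
  fix v \<rho>
  assume v: "v \<in> Arr X" and "\<rho> \<in> hom B (FOb p (Dom X v)) (FOb p (Dom X (u \<cdot>\<^bsub>X\<^esub> w)))"
    and "Cod X v = Cod X (u \<cdot>\<^bsub>X\<^esub> w) \<and> FAr p (u \<cdot>\<^bsub>X\<^esub> w) \<cdot>\<^bsub>B\<^esub> \<rho> = FAr p v"
  then have r[simp]: "\<rho> \<in> Arr B" "Dom B \<rho> = FOb p (Dom X v)" "Cod B \<rho> = FOb p (Dom X w)"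
    "Cod X v = Cod X u" and e: "FAr p u \<cdot>\<^bsub>B\<^esub> (FAr p w \<cdot>\<^bsub>B\<^esub> \<rho>) = FAr p v"
    by (auto simp: hom_def)
  obtain z where z: "z \<in> Arr X" "Dom X z = Dom X v" "Cod X z = Dom X u" "FAr p z = FAr p w \<cdot>\<^bsub>B\<^esub> \<rho>"
    "u \<cdot>\<^bsub>X\<^esub> z = v"
    using cartesian_fill[OF u v, of "FAr p w \<cdot>\<^bsub>B\<^esub> \<rho>"] e v by auto
  have 1: "FAr p (inv_arr X w) \<cdot>\<^bsub>B\<^esub> FAr p w = Ident B (FOb p (Dom X w))"
    using functor_Comp[OF proj, of w "inv_arr X w"] by simp
  have "FAr p (inv_arr X w \<cdot>\<^bsub>X\<^esub> z) = (FAr p (inv_arr X w) \<cdot>\<^bsub>B\<^esub> FAr p w) \<cdot>\<^bsub>B\<^esub> \<rho>"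
    using z by simp
  then have 2: "FAr p (inv_arr X w \<cdot>\<^bsub>X\<^esub> z) = \<rho>" unfolding 1 by simp
  show "\<exists>!z. z \<in> hom X (Dom X v) (Dom X (u \<cdot>\<^bsub>X\<^esub> w)) \<and> FAr p z = \<rho> \<and> (u \<cdot>\<^bsub>X\<^esub> w) \<cdot>\<^bsub>X\<^esub> z = v"
  proof (rule ex1I[where a = "inv_arr X w \<cdot>\<^bsub>X\<^esub> z"])
    show "inv_arr X w \<cdot>\<^bsub>X\<^esub> z \<in> hom X (Dom X v) (Dom X (u \<cdot>\<^bsub>X\<^esub> w)) \<and> FAr p (inv_arr X w \<cdot>\<^bsub>X\<^esub> z) = \<rho> \<and>
      (u \<cdot>\<^bsub>X\<^esub> w) \<cdot>\<^bsub>X\<^esub> (inv_arr X w \<cdot>\<^bsub>X\<^esub> z) = v"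
      using z 2 by (simp add: hom_def)
    fix y assume "y \<in> hom X (Dom X v) (Dom X (u \<cdot>\<^bsub>X\<^esub> w)) \<and> FAr p y = \<rho> \<and> (u \<cdot>\<^bsub>X\<^esub> w) \<cdot>\<^bsub>X\<^esub> y = v"
    then have y: "y \<in> Arr X" "Dom X y = Dom X v" "Cod X y = Dom X w" "FAr p y = \<rho>" "u \<cdot>\<^bsub>X\<^esub> (w \<cdot>\<^bsub>X\<^esub> y) = v"
      by (auto simp: hom_def)
    have "w \<cdot>\<^bsub>X\<^esub> y = z" by (rule cartesian_unique[OF u]) (use y z in auto)
    then show "y = inv_arr X w \<cdot>\<^bsub>X\<^esub> z" using y by auto
  qed
qed

text \<open>Each of the two lifts fills through the other, and uniqueness of fillers makes the two
  vertical arrows mutually inverse. This is the tool for passing between chosen lifts and explicit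
  ones.\<close>

lemma cartesian_lift_iso:
  assumes u: "cartesian X B p u" and v: "cartesian X B p v" and c: "Cod X v = Cod X u"
    and e: "FAr p v = FAr p u"
  obtains w where "w \<in> Arr X" "is_iso X w" "Dom X w = Dom X v" "Cod X w = Dom X u"
    "FAr p w = Ident B (FOb p (Dom X u))" "u \<cdot>\<^bsub>X\<^esub> w = v"
proof -
  have [simp]: "u \<in> Arr X" "v \<in> Arr X" using cartesian_Arr u v by auto
  have [simp]: "FOb p (Dom X v) = FOb p (Dom X u)"
    using functor_Dom[OF proj, of u] functor_Dom[OF proj, of v] e by simp
  obtain w where w: "w \<in> Arr X" "Dom X w = Dom X v" "Cod X w = Dom X u"
    "FAr p w = Ident B (FOb p (Dom X u))" "u \<cdot>\<^bsub>X\<^esub> w = v"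
    using cartesian_fill_vert[OF u, of v] c e by auto
  obtain w' where w': "w' \<in> Arr X" "Dom X w' = Dom X u" "Cod X w' = Dom X v"
    "FAr p w' = Ident B (FOb p (Dom X u))" "v \<cdot>\<^bsub>X\<^esub> w' = u"
    using cartesian_fill_vert[OF v, of u] c e by auto
  have "w' \<cdot>\<^bsub>X\<^esub> w = Ident X (Dom X v)"
    by (rule cartesian_unique[OF v]) (use w w' in \<open>auto simp: X.Comp_assoc[symmetric] simp del: X.Comp_assoc\<close>)
  moreover have "w \<cdot>\<^bsub>X\<^esub> w' = Ident X (Dom X u)"
    by (rule cartesian_unique[OF u]) (use w w' in \<open>auto simp: X.Comp_assoc[symmetric] simp del: X.Comp_assoc\<close>)
  ultimately have "is_iso X w" using w w' by (intro X.is_isoI[where g = w']) auto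
  then show ?thesis using w that by blast
qed

end

section \<open>Cocartesian arrows, by passing to opposite categories\<close>

context category_over
begin

interpretation op: category_over "op X" "op B" p by (rule op)

lemma cocartesian_Arr: "cocartesian X B p u \<Longrightarrow> u \<in> Arr X"
  by (simp add: cocartesian_def)

lemmas cocartesian_fill = op.cartesian_fill[unfolded op_simps op_cartesian]
lemmas cocartesian_unique = op.cartesian_unique[unfolded op_simps op_cartesian]
lemmas cocartesian_comp_iso = op.cartesian_comp_iso[unfolded op_simps op_cartesian op_iso]
lemmas cocartesian_lift_iso = op.cartesian_lift_iso[unfolded op_simps op_cartesian op_iso]

end

text \<open>A single arrow \<open>\<tau>\<close> is fixed, because a sesquicartesian fibration
  guarantees cartesian lifts along convex arrows only.\<close>

locale cart_lifts = category_over +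
  fixes \<tau>
  assumes base_Arr: "\<tau> \<in> Arr B"
    and lift_ex: "\<And>x. \<lbrakk>x \<in> Obj X; FOb p x = Cod B \<tau>\<rbrakk> \<Longrightarrow> \<exists>u. is_cart_lift X B p \<tau> x u"
begin

lemma lift:
  assumes "x \<in> Obj X" "FOb p x = Cod B \<tau>"
  shows "cartesian X B p (cart_lift X B p \<tau> x)" "cart_lift X B p \<tau> x \<in> Arr X"
    "FAr p (cart_lift X B p \<tau> x) = \<tau>" "Cod X (cart_lift X B p \<tau> x) = x"
    "FOb p (Dom X (cart_lift X B p \<tau> x)) = Dom B \<tau>" "Dom X (cart_lift X B p \<tau> x) \<in> Obj X"
proof -
  have "is_cart_lift X B p \<tau> x (cart_lift X B p \<tau> x)"
    unfolding cart_lift_def by (rule someI_ex) (rule lift_ex[OF assms])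
  then show "cartesian X B p (cart_lift X B p \<tau> x)" "FAr p (cart_lift X B p \<tau> x) = \<tau>"
    "Cod X (cart_lift X B p \<tau> x) = x" and u: "cart_lift X B p \<tau> x \<in> Arr X"
    by (auto simp: is_cart_lift_def cartesian_Arr)
  then show "FOb p (Dom X (cart_lift X B p \<tau> x)) = Dom B \<tau>" "Dom X (cart_lift X B p \<tau> x) \<in> Obj X"
    using functor_Dom[OF proj u] by auto
qed

lemma pullback_Ob:
  assumes "x \<in> Obj X" "FOb p x = Cod B \<tau>"
  shows "FOb (pullback X B p \<tau>) x = Dom X (cart_lift X B p \<tau> x)"
  using assms by (simp add: pullback_def Let_def)

text \<open>Discharges the definite description in \<open>pullback\<close>: the vertical filler
  through the chosen lift exists, and it is unique because that lift is cartesian.\<close>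

lemma pullback_Ar:
  assumes u: "u \<in> Arr X" "FAr p u = Ident B (Cod B \<tau>)"
  shows "FAr (pullback X B p \<tau>) u \<in> Arr X"
    "Dom X (FAr (pullback X B p \<tau>) u) = Dom X (cart_lift X B p \<tau> (Dom X u))"
    "Cod X (FAr (pullback X B p \<tau>) u) = Dom X (cart_lift X B p \<tau> (Cod X u))"
    "FAr p (FAr (pullback X B p \<tau>) u) = Ident B (Dom B \<tau>)"
    "cart_lift X B p \<tau> (Cod X u) \<cdot>\<^bsub>X\<^esub> FAr (pullback X B p \<tau>) u = u \<cdot>\<^bsub>X\<^esub> cart_lift X B p \<tau> (Dom X u)"
proof -
  let ?l = "cart_lift X B p \<tau>"
  let ?P = "\<lambda>w. w \<in> hom X (Dom X (?l (Dom X u))) (Dom X (?l (Cod X u))) \<and>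
              FAr p w = Ident B (Dom B \<tau>) \<and> ?l (Cod X u) \<cdot>\<^bsub>X\<^esub> w = u \<cdot>\<^bsub>X\<^esub> ?l (Dom X u)"
  have [simp]: "FOb p (Dom X u) = Cod B \<tau>" "FOb p (Cod X u) = Cod B \<tau>"
    using vert_Ob[OF u] base_Arr by auto
  note [simp] = lift base_Arr u
  obtain w where w: "w \<in> Arr X" "Dom X w = Dom X (u \<cdot>\<^bsub>X\<^esub> ?l (Dom X u))" "Cod X w = Dom X (?l (Cod X u))"
    "FAr p w = Ident B (FOb p (Dom X (?l (Cod X u))))" "?l (Cod X u) \<cdot>\<^bsub>X\<^esub> w = u \<cdot>\<^bsub>X\<^esub> ?l (Dom X u)"
    using cartesian_fill_vert[of "?l (Cod X u)" "u \<cdot>\<^bsub>X\<^esub> ?l (Dom X u)"] by auto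
  have "\<exists>!w. ?P w"
  proof (rule ex1I[where a = w])
    show "?P w" using w by (auto simp: hom_def)
    fix y assume "?P y"
    then show "y = w" using w
      by - (rule cartesian_unique[of "?l (Cod X u)"]; auto simp: hom_def)
  qed
  from theI'[OF this] have "?P (FAr (pullback X B p \<tau>) u)"
    by (simp add: pullback_def Let_def)
  then show "FAr (pullback X B p \<tau>) u \<in> Arr X"
    "Dom X (FAr (pullback X B p \<tau>) u) = Dom X (?l (Dom X u))"
    "Cod X (FAr (pullback X B p \<tau>) u) = Dom X (?l (Cod X u))"
    "FAr p (FAr (pullback X B p \<tau>) u) = Ident B (Dom B \<tau>)"
    "?l (Cod X u) \<cdot>\<^bsub>X\<^esub> FAr (pullback X B p \<tau>) u = u \<cdot>\<^bsub>X\<^esub> ?l (Dom X u)"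
    by (auto simp: hom_def)
qed

lemma pullback_Ar_eqI:
  assumes u: "u \<in> Arr X" "FAr p u = Ident B (Cod B \<tau>)"
    and w: "w \<in> Arr X" "Dom X w = Dom X (cart_lift X B p \<tau> (Dom X u))"
      "Cod X w = Dom X (cart_lift X B p \<tau> (Cod X u))" "FAr p w = Ident B (Dom B \<tau>)"
      "cart_lift X B p \<tau> (Cod X u) \<cdot>\<^bsub>X\<^esub> w = u \<cdot>\<^bsub>X\<^esub> cart_lift X B p \<tau> (Dom X u)"
  shows "FAr (pullback X B p \<tau>) u = w"
proof (rule cartesian_unique)
  show "cartesian X B p (cart_lift X B p \<tau> (Cod X u))"
    using vert_Ob[OF u] base_Arr u by (auto simp: lift)
qed (use w pullback_Ar[OF u] in auto)

lemma pullback_functor: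
  "is_functor (fibre X B p (Cod B \<tau>)) (fibre X B p (Dom B \<tau>)) (pullback X B p \<tau>)"
proof (rule is_functorI)
  note [simp] = lift base_Arr
  fix x assume "x \<in> Obj (fibre X B p (Cod B \<tau>))"
  then show "FAr (pullback X B p \<tau>) (Ident (fibre X B p (Cod B \<tau>)) x) =
    Ident (fibre X B p (Dom B \<tau>)) (FOb (pullback X B p \<tau>) x)"
    by (auto simp: pullback_Ob intro!: pullback_Ar_eqI)
next
  note [simp] = lift base_Arr pullback_Ar(1-4)
  fix f g assume "f \<in> Arr (fibre X B p (Cod B \<tau>))" "g \<in> Arr (fibre X B p (Cod B \<tau>))"
    "Cod (fibre X B p (Cod B \<tau>)) f = Dom (fibre X B p (Cod B \<tau>)) g"
  then have [simp]: "f \<in> Arr X" "g \<in> Arr X" "Cod X f = Dom X g"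
    "FAr p f = Ident B (Cod B \<tau>)" "FAr p g = Ident B (Cod B \<tau>)" by auto
  have [simp]: "FOb p (Dom X f) = Cod B \<tau>" "FOb p (Dom X g) = Cod B \<tau>" "FOb p (Cod X g) = Cod B \<tau>"
    using vert_Ob[of f "Cod B \<tau>"] vert_Ob[of g "Cod B \<tau>"] by auto
  have "cart_lift X B p \<tau> (Cod X g) \<cdot>\<^bsub>X\<^esub> (FAr (pullback X B p \<tau>) g \<cdot>\<^bsub>X\<^esub> FAr (pullback X B p \<tau>) f)
    = (cart_lift X B p \<tau> (Cod X g) \<cdot>\<^bsub>X\<^esub> FAr (pullback X B p \<tau>) g) \<cdot>\<^bsub>X\<^esub> FAr (pullback X B p \<tau>) f"
    by simp
  also have "\<dots> = g \<cdot>\<^bsub>X\<^esub> (cart_lift X B p \<tau> (Cod X f) \<cdot>\<^bsub>X\<^esub> FAr (pullback X B p \<tau>) f)"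
    unfolding pullback_Ar(5)[OF \<open>g \<in> Arr X\<close> \<open>FAr p g = Ident B (Cod B \<tau>)\<close>] by simp
  also have "\<dots> = g \<cdot>\<^bsub>X\<^esub> (f \<cdot>\<^bsub>X\<^esub> cart_lift X B p \<tau> (Dom X f))"
    unfolding pullback_Ar(5)[OF \<open>f \<in> Arr X\<close> \<open>FAr p f = Ident B (Cod B \<tau>)\<close>] ..
  finally show "FAr (pullback X B p \<tau>) (g \<cdot>\<^bsub>fibre X B p (Cod B \<tau>)\<^esub> f) =
    FAr (pullback X B p \<tau>) g \<cdot>\<^bsub>fibre X B p (Dom B \<tau>)\<^esub> FAr (pullback X B p \<tau>) f"
    by (auto intro!: pullback_Ar_eqI)
qed (use base_Arr in \<open>auto simp: fibre_category lift pullback_Ob pullback_Ar vert_Ob\<close>,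
     auto simp: pullback_def Let_def)

end

locale cocart_lifts = category_over +
  fixes \<sigma>
  assumes base_Arr: "\<sigma> \<in> Arr B"
    and lift_ex: "\<And>x. \<lbrakk>x \<in> Obj X; FOb p x = Dom B \<sigma>\<rbrakk> \<Longrightarrow> \<exists>u. is_cocart_lift X B p \<sigma> x u"
begin

interpretation op: cart_lifts "op X" "op B" p \<sigma>
  using base_Arr lift_ex op by (auto simp: cart_lifts_def cart_lifts_axioms_def)

lemmas lift = op.lift[unfolded op_simps op_cartesian op_cart_lift]
lemmas pushforward_Ob = op.pullback_Ob[unfolded op_simps op_cartesian op_cart_lift op_pullback]
lemmas pushforward_Ar = op.pullback_Ar[unfolded op_simps op_cartesian op_cart_lift op_pullback]
lemmas pushforward_Ar_eqI = op.pullback_Ar_eqI[unfolded op_simps op_cartesian op_cart_lift op_pullback]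
lemmas pushforward_functor =
  op.pullback_functor[THEN op_functor, unfolded op_fibre op_simps op_cartesian op_cart_lift op_pullback]

end

section \<open>Beck-Chevalley squares\<close>

context category
begin

text \<open>Simplification nests composites to the right, which hides a commuting square that is
  preceded by a further arrow \<open>h\<close>. This rule applies the square in that
  position.\<close>

lemma Comp_reassoc:
  assumes "a \<cdot> b = c \<cdot> d" "a \<in> Arr C" "b \<in> Arr C" "c \<in> Arr C" "d \<in> Arr C" "h \<in> Arr C"
    "Cod C b = Dom C a" "Cod C d = Dom C c" "Cod C h = Dom C b" "Dom C d = Dom C b"
  shows "a \<cdot> (b \<cdot> h) = c \<cdot> (d \<cdot> h)"
proof -
  have "a \<cdot> (b \<cdot> h) = (a \<cdot> b) \<cdot> h" using assms(2-) by simp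
  also have "\<dots> = c \<cdot> (d \<cdot> h)" unfolding assms(1) using assms(2-) by simp
  finally show ?thesis .
qed

lemma Comp_reassoc':
  assumes "a \<cdot> b = c" "a \<in> Arr C" "b \<in> Arr C" "h \<in> Arr C" "Cod C b = Dom C a" "Cod C h = Dom C b"
  shows "a \<cdot> (b \<cdot> h) = c \<cdot> h"
  using assms by (metis Comp_assoc)

end

text \<open>The uniqueness principle for comparison maps: an arrow from the end of a cocartesian
  arrow to the start of a cartesian one is known once its base arrow and the threefold composite are
  known.\<close>

lemma (in category_over) cocart_cart_cancel:
  assumes d: "cocartesian X B p d" and c: "cartesian X B p c"
    and w: "w \<in> Arr X" "w' \<in> Arr X" "Dom X w = Cod X d" "Dom X w' = Cod X d" "Cod X w = Dom X c"
      "Cod X w' = Dom X c" "FAr p w = FAr p w'"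
    and eq: "c \<cdot>\<^bsub>X\<^esub> (w \<cdot>\<^bsub>X\<^esub> d) = c \<cdot>\<^bsub>X\<^esub> (w' \<cdot>\<^bsub>X\<^esub> d)"
  shows "w = w'"
proof -
  have [simp]: "c \<in> Arr X" "d \<in> Arr X" using c d cartesian_Arr cocartesian_Arr by auto
  have "w \<cdot>\<^bsub>X\<^esub> d = w' \<cdot>\<^bsub>X\<^esub> d" by (rule cartesian_unique[OF c]) (use w eq in auto)
  then show ?thesis by - (rule cocartesian_unique[OF d]; use w in auto)
qed

text \<open>Meant for pullback squares and for identity-extension squares alike, hence phrased for a
  commuting square with lifts along its four sides.\<close>

locale bc_square = category_over +
  fixes \<tau> \<sigma>' \<sigma> \<tau>'
  assumes lifts_t: "cart_lifts X B p \<tau>" and lifts_t': "cart_lifts X B p \<tau>'"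
    and lifts_s: "cocart_lifts X B p \<sigma>" and lifts_s': "cocart_lifts X B p \<sigma>'"
    and corners [simp]: "Dom B \<sigma>' = Dom B \<tau>'" "Cod B \<sigma>' = Dom B \<tau>" "Cod B \<tau>' = Dom B \<sigma>"
      "Cod B \<tau> = Cod B \<sigma>"
    and square: "\<tau> \<cdot>\<^bsub>B\<^esub> \<sigma>' = \<sigma> \<cdot>\<^bsub>B\<^esub> \<tau>'"
begin

sublocale t: cart_lifts X B p \<tau> by (rule lifts_t)
sublocale t': cart_lifts X B p \<tau>' by (rule lifts_t')
sublocale s: cocart_lifts X B p \<sigma> by (rule lifts_s)
sublocale s': cocart_lifts X B p \<sigma>' by (rule lifts_s')

lemmas base_Arrs [simp] = t.base_Arr t'.base_Arr s.base_Arr s'.base_Arr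

abbreviation c where "c x \<equiv> cart_lift X B p \<tau>' x"
abbreviation d where "d x \<equiv> cocart_lift X B p \<sigma> x"
abbreviation d' where "d' x \<equiv> cocart_lift X B p \<sigma>' (Dom X (c x))"
abbreviation c' where "c' x \<equiv> cart_lift X B p \<tau> (Cod X (d x))"
abbreviation bc where "bc \<equiv> bc_comparison X B p \<tau> \<sigma>' \<sigma> \<tau>'"

lemmas lift_simps = t.lift t'.lift s.lift s'.lift

lemma bc:
  assumes x: "x \<in> Obj X" "FOb p x = Dom B \<sigma>"
  shows "bc x \<in> Arr X" "Dom X (bc x) = Cod X (d' x)" "Cod X (bc x) = Dom X (c' x)"
    "FAr p (bc x) = Ident B (Dom B \<tau>)" "c' x \<cdot>\<^bsub>X\<^esub> (bc x \<cdot>\<^bsub>X\<^esub> d' x) = d x \<cdot>\<^bsub>X\<^esub> c x"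
proof -
  note [simp] = lift_simps x
  let ?P = "\<lambda>w. w \<in> hom X (Cod X (d' x)) (Dom X (c' x)) \<and> FAr p w = Ident B (Cod B \<sigma>') \<and>
    c' x \<cdot>\<^bsub>X\<^esub> (w \<cdot>\<^bsub>X\<^esub> d' x) = d x \<cdot>\<^bsub>X\<^esub> c x"
  \<comment> \<open>The composite of \<open>c x\<close> and \<open>d x\<close> is factored through
    the cocartesian \<open>d' x\<close>, which leaves an arrow over \<open>\<tau>\<close>; this one
    is factored through the cartesian \<open>c' x\<close>, which leaves a vertical arrow.\<close>
  obtain w1 where w1: "w1 \<in> Arr X" "Cod X w1 = Cod X (d x \<cdot>\<^bsub>X\<^esub> c x)" "Dom X w1 = Cod X (d' x)"
    "FAr p w1 = \<tau>" "w1 \<cdot>\<^bsub>X\<^esub> d' x = d x \<cdot>\<^bsub>X\<^esub> c x"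
    using cocartesian_fill[of "d' x" "d x \<cdot>\<^bsub>X\<^esub> c x" \<tau>] square by auto
  obtain w where w: "w \<in> Arr X" "Dom X w = Dom X w1" "Cod X w = Dom X (c' x)"
    "FAr p w = Ident B (FOb p (Dom X (c' x)))" "c' x \<cdot>\<^bsub>X\<^esub> w = w1"
    using cartesian_fill_vert[of "c' x" w1] w1 by auto
  have "\<exists>!w. ?P w"
  proof (rule ex1I[where a = w])
    show "?P w" using w w1 by (auto simp: hom_def X.Comp_reassoc')
    fix y assume "?P y"
    then show "y = w" using w w1
      by - (rule cocart_cart_cancel[of "d' x" "c' x"]; auto simp: hom_def X.Comp_reassoc')
  qed
  from theI'[OF this] have "?P (bc x)" by (simp add: bc_comparison_def Let_def)
  then show "bc x \<in> Arr X" "Dom X (bc x) = Cod X (d' x)" "Cod X (bc x) = Dom X (c' x)"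
    "FAr p (bc x) = Ident B (Dom B \<tau>)" "c' x \<cdot>\<^bsub>X\<^esub> (bc x \<cdot>\<^bsub>X\<^esub> d' x) = d x \<cdot>\<^bsub>X\<^esub> c x"
    by (auto simp: hom_def)
qed

definition push_pull_factor where
  "push_pull_factor \<longleftrightarrow> (\<forall>u v. cartesian X B p u \<and> FAr p u = \<tau>' \<and> cocartesian X B p v \<and> FAr p v = \<sigma> \<and>
     Dom X v = Cod X u \<longrightarrow>
     (\<exists>u0 v0. cartesian X B p u0 \<and> FAr p u0 = \<tau> \<and> cocartesian X B p v0 \<and> FAr p v0 = \<sigma>' \<and>
        Dom X v0 = Dom X u \<and> Cod X u0 = Cod X v \<and> Cod X v0 = Dom X u0 \<and> u0 \<cdot>\<^bsub>X\<^esub> v0 = v \<cdot>\<^bsub>X\<^esub> u))"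

text \<open>Apply the factorization to the chosen lifts. Comparison of lifts gives vertical
  isomorphisms \<open>r\<close> on the cocartesian side and \<open>s\<close> on the cartesian side,
  and by uniqueness the Beck-Chevalley map can only be \<open>r\<close> followed by
  \<open>s\<close>.\<close>

lemma bc_iso:
  assumes f: "push_pull_factor" and x: "x \<in> Obj X" "FOb p x = Dom B \<sigma>"
  shows "is_iso X (bc x)"
proof -
  note [simp] = lift_simps x bc
  obtain u0 v0 where u0: "cartesian X B p u0" "FAr p u0 = \<tau>" and v0: "cocartesian X B p v0" "FAr p v0 = \<sigma>'"
    and uv: "Dom X v0 = Dom X (c x)" "Cod X u0 = Cod X (d x)" "Cod X v0 = Dom X u0"
      "u0 \<cdot>\<^bsub>X\<^esub> v0 = d x \<cdot>\<^bsub>X\<^esub> c x"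
    using f[unfolded push_pull_factor_def, rule_format, of "c x" "d x"] by auto
  have [simp]: "u0 \<in> Arr X" "v0 \<in> Arr X" using u0 v0 cartesian_Arr cocartesian_Arr by auto
  have [simp]: "FOb p (Dom X u0) = Dom B \<tau>" using functor_Dom[OF proj, of u0] u0 by simp
  obtain r where r: "r \<in> Arr X" "is_iso X r" "Cod X r = Cod X v0" "Dom X r = Cod X (d' x)"
    "FAr p r = Ident B (FOb p (Cod X (d' x)))" "r \<cdot>\<^bsub>X\<^esub> d' x = v0"
    using cocartesian_lift_iso[of "d' x" v0] v0 uv by auto
  obtain s where s: "s \<in> Arr X" "is_iso X s" "Dom X s = Dom X u0" "Cod X s = Dom X (c' x)"
    "FAr p s = Ident B (FOb p (Dom X (c' x)))" "c' x \<cdot>\<^bsub>X\<^esub> s = u0"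
    using cartesian_lift_iso[of "c' x" u0] u0 uv by auto
  have "c' x \<cdot>\<^bsub>X\<^esub> ((s \<cdot>\<^bsub>X\<^esub> r) \<cdot>\<^bsub>X\<^esub> d' x) = u0 \<cdot>\<^bsub>X\<^esub> v0"
    using r s uv by (simp add: X.Comp_reassoc'[OF s(6)])
  then have "bc x = s \<cdot>\<^bsub>X\<^esub> r"
    by - (rule cocart_cart_cancel[of "d' x" "c' x"]; use r s uv in simp)
  then show ?thesis using r s uv by simp
qed

text \<open>Naturality is tested between \<open>d'\<close> at the source and \<open>c'\<close> at
  the target, where both sides reduce to the composite of \<open>f\<close> with the lifts
  \<open>c\<close> and \<open>d\<close>.\<close>

lemma bc_nat_iso:
  assumes iso: "\<And>x. \<lbrakk>x \<in> Obj X; FOb p x = Dom B \<sigma>\<rbrakk> \<Longrightarrow> is_iso X (bc x)"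
  shows "nat_iso (fibre X B p (Dom B \<sigma>)) (fibre X B p (Dom B \<tau>))
    (comp_func (fibre X B p (Dom B \<sigma>)) (pushforward X B p \<sigma>') (pullback X B p \<tau>'))
    (comp_func (fibre X B p (Dom B \<sigma>)) (pullback X B p \<tau>) (pushforward X B p \<sigma>)) bc"
proof (rule nat_isoI)
  note [simp] = lift_simps bc t.pullback_Ob t'.pullback_Ob s.pushforward_Ob s'.pushforward_Ob
    t.pullback_Ar(1-4) t'.pullback_Ar(1-4) s.pushforward_Ar(1-4) s'.pushforward_Ar(1-4)
  show "is_functor (fibre X B p (Dom B \<sigma>)) (fibre X B p (Dom B \<tau>))
    (comp_func (fibre X B p (Dom B \<sigma>)) (pushforward X B p \<sigma>') (pullback X B p \<tau>'))"
    using comp_functor[OF t'.pullback_functor, of "fibre X B p (Dom B \<tau>)" "pushforward X B p \<sigma>'"] s'.pushforward_functor by simp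
  show "is_functor (fibre X B p (Dom B \<sigma>)) (fibre X B p (Dom B \<tau>))
    (comp_func (fibre X B p (Dom B \<sigma>)) (pullback X B p \<tau>) (pushforward X B p \<sigma>))"
    using comp_functor[OF s.pushforward_functor, of "fibre X B p (Dom B \<tau>)" "pullback X B p \<tau>"] t.pullback_functor by simp
  show "bc \<in> extensional (Obj (fibre X B p (Dom B \<sigma>)))" by (simp add: bc_comparison_def)
  fix x assume "x \<in> Obj (fibre X B p (Dom B \<sigma>))"
  then have x[simp]: "x \<in> Obj X" "FOb p x = Dom B \<sigma>" by auto
  show "bc x \<in> hom (fibre X B p (Dom B \<tau>))
    (FOb (comp_func (fibre X B p (Dom B \<sigma>)) (pushforward X B p \<sigma>') (pullback X B p \<tau>')) x)
    (FOb (comp_func (fibre X B p (Dom B \<sigma>)) (pullback X B p \<tau>) (pushforward X B p \<sigma>)) x)"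
    by (simp add: hom_def)
  show "is_iso (fibre X B p (Dom B \<tau>)) (bc x)" by (simp add: fibre_iso iso)
next
  note [simp] = lift_simps bc t.pullback_Ob t'.pullback_Ob s.pushforward_Ob s'.pushforward_Ob
    t.pullback_Ar(1-4) t'.pullback_Ar(1-4) s.pushforward_Ar(1-4) s'.pushforward_Ar(1-4)
  fix f assume "f \<in> Arr (fibre X B p (Dom B \<sigma>))"
  then have f[simp]: "f \<in> Arr X" "FAr p f = Ident B (Dom B \<sigma>)" by auto
  let ?x = "Dom X f" and ?y = "Cod X f"
  have [simp]: "FOb p ?x = Dom B \<sigma>" "FOb p ?y = Dom B \<sigma>" using vert_Ob[OF f] by auto
  let ?g = "FAr (pullback X B p \<tau>') f" and ?h = "FAr (pushforward X B p \<sigma>) f"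
  let ?g' = "FAr (pushforward X B p \<sigma>') ?g" and ?h' = "FAr (pullback X B p \<tau>) ?h"
  have "c' ?y \<cdot>\<^bsub>X\<^esub> (bc ?y \<cdot>\<^bsub>X\<^esub> (?g' \<cdot>\<^bsub>X\<^esub> d' ?x)) = c' ?y \<cdot>\<^bsub>X\<^esub> (bc ?y \<cdot>\<^bsub>X\<^esub> (d' ?y \<cdot>\<^bsub>X\<^esub> ?g))"
    using s'.pushforward_Ar(5)[of ?g] by simp
  also have "\<dots> = (c' ?y \<cdot>\<^bsub>X\<^esub> (bc ?y \<cdot>\<^bsub>X\<^esub> d' ?y)) \<cdot>\<^bsub>X\<^esub> ?g" by (simp del: bc(5))
  also have "\<dots> = d ?y \<cdot>\<^bsub>X\<^esub> (c ?y \<cdot>\<^bsub>X\<^esub> ?g)" by simp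
  also have "\<dots> = (d ?y \<cdot>\<^bsub>X\<^esub> f) \<cdot>\<^bsub>X\<^esub> c ?x" by (simp add: t'.pullback_Ar(5))
  also have "\<dots> = ?h \<cdot>\<^bsub>X\<^esub> (c' ?x \<cdot>\<^bsub>X\<^esub> (bc ?x \<cdot>\<^bsub>X\<^esub> d' ?x))"
    using s.pushforward_Ar(5)[of f, symmetric] by simp
  also have "\<dots> = c' ?y \<cdot>\<^bsub>X\<^esub> (?h' \<cdot>\<^bsub>X\<^esub> (bc ?x \<cdot>\<^bsub>X\<^esub> d' ?x))"
    by (rule X.Comp_reassoc) (use t.pullback_Ar(5)[of ?h] in auto)
  finally have "bc ?y \<cdot>\<^bsub>X\<^esub> ?g' = ?h' \<cdot>\<^bsub>X\<^esub> bc ?x"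
    by - (rule cocart_cart_cancel[of "d' ?x" "c' ?y"]; simp)
  then show "bc (Cod (fibre X B p (Dom B \<sigma>)) f) \<cdot>\<^bsub>fibre X B p (Dom B \<tau>)\<^esub>
    FAr (comp_func (fibre X B p (Dom B \<sigma>)) (pushforward X B p \<sigma>') (pullback X B p \<tau>')) f =
    FAr (comp_func (fibre X B p (Dom B \<sigma>)) (pullback X B p \<tau>) (pushforward X B p \<sigma>)) f
      \<cdot>\<^bsub>fibre X B p (Dom B \<tau>)\<^esub> bc (Dom (fibre X B p (Dom B \<sigma>)) f)"
    by simp
qed

text \<open>An object of the fibre over \<open>Dom B \<sigma>\<close> is seen as the middle of a
  cartesian arrow \<open>a\<close> over \<open>\<tau>'\<close> followed by a cocartesian arrow
  \<open>b\<close> over \<open>\<sigma>\<close>. In these terms an arrow of the iso-comma category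
  is a pair \<open>u\<close>, \<open>v\<close> with one equation between long composites, and
  \<open>es\<close> is the factorization converse to \<open>push_pull_factor\<close>.\<close>

lemma bc_homotopy_pullback:
  assumes factor: "push_pull_factor"
    and ff: "\<And>a b a' b' u v. \<lbrakk>cartesian X B p a; FAr p a = \<tau>'; cocartesian X B p b; FAr p b = \<sigma>; Dom X b = Cod X a;
       cartesian X B p a'; FAr p a' = \<tau>'; cocartesian X B p b'; FAr p b' = \<sigma>; Dom X b' = Cod X a';
       u \<in> Arr X; FAr p u = Ident B (Dom B \<tau>'); Dom X u = Dom X a; Cod X u = Dom X a';
       v \<in> Arr X; FAr p v = Ident B (Cod B \<sigma>); Dom X v = Cod X b; Cod X v = Cod X b';
       b' \<cdot>\<^bsub>X\<^esub> (a' \<cdot>\<^bsub>X\<^esub> u) = v \<cdot>\<^bsub>X\<^esub> (b \<cdot>\<^bsub>X\<^esub> a)\<rbrakk> \<Longrightarrow>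
       \<exists>!z. z \<in> Arr X \<and> FAr p z = Ident B (Dom B \<sigma>) \<and> Dom X z = Cod X a \<and> Cod X z = Cod X a' \<and>
         a' \<cdot>\<^bsub>X\<^esub> u = z \<cdot>\<^bsub>X\<^esub> a \<and> v \<cdot>\<^bsub>X\<^esub> b = b' \<cdot>\<^bsub>X\<^esub> z"
    and es: "\<And>a b. \<lbrakk>cartesian X B p a; FAr p a = \<tau>; cocartesian X B p b; FAr p b = \<sigma>'; Dom X a = Cod X b\<rbrakk> \<Longrightarrow>
       \<exists>a0 b0. cartesian X B p a0 \<and> FAr p a0 = \<tau>' \<and> cocartesian X B p b0 \<and> FAr p b0 = \<sigma> \<and>
         Dom X a0 = Dom X b \<and> Cod X b0 = Cod X a \<and> Dom X b0 = Cod X a0 \<and> b0 \<cdot>\<^bsub>X\<^esub> a0 = a \<cdot>\<^bsub>X\<^esub> b"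
  shows "homotopy_pullback (fibre X B p (Dom B \<sigma>)) (fibre X B p (Dom B \<tau>')) (fibre X B p (Cod B \<sigma>))
    (fibre X B p (Dom B \<tau>)) (pullback X B p \<tau>') (pushforward X B p \<sigma>) (pushforward X B p \<sigma>')
    (pullback X B p \<tau>) bc"
proof (rule homotopy_pullbackI)
  note [simp] = lift_simps bc t.pullback_Ob t'.pullback_Ob s.pushforward_Ob s'.pushforward_Ob
    t.pullback_Ar(1-4) t'.pullback_Ar(1-4) s.pushforward_Ar(1-4) s'.pushforward_Ar(1-4)
  fix x x' u v
  assume "x \<in> Obj (fibre X B p (Dom B \<sigma>))" "x' \<in> Obj (fibre X B p (Dom B \<sigma>))"
    and "u \<in> hom (fibre X B p (Dom B \<tau>')) (FOb (pullback X B p \<tau>') x) (FOb (pullback X B p \<tau>') x')"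
    and "v \<in> hom (fibre X B p (Cod B \<sigma>)) (FOb (pushforward X B p \<sigma>) x) (FOb (pushforward X B p \<sigma>) x')"
    and "bc x' \<cdot>\<^bsub>fibre X B p (Dom B \<tau>)\<^esub> FAr (pushforward X B p \<sigma>') u =
      FAr (pullback X B p \<tau>) v \<cdot>\<^bsub>fibre X B p (Dom B \<tau>)\<^esub> bc x"
  then have [simp]: "x \<in> Obj X" "FOb p x = Dom B \<sigma>" "x' \<in> Obj X" "FOb p x' = Dom B \<sigma>"
      "u \<in> Arr X" "FAr p u = Ident B (Dom B \<tau>')" "Dom X u = Dom X (c x)" "Cod X u = Dom X (c x')"
      "v \<in> Arr X" "FAr p v = Ident B (Cod B \<sigma>)" "Dom X v = Cod X (d x)" "Cod X v = Cod X (d x')"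
    and e: "bc x' \<cdot>\<^bsub>X\<^esub> FAr (pushforward X B p \<sigma>') u = FAr (pullback X B p \<tau>) v \<cdot>\<^bsub>X\<^esub> bc x"
    by (auto simp: hom_def)
  let ?u = "FAr (pushforward X B p \<sigma>') u" and ?v = "FAr (pullback X B p \<tau>) v"
  \<comment> \<open>The equation \<open>e\<close> relates a pushforward and a pullback of vertical
    arrows. Surrounding it by \<open>d' x\<close> and \<open>c' x'\<close> unfolds it into an
    equation between the lifts themselves.\<close>
  have "d x' \<cdot>\<^bsub>X\<^esub> (c x' \<cdot>\<^bsub>X\<^esub> u) = (c' x' \<cdot>\<^bsub>X\<^esub> (bc x' \<cdot>\<^bsub>X\<^esub> d' x')) \<cdot>\<^bsub>X\<^esub> u" by simp
  also have "\<dots> = c' x' \<cdot>\<^bsub>X\<^esub> (bc x' \<cdot>\<^bsub>X\<^esub> (d' x' \<cdot>\<^bsub>X\<^esub> u))" by (simp del: bc(5))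
  also have "\<dots> = c' x' \<cdot>\<^bsub>X\<^esub> (bc x' \<cdot>\<^bsub>X\<^esub> (?u \<cdot>\<^bsub>X\<^esub> d' x))" using s'.pushforward_Ar(5)[of u] by simp
  also have "\<dots> = c' x' \<cdot>\<^bsub>X\<^esub> (?v \<cdot>\<^bsub>X\<^esub> (bc x \<cdot>\<^bsub>X\<^esub> d' x))" by (simp add: X.Comp_reassoc[OF e])
  also have "\<dots> = v \<cdot>\<^bsub>X\<^esub> (c' x \<cdot>\<^bsub>X\<^esub> (bc x \<cdot>\<^bsub>X\<^esub> d' x))"
    by (rule X.Comp_reassoc) (use t.pullback_Ar(5)[of v] in auto)
  finally have "d x' \<cdot>\<^bsub>X\<^esub> (c x' \<cdot>\<^bsub>X\<^esub> u) = v \<cdot>\<^bsub>X\<^esub> (d x \<cdot>\<^bsub>X\<^esub> c x)" by simp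
  then have ex1: "\<exists>!z. z \<in> Arr X \<and> FAr p z = Ident B (Dom B \<sigma>) \<and> Dom X z = Cod X (c x) \<and>
      Cod X z = Cod X (c x') \<and> c x' \<cdot>\<^bsub>X\<^esub> u = z \<cdot>\<^bsub>X\<^esub> c x \<and> v \<cdot>\<^bsub>X\<^esub> d x = d x' \<cdot>\<^bsub>X\<^esub> z"
    by (intro ff) simp_all
  \<comment> \<open>By the defining squares of the two functors, \<open>z\<close> pulls back to
    \<open>u\<close> and pushes forward to \<open>v\<close> exactly if it makes both squares of
    \<open>ff\<close> commute.\<close>
  have "z \<in> hom (fibre X B p (Dom B \<sigma>)) x x' \<and> FAr (pullback X B p \<tau>') z = u \<and> FAr (pushforward X B p \<sigma>) z = v
    \<longleftrightarrow> z \<in> Arr X \<and> FAr p z = Ident B (Dom B \<sigma>) \<and> Dom X z = Cod X (c x) \<and>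
      Cod X z = Cod X (c x') \<and> c x' \<cdot>\<^bsub>X\<^esub> u = z \<cdot>\<^bsub>X\<^esub> c x \<and> v \<cdot>\<^bsub>X\<^esub> d x = d x' \<cdot>\<^bsub>X\<^esub> z" for z
    using t'.pullback_Ar(5)[of z] s.pushforward_Ar(5)[of z]
    by (auto simp: hom_def intro: t'.pullback_Ar_eqI s.pushforward_Ar_eqI)
  then show "\<exists>!z. z \<in> hom (fibre X B p (Dom B \<sigma>)) x x' \<and> FAr (pullback X B p \<tau>') z = u \<and> FAr (pushforward X B p \<sigma>) z = v"
    using ex1 by simp
next
  note [simp] = lift_simps bc t.pullback_Ob t'.pullback_Ob s.pushforward_Ob s'.pushforward_Ob
    t.pullback_Ar(1-4) t'.pullback_Ar(1-4) s.pushforward_Ar(1-4) s'.pushforward_Ar(1-4)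
  fix y1 y2 w
  assume "y1 \<in> Obj (fibre X B p (Dom B \<tau>'))" "y2 \<in> Obj (fibre X B p (Cod B \<sigma>))"
    and "w \<in> hom (fibre X B p (Dom B \<tau>)) (FOb (pushforward X B p \<sigma>') y1) (FOb (pullback X B p \<tau>) y2)"
    and wi: "is_iso (fibre X B p (Dom B \<tau>)) w"
  then have [simp]: "y1 \<in> Obj X" "FOb p y1 = Dom B \<tau>'" "y2 \<in> Obj X" "FOb p y2 = Cod B \<sigma>"
      "w \<in> Arr X" "FAr p w = Ident B (Dom B \<tau>)" "Dom X w = Cod X (cocart_lift X B p \<sigma>' y1)"
      "Cod X w = Dom X (cart_lift X B p \<tau> y2)"
    by (auto simp: hom_def)
  have [simp]: "is_iso X w" using wi by (simp add: fibre_iso)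
  let ?l = "cocart_lift X B p \<sigma>' y1" and ?m = "cart_lift X B p \<tau> y2"
  \<comment> \<open>Composing the chosen lift with the isomorphism \<open>w\<close> keeps it
    cartesian and makes its source agree strictly with the end of \<open>?l\<close>, as
    \<open>es\<close> demands.\<close>
  obtain a b where a: "cartesian X B p a" "FAr p a = \<tau>'" and b: "cocartesian X B p b" "FAr p b = \<sigma>"
    and ab: "Dom X a = Dom X ?l" "Cod X b = Cod X (?m \<cdot>\<^bsub>X\<^esub> w)" "Dom X b = Cod X a"
      "b \<cdot>\<^bsub>X\<^esub> a = (?m \<cdot>\<^bsub>X\<^esub> w) \<cdot>\<^bsub>X\<^esub> ?l"
    using es[of "?m \<cdot>\<^bsub>X\<^esub> w" ?l] cartesian_comp_iso[of ?m w] by auto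
  have [simp]: "a \<in> Arr X" "b \<in> Arr X" using a b cartesian_Arr cocartesian_Arr by auto
  define x where "x = Cod X a"
  have [simp]: "x \<in> Obj X" "FOb p x = Dom B \<sigma>" "Cod X a = x"
    using functor_Cod[OF proj, of a] a by (auto simp: x_def)
  \<comment> \<open>The middle object \<open>x\<close> now carries arbitrary lifts and chosen ones;
    the vertical isomorphisms between them are the required \<open>u\<close> and
    \<open>v\<close>.\<close>
  obtain u where u: "u \<in> Arr X" "is_iso X u" "Dom X u = Dom X (c x)" "Cod X u = Dom X a"
    "FAr p u = Ident B (FOb p (Dom X a))" "a \<cdot>\<^bsub>X\<^esub> u = c x"
    using cartesian_lift_iso[of a "c x"] a by auto
  obtain v where v: "v \<in> Arr X" "is_iso X v" "Cod X v = Cod X b" "Dom X v = Cod X (d x)"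
    "FAr p v = Ident B (FOb p (Cod X (d x)))" "v \<cdot>\<^bsub>X\<^esub> d x = b"
    using cocartesian_lift_iso[of "d x" b] b ab by auto
  have [simp]: "u \<in> Arr X" "is_iso X u" "Dom X u = Dom X (c x)" "Cod X u = y1" "FAr p u = Ident B (Dom B \<tau>')"
    "v \<in> Arr X" "is_iso X v" "Cod X v = y2" "Dom X v = Cod X (d x)" "FAr p v = Ident B (Cod B \<sigma>)"
    "Dom X b = x" "Dom X a = y1" "Cod X b = y2"
    using u v ab by simp_all
  let ?u = "FAr (pushforward X B p \<sigma>') u" and ?v = "FAr (pullback X B p \<tau>) v"
  have "?m \<cdot>\<^bsub>X\<^esub> ((w \<cdot>\<^bsub>X\<^esub> ?u) \<cdot>\<^bsub>X\<^esub> d' x) = ((?m \<cdot>\<^bsub>X\<^esub> w) \<cdot>\<^bsub>X\<^esub> ?l) \<cdot>\<^bsub>X\<^esub> u"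
    using s'.pushforward_Ar(5)[of u] by simp
  also have "\<dots> = b \<cdot>\<^bsub>X\<^esub> (a \<cdot>\<^bsub>X\<^esub> u)" using ab(4)[symmetric] by (simp del: X.Comp_assoc) simp
  also have "\<dots> = v \<cdot>\<^bsub>X\<^esub> (d x \<cdot>\<^bsub>X\<^esub> c x)" by (simp add: u(6) v(6)[symmetric])
  also have "\<dots> = v \<cdot>\<^bsub>X\<^esub> (c' x \<cdot>\<^bsub>X\<^esub> (bc x \<cdot>\<^bsub>X\<^esub> d' x))" by simp
  also have "\<dots> = ?m \<cdot>\<^bsub>X\<^esub> (?v \<cdot>\<^bsub>X\<^esub> (bc x \<cdot>\<^bsub>X\<^esub> d' x))"
    by (rule X.Comp_reassoc) (use t.pullback_Ar(5)[of v] in auto)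
  finally have "w \<cdot>\<^bsub>X\<^esub> ?u = ?v \<cdot>\<^bsub>X\<^esub> bc x"
    by - (rule cocart_cart_cancel[of "d' x" "?m"]; simp)
  then show "\<exists>x\<in>Obj (fibre X B p (Dom B \<sigma>)).
    \<exists>u\<in>hom (fibre X B p (Dom B \<tau>')) (FOb (pullback X B p \<tau>') x) y1.
    \<exists>v\<in>hom (fibre X B p (Cod B \<sigma>)) (FOb (pushforward X B p \<sigma>) x) y2.
      is_iso (fibre X B p (Dom B \<tau>')) u \<and> is_iso (fibre X B p (Cod B \<sigma>)) v \<and>
      w \<cdot>\<^bsub>fibre X B p (Dom B \<tau>)\<^esub> FAr (pushforward X B p \<sigma>') u =
        FAr (pullback X B p \<tau>) v \<cdot>\<^bsub>fibre X B p (Dom B \<tau>)\<^esub> bc x"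
    by (intro bexI[where x = x] bexI[where x = u] bexI[where x = v]) (auto simp: hom_def fibre_iso)
next
  show "nat_iso (fibre X B p (Dom B \<sigma>)) (fibre X B p (Dom B \<tau>))
    (comp_func (fibre X B p (Dom B \<sigma>)) (pushforward X B p \<sigma>') (pullback X B p \<tau>'))
    (comp_func (fibre X B p (Dom B \<sigma>)) (pullback X B p \<tau>) (pushforward X B p \<sigma>)) bc"
    by (rule bc_nat_iso) (rule bc_iso[OF factor])
qed (use t.pullback_functor t'.pullback_functor s.pushforward_functor s'.pushforward_functor in simp_all)

end

section \<open>Functors over a base\<close>

lemma functor_overD:
  assumes "functor_over S T c"
  shows functor_over_functor: "is_functor (fst S) (fst T) c"
    and functor_over_Ob: "\<And>x. x \<in> Obj (fst S) \<Longrightarrow> FOb (snd T) (FOb c x) = FOb (snd S) x"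
    and functor_over_Ar: "\<And>u. u \<in> Arr (fst S) \<Longrightarrow> FAr (snd T) (FAr c u) = FAr (snd S) u"
proof -
  show "is_functor (fst S) (fst T) c" using assms by (simp add: functor_over_def)
  have e: "comp_func (fst S) (snd T) c = snd S" using assms by (simp add: functor_over_def)
  show "FOb (snd T) (FOb c x) = FOb (snd S) x" if "x \<in> Obj (fst S)" for x
    using arg_cong[OF e, of "\<lambda>F. FOb F x"] that by simp
  show "FAr (snd T) (FAr c u) = FAr (snd S) u" if "u \<in> Arr (fst S)" for u
    using arg_cong[OF e, of "\<lambda>F. FAr F u"] that by simp
qed

lemma functor_overI:
  assumes S: "is_functor (fst S) B (snd S)" and T: "is_functor (fst T) B (snd T)"
    and c: "is_functor (fst S) (fst T) c"
    and "\<And>x. x \<in> Obj (fst S) \<Longrightarrow> FOb (snd T) (FOb c x) = FOb (snd S) x"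
    and "\<And>u. u \<in> Arr (fst S) \<Longrightarrow> FAr (snd T) (FAr c u) = FAr (snd S) u"
  shows "functor_over S T c"
  unfolding functor_over_def
  using c functor_eqI[OF comp_functor[OF c T] S] assms(4,5) by simp

lemma functor_over_id:
  assumes "is_functor (fst S) B (snd S)"
  shows "functor_over S S (id_func (fst S))"
  by (rule functor_overI[OF assms assms]) (auto intro: id_functor functor_cat_dom[OF assms])

lemma functor_over_comp:
  assumes S: "is_functor (fst S) B (snd S)" and U: "is_functor (fst U) B (snd U)"
    and c: "functor_over S T c" and d: "functor_over T U d"
  shows "functor_over S U (comp_func (fst S) d c)"
proof (rule functor_overI[OF S U])
  note c' = functor_over_functor[OF c] and d' = functor_over_functor[OF d]
  show "is_functor (fst S) (fst U) (comp_func (fst S) d c)" by (rule comp_functor[OF c' d'])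
qed (simp_all add: functor_overD[OF c] functor_overD[OF d] functor_simps[OF functor_over_functor[OF c]])

lemma over_category_simps [simp]:
  "Obj (over_category obs mor) = obs"
  "Arr (over_category obs mor) = {(S, T, c). S \<in> obs \<and> T \<in> obs \<and> functor_over S T c \<and> mor S T c}"
  "Dom (over_category obs mor) (S, T, c) = S" "Cod (over_category obs mor) (S, T, c) = T"
  "Ident (over_category obs mor) S = (S, S, id_func (fst S))"
  "(S', T', c') \<cdot>\<^bsub>over_category obs mor\<^esub> (S, T, c) = (S, T', comp_func (fst S) c' c)"
  by (auto simp: over_category_def)

lemma over_category_category:
  assumes obs: "\<And>S. S \<in> obs \<Longrightarrow> is_functor (fst S) B (snd S)"
    and id: "\<And>S. S \<in> obs \<Longrightarrow> mor S S (id_func (fst S))"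
    and comp: "\<And>S T U c d. \<lbrakk>S \<in> obs; T \<in> obs; U \<in> obs; functor_over S T c; functor_over T U d;
      mor S T c; mor T U d\<rbrakk> \<Longrightarrow> mor S U (comp_func (fst S) d c)"
  shows "category (over_category obs mor)"
proof
  fix f g h
  assume "f \<in> Arr (over_category obs mor)" "g \<in> Arr (over_category obs mor)" "h \<in> Arr (over_category obs mor)"
    "Cod (over_category obs mor) f = Dom (over_category obs mor) g"
    "Cod (over_category obs mor) g = Dom (over_category obs mor) h"
  then show "(h \<cdot>\<^bsub>over_category obs mor\<^esub> g) \<cdot>\<^bsub>over_category obs mor\<^esub> f =
    h \<cdot>\<^bsub>over_category obs mor\<^esub> (g \<cdot>\<^bsub>over_category obs mor\<^esub> f)"
    by (auto simp: comp_func_assoc dest!: functor_over_functor)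
next
  fix f g
  assume "f \<in> Arr (over_category obs mor)" "g \<in> Arr (over_category obs mor)"
    "Cod (over_category obs mor) f = Dom (over_category obs mor) g"
  moreover obtain S T c where f: "f = (S, T, c)" by (metis prod_cases3)
  moreover obtain T' U d where g: "g = (T', U, d)" by (metis prod_cases3)
  ultimately have 1: "S \<in> obs" "T \<in> obs" "U \<in> obs" "functor_over S T c" "functor_over T U d" "mor S T c" "mor T U d"
    "T' = T" by auto
  have "functor_over S U (comp_func (fst S) d c)"
    by (rule functor_over_comp[OF obs[OF 1(1)] obs[OF 1(3)] 1(4,5)])
  moreover have "mor S U (comp_func (fst S) d c)" by (rule comp[OF 1(1-7)])
  ultimately show "g \<cdot>\<^bsub>over_category obs mor\<^esub> f \<in> Arr (over_category obs mor)"
    using 1 by (simp add: f g)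
qed (auto simp: id intro: functor_over_id[OF obs] simp: comp_func_id_left comp_func_id_right dest: functor_over_functor)

locale functor_over_base = X: category_over X B p + Y: category_over Y B q
  for X :: "('o, 'm) cat" and B :: "('b, 'k) cat" and p
    and Y :: "('o1, 'm1) cat" and q +
  fixes F
  assumes over: "functor_over (X, p) (Y, q) F"
begin

lemmas F_functor = functor_over_functor[OF over, simplified]
lemmas over_simps [simp] = functor_overD(2,3)[OF over, simplified] functor_simps[OF F_functor]

lemma restrict_functor:
  assumes "b \<in> Obj B"
  shows "is_functor (fibre X B p b) (fibre Y B q b) (restrict_func (fibre X B p b) F)"
  using X.fibre_category[OF assms]
  by (intro is_functorI) (auto simp: X.fibre_category[OF assms] Y.fibre_category[OF assms] assms X.vert_Ob
      restrict_func_def)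

end

locale push_square = functor_over_base +
  fixes f
  assumes X_lifts: "cocart_lifts X B p f" and Y_lifts: "cocart_lifts Y B q f"
    and preserves: "\<And>u. cocartesian X B p u \<Longrightarrow> cocartesian Y B q (FAr F u)"
begin

sublocale X: cocart_lifts X B p f by (rule X_lifts)
sublocale Y: cocart_lifts Y B q f by (rule Y_lifts)

abbreviation l where "l x \<equiv> cocart_lift X B p f x"
abbreviation l' where "l' x \<equiv> cocart_lift Y B q f x"
abbreviation cmp where "cmp \<equiv> push_comparison B (X, p) (Y, q) F f"

lemmas lift_simps = X.lift Y.lift X.base_Arr X.pushforward_Ob Y.pushforward_Ob
  X.pushforward_Ar(1-4) Y.pushforward_Ar(1-4)

text \<open>\<open>F\<close> sends the chosen cocartesian lift to a cocartesian arrow, so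
  \<open>cmp x\<close> compares two lifts of \<open>f\<close> at \<open>FOb F x\<close> and is
  therefore invertible.\<close>

lemma cmp:
  assumes x: "x \<in> Obj X" "FOb p x = Dom B f"
  shows "cmp x \<in> Arr Y" "Dom Y (cmp x) = Cod Y (l' (FOb F x))" "Cod Y (cmp x) = FOb F (Cod X (l x))"
    "FAr q (cmp x) = Ident B (Cod B f)" "cmp x \<cdot>\<^bsub>Y\<^esub> l' (FOb F x) = FAr F (l x)" "is_iso Y (cmp x)"
proof -
  note [simp] = lift_simps x
  let ?P = "\<lambda>w. w \<in> hom Y (Cod Y (l' (FOb F x))) (FOb F (Cod X (l x))) \<and> FAr q w = Ident B (Cod B f) \<and>
            w \<cdot>\<^bsub>Y\<^esub> l' (FOb F x) = FAr F (l x)"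
  obtain w where w: "w \<in> Arr Y" "is_iso Y w" "Cod Y w = Cod Y (FAr F (l x))" "Dom Y w = Cod Y (l' (FOb F x))"
    "FAr q w = Ident B (FOb q (Cod Y (l' (FOb F x))))" "w \<cdot>\<^bsub>Y\<^esub> l' (FOb F x) = FAr F (l x)"
    using Y.cocartesian_lift_iso[of "l' (FOb F x)" "FAr F (l x)"] preserves by auto
  have u: "y = w" if "?P y" for y
    by (rule Y.cocartesian_unique[of "l' (FOb F x)"]; use that w in \<open>simp add: hom_def\<close>)
  have ex1: "\<exists>!w. ?P w" by (rule ex1I[where a = w], use w in \<open>simp add: hom_def\<close>) (rule u)
  from theI'[OF ex1] have P: "?P (cmp x)" by (simp add: push_comparison_def Let_def)
  then show "cmp x \<in> Arr Y" "Dom Y (cmp x) = Cod Y (l' (FOb F x))" "Cod Y (cmp x) = FOb F (Cod X (l x))"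
    "FAr q (cmp x) = Ident B (Cod B f)" "cmp x \<cdot>\<^bsub>Y\<^esub> l' (FOb F x) = FAr F (l x)"
    by (auto simp: hom_def)
  show "is_iso Y (cmp x)" using u[OF P] w by simp
qed

lemma cmp_eqI:
  assumes x: "x \<in> Obj X" "FOb p x = Dom B f"
    and w: "w \<in> Arr Y" "Dom Y w = Cod Y (l' (FOb F x))" "Cod Y w = FOb F (Cod X (l x))"
      "FAr q w = Ident B (Cod B f)" "w \<cdot>\<^bsub>Y\<^esub> l' (FOb F x) = FAr F (l x)"
  shows "cmp x = w"
  by (rule Y.cocartesian_unique[of "l' (FOb F x)"]; use x w in \<open>simp add: lift_simps cmp\<close>)

text \<open>Naturality is tested after precomposing with the cocartesian lift at the source; both
  sides become the image under \<open>F\<close> of \<open>u\<close> followed by a chosen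
  lift.\<close>

lemma cmp_nat_iso:
  "nat_iso (fibre X B p (Dom B f)) (fibre Y B q (Cod B f))
    (comp_func (fibre X B p (Dom B f)) (pushforward Y B q f) (restrict_func (fibre X B p (Dom B f)) F))
    (comp_func (fibre X B p (Dom B f)) (restrict_func (fibre X B p (Cod B f)) F) (pushforward X B p f)) cmp"
proof (rule nat_isoI)
  note [simp] = lift_simps cmp(1-4,6)
  show "is_functor (fibre X B p (Dom B f)) (fibre Y B q (Cod B f))
    (comp_func (fibre X B p (Dom B f)) (pushforward Y B q f) (restrict_func (fibre X B p (Dom B f)) F))"
    using comp_functor[OF restrict_functor Y.pushforward_functor] by simp
  show "is_functor (fibre X B p (Dom B f)) (fibre Y B q (Cod B f))
    (comp_func (fibre X B p (Dom B f)) (restrict_func (fibre X B p (Cod B f)) F) (pushforward X B p f))"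
    using comp_functor[OF X.pushforward_functor restrict_functor] by simp
  show "cmp \<in> extensional (Obj (fibre X B p (Dom B f)))" by (simp add: push_comparison_def)
  fix x assume "x \<in> Obj (fibre X B p (Dom B f))"
  then have x[simp]: "x \<in> Obj X" "FOb p x = Dom B f" by auto
  show "cmp x \<in> hom (fibre Y B q (Cod B f))
    (FOb (comp_func (fibre X B p (Dom B f)) (pushforward Y B q f) (restrict_func (fibre X B p (Dom B f)) F)) x)
    (FOb (comp_func (fibre X B p (Dom B f)) (restrict_func (fibre X B p (Cod B f)) F) (pushforward X B p f)) x)"
    by (simp add: hom_def)
  show "is_iso (fibre Y B q (Cod B f)) (cmp x)" by (simp add: Y.fibre_iso)
next
  note [simp] = lift_simps cmp(1-4,6)
  fix u assume "u \<in> Arr (fibre X B p (Dom B f))"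
  then have u[simp]: "u \<in> Arr X" "FAr p u = Ident B (Dom B f)" by auto
  let ?x = "Dom X u" and ?y = "Cod X u"
  have [simp]: "FOb p ?x = Dom B f" "FOb p ?y = Dom B f" using X.vert_Ob[OF u] by auto
  let ?g = "FAr (pushforward Y B q f) (FAr F u)" and ?h = "FAr (pushforward X B p f) u"
  have "(cmp ?y \<cdot>\<^bsub>Y\<^esub> ?g) \<cdot>\<^bsub>Y\<^esub> l' (FOb F ?x) = cmp ?y \<cdot>\<^bsub>Y\<^esub> (l' (FOb F ?y) \<cdot>\<^bsub>Y\<^esub> FAr F u)"
    using Y.pushforward_Ar(5)[of "FAr F u"] by simp
  also have "\<dots> = FAr F (l ?y) \<cdot>\<^bsub>Y\<^esub> FAr F u" by (rule Y.X.Comp_reassoc') (auto simp: cmp(5))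
  also have "\<dots> = FAr F (?h \<cdot>\<^bsub>X\<^esub> l ?x)" by (simp add: X.pushforward_Ar(5) del: over_simps(10) flip: over_simps(10))
  also have "\<dots> = (FAr F ?h \<cdot>\<^bsub>Y\<^esub> cmp ?x) \<cdot>\<^bsub>Y\<^esub> l' (FOb F ?x)" by (simp add: cmp(5))
  finally have "cmp ?y \<cdot>\<^bsub>Y\<^esub> ?g = FAr F ?h \<cdot>\<^bsub>Y\<^esub> cmp ?x"
    by - (rule Y.cocartesian_unique[of "l' (FOb F ?x)"]; simp)
  then show "cmp (Cod (fibre X B p (Dom B f)) u) \<cdot>\<^bsub>fibre Y B q (Cod B f)\<^esub>
    FAr (comp_func (fibre X B p (Dom B f)) (pushforward Y B q f) (restrict_func (fibre X B p (Dom B f)) F)) u =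
    FAr (comp_func (fibre X B p (Dom B f)) (restrict_func (fibre X B p (Cod B f)) F) (pushforward X B p f)) u
      \<cdot>\<^bsub>fibre Y B q (Cod B f)\<^esub> cmp (Dom (fibre X B p (Dom B f)) u)"
    by simp
qed

text \<open>The analogue of \<open>bc_homotopy_pullback\<close> with \<open>F\<close> in place of
  the pullback functors. Chosen lifts are again replaced by arbitrary ones, and \<open>es\<close>
  asks that a cocartesian arrow ending in the image of \<open>F\<close> be the image of one in
  \<open>X\<close>, up to a vertical isomorphism at its source.\<close>

lemma push_homotopy_pullback:
  assumes ff: "\<And>a b u v. \<lbrakk>cocartesian X B p a; FAr p a = f; cocartesian X B p b; FAr p b = f;
       u \<in> Arr Y; FAr q u = Ident B (Dom B f); Dom Y u = FOb F (Dom X a); Cod Y u = FOb F (Dom X b);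
       v \<in> Arr X; FAr p v = Ident B (Cod B f); Dom X v = Cod X a; Cod X v = Cod X b;
       FAr F b \<cdot>\<^bsub>Y\<^esub> u = FAr F (v \<cdot>\<^bsub>X\<^esub> a)\<rbrakk> \<Longrightarrow>
       \<exists>!z. z \<in> Arr X \<and> FAr p z = Ident B (Dom B f) \<and> Dom X z = Dom X a \<and> Cod X z = Dom X b \<and>
         FAr F z = u \<and> v \<cdot>\<^bsub>X\<^esub> a = b \<cdot>\<^bsub>X\<^esub> z"
    and es: "\<And>a x. \<lbrakk>cocartesian Y B q a; FAr q a = f; x \<in> Obj X; FOb p x = Cod B f; Cod Y a = FOb F x\<rbrakk> \<Longrightarrow>
       \<exists>b u. cocartesian X B p b \<and> FAr p b = f \<and> Cod X b = x \<and> is_iso Y u \<and> FAr q u = Ident B (Dom B f) \<and>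
         Dom Y u = FOb F (Dom X b) \<and> Cod Y u = Dom Y a \<and> a \<cdot>\<^bsub>Y\<^esub> u = FAr F b"
  shows "homotopy_pullback (fibre X B p (Dom B f)) (fibre Y B q (Dom B f)) (fibre X B p (Cod B f))
    (fibre Y B q (Cod B f)) (restrict_func (fibre X B p (Dom B f)) F) (pushforward X B p f)
    (pushforward Y B q f) (restrict_func (fibre X B p (Cod B f)) F) cmp"
proof (rule homotopy_pullbackI)
  note [simp] = lift_simps cmp(1-4,6)
  fix x x' u v
  assume "x \<in> Obj (fibre X B p (Dom B f))" "x' \<in> Obj (fibre X B p (Dom B f))"
    and "u \<in> hom (fibre Y B q (Dom B f)) (FOb (restrict_func (fibre X B p (Dom B f)) F) x)
      (FOb (restrict_func (fibre X B p (Dom B f)) F) x')"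
    and "v \<in> hom (fibre X B p (Cod B f)) (FOb (pushforward X B p f) x) (FOb (pushforward X B p f) x')"
    and "cmp x' \<cdot>\<^bsub>fibre Y B q (Cod B f)\<^esub> FAr (pushforward Y B q f) u =
      FAr (restrict_func (fibre X B p (Cod B f)) F) v \<cdot>\<^bsub>fibre Y B q (Cod B f)\<^esub> cmp x"
  then have [simp]: "x \<in> Obj X" "FOb p x = Dom B f" "x' \<in> Obj X" "FOb p x' = Dom B f"
      "u \<in> Arr Y" "FAr q u = Ident B (Dom B f)" "Dom Y u = FOb F x" "Cod Y u = FOb F x'"
      "v \<in> Arr X" "FAr p v = Ident B (Cod B f)" "Dom X v = Cod X (l x)" "Cod X v = Cod X (l x')"
    and e: "cmp x' \<cdot>\<^bsub>Y\<^esub> FAr (pushforward Y B q f) u = FAr F v \<cdot>\<^bsub>Y\<^esub> cmp x"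
    by (auto simp: hom_def)
  let ?u = "FAr (pushforward Y B q f) u"
  have "FAr F (l x') \<cdot>\<^bsub>Y\<^esub> u = cmp x' \<cdot>\<^bsub>Y\<^esub> (l' (FOb F x') \<cdot>\<^bsub>Y\<^esub> u)"
    by (rule Y.X.Comp_reassoc'[symmetric]) (auto simp: cmp(5))
  also have "\<dots> = (cmp x' \<cdot>\<^bsub>Y\<^esub> ?u) \<cdot>\<^bsub>Y\<^esub> l' (FOb F x)" using Y.pushforward_Ar(5)[of u] by simp
  also have "\<dots> = FAr F (v \<cdot>\<^bsub>X\<^esub> l x)" unfolding e by (simp add: cmp(5))
  finally have "\<exists>!z. z \<in> Arr X \<and> FAr p z = Ident B (Dom B f) \<and> Dom X z = Dom X (l x) \<and>
      Cod X z = Dom X (l x') \<and> FAr F z = u \<and> v \<cdot>\<^bsub>X\<^esub> l x = l x' \<cdot>\<^bsub>X\<^esub> z"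
    by (intro ff) simp_all
  moreover have "z \<in> hom (fibre X B p (Dom B f)) x x' \<and> FAr (restrict_func (fibre X B p (Dom B f)) F) z = u \<and>
      FAr (pushforward X B p f) z = v \<longleftrightarrow>
      z \<in> Arr X \<and> FAr p z = Ident B (Dom B f) \<and> Dom X z = Dom X (l x) \<and>
      Cod X z = Dom X (l x') \<and> FAr F z = u \<and> v \<cdot>\<^bsub>X\<^esub> l x = l x' \<cdot>\<^bsub>X\<^esub> z" for z
    using X.pushforward_Ar(5)[of z] by (auto simp: hom_def intro: X.pushforward_Ar_eqI)
  ultimately show "\<exists>!z. z \<in> hom (fibre X B p (Dom B f)) x x' \<and>
      FAr (restrict_func (fibre X B p (Dom B f)) F) z = u \<and> FAr (pushforward X B p f) z = v"
    by simp
next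
  note [simp] = lift_simps cmp(1-4,6)
  fix y x w
  assume "y \<in> Obj (fibre Y B q (Dom B f))" "x \<in> Obj (fibre X B p (Cod B f))"
    and "w \<in> hom (fibre Y B q (Cod B f)) (FOb (pushforward Y B q f) y)
      (FOb (restrict_func (fibre X B p (Cod B f)) F) x)"
    and wi: "is_iso (fibre Y B q (Cod B f)) w"
  then have [simp]: "y \<in> Obj Y" "FOb q y = Dom B f" "x \<in> Obj X" "FOb p x = Cod B f"
      "w \<in> Arr Y" "FAr q w = Ident B (Cod B f)" "Dom Y w = Cod Y (l' y)" "Cod Y w = FOb F x"
    by (auto simp: hom_def)
  have [simp]: "is_iso Y w" using wi by (simp add: Y.fibre_iso)
  \<comment> \<open>The given isomorphism \<open>w\<close> is absorbed into the lift, this time on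
    the target side.\<close>
  obtain b u where b: "cocartesian X B p b" "FAr p b = f" "Cod X b = x"
    and u[simp]: "is_iso Y u" "FAr q u = Ident B (Dom B f)" "Dom Y u = FOb F (Dom X b)" "Cod Y u = y"
    and e: "(w \<cdot>\<^bsub>Y\<^esub> l' y) \<cdot>\<^bsub>Y\<^esub> u = FAr F b"
    using es[of "w \<cdot>\<^bsub>Y\<^esub> l' y" x] Y.cocartesian_comp_iso[of "l' y" w] by auto
  have [simp]: "b \<in> Arr X" "u \<in> Arr Y" using b u X.cocartesian_Arr is_iso_Arr[OF u(1)] by auto
  define z where "z = Dom X b"
  have [simp]: "z \<in> Obj X" "FOb p z = Dom B f" "Dom X b = z"
    using functor_Dom[OF X.proj, of b] b by (auto simp: z_def)
  obtain v where v: "v \<in> Arr X" "is_iso X v" "Cod X v = Cod X b" "Dom X v = Cod X (l z)"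
    "FAr p v = Ident B (FOb p (Cod X (l z)))" "v \<cdot>\<^bsub>X\<^esub> l z = b"
    using X.cocartesian_lift_iso[of "l z" b] b by auto
  have [simp]: "v \<in> Arr X" "is_iso X v" "Cod X v = x" "Dom X v = Cod X (l z)" "FAr p v = Ident B (Cod B f)"
    using v b by simp_all
  let ?u = "FAr (pushforward Y B q f) u"
  have "(w \<cdot>\<^bsub>Y\<^esub> ?u) \<cdot>\<^bsub>Y\<^esub> l' (FOb F z) = FAr F b"
    using Y.pushforward_Ar(5)[of u] e by simp
  also have "\<dots> = (FAr F v \<cdot>\<^bsub>Y\<^esub> cmp z) \<cdot>\<^bsub>Y\<^esub> l' (FOb F z)" unfolding v(6)[symmetric] by (simp add: cmp(5))
  finally have "w \<cdot>\<^bsub>Y\<^esub> ?u = FAr F v \<cdot>\<^bsub>Y\<^esub> cmp z"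
    by - (rule Y.cocartesian_unique[of "l' (FOb F z)"]; simp)
  then show "\<exists>x'\<in>Obj (fibre X B p (Dom B f)).
    \<exists>u\<in>hom (fibre Y B q (Dom B f)) (FOb (restrict_func (fibre X B p (Dom B f)) F) x') y.
    \<exists>v\<in>hom (fibre X B p (Cod B f)) (FOb (pushforward X B p f) x') x.
      is_iso (fibre Y B q (Dom B f)) u \<and> is_iso (fibre X B p (Cod B f)) v \<and>
      w \<cdot>\<^bsub>fibre Y B q (Cod B f)\<^esub> FAr (pushforward Y B q f) u =
        FAr (restrict_func (fibre X B p (Cod B f)) F) v \<cdot>\<^bsub>fibre Y B q (Cod B f)\<^esub> cmp x'"
    by (intro bexI[where x = z] bexI[where x = u] bexI[where x = v])
       (auto simp: hom_def X.fibre_iso Y.fibre_iso)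
qed (use X.pushforward_functor Y.pushforward_functor cmp_nat_iso X.base_Arr in \<open>simp_all add: restrict_functor\<close>)

end

section \<open>Identities and composites of morphisms of iesq sesquicartesian fibrations\<close>

lemma sesquicartesianD:
  assumes "sesquicartesian X p"
  shows sesquicartesian_over: "category_over X Ords p"
    and sesquicartesian_push: "f \<in> Arr Ords \<Longrightarrow> cocart_lifts X Ords p f"
    and sesquicartesian_pull: "\<lbrakk>f \<in> Arr Ords; convex_ord f\<rbrakk> \<Longrightarrow> cart_lifts X Ords p f"
  using assms
  by (auto simp: sesquicartesian_def cocartesian_fibration_def cartesian_fibration_over_def category_over_def
      cocart_lifts_def cocart_lifts_axioms_def cart_lifts_def cart_lifts_axioms_def)

text \<open>The right-hand side has the shape of the 2-cell produced by
  \<open>homotopy_pullback_paste\<close>, so that pasting yields precisely the square demanded of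
  the composite. The equality holds because a vertical arrow out of the end of a cocartesian lift is
  determined by its composite with that lift.\<close>

lemma push_comparison_comp:
  assumes XY: "push_square X B p Y q c f" and YZ: "push_square Y B q Z r d f"
  shows "push_square X B p Z r (comp_func X d c) f"
    and "push_comparison B (X, p) (Z, r) (comp_func X d c) f =
      (\<lambda>x\<in>Obj (fibre X B p (Dom B f)). FAr (restrict_func (fibre Y B q (Cod B f)) d)
         (push_comparison B (X, p) (Y, q) c f x) \<cdot>\<^bsub>fibre Z B r (Cod B f)\<^esub>
         push_comparison B (Y, q) (Z, r) d f (FOb (restrict_func (fibre X B p (Dom B f)) c) x))"
proof -
  interpret XY: push_square X B p Y q c f by fact
  interpret YZ: push_square Y B q Z r d f by fact
  show XZ: "push_square X B p Z r (comp_func X d c) f"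
  proof (unfold_locales)
    show "functor_over (X, p) (Z, r) (comp_func X d c)"
      using functor_over_comp[OF _ _ XY.over YZ.over] XY.X.proj YZ.Y.proj by simp
    fix u assume u: "cocartesian X B p u"
    then show "cocartesian Z B r (FAr (comp_func X d c) u)"
      using XY.preserves[OF u] YZ.preserves XY.X.cocartesian_Arr[OF u] by simp
  qed
  interpret XZ: push_square X B p Z r "comp_func X d c" f by fact
  show "push_comparison B (X, p) (Z, r) (comp_func X d c) f =
      (\<lambda>x\<in>Obj (fibre X B p (Dom B f)). FAr (restrict_func (fibre Y B q (Cod B f)) d)
         (push_comparison B (X, p) (Y, q) c f x) \<cdot>\<^bsub>fibre Z B r (Cod B f)\<^esub>
         push_comparison B (Y, q) (Z, r) d f (FOb (restrict_func (fibre X B p (Dom B f)) c) x))"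
  proof (rule extensionalityI[where A = "Obj (fibre X B p (Dom B f))"])
    fix x assume "x \<in> Obj (fibre X B p (Dom B f))"
    then have [simp]: "x \<in> Obj X" "FOb p x = Dom B f" by auto
    note [simp] = XY.lift_simps YZ.lift_simps XY.cmp(1-4) YZ.cmp(1-4)
    have "FAr d (XY.cmp x) \<cdot>\<^bsub>Z\<^esub> FAr d (cocart_lift Y B q f (FOb c x)) = FAr d (FAr c (cocart_lift X B p f x))"
      using functor_Comp[OF YZ.F_functor, of "cocart_lift Y B q f (FOb c x)" "XY.cmp x"] XY.cmp(5)[of x]
      by simp
    then have "XZ.cmp x = FAr d (XY.cmp x) \<cdot>\<^bsub>Z\<^esub> YZ.cmp (FOb c x)"
      by (intro XZ.cmp_eqI) (auto simp: YZ.cmp(5))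
    then show "XZ.cmp x =
      (\<lambda>x\<in>Obj (fibre X B p (Dom B f)). FAr (restrict_func (fibre Y B q (Cod B f)) d)
         (push_comparison B (X, p) (Y, q) c f x) \<cdot>\<^bsub>fibre Z B r (Cod B f)\<^esub>
         push_comparison B (Y, q) (Z, r) d f (FOb (restrict_func (fibre X B p (Dom B f)) c) x)) x"
      by simp
  qed (auto simp: push_comparison_def)
qed

lemma iesq_sesq_morphism_push_square:
  assumes "sesquicartesian X p" "sesquicartesian Y q" "functor_over (X, p) (Y, q) c"
    "\<And>u. cocartesian X Ords p u \<Longrightarrow> cocartesian Y Ords q (FAr c u)" "f \<in> Arr Ords"
  shows "push_square X Ords p Y q c f"
  using assms sesquicartesianD[OF assms(1)] sesquicartesianD[OF assms(2)]
  by (simp add: push_square_def push_square_axioms_def functor_over_base_def functor_over_base_axioms_def)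

lemma iesq_sesq_morphism_id:
  assumes X: "sesquicartesian X p"
  shows "iesq_sesq_morphism (X, p) (X, p) (id_func X)"
proof -
  interpret category_over X Ords p by (rule sesquicartesian_over[OF X])
  have over: "functor_over (X, p) (X, p) (id_func X)" using functor_over_id[of "(X, p)"] proj by simp
  { fix n k f assume f: "f \<in> hom Ords n k"
    interpret push_square X Ords p X p "id_func X" f
      by (rule iesq_sesq_morphism_push_square[OF X X over])
         (use f cocartesian_Arr in \<open>auto simp: hom_def\<close>)
    have "homotopy_pullback (fibre X Ords p (Dom Ords f)) (fibre X Ords p (Dom Ords f))
      (fibre X Ords p (Cod Ords f)) (fibre X Ords p (Cod Ords f))
      (restrict_func (fibre X Ords p (Dom Ords f)) (id_func X)) (pushforward X Ords p f)
      (pushforward X Ords p f) (restrict_func (fibre X Ords p (Cod Ords f)) (id_func X)) cmp"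
    proof (rule push_homotopy_pullback)
      fix a b u v
      assume "cocartesian X Ords p a" "cocartesian X Ords p b"
      then show "\<exists>!z. z \<in> Arr X \<and> FAr p z = Ident Ords (Dom Ords f) \<and> Dom X z = Dom X a \<and> Cod X z = Dom X b \<and>
        FAr (id_func X) z = u \<and> v \<cdot>\<^bsub>X\<^esub> a = b \<cdot>\<^bsub>X\<^esub> z"
        if "u \<in> Arr X" "FAr p u = Ident Ords (Dom Ords f)" "Dom X u = FOb (id_func X) (Dom X a)"
          "Cod X u = FOb (id_func X) (Dom X b)" "v \<in> Arr X" "FAr p v = Ident Ords (Cod Ords f)"
          "Dom X v = Cod X a" "Cod X v = Cod X b" "FAr (id_func X) b \<cdot>\<^bsub>X\<^esub> u = FAr (id_func X) (v \<cdot>\<^bsub>X\<^esub> a)"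
        \<comment> \<open>With identity functors on both sides the only candidate for
          \<open>z\<close> is \<open>u\<close> itself.\<close>
        using that cocartesian_Arr by (intro ex1I[where a = u]) auto
    next
      fix a x assume a: "cocartesian X Ords p a" "FAr p a = f" "x \<in> Obj X" "FOb p x = Cod Ords f"
        "Cod X a = FOb (id_func X) x"
      have "FOb p (Dom X a) = Dom Ords f" using functor_Dom[OF proj, of a] cocartesian_Arr a by auto
      then show "\<exists>b u. cocartesian X Ords p b \<and> FAr p b = f \<and> Cod X b = x \<and> is_iso X u \<and>
        FAr p u = Ident Ords (Dom Ords f) \<and> Dom X u = FOb (id_func X) (Dom X b) \<and> Cod X u = Dom X a \<and>
        a \<cdot>\<^bsub>X\<^esub> u = FAr (id_func X) b"
        using a cocartesian_Arr[OF a(1)] by (intro exI[where x = a] exI[where x = "Ident X (Dom X a)"]) auto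
    qed
    then have "homotopy_pullback (fibre X Ords p n) (fibre X Ords p n)
      (fibre X Ords p k) (fibre X Ords p k)
      (restrict_func (fibre X Ords p n) (id_func X)) (pushforward X Ords p f)
      (pushforward X Ords p f) (restrict_func (fibre X Ords p k) (id_func X)) cmp"
      using f by (simp add: hom_def) }
  then show ?thesis unfolding iesq_sesq_morphism_def
    using cocartesian_Arr cartesian_Arr by auto
qed

lemma iesq_sesq_morphism_comp:
  assumes X: "sesquicartesian X p" and Y: "sesquicartesian Y q" and Z: "sesquicartesian Z r"
    and c: "functor_over (X, p) (Y, q) c" "iesq_sesq_morphism (X, p) (Y, q) c"
    and d: "functor_over (Y, q) (Z, r) d" "iesq_sesq_morphism (Y, q) (Z, r) d"
  shows "iesq_sesq_morphism (X, p) (Z, r) (comp_func X d c)"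
proof -
  interpret X: category_over X Ords p by (rule sesquicartesian_over[OF X])
  have c_cocart: "\<And>u. cocartesian X Ords p u \<Longrightarrow> cocartesian Y Ords q (FAr c u)"
    and c_cart: "\<And>u. cartesian X Ords p u \<Longrightarrow> convex_ord (FAr p u) \<Longrightarrow> cartesian Y Ords q (FAr c u)"
    and c_hp: "\<And>n k f. f \<in> hom Ords n k \<Longrightarrow> homotopy_pullback
          (fibre X Ords p n) (fibre Y Ords q n) (fibre X Ords p k) (fibre Y Ords q k)
          (restrict_func (fibre X Ords p n) c) (pushforward X Ords p f)
          (pushforward Y Ords q f) (restrict_func (fibre X Ords p k) c)
          (push_comparison Ords (X, p) (Y, q) c f)"
    using c(2) by (auto simp: iesq_sesq_morphism_def)
  have d_cocart: "\<And>u. cocartesian Y Ords q u \<Longrightarrow> cocartesian Z Ords r (FAr d u)"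
    and d_cart: "\<And>u. cartesian Y Ords q u \<Longrightarrow> convex_ord (FAr q u) \<Longrightarrow> cartesian Z Ords r (FAr d u)"
    and d_hp: "\<And>n k f. f \<in> hom Ords n k \<Longrightarrow> homotopy_pullback
          (fibre Y Ords q n) (fibre Z Ords r n) (fibre Y Ords q k) (fibre Z Ords r k)
          (restrict_func (fibre Y Ords q n) d) (pushforward Y Ords q f)
          (pushforward Z Ords r f) (restrict_func (fibre Y Ords q k) d)
          (push_comparison Ords (Y, q) (Z, r) d f)"
    using d(2) by (auto simp: iesq_sesq_morphism_def)
  have [simp]: "FAr q (FAr c u) = FAr p u" if "u \<in> Arr X" for u
    using functor_over_Ar[OF c(1)] that by simp
  { fix n k f assume f: "f \<in> hom Ords n k"
    then have f': "f \<in> Arr Ords" "Dom Ords f = n" "Cod Ords f = k" by (auto simp: hom_def)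
    have XY: "push_square X Ords p Y q c f"
      by (rule iesq_sesq_morphism_push_square[OF X Y c(1) c_cocart f'(1)])
    have YZ: "push_square Y Ords q Z r d f"
      by (rule iesq_sesq_morphism_push_square[OF Y Z d(1) d_cocart f'(1)])
    interpret XY: push_square X Ords p Y q c f by (rule XY)
    \<comment> \<open>Restriction to a fibre commutes with composition of functors, which brings the
      sides of the pasted square into the form used in the definition.\<close>
    have r: "restrict_func (fibre X Ords p m) (comp_func X d c) =
      comp_func (fibre X Ords p m) (restrict_func (fibre Y Ords q m) d) (restrict_func (fibre X Ords p m) c)"
      if "m \<in> Obj Ords" for m
      by (rule func_eqI[where A = "Obj (fibre X Ords p m)" and B = "Arr (fibre X Ords p m)"])
         (simp_all del: fibre_simps(1,2), simp_all)
    have "n \<in> Obj Ords" "k \<in> Obj Ords" using f X.B.hom_Obj by auto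
    then have "homotopy_pullback
          (fibre X Ords p n) (fibre Z Ords r n) (fibre X Ords p k) (fibre Z Ords r k)
          (restrict_func (fibre X Ords p n) (comp_func X d c)) (pushforward X Ords p f)
          (pushforward Z Ords r f) (restrict_func (fibre X Ords p k) (comp_func X d c))
          (push_comparison Ords (X, p) (Z, r) (comp_func X d c) f)"
      unfolding push_comparison_comp(2)[OF XY YZ] f'(2,3)
      using homotopy_pullback_paste[OF c_hp[OF f] d_hp[OF f]] by (simp only: r) }
  then show ?thesis unfolding iesq_sesq_morphism_def
    using X.cocartesian_Arr X.cartesian_Arr c_cocart c_cart d_cocart d_cart by auto
qed

section \<open>The categories of iesq sesquicartesian fibrations and of right fibrations\<close>

lemma IesqSesq_category: "category (IesqSesq :: (('o, 'm, nat, ord_map) over, _) cat)"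
  unfolding IesqSesq_def
proof (rule over_category_category)
  fix S :: "('o, 'm, nat, ord_map) over"
  assume "S \<in> {(X, p). sesquicartesian X p \<and> iesq X p}"
  then show "is_functor (fst S) Ords (snd S)" "iesq_sesq_morphism S S (id_func (fst S))"
    using iesq_sesq_morphism_id category_over.proj[OF sesquicartesian_over] by auto
qed (use iesq_sesq_morphism_comp in fastforce)

lemma RFib_simps:
  "S \<in> Obj RFib \<longleftrightarrow> right_fibration (fst S) CPos (snd S) \<and>
     (\<forall>P \<in> Obj CPos. locally_finite_groupoid (fibre (fst S) CPos (snd S) P))"
  "(S, T, c) \<in> Arr RFib \<longleftrightarrow> S \<in> Obj RFib \<and> T \<in> Obj RFib \<and> functor_over S T c"
  "Dom RFib (S, T, c) = S" "Cod RFib (S, T, c) = T" "Ident RFib S = (S, S, id_func (fst S))"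
  "(S', T', c') \<cdot>\<^bsub>RFib\<^esub> (S, T, c) = (S, T', comp_func (fst S) c' c)"
  unfolding RFib_def by (auto split: prod.splits)

lemma RFib_category: "category (RFib :: (('a::infinite, 'o, 'm) cover, _) cat)"
  unfolding RFib_def
  by (rule over_category_category[where B = CPos])
     (auto simp: right_fibration_def cartesian_fibration_over_def)

section \<open>Finite posets and ordinals\<close>

abbreviation app :: "'a \<times> 'b \<times> ('c \<Rightarrow> 'd) \<Rightarrow> 'c \<Rightarrow> 'd" where
  "app f \<equiv> snd (snd f)"

lemma Ords_simps [simp]:
  "Obj Ords = UNIV"
  "(n, k, f) \<in> Arr Ords \<longleftrightarrow> f \<in> {1..n} \<rightarrow>\<^sub>E {1..k} \<and> mono_on {1..n} f"
  "Dom Ords m = fst m" "Cod Ords m = fst (snd m)"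
  "Ident Ords n = (n, n, \<lambda>x\<in>{1..n}. x)"
  "m' \<cdot>\<^bsub>Ords\<^esub> m = (fst m, fst (snd m'), compose {1..fst m} (app m') (app m))"
  by (auto simp: Ords_def split_beta)

lemma Ords_app:
  assumes "m \<in> Arr Ords"
  shows "x \<in> {1..fst m} \<Longrightarrow> app m x \<in> {1..fst (snd m)}"
    and "\<lbrakk>x \<in> {1..fst m}; y \<in> {1..fst m}; x \<le> y\<rbrakk> \<Longrightarrow> app m x \<le> app m y"
  using assms by (cases m; auto simp: mono_on_def PiE_iff)+

lemma Ords_eqI:
  assumes "m \<in> Arr Ords" "m' \<in> Arr Ords" "fst m = fst m'" "fst (snd m) = fst (snd m')"
    and "\<And>x. x \<in> {1..fst m} \<Longrightarrow> app m x = app m' x"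
  shows "m = m'"
proof -
  have "app m = app m'"
    by (rule PiE_ext[of _ "{1..fst m}" "\<lambda>_. {1..fst (snd m)}"]) (use assms in \<open>auto simp: Ords_def\<close>)
  then show ?thesis using assms(3,4) by (simp add: prod_eq_iff)
qed

lemma Ords_category: "category Ords"
proof
  fix f g assume "f \<in> Arr Ords" "g \<in> Arr Ords" "Cod Ords f = Dom Ords g"
  then show "g \<cdot>\<^bsub>Ords\<^esub> f \<in> Arr Ords"
    by (cases f; cases g) (auto simp: compose_def mono_on_def PiE_iff)
next
  fix f assume "f \<in> Arr Ords"
  then show "f \<cdot>\<^bsub>Ords\<^esub> Ident Ords (Dom Ords f) = f" "Ident Ords (Cod Ords f) \<cdot>\<^bsub>Ords\<^esub> f = f"
    by (cases f; auto simp: compose_def PiE_iff extensional_def fun_eq_iff)+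
qed (auto simp: mono_on_def compose_def PiE_iff fun_eq_iff)

text \<open>Successors go to successors, so a convex map is a translation. Injectivity, reflection
  of the order and the fact that the image is an interval all follow from this formula.\<close>

lemma convex_ord_shift:
  assumes m: "m \<in> Arr Ords" and c: "convex_ord m" and x: "x \<in> {1..fst m}"
  shows "app m x = app m 1 + (x - 1)"
proof -
  have "x \<in> {1..fst m} \<longrightarrow> app m x = app m 1 + (x - 1)"
  proof (induction x)
    case (Suc x)
    then show ?case using c by (cases m; cases "x = 0") (auto simp: convex_ord_def)
  qed simp
  then show ?thesis using x by simp
qed

lemma convex_ord_inj:
  assumes "m \<in> Arr Ords" "convex_ord m" "x \<in> {1..fst m}" "y \<in> {1..fst m}"
  shows "app m x = app m y \<longleftrightarrow> x = y" "app m x \<le> app m y \<longleftrightarrow> x \<le> y"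
  using convex_ord_shift[OF assms(1,2,3)] convex_ord_shift[OF assms(1,2,4)] assms(3,4) by auto

lemma convex_ord_between:
  assumes m: "m \<in> Arr Ords" "convex_ord m" and x: "x \<in> {1..fst m}" and y: "y \<in> {1..fst m}"
    and z: "app m x \<le> z" "z \<le> app m y"
  shows "z \<in> app m ` {1..fst m}"
\<comment> \<open>The preimage of \<open>z\<close> is its distance from the first value, plus one
  because ordinals start at 1. Truncated subtraction is exact here, as \<open>z\<close> is at least
  \<open>app m 1\<close>.\<close>
proof (rule image_eqI[where x = "Suc (z - app m 1)"])
  have "app m 1 \<le> z" using z(1) convex_ord_shift[OF m x] by simp
  moreover have "z - app m 1 \<le> y - 1" using z(2) convex_ord_shift[OF m y] by simp
  ultimately show i: "Suc (z - app m 1) \<in> {1..fst m}" using y by auto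
  show "z = app m (Suc (z - app m 1))" using convex_ord_shift[OF m i] \<open>app m 1 \<le> z\<close> by simp
qed

text \<open>The unique interpolant in the definition hides injectivity and reflection of the order.
  Both come from applying it where \<open>x\<close> is an end of the interval, since the interpolant
  must sit between the given points of \<open>K\<close>.\<close>

lemma convex_map_iff:
  assumes K: "finite_poset K" and P: "finite_poset P"
  shows "convex_map K P f \<longleftrightarrow> f \<in> fst K \<rightarrow>\<^sub>E fst P \<and>
    (\<forall>a \<in> fst K. \<forall>b \<in> fst K. (a, b) \<in> snd K \<longleftrightarrow> (f a, f b) \<in> snd P) \<and>
    (\<forall>a \<in> fst K. \<forall>b \<in> fst K. \<forall>x \<in> fst P. (f a, x) \<in> snd P \<and> (x, f b) \<in> snd P \<longrightarrow> x \<in> f ` fst K)"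
    (is "_ \<longleftrightarrow> ?f \<and> ?emb \<and> ?con")
proof -
  have refl: "(x, x) \<in> snd P" if "x \<in> fst P" for x
    using P that by (auto simp: finite_poset_def partial_order_on_def preorder_on_def refl_on_def)
  have anti: "a = b" if "(a, b) \<in> snd K" "(b, a) \<in> snd K" for a b
    using K that by (auto simp: finite_poset_def partial_order_on_def antisym_def)
  have sub: "snd K \<subseteq> fst K \<times> fst K"
    using K by (auto simp: finite_poset_def partial_order_on_def preorder_on_def refl_on_def)
  show ?thesis
  proof
    assume c: "convex_map K P f"
    then have f: ?f and m: "\<And>a b. (a, b) \<in> snd K \<Longrightarrow> (f a, f b) \<in> snd P"
      and u: "\<And>a b x. \<lbrakk>a \<in> fst K; b \<in> fst K; x \<in> fst P; (f a, x) \<in> snd P; (x, f b) \<in> snd P\<rbrakk> \<Longrightarrow>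
        \<exists>k. k \<in> fst K \<and> (a, k) \<in> snd K \<and> (k, b) \<in> snd K \<and> f k = x"
      unfolding convex_map_def by blast+
    have inj: "a = b" if ab: "a \<in> fst K" "b \<in> fst K" "f a = f b" for a b
    proof -
      have "f a \<in> fst P" using f ab by auto
      then have "\<exists>!k. k \<in> fst K \<and> (a, k) \<in> snd K \<and> (k, a) \<in> snd K \<and> f k = f a"
        using c ab refl unfolding convex_map_def by auto
      \<comment> \<open>When \<open>f a = f b\<close>, the interpolant between \<open>a\<close> and
        \<open>b\<close> gives \<open>(a, b) \<in> snd K\<close> by transitivity. Exchanging the two
        points gives the reverse relation, and antisymmetry concludes.\<close>
      moreover have "\<exists>k. k \<in> fst K \<and> (a, k) \<in> snd K \<and> (k, b) \<in> snd K \<and> f k = f a"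
        "\<exists>k. k \<in> fst K \<and> (b, k) \<in> snd K \<and> (k, a) \<in> snd K \<and> f k = f a"
        using u[of a b "f a"] u[of b a "f a"] ab refl[OF \<open>f a \<in> fst P\<close>] \<open>f a \<in> fst P\<close> by simp_all
      ultimately have "(a, b) \<in> snd K" "(b, a) \<in> snd K"
        using K unfolding finite_poset_def partial_order_on_def preorder_on_def trans_def by blast+
      then show ?thesis by (rule anti)
    qed
    \<comment> \<open>With \<open>x = f b\<close> the interpolant lies above \<open>a\<close>, and
      by injectivity it is \<open>b\<close>.\<close>
    have "(a, b) \<in> snd K" if "a \<in> fst K" "b \<in> fst K" "(f a, f b) \<in> snd P" for a b
      using u[of a b "f b"] that refl[of "f b"] f inj by (auto simp: PiE_iff)
    then show "?f \<and> ?emb \<and> ?con" using f m u by blast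
  next
    assume h: "?f \<and> ?emb \<and> ?con"
    have inj: "a = b" if "a \<in> fst K" "b \<in> fst K" "f a = f b" for a b
      using h that refl[of "f a"] by (intro anti) (auto simp: PiE_iff)
    show "convex_map K P f"
      unfolding convex_map_def
    proof (intro conjI ballI impI)
      show "case ab of (a, b) \<Rightarrow> (f a, f b) \<in> snd P" if "ab \<in> snd K" for ab
        using h that sub by (cases ab) auto
      fix a b x assume a: "a \<in> fst K" "b \<in> fst K" "x \<in> fst P" "(f a, x) \<in> snd P \<and> (x, f b) \<in> snd P"
      then obtain k where "k \<in> fst K" "f k = x" using h by blast
      then show "\<exists>!k. k \<in> fst K \<and> (a, k) \<in> snd K \<and> (k, b) \<in> snd K \<and> f k = x"
        using a h inj by (intro ex1I[where a = k]) auto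
    qed (use h in blast)
  qed
qed

lemma CPos_simps [simp]:
  "Obj CPos = {P. finite_poset P}"
  "(K, P, f) \<in> Arr CPos \<longleftrightarrow> finite_poset K \<and> finite_poset P \<and> convex_map K P f"
  "Dom CPos f' = fst f'" "Cod CPos f' = fst (snd f')"
  "Ident CPos P = (P, P, \<lambda>a\<in>fst P. a)"
  "g' \<cdot>\<^bsub>CPos\<^esub> f' = (fst f', fst (snd g'), compose (fst (fst f')) (app g') (app f'))"
  by (auto simp: CPos_def split_beta)

lemma CPos_Arr_iff:
  "f \<in> Arr CPos \<longleftrightarrow> finite_poset (fst f) \<and> finite_poset (fst (snd f)) \<and>
    app f \<in> fst (fst f) \<rightarrow>\<^sub>E fst (fst (snd f)) \<and>
    (\<forall>a \<in> fst (fst f). \<forall>b \<in> fst (fst f). (a, b) \<in> snd (fst f) \<longleftrightarrow> (app f a, app f b) \<in> snd (fst (snd f))) \<and>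
    (\<forall>a \<in> fst (fst f). \<forall>b \<in> fst (fst f). \<forall>x \<in> fst (fst (snd f)).
       (app f a, x) \<in> snd (fst (snd f)) \<and> (x, app f b) \<in> snd (fst (snd f)) \<longrightarrow> x \<in> app f ` fst (fst f))"
  by (cases f) (auto simp: convex_map_iff)

lemma finite_posetD:
  assumes "finite_poset P"
  shows "x \<in> fst P \<Longrightarrow> (x, x) \<in> snd P" "(x, y) \<in> snd P \<Longrightarrow> x \<in> fst P" "(x, y) \<in> snd P \<Longrightarrow> y \<in> fst P"
    "\<lbrakk>(x, y) \<in> snd P; (y, z) \<in> snd P\<rbrakk> \<Longrightarrow> (x, z) \<in> snd P" "\<lbrakk>(x, y) \<in> snd P; (y, x) \<in> snd P\<rbrakk> \<Longrightarrow> x = y"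
    "finite (fst P)"
  using assms
  by (auto simp: finite_poset_def partial_order_on_def preorder_on_def refl_on_def antisym_def dest: transD)

lemma CPos_app:
  assumes f: "f \<in> Arr CPos"
  shows "x \<in> fst (fst f) \<Longrightarrow> app f x \<in> fst (fst (snd f))"
    and "\<lbrakk>x \<in> fst (fst f); y \<in> fst (fst f)\<rbrakk> \<Longrightarrow> (app f x, app f y) \<in> snd (fst (snd f)) \<longleftrightarrow> (x, y) \<in> snd (fst f)"
    and "\<lbrakk>x \<in> fst (fst f); y \<in> fst (fst f)\<rbrakk> \<Longrightarrow> app f x = app f y \<longleftrightarrow> x = y"
proof -
  note * = f[unfolded CPos_Arr_iff]
  show "x \<in> fst (fst f) \<Longrightarrow> app f x \<in> fst (fst (snd f))" using * by (auto simp: PiE_iff)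
  show 2: "(app f x, app f y) \<in> snd (fst (snd f)) \<longleftrightarrow> (x, y) \<in> snd (fst f)"
    if "x \<in> fst (fst f)" "y \<in> fst (fst f)" for x y using * that by auto
  show "app f x = app f y \<longleftrightarrow> x = y" if "x \<in> fst (fst f)" "y \<in> fst (fst f)"
    using 2[of x y] 2[of y x] 2[of x x] that * finite_posetD(1)[of "fst (snd f)" "app f x"]
      finite_posetD(5)[of "fst f" x y] by (auto simp: PiE_iff)
qed

lemma CPos_eqI:
  assumes "f \<in> Arr CPos" "f' \<in> Arr CPos" "fst f = fst f'" "fst (snd f) = fst (snd f')"
    and "\<And>x. x \<in> fst (fst f) \<Longrightarrow> app f x = app f' x"
  shows "f = f'"
proof -
  have "app f = app f'"
    by (rule PiE_ext[of _ "fst (fst f)" "\<lambda>_. fst (fst (snd f))"])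
       (use assms(1-4) in \<open>auto simp: CPos_Arr_iff assms(5)\<close>)
  then show ?thesis using assms(3,4) by (simp add: prod_eq_iff)
qed

lemma CPos_category: "category (CPos :: ('a::infinite poset, _) cat)"
proof
  fix f g :: "'a poset_map" assume fg: "f \<in> Arr CPos" "g \<in> Arr CPos" "Cod CPos f = Dom CPos g"
  note f = CPos_app[OF fg(1)] and g = CPos_app[OF fg(2)]
  have e: "fst (snd f) = fst g" using fg by simp
  \<comment> \<open>Convexity of \<open>g\<close> gives a point \<open>y\<close> over
    \<open>x\<close>. As \<open>g\<close> reflects the order, \<open>y\<close> lies between two
    values of \<open>f\<close>, and convexity of \<open>f\<close> applies.\<close>
  have "\<exists>k \<in> fst (fst f). app g (app f k) = x" if "a \<in> fst (fst f)" "b \<in> fst (fst f)" "x \<in> fst (fst (snd g))"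
    "(app g (app f a), x) \<in> snd (fst (snd g))" "(x, app g (app f b)) \<in> snd (fst (snd g))" for a b x
  proof -
    have ab: "app f a \<in> fst (fst g)" "app f b \<in> fst (fst g)" using that f(1) e by auto
    have "x \<in> app g ` fst (fst g)" using fg(2)[unfolded CPos_Arr_iff] that ab by blast
    then obtain y where y: "y \<in> fst (fst g)" "app g y = x" by auto
    then have "(app f a, y) \<in> snd (fst g)" "(y, app f b) \<in> snd (fst g)" using that ab g(2) by auto
    then have "y \<in> app f ` fst (fst f)" using fg(1)[unfolded CPos_Arr_iff] that y e by metis
    then show ?thesis using y by blast
  qed
  then show "g \<cdot>\<^bsub>CPos\<^esub> f \<in> Arr CPos"
    using fg e f g unfolding CPos_Arr_iff
    by (auto simp: compose_def PiE_iff image_iff) metis+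
next
  fix P :: "'a poset" assume "P \<in> Obj CPos"
  then show "Ident CPos P \<in> Arr CPos" by (auto simp: CPos_Arr_iff simp del: CPos_simps(2))
next
  fix f :: "'a poset_map" assume "f \<in> Arr CPos"
  then show "f \<cdot>\<^bsub>CPos\<^esub> Ident CPos (Dom CPos f) = f" "Ident CPos (Cod CPos f) \<cdot>\<^bsub>CPos\<^esub> f = f"
    unfolding CPos_Arr_iff
    by (cases f; auto simp: compose_def PiE_iff extensional_def fun_eq_iff)+
next
  fix f g h :: "'a poset_map"
  assume "f \<in> Arr CPos" "g \<in> Arr CPos" "h \<in> Arr CPos" "Cod CPos f = Dom CPos g" "Cod CPos g = Dom CPos h"
  then show "(h \<cdot>\<^bsub>CPos\<^esub> g) \<cdot>\<^bsub>CPos\<^esub> f = h \<cdot>\<^bsub>CPos\<^esub> (g \<cdot>\<^bsub>CPos\<^esub> f)"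
    using CPos_app(1)[of f] by (auto simp: compose_def fun_eq_iff)
qed (auto simp: CPos_Arr_iff)

lemma CPos_Comp_app:
  "x \<in> fst (fst f) \<Longrightarrow> app (g \<cdot>\<^bsub>CPos\<^esub> f) x = app g (app f x)"
  by (simp add: compose_def)

text \<open>As \<open>f\<close> is an embedding, \<open>h\<close> must be \<open>g\<close> followed
  by the inverse of \<open>f\<close> on its image. Its convexity is inherited from \<open>g\<close>:
  a point between values of \<open>h\<close> is sent by \<open>f\<close> between values of
  \<open>g\<close>.\<close>

lemma CPos_factor:
  fixes f g :: "'a::infinite poset_map"
  assumes f: "f \<in> Arr CPos" and g: "g \<in> Arr CPos" and c: "Cod CPos g = Cod CPos f"
    and im: "app g ` fst (fst g) \<subseteq> app f ` fst (fst f)"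
  obtains h where "h \<in> Arr CPos" "Dom CPos h = Dom CPos g" "Cod CPos h = Dom CPos f" "f \<cdot>\<^bsub>CPos\<^esub> h = g"
proof -
  note f' = CPos_app[OF f] and g' = CPos_app[OF g]
  define h where "h = (fst g, fst f, \<lambda>x\<in>fst (fst g). inv_into (fst (fst f)) (app f) (app g x))"
  have h1: "app h x \<in> fst (fst f)" "app f (app h x) = app g x" if "x \<in> fst (fst g)" for x
    using im that by (auto simp: h_def intro!: inv_into_into f_inv_into_f)
  have fh: "fst h = fst g" "fst (snd h) = fst f" by (auto simp: h_def)
  have "app h \<in> fst (fst h) \<rightarrow>\<^sub>E fst (fst (snd h))" using h1(1) fh by (auto simp: h_def)
  moreover have emb: "(app h a, app h b) \<in> snd (fst f) \<longleftrightarrow> (a, b) \<in> snd (fst g)"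
    if "a \<in> fst (fst g)" "b \<in> fst (fst g)" for a b
    using that f'(2)[of "app h a" "app h b"] g'(2)[of a b] h1[of a] h1[of b] c by simp
  moreover have "x \<in> app h ` fst (fst g)"
    if x: "a \<in> fst (fst g)" "b \<in> fst (fst g)" "x \<in> fst (fst f)" "(app h a, x) \<in> snd (fst f)" "(x, app h b) \<in> snd (fst f)" for a b x
  proof -
    have "(app g a, app f x) \<in> snd (fst (snd g))" "(app f x, app g b) \<in> snd (fst (snd g))"
      using x f'(2)[of "app h a" x] f'(2)[of x "app h b"] h1[of a] h1[of b] c by auto
    moreover have "app f x \<in> fst (fst (snd g))" using f'(1)[of x] x c by simp
    ultimately obtain y where "y \<in> fst (fst g)" "app f x = app g y"
      using g[unfolded CPos_Arr_iff] x by blast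
    then show ?thesis using f'(3)[of x "app h y"] h1[of y] x by (intro image_eqI[where x = y]) auto
  qed
  ultimately have h: "h \<in> Arr CPos" using f g unfolding CPos_Arr_iff by (simp add: fh)
  have "f \<cdot>\<^bsub>CPos\<^esub> h = g"
    by (rule CPos_eqI) (use category.Comp_in[OF CPos_category h f] g c fh h1 in \<open>auto simp: compose_def\<close>)
  then show ?thesis using that[of h] h fh by simp
qed

lemma CPos_mono:
  fixes f h h' :: "'a::infinite poset_map"
  assumes f: "f \<in> Arr CPos" and h: "h \<in> Arr CPos" "h' \<in> Arr CPos" and d: "Dom CPos h = Dom CPos h'"
    "Cod CPos h = Dom CPos f" "Cod CPos h' = Dom CPos f" and e: "f \<cdot>\<^bsub>CPos\<^esub> h = f \<cdot>\<^bsub>CPos\<^esub> h'"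
  shows "h = h'"
proof (rule CPos_eqI[OF h])
  fix x assume x: "x \<in> fst (fst h)"
  have "app f (app h x) = app (f \<cdot>\<^bsub>CPos\<^esub> h) x" by (rule CPos_Comp_app[symmetric, OF x])
  also have "\<dots> = app (f \<cdot>\<^bsub>CPos\<^esub> h') x" unfolding e ..
  also have "\<dots> = app f (app h' x)" by (rule CPos_Comp_app) (use x d in simp)
  finally show "app h x = app h' x"
    using CPos_app(3)[OF f, of "app h x" "app h' x"] CPos_app(1)[OF h(1), of x] CPos_app(1)[OF h(2), of x] x d by simp
qed (use d in auto)

lemma CPos_iso_image:
  fixes f :: "'a::infinite poset_map"
  assumes f: "is_iso CPos f"
  shows "app f ` fst (fst f) = fst (fst (snd f))"
proof
  have f': "f \<in> Arr CPos" using f by (rule is_iso_Arr)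
  show "app f ` fst (fst f) \<subseteq> fst (fst (snd f))" using CPos_app(1)[OF f'] by auto
  show "fst (fst (snd f)) \<subseteq> app f ` fst (fst f)"
  proof
    fix y assume y: "y \<in> fst (fst (snd f))"
    have g: "inv_arr CPos f \<in> Arr CPos" "fst (inv_arr CPos f) = fst (snd f)" "fst (snd (inv_arr CPos f)) = fst f"
      "f \<cdot>\<^bsub>CPos\<^esub> inv_arr CPos f = Ident CPos (fst (snd f))"
      using inv_arr[OF f] by simp_all
    then show "y \<in> app f ` fst (fst f)"
      using CPos_Comp_app[of y "inv_arr CPos f" f] CPos_app(1)[OF g(1), of y] y
      by (intro image_eqI[where x = "app (inv_arr CPos f) y"]) auto
  qed
qed

section \<open>Right fibrations over finite posets and convex maps\<close>

context category_over
begin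

text \<open>An arrow factors through a cartesian lift of its image by a vertical arrow, and groupoid
  fibres make that vertical arrow invertible.\<close>

lemma all_cartesian:
  assumes rf: "right_fibration X B p" and u: "u \<in> Arr X"
  shows "cartesian X B p u"
proof -
  have "\<forall>\<tau>\<in>Arr B. \<forall>x\<in>Obj X. True \<and> FOb p x = Cod B \<tau> \<longrightarrow>
      (\<exists>l. cartesian X B p l \<and> FAr p l = \<tau> \<and> Cod X l = x)"
    using rf unfolding right_fibration_def cartesian_fibration_over_def is_cart_lift_def by blast
  from this[rule_format, of "FAr p u" "Cod X u"] obtain l where
    l: "cartesian X B p l" "FAr p l = FAr p u" "Cod X l = Cod X u"
    using u by auto
  obtain w where w: "w \<in> Arr X" "Dom X w = Dom X u" "Cod X w = Dom X l"
    "FAr p w = Ident B (FOb p (Dom X l))" "l \<cdot>\<^bsub>X\<^esub> w = u"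
    using cartesian_fill_vert[OF l(1) u] l by auto
  have b: "FOb p (Dom X l) \<in> Obj B" using cartesian_Arr[OF l(1)] by simp
  then have "groupoid (fibre X B p (FOb p (Dom X l)))" using rf by (simp add: right_fibration_def)
  then have "is_iso (fibre X B p (FOb p (Dom X l))) w" using w by (simp add: groupoid_def)
  then have "is_iso X w" using fibre_iso[OF b] by simp
  then show ?thesis using cartesian_comp_iso[OF l(1)] w by auto
qed

text \<open>Filling the identity of the target over the inverse base arrow gives a right inverse;
  uniqueness of fillers makes it two-sided.\<close>

lemma reflect_iso:
  assumes u: "cartesian X B p u" and i: "is_iso B (FAr p u)"
  shows "is_iso X u"
proof -
  have u'[simp]: "u \<in> Arr X" using u by (rule cartesian_Arr)
  note [simp] = i
  obtain w where w: "w \<in> Arr X" "Dom X w = Cod X u" "Cod X w = Dom X u" "FAr p w = inv_arr B (FAr p u)"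
    "u \<cdot>\<^bsub>X\<^esub> w = Ident X (Cod X u)"
    using cartesian_fill[OF u, of "Ident X (Cod X u)" "inv_arr B (FAr p u)"] by auto
  have "u \<cdot>\<^bsub>X\<^esub> (w \<cdot>\<^bsub>X\<^esub> u) = (u \<cdot>\<^bsub>X\<^esub> w) \<cdot>\<^bsub>X\<^esub> u" using w(1-4) by simp
  also have "\<dots> = u \<cdot>\<^bsub>X\<^esub> Ident X (Dom X u)" using w by simp
  finally have "w \<cdot>\<^bsub>X\<^esub> u = Ident X (Dom X u)"
    by - (rule cartesian_unique[OF u]; use w(1-4) in simp)
  then show ?thesis using w by (intro X.is_isoI[where g = w]) auto
qed

text \<open>The converse of \<open>all_cartesian\<close>: a vertical arrow lies over an identity,
  and a cartesian arrow over an isomorphism is invertible, so the fibres are groupoids.\<close>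

lemma right_fibrationI:
  assumes lifts: "\<And>\<tau> x. \<lbrakk>\<tau> \<in> Arr B; x \<in> Obj X; FOb p x = Cod B \<tau>\<rbrakk> \<Longrightarrow>
      \<exists>u \<in> Arr X. FAr p u = \<tau> \<and> Cod X u = x"
    and cart: "\<And>u. u \<in> Arr X \<Longrightarrow> cartesian X B p u"
  shows "right_fibration X B p"
  unfolding right_fibration_def cartesian_fibration_over_def is_cart_lift_def
proof (intro conjI ballI impI)
  fix \<tau> x assume "\<tau> \<in> Arr B" "x \<in> Obj X" "True \<and> FOb p x = Cod B \<tau>"
  then show "\<exists>u. cartesian X B p u \<and> FAr p u = \<tau> \<and> Cod X u = x" using lifts[of \<tau> x] cart by blast
next
  fix b assume b: "b \<in> Obj B"
  then show "groupoid (fibre X B p b)"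
    unfolding groupoid_def using fibre_category[OF b] fibre_iso[OF b] reflect_iso[OF cart] by auto
qed (rule proj)

end

text \<open>From here on the two base categories are handled through the laws of a category, so the
  rules expanding sources, targets, identities and composites into tuples are withdrawn.\<close>

declare CPos_simps(3-6) [simp del] Ords_simps(3-6) [simp del]

lemma CPos_Dom_Cod [simp]: "Dom CPos (K, P, f) = K" "Cod CPos (K, P, f) = P"
  by (simp_all add: CPos_simps(3,4))

lemma Ords_Dom_Cod [simp]: "Dom Ords (n, k, f) = n" "Cod Ords (n, k, f) = k"
  by (simp_all add: Ords_simps(3,4))

lemmas Ords_app' = Ords_app[folded Ords_simps(3,4)]
lemmas Ords_eqI' = Ords_eqI[folded Ords_simps(3,4)]
lemmas convex_ord_inj' = convex_ord_inj[folded Ords_simps(3,4)]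
lemmas convex_ord_between' = convex_ord_between[folded Ords_simps(3,4)]

lemma Ords_app_Comp [simp]: "x \<in> {1..Dom Ords m} \<Longrightarrow> app (m' \<cdot>\<^bsub>Ords\<^esub> m) x = app m' (app m x)"
  by (simp add: Ords_simps(3,6) compose_def)

lemma CPos_app_Ident [simp]: "x \<in> fst P \<Longrightarrow> app (Ident CPos P) x = x"
  by (simp add: CPos_simps(5))

lemma Ords_app_Ident [simp]: "x \<in> {1..n} \<Longrightarrow> app (Ident Ords n) x = x"
  by (simp add: Ords_simps(5))

locale poset_fibration = category_over E CPos p
  for E :: "('o, 'm) cat" and p :: "('o, 'm, 'a::infinite poset, 'a poset_map) func" +
  assumes rfib: "right_fibration E CPos p"
begin

abbreviation pts where "pts e \<equiv> fst (FOb p e)"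
abbreviation ar where "ar r \<equiv> app (FAr p r)"
abbreviation le where "le e x y \<equiv> (x, y) \<in> snd (FOb p e)"

lemma fst_FAr [simp]:
  assumes "r \<in> Arr E"
  shows "fst (FAr p r) = FOb p (Dom E r)" "fst (snd (FAr p r)) = FOb p (Cod E r)"
  using functor_Dom[OF proj assms] functor_Cod[OF proj assms] by (simp_all add: CPos_simps(3,4))

lemma ar [simp]:
  assumes "r \<in> Arr E"
  shows "x \<in> pts (Dom E r) \<Longrightarrow> ar r x \<in> pts (Cod E r)"
    and "\<lbrakk>x \<in> pts (Dom E r); y \<in> pts (Dom E r)\<rbrakk> \<Longrightarrow> le (Cod E r) (ar r x) (ar r y) \<longleftrightarrow> le (Dom E r) x y"
    and "\<lbrakk>x \<in> pts (Dom E r); y \<in> pts (Dom E r)\<rbrakk> \<Longrightarrow> ar r x = ar r y \<longleftrightarrow> x = y"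
  using CPos_app[of "FAr p r"] assms by auto

lemma ar_Comp [simp]:
  assumes "r \<in> Arr E" "s \<in> Arr E" "Cod E r = Dom E s" "x \<in> pts (Dom E r)"
  shows "ar (s \<cdot>\<^bsub>E\<^esub> r) x = ar s (ar r x)" "app (FAr p s \<cdot>\<^bsub>CPos\<^esub> FAr p r) x = ar s (ar r x)"
  using CPos_Comp_app[of x "FAr p r" "FAr p s"] assms by simp_all

lemma pts_poset: "e \<in> Obj E \<Longrightarrow> finite_poset (FOb p e)"
  using functor_Ob[OF proj, of e] by simp

lemma cart: "r \<in> Arr E \<Longrightarrow> cartesian E CPos p r"
  by (rule all_cartesian[OF rfib])

lemma E_monic:
  assumes "r \<in> Arr E" "w \<in> Arr E" "w' \<in> Arr E" "Dom E w = Dom E w'" "Cod E w = Dom E r"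
    "Cod E w' = Dom E r" and eq: "r \<cdot>\<^bsub>E\<^esub> w = r \<cdot>\<^bsub>E\<^esub> w'"
  shows "w = w'"
proof (rule cartesian_unique[OF cart[OF assms(1)] assms(2-6) _ eq])
  have "FAr p r \<cdot>\<^bsub>CPos\<^esub> FAr p w = FAr p r \<cdot>\<^bsub>CPos\<^esub> FAr p w'"
    using arg_cong[OF eq, of "FAr p"] assms(1-6) by simp
  then show "FAr p w = FAr p w'"
    by - (rule CPos_mono[of "FAr p r"]; use assms(1-6) in simp)
qed

lemma E_factor:
  assumes r: "r \<in> Arr E" and s: "s \<in> Arr E" "Cod E s = Cod E r"
    and im: "ar s ` pts (Dom E s) \<subseteq> ar r ` pts (Dom E r)"
  obtains w where "w \<in> Arr E" "Dom E w = Dom E s" "Cod E w = Dom E r" "r \<cdot>\<^bsub>E\<^esub> w = s"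
proof -
  obtain h where h: "h \<in> Arr CPos" "Dom CPos h = Dom CPos (FAr p s)" "Cod CPos h = Dom CPos (FAr p r)"
    "FAr p r \<cdot>\<^bsub>CPos\<^esub> h = FAr p s"
    by (rule CPos_factor[of "FAr p r" "FAr p s"]) (use r s im in simp_all)
  show ?thesis
    by (rule cartesian_fill[OF cart[OF r] s(1), of h]) (use h r s that in auto)
qed

lemma E_iso_image:
  assumes r: "is_iso E r"
  shows "ar r ` pts (Dom E r) = pts (Cod E r)"
  using CPos_iso_image[OF functor_iso[OF proj r]] is_iso_Arr[OF r] by simp

lemma ar_inv_arr [simp]:
  assumes r: "is_iso E r"
  shows "x \<in> pts (Dom E r) \<Longrightarrow> ar (inv_arr E r) (ar r x) = x"
    and "y \<in> pts (Cod E r) \<Longrightarrow> ar r (ar (inv_arr E r) y) = y"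
  using ar_Comp(1)[of r "inv_arr E r" x] ar_Comp(1)[of "inv_arr E r" r y] r is_iso_Arr[OF r] by auto

text \<open>Restricts the structure \<open>e\<close> to a convex set of its points, by lifting the
  inclusion of that set with the induced order. It is the source of the cartesian lifts in the comma
  category.\<close>

lemma E_restrict:
  assumes e: "e \<in> Obj E" and A: "A \<subseteq> pts e"
    and convex: "\<And>a b x. \<lbrakk>a \<in> A; b \<in> A; le e a x; le e x b\<rbrakk> \<Longrightarrow> x \<in> A"
  obtains r where "r \<in> Arr E" "Cod E r = e" "ar r ` pts (Dom E r) = A"
proof -
  note P = finite_posetD[OF pts_poset[OF e]]
  let ?K = "(A, snd (FOb p e) \<inter> A \<times> A)"
  have "trans (snd ?K)" by (rule transI) (use P(4) in auto)
  moreover have "antisym (snd ?K)" by (rule antisymI) (use P(5) in auto)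
  moreover have "\<forall>x \<in> A. (x, x) \<in> snd ?K" using A P(1) by auto
  ultimately have K: "finite_poset ?K" using finite_subset[OF A P(6)]
    by (auto simp: finite_poset_def partial_order_on_def preorder_on_def refl_on_def)
  let ?f = "(?K, FOb p e, \<lambda>a\<in>A. a)"
  have "convex_map ?K (FOb p e) (\<lambda>a\<in>A. a)"
    unfolding convex_map_iff[OF K pts_poset[OF e]]
  proof (intro conjI ballI impI)
    fix a b x assume "a \<in> fst ?K" "b \<in> fst ?K" "x \<in> pts e"
      "le e ((\<lambda>a\<in>A. a) a) x \<and> le e x ((\<lambda>a\<in>A. a) b)"
    then have "x \<in> A" using convex[of a b x] by simp
    then show "x \<in> (\<lambda>a\<in>A. a) ` fst ?K" by simp
  qed (use A in auto)
  then have f: "?f \<in> Arr CPos" using K pts_poset[OF e] by simp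
  obtain r where r: "cartesian E CPos p r" "FAr p r = ?f" "Cod E r = e"
    using rfib f e unfolding right_fibration_def cartesian_fibration_over_def is_cart_lift_def
    by (metis CPos_Dom_Cod(2))
  have r': "r \<in> Arr E" by (rule cartesian_Arr[OF r(1)])
  have "ar r ` pts (Dom E r) = A" using fst_FAr(1)[OF r', symmetric] r(2) by simp
  then show ?thesis using that[OF r' r(3)] by simp
qed

section \<open>The comma category\<close>

abbreviation K where "K \<equiv> comma (E, p)"
abbreviation \<pi> where "\<pi> \<equiv> comma_proj (E, p)"

lemma K_simps [simp]:
  "(e, k, \<phi>) \<in> Obj K \<longleftrightarrow> e \<in> Obj E \<and> \<phi> \<in> pts e \<rightarrow>\<^sub>E {1..k} \<and> (\<forall>x y. le e x y \<longrightarrow> \<phi> x \<le> \<phi> y)"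
  "((e, k, \<phi>), (e', k', \<phi>'), r, m) \<in> Arr K \<longleftrightarrow> (e, k, \<phi>) \<in> Obj K \<and> (e', k', \<phi>') \<in> Obj K \<and>
     r \<in> Arr E \<and> Dom E r = e \<and> Cod E r = e' \<and> m \<in> Arr Ords \<and> Dom Ords m = k \<and> Cod Ords m = k' \<and>
     (\<forall>x \<in> pts e. \<phi>' (ar r x) = app m (\<phi> x))"
  "Dom K (s, t, r, m) = s" "Cod K (s, t, r, m) = t"
  "Ident K (e, k, \<phi>) = ((e, k, \<phi>), (e, k, \<phi>), Ident E e, Ident Ords k)"
  "(s', t', r', m') \<cdot>\<^bsub>K\<^esub> (s, t, r, m) = (s, t', r' \<cdot>\<^bsub>E\<^esub> r, m' \<cdot>\<^bsub>Ords\<^esub> m)"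
  by (auto simp: comma_def Let_def monotone_to_ord_def hom_def)

lemma K_Obj_cases:
  assumes "x \<in> Obj K"
  obtains e k \<phi> where "x = (e, k, \<phi>)" "(e, k, \<phi>) \<in> Obj K"
  using assms by (metis prod_cases3)

lemma K_Arr_cases:
  assumes "u \<in> Arr K"
  obtains e k \<phi> e' k' \<phi>' r m where "u = ((e, k, \<phi>), (e', k', \<phi>'), r, m)"
    "((e, k, \<phi>), (e', k', \<phi>'), r, m) \<in> Arr K"
  using assms by (metis prod_cases3)

lemma proj_K [simp]:
  "(e, k, \<phi>) \<in> Obj K \<Longrightarrow> FOb \<pi> (e, k, \<phi>) = k" "(s, t, r, m) \<in> Arr K \<Longrightarrow> FAr \<pi> (s, t, r, m) = m"
  unfolding comma_proj_def by simp_all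

sublocale O: category Ords by (rule Ords_category)

lemma K_category: "category K"
proof
  fix f g assume fg: "f \<in> Arr K" "g \<in> Arr K" "Cod K f = Dom K g"
  obtain e k \<phi> e' k' \<phi>' r m where f: "f = ((e, k, \<phi>), (e', k', \<phi>'), r, m)"
    "((e, k, \<phi>), (e', k', \<phi>'), r, m) \<in> Arr K" using K_Arr_cases[OF fg(1)] by blast
  obtain e1 k1 \<phi>1 e2 k2 \<phi>2 r' m' where g: "g = ((e1, k1, \<phi>1), (e2, k2, \<phi>2), r', m')"
    "((e1, k1, \<phi>1), (e2, k2, \<phi>2), r', m') \<in> Arr K" using K_Arr_cases[OF fg(2)] by blast
  show "g \<cdot>\<^bsub>K\<^esub> f \<in> Arr K" using f g fg(3) by (auto simp: PiE_iff)
  show "Dom K (g \<cdot>\<^bsub>K\<^esub> f) = Dom K f" "Cod K (g \<cdot>\<^bsub>K\<^esub> f) = Cod K g" using f g by auto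
next
  fix f assume "f \<in> Arr K"
  then show "Dom K f \<in> Obj K" "Cod K f \<in> Obj K" "f \<cdot>\<^bsub>K\<^esub> Ident K (Dom K f) = f" "Ident K (Cod K f) \<cdot>\<^bsub>K\<^esub> f = f"
    by - (erule K_Arr_cases; simp)+
next
  fix x assume "x \<in> Obj K"
  then show "Ident K x \<in> Arr K" "Dom K (Ident K x) = x" "Cod K (Ident K x) = x"
    by - (erule K_Obj_cases; simp add: PiE_iff)+
next
  fix f g h assume fg: "f \<in> Arr K" "g \<in> Arr K" "h \<in> Arr K" "Cod K f = Dom K g" "Cod K g = Dom K h"
  obtain e k \<phi> e' k' \<phi>' r m where f: "f = ((e, k, \<phi>), (e', k', \<phi>'), r, m)"
    "((e, k, \<phi>), (e', k', \<phi>'), r, m) \<in> Arr K" using K_Arr_cases[OF fg(1)] by blast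
  obtain e1 k1 \<phi>1 e2 k2 \<phi>2 r' m' where g: "g = ((e1, k1, \<phi>1), (e2, k2, \<phi>2), r', m')"
    "((e1, k1, \<phi>1), (e2, k2, \<phi>2), r', m') \<in> Arr K" using K_Arr_cases[OF fg(2)] by blast
  obtain e3 k3 \<phi>3 e4 k4 \<phi>4 r'' m'' where h: "h = ((e3, k3, \<phi>3), (e4, k4, \<phi>4), r'', m'')"
    "((e3, k3, \<phi>3), (e4, k4, \<phi>4), r'', m'') \<in> Arr K" using K_Arr_cases[OF fg(3)] by blast
  show "(h \<cdot>\<^bsub>K\<^esub> g) \<cdot>\<^bsub>K\<^esub> f = h \<cdot>\<^bsub>K\<^esub> (g \<cdot>\<^bsub>K\<^esub> f)"
    using f g h fg(4,5) by simp
qed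

sublocale K: category K by (rule K_category)

lemma K_functor: "is_functor K Ords \<pi>"
proof (rule is_functorI)
  fix f g assume fg: "f \<in> Arr K" "g \<in> Arr K" "Cod K f = Dom K g"
  have "g \<cdot>\<^bsub>K\<^esub> f \<in> Arr K" using fg by simp
  moreover obtain s t r m where f: "f = (s, t, r, m)" by (metis prod_cases4)
  moreover obtain s' t' r' m' where g: "g = (s', t', r', m')" by (metis prod_cases4)
  ultimately show "FAr \<pi> (g \<cdot>\<^bsub>K\<^esub> f) = FAr \<pi> g \<cdot>\<^bsub>Ords\<^esub> FAr \<pi> f"
    using fg by (simp del: K_simps(2))
next
  fix f assume "f \<in> Arr K"
  then show "FAr \<pi> f \<in> Arr Ords \<and> Dom Ords (FAr \<pi> f) = FOb \<pi> (Dom K f) \<and> Cod Ords (FAr \<pi> f) = FOb \<pi> (Cod K f)"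
    by - (erule K_Arr_cases, simp)
next
  fix x assume x: "x \<in> Obj K"
  show "FAr \<pi> (Ident K x) = Ident Ords (FOb \<pi> x)"
    using K.Ident_in[OF x] by - (rule K_Obj_cases[OF x], simp del: K_simps(2))
qed (auto simp: K_category Ords_category comma_proj_def)

sublocale K: category_over K Ords \<pi> by unfold_locales (rule K_functor)

lemma K_iso_E:
  assumes "is_iso K (s, t, r, m)"
  shows "is_iso E r"
proof -
  note u = is_iso_Arr[OF assms]
  obtain s' t' r' m' where i: "inv_arr K (s, t, r, m) = (s', t', r', m')" by (metis prod_cases4)
  obtain e k \<phi> where s: "s = (e, k, \<phi>)" by (metis prod_cases3)
  obtain e' k' \<phi>' where t: "t = (e', k', \<phi>')" by (metis prod_cases3)
  have [simp]: "s' = t" "t' = s" using inv_arr(2,3)[OF assms] i by auto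
  show ?thesis
    using u inv_arr(1,4,5)[OF assms, unfolded i]
    by (intro X.is_isoI[where g = r']) (auto simp: s t)
qed

text \<open>The \<open>E\<close>-component of a filler must be the inverse of \<open>r\<close>
  followed by \<open>r2\<close>, and its ordinal component is prescribed as \<open>\<rho>\<close>.
  What needs an argument is that the two are compatible with the structure maps.\<close>

lemma K_cocartesianI:
  assumes u: "((e, k, \<phi>), (e', k', \<phi>'), r, m) \<in> Arr K" (is "?u \<in> _") and r: "is_iso E r"
  shows "cocartesian K Ords \<pi> ((e, k, \<phi>), (e', k', \<phi>'), r, m)"
  unfolding cocartesian_def
proof (intro conjI ballI impI)
  show "?u \<in> Arr K" by fact
  fix v \<rho> assume v: "v \<in> Arr K" and \<rho>: "\<rho> \<in> hom Ords (FOb \<pi> (Cod K ?u)) (FOb \<pi> (Cod K v))"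
    and d: "Dom K v = Dom K ?u \<and> \<rho> \<cdot>\<^bsub>Ords\<^esub> FAr \<pi> ?u = FAr \<pi> v"
  obtain e2 k2 \<phi>2 r2 m2 where v': "v = ((e, k, \<phi>), (e2, k2, \<phi>2), r2, m2)"
    using v d by - (erule K_Arr_cases, simp)
  note v = v[unfolded v']
  have "(e', k', \<phi>') \<in> Obj K" "(e2, k2, \<phi>2) \<in> Obj K" using u v by simp_all
  then have rho: "\<rho> \<in> Arr Ords" "Dom Ords \<rho> = k'" "Cod Ords \<rho> = k2" "\<rho> \<cdot>\<^bsub>Ords\<^esub> m = m2"
    using \<rho> d u v unfolding v' by (simp_all add: hom_def del: K_simps(1,2))
  have [simp]: "is_iso E r" by fact
  have u': "r \<in> Arr E" "Dom E r = e" "Cod E r = e'" "e \<in> Obj E" "e' \<in> Obj E" using u by auto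
  have v'': "r2 \<in> Arr E" "Dom E r2 = e" "Cod E r2 = e2" using v by auto
  let ?w = "((e', k', \<phi>'), (e2, k2, \<phi>2), r2 \<cdot>\<^bsub>E\<^esub> inv_arr E r, \<rho>)"
  have c: "\<phi>2 (ar (r2 \<cdot>\<^bsub>E\<^esub> inv_arr E r) y) = app \<rho> (\<phi>' y)" if y: "y \<in> pts e'" for y
  proof -
    \<comment> \<open>Every point of \<open>e'\<close> is the image under \<open>r\<close> of a
      point of \<open>e\<close>, and there the factorization of \<open>m2\<close> through
      \<open>m\<close> can be evaluated.\<close>
    define x where "x = ar (inv_arr E r) y"
    have x: "x \<in> pts e" "ar r x = y" using y u' ar(1)[of "inv_arr E r" y] by (auto simp: x_def)
    have "\<phi> x \<in> {1..k}" using u x by (auto simp: PiE_iff)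
    then have "app \<rho> (app m (\<phi> x)) = app m2 (\<phi> x)"
      using u by (subst rho(4)[symmetric]) auto
    then show ?thesis using x y u u' v v'' by (auto simp: x_def[symmetric])
  qed
  have w: "?w \<in> Arr K" using u v c rho u' by auto
  show "\<exists>!w. w \<in> hom K (Cod K ?u) (Cod K v) \<and> FAr \<pi> w = \<rho> \<and> w \<cdot>\<^bsub>K\<^esub> ?u = v"
  proof (rule ex1I[where a = ?w])
    show "?w \<in> hom K (Cod K ?u) (Cod K v) \<and> FAr \<pi> ?w = \<rho> \<and> ?w \<cdot>\<^bsub>K\<^esub> ?u = v"
      using w u' v'' rho unfolding v' by (simp add: hom_def del: K_simps(2))
    fix z assume z: "z \<in> hom K (Cod K ?u) (Cod K v) \<and> FAr \<pi> z = \<rho> \<and> z \<cdot>\<^bsub>K\<^esub> ?u = v"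
    then have "z \<in> Arr K" by (simp add: hom_def)
    then obtain r' where z': "z = ((e', k', \<phi>'), (e2, k2, \<phi>2), r', \<rho>)"
      using z unfolding v' by - (erule K_Arr_cases, auto simp: hom_def simp del: K_simps(2))
    have "r' \<in> Arr E" "Dom E r' = e'" "r' \<cdot>\<^bsub>E\<^esub> r = r2" using z unfolding z' v' by (auto simp: hom_def)
    then show "z = ?w" using u' unfolding z' by auto
  qed
qed

text \<open>Pushing forward postcomposes the structure map and leaves the object of \<open>E\<close>
  alone. This explicit lift serves as the standard of comparison.\<close>

lemma K_push:
  assumes x: "(e, k, \<phi>) \<in> Obj K" and m: "m \<in> Arr Ords" "Dom Ords m = k"
  defines "u \<equiv> ((e, k, \<phi>), (e, Cod Ords m, compose (pts e) (app m) \<phi>), Ident E e, m)"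
  shows "u \<in> Arr K" "cocartesian K Ords \<pi> u" "FAr \<pi> u = m"
proof -
  show u: "u \<in> Arr K"
    using x m Ords_app'[OF m(1)]  finite_posetD(2,3)[OF pts_poset[of e]]
    by (auto simp: u_def compose_def PiE_iff)
  show "cocartesian K Ords \<pi> u" unfolding u_def
    by (rule K_cocartesianI) (use u x in \<open>auto simp: u_def\<close>)
  show "FAr \<pi> u = m" using u by (simp add: u_def del: K_simps(2))
qed

text \<open>For the direction not covered by \<open>K_cocartesianI\<close>, compare with the lift of
  \<open>K_push\<close>: its \<open>E\<close>-component is an identity, so the
  \<open>E\<close>-component of the comparison isomorphism is \<open>r\<close> itself.\<close>

lemma K_cocartesian_iff:
  assumes u: "((e, k, \<phi>), (e', k', \<phi>'), r, m) \<in> Arr K" (is "?u \<in> _")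
  shows "cocartesian K Ords \<pi> ?u \<longleftrightarrow> is_iso E r"
proof
  assume c: "cocartesian K Ords \<pi> ?u"
  have x: "(e, k, \<phi>) \<in> Obj K" "m \<in> Arr Ords" "Dom Ords m = k" using u by auto
  note l = K_push[OF x]
  let ?l = "((e, k, \<phi>), (e, Cod Ords m, compose (pts e) (app m) \<phi>), Ident E e, m)"
  show "is_iso E r"
  proof (rule K.cocartesian_lift_iso[OF l(2) c])
    show "Dom K ?u = Dom K ?l" by simp
    show "FAr \<pi> ?u = FAr \<pi> ?l" using l(3) u by (simp del: K_simps(2))
    fix w assume w: "w \<in> Arr K" "is_iso K w" "Cod K w = Cod K ?u" "Dom K w = Cod K ?l" "w \<cdot>\<^bsub>K\<^esub> ?l = ?u"
    obtain s t r' m' where w': "w = (s, t, r', m')" by (metis prod_cases4)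
    have "is_iso E r'" using K_iso_E w(2) unfolding w' by blast
    moreover have "r' = r" using w(1,3,4,5) unfolding w' by auto
    ultimately show "is_iso E r" by simp
  qed
qed (rule K_cocartesianI[OF u])

text \<open>The image condition makes \<open>E_factor\<close> applicable, which produces the
  \<open>E\<close>-component \<open>q\<close> of a filler; since arrows of \<open>E\<close> are
  monic, \<open>q\<close> is the only choice.\<close>

lemma K_cartesianI:
  assumes u: "((e, k, \<phi>), (e', k', \<phi>'), r, m) \<in> Arr K" (is "?u \<in> _") and m: "convex_ord m"
    and im: "ar r ` pts e = {y \<in> pts e'. \<phi>' y \<in> app m ` {1..k}}"
  shows "cartesian K Ords \<pi> ((e, k, \<phi>), (e', k', \<phi>'), r, m)"
  unfolding cartesian_def
proof (intro conjI ballI impI)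
  show "?u \<in> Arr K" by fact
  fix v \<rho> assume v: "v \<in> Arr K" and \<rho>: "\<rho> \<in> hom Ords (FOb \<pi> (Dom K v)) (FOb \<pi> (Dom K ?u))"
    and d: "Cod K v = Cod K ?u \<and> FAr \<pi> ?u \<cdot>\<^bsub>Ords\<^esub> \<rho> = FAr \<pi> v"
  obtain e2 k2 \<phi>2 r2 m2 where v': "v = ((e2, k2, \<phi>2), (e', k', \<phi>'), r2, m2)"
    using v d by - (erule K_Arr_cases, simp)
  note v = v[unfolded v']
  have "(e, k, \<phi>) \<in> Obj K" "(e2, k2, \<phi>2) \<in> Obj K" using u v by simp_all
  then have rho: "\<rho> \<in> Arr Ords" "Dom Ords \<rho> = k2" "Cod Ords \<rho> = k" "m \<cdot>\<^bsub>Ords\<^esub> \<rho> = m2"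
    using \<rho> d u v unfolding v' by (simp_all add: hom_def del: K_simps(1,2))
  have u': "r \<in> Arr E" "Dom E r = e" "Cod E r = e'" "e \<in> Obj E" "e' \<in> Obj E"
      "m \<in> Arr Ords" "Dom Ords m = k" using u by auto
  have v'': "r2 \<in> Arr E" "Dom E r2 = e2" "Cod E r2 = e'" using v by auto
  have key: "\<phi>' (ar r2 x) = app m (app \<rho> (\<phi>2 x))" "app \<rho> (\<phi>2 x) \<in> {1..k}" "\<phi>2 x \<in> {1..k2}" if x: "x \<in> pts e2" for x
  proof -
    show i: "\<phi>2 x \<in> {1..k2}" using v x by (auto simp: PiE_iff)
    then show "app \<rho> (\<phi>2 x) \<in> {1..k}" using Ords_app'[OF rho(1), of "\<phi>2 x"] rho by simp
    have "app m2 (\<phi>2 x) = app m (app \<rho> (\<phi>2 x))" using i rho(1-3) by (subst rho(4)[symmetric]) auto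
    then show "\<phi>' (ar r2 x) = app m (app \<rho> (\<phi>2 x))" using v x by simp
  qed
  have sub: "ar r2 ` pts (Dom E r2) \<subseteq> ar r ` pts (Dom E r)"
    unfolding u'(2) v''(2) im using key ar(1)[OF v''(1)] v'' by auto
  obtain q where q: "q \<in> Arr E" "Dom E q = e2" "Cod E q = e" "r \<cdot>\<^bsub>E\<^esub> q = r2"
    by (rule E_factor[OF u'(1) v''(1) _ sub]) (use u' v'' in simp_all)
  let ?w = "((e2, k2, \<phi>2), (e, k, \<phi>), q, \<rho>)"
  \<comment> \<open>Only the images under \<open>m\<close> can be compared directly, through
    \<open>\<phi>'\<close>; convexity makes \<open>m\<close> injective, so it can be
    cancelled.\<close>
  have "\<phi> (ar q x) = app \<rho> (\<phi>2 x)" if x: "x \<in> pts e2" for x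
  proof -
    have i: "ar q x \<in> pts e" using ar(1)[OF q(1)] q x by simp
    have "app m (\<phi> (ar q x)) = \<phi>' (ar r (ar q x))" using u i by simp
    also have "\<dots> = \<phi>' (ar r2 x)" using ar_Comp(1)[of q r x] q u' x by simp
    also have "\<dots> = app m (app \<rho> (\<phi>2 x))" by (rule key(1)[OF x])
    finally show ?thesis using convex_ord_inj'(1)[OF u'(6) m] key(2)[OF x] u i u'(7) by (auto simp: PiE_iff)
  qed
  then have w: "?w \<in> Arr K" using u v q rho by auto
  show "\<exists>!w. w \<in> hom K (Dom K v) (Dom K ?u) \<and> FAr \<pi> w = \<rho> \<and> ?u \<cdot>\<^bsub>K\<^esub> w = v"
  proof (rule ex1I[where a = ?w])
    show "?w \<in> hom K (Dom K v) (Dom K ?u) \<and> FAr \<pi> ?w = \<rho> \<and> ?u \<cdot>\<^bsub>K\<^esub> ?w = v"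
      using w q rho unfolding v' by (simp add: hom_def del: K_simps(2))
    fix z assume z: "z \<in> hom K (Dom K v) (Dom K ?u) \<and> FAr \<pi> z = \<rho> \<and> ?u \<cdot>\<^bsub>K\<^esub> z = v"
    then have "z \<in> Arr K" by (simp add: hom_def)
    then obtain r' where z': "z = ((e2, k2, \<phi>2), (e, k, \<phi>), r', \<rho>)"
      using z unfolding v' by - (erule K_Arr_cases, auto simp: hom_def simp del: K_simps(2))
    have "r' \<in> Arr E" "Dom E r' = e2" "Cod E r' = e" "r \<cdot>\<^bsub>E\<^esub> r' = r2" using z unfolding z' v' by (auto simp: hom_def)
    then have "r' = q" using u' q by - (rule E_monic[OF u'(1)]; simp)
    then show "z = ?w" unfolding z' by simp
  qed
qed

text \<open>Pulling back along a convex \<open>m\<close> restricts to the points whose value lies in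
  the image of \<open>m\<close>. They form a convex subset because \<open>\<phi>'\<close> is
  monotone and that image is an interval. The values are then read back through the injective
  \<open>m\<close>.\<close>

lemma K_pull:
  assumes x: "(e', k', \<phi>') \<in> Obj K" and m: "m \<in> Arr Ords" "Cod Ords m = k'" "convex_ord m"
  obtains e \<phi> r where "((e, Dom Ords m, \<phi>), (e', k', \<phi>'), r, m) \<in> Arr K"
    "ar r ` pts e = {y \<in> pts e'. \<phi>' y \<in> app m ` {1..Dom Ords m}}"
    "cartesian K Ords \<pi> ((e, Dom Ords m, \<phi>), (e', k', \<phi>'), r, m)"
proof -
  let ?k = "Dom Ords m" and ?A = "{y \<in> pts e'. \<phi>' y \<in> app m ` {1..Dom Ords m}}"
  have e': "e' \<in> Obj E" using x by simp
  note P = finite_posetD[OF pts_poset[OF e']]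
  obtain r where r: "r \<in> Arr E" "Cod E r = e'" "ar r ` pts (Dom E r) = ?A"
  proof (rule E_restrict[OF e', of ?A])
    fix a b y assume "a \<in> ?A" "b \<in> ?A" and ay: "le e' a y" "le e' y b"
    then obtain i j where "i \<in> {1..?k}" "\<phi>' a = app m i" "j \<in> {1..?k}" "\<phi>' b = app m j" by auto
    moreover have "\<phi>' a \<le> \<phi>' y" "\<phi>' y \<le> \<phi>' b" using x ay by auto
    ultimately have "\<phi>' y \<in> app m ` {1..?k}" using convex_ord_between'[OF m(1,3), of i j "\<phi>' y"] by simp
    then show "y \<in> ?A" using P(2) ay by blast
  qed auto
  define e where "e = Dom E r"
  have e: "e \<in> Obj E" using r by (simp add: e_def)
  note Q = finite_posetD[OF pts_poset[OF e]]
  define \<phi> where "\<phi> = (\<lambda>x\<in>pts e. inv_into {1..?k} (app m) (\<phi>' (ar r x)))"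
  have phi: "\<phi> x \<in> {1..?k}" "app m (\<phi> x) = \<phi>' (ar r x)" if "x \<in> pts e" for x
  proof -
    have "\<phi>' (ar r x) \<in> app m ` {1..?k}" using r(3) that e_def by blast
    then show "\<phi> x \<in> {1..?k}" "app m (\<phi> x) = \<phi>' (ar r x)"
      using inv_into_into[of "\<phi>' (ar r x)" "app m" "{1..?k}"] f_inv_into_f[of "\<phi>' (ar r x)" "app m" "{1..?k}"] that
      by (auto simp: \<phi>_def)
  qed
  have "\<phi> x \<le> \<phi> y" if xy: "le e x y" for x y
  proof -
    have i: "x \<in> pts e" "y \<in> pts e" using Q(2,3)[OF xy] by auto
    have "le e' (ar r x) (ar r y)" using ar(2)[OF r(1), of x y] i xy r(2) by (simp add: e_def)
    then have "app m (\<phi> x) \<le> app m (\<phi> y)" using x phi(2)[OF i(1)] phi(2)[OF i(2)] by simp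
    then show ?thesis using convex_ord_inj'(2)[OF m(1,3) phi(1)[OF i(1)] phi(1)[OF i(2)]] by simp
  qed
  then have u: "((e, ?k, \<phi>), (e', k', \<phi>'), r, m) \<in> Arr K"
    using e x r m phi by (auto simp: e_def[symmetric]) (auto simp: \<phi>_def)
  moreover have im: "ar r ` pts e = ?A" using r(3) by (simp add: e_def)
  ultimately show ?thesis using that K_cartesianI[OF u m(3) im] by blast
qed

text \<open>Compare with the lift from \<open>K_pull\<close>: an isomorphism of \<open>E\<close> is
  onto on points, so the two lifts have the same image.\<close>

lemma K_cartesian_iff:
  assumes u: "((e, k, \<phi>), (e', k', \<phi>'), r, m) \<in> Arr K" (is "?u \<in> _") and m: "convex_ord m"
  shows "cartesian K Ords \<pi> ?u \<longleftrightarrow> ar r ` pts e = {y \<in> pts e'. \<phi>' y \<in> app m ` {1..k}}"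
proof
  assume c: "cartesian K Ords \<pi> ?u"
  have u': "(e', k', \<phi>') \<in> Obj K" "m \<in> Arr Ords" "Cod Ords m = k'" "Dom Ords m = k" using u by auto
  obtain e1 \<phi>1 r1 where l: "((e1, Dom Ords m, \<phi>1), (e', k', \<phi>'), r1, m) \<in> Arr K"
    "ar r1 ` pts e1 = {y \<in> pts e'. \<phi>' y \<in> app m ` {1..Dom Ords m}}"
    "cartesian K Ords \<pi> ((e1, Dom Ords m, \<phi>1), (e', k', \<phi>'), r1, m)"
    using K_pull[OF u'(1-3) m] by blast
  let ?l = "((e1, Dom Ords m, \<phi>1), (e', k', \<phi>'), r1, m)"
  show "ar r ` pts e = {y \<in> pts e'. \<phi>' y \<in> app m ` {1..k}}"
  proof (rule K.cartesian_lift_iso[OF l(3) c])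
    show "Cod K ?u = Cod K ?l" by simp
    show "FAr \<pi> ?u = FAr \<pi> ?l" using l(1) u by (simp del: K_simps(2))
    fix w assume w: "w \<in> Arr K" "is_iso K w" "Dom K w = Dom K ?u" "Cod K w = Dom K ?l" "?l \<cdot>\<^bsub>K\<^esub> w = ?u"
    obtain s t r' m' where w': "w = (s, t, r', m')" by (metis prod_cases4)
    have r': "is_iso E r'" using K_iso_E w(2) unfolding w' by blast
    have d: "r' \<in> Arr E" "Dom E r' = e" "Cod E r' = e1" "r1 \<cdot>\<^bsub>E\<^esub> r' = r" using w(1,3,4,5) unfolding w' by auto
    have "ar r ` pts e = ar r1 ` (ar r' ` pts e)"
      unfolding image_image using d l(1) by (intro image_cong) auto
    also have "ar r' ` pts e = pts e1" using E_iso_image[OF r'] d by simp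
    finally show "ar r ` pts e = {y \<in> pts e'. \<phi>' y \<in> app m ` {1..k}}" using l(2) u'(4) by simp
  qed
qed (rule K_cartesianI[OF u m])

end

section \<open>The comma category is an iesq sesquicartesian fibration\<close>

text \<open>Arrows out of the one-element ordinal are points, so the universal property describes
  the points of the pullback corner as pairs of points with equal image. The second conclusion is
  the pointwise consequence on which the Beck-Chevalley factorization rests.\<close>

lemma Ords_pullback_convex:
  assumes pb: "pullback_square Ords \<tau> \<sigma>' \<sigma> \<tau>'" and c: "convex_ord \<tau>"
  shows "convex_ord \<tau>'"
    and "\<And>i. \<lbrakk>i \<in> {1..Dom Ords \<sigma>}; app \<sigma> i \<in> app \<tau> ` {1..Dom Ords \<tau>}\<rbrakk> \<Longrightarrow> i \<in> app \<tau>' ` {1..Dom Ords \<tau>'}"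
proof -
  interpret category Ords by (rule Ords_category)
  have A: "\<tau> \<in> Arr Ords" "\<sigma>' \<in> Arr Ords" "\<sigma> \<in> Arr Ords" "\<tau>' \<in> Arr Ords"
    and d: "Dom Ords \<sigma>' = Dom Ords \<tau>'" "Cod Ords \<sigma>' = Dom Ords \<tau>" "Cod Ords \<tau>' = Dom Ords \<sigma>" "Cod Ords \<tau> = Cod Ords \<sigma>"
    and sq: "\<tau> \<cdot>\<^bsub>Ords\<^esub> \<sigma>' = \<sigma> \<cdot>\<^bsub>Ords\<^esub> \<tau>'"
    using pb by (auto simp: pullback_square_def)
  have univ: "\<exists>!w. w \<in> hom Ords (Dom Ords u) (Dom Ords \<sigma>') \<and> \<sigma>' \<cdot>\<^bsub>Ords\<^esub> w = u \<and> \<tau>' \<cdot>\<^bsub>Ords\<^esub> w = v"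
    if "u \<in> Arr Ords" "v \<in> Arr Ords" "Dom Ords u = Dom Ords v" "Cod Ords u = Dom Ords \<tau>"
      "Cod Ords v = Dom Ords \<sigma>" "\<tau> \<cdot>\<^bsub>Ords\<^esub> u = \<sigma> \<cdot>\<^bsub>Ords\<^esub> v" for u v
    using pb that unfolding pullback_square_def by blast
  \<comment> \<open>The arrow from the ordinal 1 that picks out the point \<open>i\<close> of
    \<open>n\<close>.\<close>
  define pt where "pt n i = (1::nat, n::nat, \<lambda>x\<in>{1..1::nat}. i)" for n i :: nat
  have pt: "pt n i \<in> Arr Ords" "Dom Ords (pt n i) = 1" "Cod Ords (pt n i) = n" "app (pt n i) 1 = i" if "i \<in> {1..n}" for n i
    using that by (auto simp: pt_def mono_on_def)
  have pt_comp: "m \<cdot>\<^bsub>Ords\<^esub> pt (Dom Ords m) i = pt (Cod Ords m) (app m i)" if "m \<in> Arr Ords" "i \<in> {1..Dom Ords m}" for m i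
  proof -
    have i: "app m i \<in> {1..Cod Ords m}" by (rule Ords_app'(1)[OF that])
    show ?thesis using that pt[OF that(2)] pt[OF i] by (intro Ords_eqI') auto
  qed
  have elt: "app \<tau> (app \<sigma>' x) = app \<sigma> (app \<tau>' x)" if "x \<in> {1..Dom Ords \<tau>'}" for x
    using Ords_app_Comp[of x \<sigma>' \<tau>] Ords_app_Comp[of x \<tau>' \<sigma>] sq d that by simp
  \<comment> \<open>Points \<open>i\<close> and \<open>j\<close> with equal image are two arrows
    from the ordinal 1 forming a cone over the square, hence come from one point of the
    corner.\<close>
  have lift: "\<exists>x \<in> {1..Dom Ords \<tau>'}. app \<tau>' x = i \<and> app \<sigma>' x = j"
    if ij: "i \<in> {1..Dom Ords \<sigma>}" "j \<in> {1..Dom Ords \<tau>}" "app \<sigma> i = app \<tau> j" for i j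
  proof -
    have "\<tau> \<cdot>\<^bsub>Ords\<^esub> pt (Dom Ords \<tau>) j = \<sigma> \<cdot>\<^bsub>Ords\<^esub> pt (Dom Ords \<sigma>) i"
      using pt_comp[OF A(1) ij(2)] pt_comp[OF A(3) ij(1)] ij d by simp
    then obtain w where w: "w \<in> hom Ords 1 (Dom Ords \<sigma>')" "\<sigma>' \<cdot>\<^bsub>Ords\<^esub> w = pt (Dom Ords \<tau>) j" "\<tau>' \<cdot>\<^bsub>Ords\<^esub> w = pt (Dom Ords \<sigma>) i"
      using univ[OF pt(1)[OF ij(2)] pt(1)[OF ij(1)]] pt(2,3)[OF ij(1)] pt(2,3)[OF ij(2)] by auto
    have "app w 1 \<in> {1..Dom Ords \<tau>'}" using w(1) Ords_app'(1)[of w 1] d by (simp add: hom_def)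
    moreover have "app \<sigma>' (app w 1) = j" "app \<tau>' (app w 1) = i"
      using Ords_app_Comp[of 1 w \<sigma>'] Ords_app_Comp[of 1 w \<tau>'] w pt(4)[OF ij(1)] pt(4)[OF ij(2)]
      by (auto simp: hom_def)
    ultimately show ?thesis by blast
  qed
  \<comment> \<open>Two points of the corner with equal image under \<open>\<tau>'\<close> also
    agree under \<open>\<sigma>'\<close>, because \<open>\<tau>\<close> is injective. The uniqueness
    part of the universal property identifies them.\<close>
  have inj: "x = y" if xy: "x \<in> {1..Dom Ords \<tau>'}" "y \<in> {1..Dom Ords \<tau>'}" "app \<tau>' x = app \<tau>' y" for x y
  proof -
    have s: "app \<sigma>' x \<in> {1..Dom Ords \<tau>}" "app \<sigma>' y \<in> {1..Dom Ords \<tau>}"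
      using Ords_app'(1)[OF A(2), of x] Ords_app'(1)[OF A(2), of y] xy d by auto
    have "app \<sigma>' x = app \<sigma>' y"
      using convex_ord_inj'(1)[OF A(1) c s] elt[OF xy(1)] elt[OF xy(2)] xy(3) by simp
    then have *: "\<sigma>' \<cdot>\<^bsub>Ords\<^esub> pt (Dom Ords \<tau>') x = \<sigma>' \<cdot>\<^bsub>Ords\<^esub> pt (Dom Ords \<tau>') y"
      "\<tau>' \<cdot>\<^bsub>Ords\<^esub> pt (Dom Ords \<tau>') x = \<tau>' \<cdot>\<^bsub>Ords\<^esub> pt (Dom Ords \<tau>') y"
      using pt_comp[OF A(2), of x] pt_comp[OF A(2), of y] pt_comp[OF A(4), of x] pt_comp[OF A(4), of y] xy d by auto
    have p: "pt (Dom Ords \<tau>') z \<in> hom Ords 1 (Dom Ords \<sigma>')" if "z \<in> {1..Dom Ords \<tau>'}" for z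
      using pt[OF that] d by (auto simp: hom_def)
    have "\<tau> \<cdot>\<^bsub>Ords\<^esub> (\<sigma>' \<cdot>\<^bsub>Ords\<^esub> pt (Dom Ords \<tau>') x) = (\<tau> \<cdot>\<^bsub>Ords\<^esub> \<sigma>') \<cdot>\<^bsub>Ords\<^esub> pt (Dom Ords \<tau>') x"
      using A d pt[OF xy(1)] by simp
    also have "\<dots> = \<sigma> \<cdot>\<^bsub>Ords\<^esub> (\<tau>' \<cdot>\<^bsub>Ords\<^esub> pt (Dom Ords \<tau>') x)" unfolding sq using A d pt[OF xy(1)] by simp
    finally have "\<exists>!w. w \<in> hom Ords (Dom Ords (\<sigma>' \<cdot>\<^bsub>Ords\<^esub> pt (Dom Ords \<tau>') x)) (Dom Ords \<sigma>') \<and>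
      \<sigma>' \<cdot>\<^bsub>Ords\<^esub> w = \<sigma>' \<cdot>\<^bsub>Ords\<^esub> pt (Dom Ords \<tau>') x \<and> \<tau>' \<cdot>\<^bsub>Ords\<^esub> w = \<tau>' \<cdot>\<^bsub>Ords\<^esub> pt (Dom Ords \<tau>') x"
      by - (rule univ; use A d pt[OF xy(1)] in simp)
    moreover have "Dom Ords (\<sigma>' \<cdot>\<^bsub>Ords\<^esub> pt (Dom Ords \<tau>') x) = 1" using A d pt[OF xy(1)] by simp
    ultimately have "pt (Dom Ords \<tau>') x = pt (Dom Ords \<tau>') y"
      using p[OF xy(1)] p[OF xy(2)] * by metis
    then show ?thesis using pt(4)[OF xy(1)] pt(4)[OF xy(2)] by simp
  qed
  show "i \<in> app \<tau>' ` {1..Dom Ords \<tau>'}" if "i \<in> {1..Dom Ords \<sigma>}" "app \<sigma> i \<in> app \<tau> ` {1..Dom Ords \<tau>}" for i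
    using lift[OF that(1)] that(2) by blast
  \<comment> \<open>A failure means that the value after \<open>app \<tau>' x\<close> is skipped.
    Its image under \<open>\<sigma>\<close> lies between two values of \<open>\<tau>\<close>, hence
    in the image of \<open>\<tau>\<close>, so the skipped value lifts to a point strictly between
    \<open>x\<close> and \<open>x + 1\<close>.\<close>
  have "app \<tau>' (x + 1) = app \<tau>' x + 1" if x: "x \<in> {1..Dom Ords \<tau>'}" "x + 1 \<in> {1..Dom Ords \<tau>'}" for x
  proof (rule ccontr)
    let ?i = "app \<tau>' x + 1"
    assume "app \<tau>' (x + 1) \<noteq> ?i"
    moreover have "app \<tau>' x \<le> app \<tau>' (x + 1)" by (rule Ords_app'(2)[OF A(4) x]) simp
    moreover have "app \<tau>' x \<noteq> app \<tau>' (x + 1)" using inj[OF x] by auto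
    ultimately have i: "app \<tau>' x \<le> ?i" "?i < app \<tau>' (x + 1)" by auto
    have t: "app \<tau>' x \<in> {1..Dom Ords \<sigma>}" "app \<tau>' (x + 1) \<in> {1..Dom Ords \<sigma>}"
      using Ords_app'(1)[OF A(4)] x d by auto
    then have i': "?i \<in> {1..Dom Ords \<sigma>}" using i by auto
    have "app \<sigma> (app \<tau>' x) \<le> app \<sigma> ?i" "app \<sigma> ?i \<le> app \<sigma> (app \<tau>' (x + 1))"
      using Ords_app'(2)[OF A(3)] t i' i by auto
    then have "app \<tau> (app \<sigma>' x) \<le> app \<sigma> ?i" "app \<sigma> ?i \<le> app \<tau> (app \<sigma>' (x + 1))"
      using elt x by auto
    moreover have "app \<sigma>' x \<in> {1..Dom Ords \<tau>}" "app \<sigma>' (x + 1) \<in> {1..Dom Ords \<tau>}"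
      using Ords_app'(1)[OF A(2)] x d by auto
    ultimately have "app \<sigma> ?i \<in> app \<tau> ` {1..Dom Ords \<tau>}" using convex_ord_between'[OF A(1) c] by blast
    then obtain j where "j \<in> {1..Dom Ords \<tau>}" "app \<sigma> ?i = app \<tau> j" by blast
    from lift[OF i' this] obtain z where z: "z \<in> {1..Dom Ords \<tau>'}" "app \<tau>' z = ?i" by blast
    have "\<not> z \<le> x" using Ords_app'(2)[OF A(4) z(1) x(1)] z(2) by auto
    moreover have "\<not> x + 1 \<le> z" using Ords_app'(2)[OF A(4) x(2) z(1)] z(2) i by auto
    ultimately show False by simp
  qed
  then show "convex_ord \<tau>'" by (cases \<tau>') (auto simp: convex_ord_def)
qed

section \<open>Identity-extension squares of ordinals\<close>

lemma ord_incl: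
  "ord_incl a n b \<in> Arr Ords" "Dom Ords (ord_incl a n b) = n" "Cod Ords (ord_incl a n b) = a + n + b"
  "convex_ord (ord_incl a n b)" "x \<in> {1..n} \<Longrightarrow> app (ord_incl a n b) x = a + x"
  "y \<in> app (ord_incl a n b) ` {1..n} \<longleftrightarrow> a < y \<and> y \<le> a + n"
proof -
  show "ord_incl a n b \<in> Arr Ords" "Dom Ords (ord_incl a n b) = n" "Cod Ords (ord_incl a n b) = a + n + b"
  "convex_ord (ord_incl a n b)"
    by (auto simp: ord_incl_def mono_on_def convex_ord_def)
  have *: "app (ord_incl a n b) x = a + x" if "x \<in> {1..n}" for x
    using that by (simp add: ord_incl_def)
  then show "x \<in> {1..n} \<Longrightarrow> app (ord_incl a n b) x = a + x" by simp
  show "y \<in> app (ord_incl a n b) ` {1..n} \<longleftrightarrow> a < y \<and> y \<le> a + n"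
  proof
    assume "a < y \<and> y \<le> a + n"
    then have "y - a \<in> {1..n}" "y = a + (y - a)" by auto
    then show "y \<in> app (ord_incl a n b) ` {1..n}" using *[of "y - a"] by (metis image_eqI)
  qed (use * in auto)
qed

lemma ord_extend:
  fixes a b :: nat
  assumes f: "f \<in> Arr Ords" "Dom Ords f = n" "Cod Ords f = k"
  defines "g \<equiv> ord_extend a b f"
  shows "g \<in> Arr Ords" "Dom Ords g = a + n + b" "Cod Ords g = a + k + b"
    and "\<And>x. \<lbrakk>x \<in> {1..a + n + b}; x \<le> a\<rbrakk> \<Longrightarrow> app g x = x"
    and "\<And>x. x \<in> {1..n} \<Longrightarrow> app g (a + x) = a + app f x"
    and "\<And>x. \<lbrakk>x \<in> {1..a + n + b}; a + n < x\<rbrakk> \<Longrightarrow> app g x = x - n + k"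
    and "ord_incl a k b \<cdot>\<^bsub>Ords\<^esub> f = g \<cdot>\<^bsub>Ords\<^esub> ord_incl a n b"
proof -
  obtain f' where f': "f = (n, k, f')" using f by (cases f) auto
  have r: "f' x \<in> {1..k}" if "x \<in> {1..n}" for x using Ords_app'(1)[OF f(1), of x] that by (simp add: f')
  have r': "Suc 0 \<le> f' x \<and> f' x \<le> k" if "Suc 0 \<le> x" "x \<le> n" for x using r[of x] that by simp
  have m: "f' x \<le> f' y" if "Suc 0 \<le> x" "x \<le> y" "y \<le> n" for x y
    using Ords_app'(2)[OF f(1), of x y] that by (simp add: f')
  have g: "g = (a + n + b, a + k + b, \<lambda>x\<in>{1..a + n + b}. if x \<le> a then x else if x \<le> a + n then a + f' (x - a) else x - n + k)"
    by (simp add: g_def ord_extend_def f')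
  show "Dom Ords g = a + n + b" "Cod Ords g = a + k + b"
    "\<And>x. \<lbrakk>x \<in> {1..a + n + b}; x \<le> a\<rbrakk> \<Longrightarrow> app g x = x"
    and mid: "\<And>x. x \<in> {1..n} \<Longrightarrow> app g (a + x) = a + app f x"
    "\<And>x. \<lbrakk>x \<in> {1..a + n + b}; a + n < x\<rbrakk> \<Longrightarrow> app g x = x - n + k"
    by (auto simp: g f')
  show gA: "g \<in> Arr Ords" unfolding g Ords_simps(2)
  proof (intro conjI mono_onI)
    show "(\<lambda>x\<in>{1..a + n + b}. if x \<le> a then x else if x \<le> a + n then a + f' (x - a) else x - n + k)
      \<in> {1..a + n + b} \<rightarrow>\<^sub>E {1..a + k + b}"
      unfolding restrict_PiE_iff
    proof
      fix x assume x: "x \<in> {1..a + n + b}"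
      show "(if x \<le> a then x else if x \<le> a + n then a + f' (x - a) else x - n + k) \<in> {1..a + k + b}"
      proof (cases "x \<le> a")
        case False
        then show ?thesis
        proof (cases "x \<le> a + n")
          case True
          then have "Suc 0 \<le> x - a" "x - a \<le> n" using False by auto
          from r'[OF this] have "1 \<le> a + f' (x - a)" "f' (x - a) \<le> k" by linarith+
          then show ?thesis using False True by simp
        next
          case hi: False
          then have "1 \<le> x - n + k" "x - n + k \<le> a + k + b" using x by auto
          then show ?thesis using False hi by simp
        qed
      qed (use x in simp)
    qed
    fix x y assume xy: "x \<in> {1..a + n + b}" "y \<in> {1..a + n + b}" "x \<le> y"
    \<comment> \<open>The step from the middle block to the top one: a middle value is at most
      \<open>a + k\<close>, and a top value exceeds \<open>a + k\<close>.\<close>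
    have "a + f' (x - a) \<le> y - n + k" if "a < x" "x \<le> a + n" "a + n < y"
    proof -
      have "f' (x - a) \<le> k" using r'[of "x - a"] that by auto
      moreover have "a \<le> y - n" using that by linarith
      ultimately show ?thesis by linarith
    qed
    then show "(\<lambda>x\<in>{1..a + n + b}. if x \<le> a then x else if x \<le> a + n then a + f' (x - a) else x - n + k) x
      \<le> (\<lambda>x\<in>{1..a + n + b}. if x \<le> a then x else if x \<le> a + n then a + f' (x - a) else x - n + k) y"
      using xy m[of "x - a" "y - a"] by auto
  qed
  interpret category Ords by (rule Ords_category)
  show "ord_incl a k b \<cdot>\<^bsub>Ords\<^esub> f = g \<cdot>\<^bsub>Ords\<^esub> ord_incl a n b"
    using f gA by (intro Ords_eqI') (auto simp: ord_incl f' g r')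
qed

text \<open>The two contributions of identity-extension squares. Only the middle block is sent to
  the middle block, which makes the cartesian arrows match; and a point outside it shares its value
  with no other point, which allows the extended map to be cancelled there.\<close>

lemma ord_extend_cases:
  assumes f: "f \<in> Arr Ords" "Dom Ords f = n" "Cod Ords f = k" and x: "x \<in> {1..a + n + b}"
  shows "app (ord_extend a b f) x \<in> app (ord_incl a k b) ` {1..k} \<longleftrightarrow> x \<in> app (ord_incl a n b) ` {1..n}"
    and "\<lbrakk>y \<in> {1..a + n + b}; x \<notin> app (ord_incl a n b) ` {1..n};
      app (ord_extend a b f) x = app (ord_extend a b f) y\<rbrakk> \<Longrightarrow> x = y"
proof -
  note g = ord_extend[where a = a and b = b, OF f]
  have mid: "a < app (ord_extend a b f) y \<and> app (ord_extend a b f) y \<le> a + k" if "a < y" "y \<le> a + n" for y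
  proof -
    have i: "y - a \<in> {1..n}" and y: "a + (y - a) = y" using that by auto
    have "app f (y - a) \<in> {1..k}" using Ords_app'(1)[OF f(1), of "y - a"] i f by simp
    then show ?thesis using g(5)[OF i] unfolding y by simp
  qed
  have lo: "app (ord_extend a b f) y = y" if "y \<in> {1..a + n + b}" "y \<le> a" for y
    using g(4) that by blast
  have hi: "app (ord_extend a b f) y = y - n + k" "a + k < app (ord_extend a b f) y"
    if "y \<in> {1..a + n + b}" "a + n < y" for y
  proof -
    show e: "app (ord_extend a b f) y = y - n + k" using g(6) that by blast
    show "a + k < app (ord_extend a b f) y" unfolding e using that(2) by linarith
  qed
  show "app (ord_extend a b f) x \<in> app (ord_incl a k b) ` {1..k} \<longleftrightarrow> x \<in> app (ord_incl a n b) ` {1..n}"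
    unfolding ord_incl(6)
  proof (cases "a < x \<and> x \<le> a + n")
    case False
    then consider "x \<le> a" | "a + n < x" by linarith
    then show "a < app (ord_extend a b f) x \<and> app (ord_extend a b f) x \<le> a + k \<longleftrightarrow> a < x \<and> x \<le> a + n"
      by cases (use lo[OF x] hi[OF x] in auto)
  qed (use mid[of x] in auto)
  assume y: "y \<in> {1..a + n + b}" and nx: "x \<notin> app (ord_incl a n b) ` {1..n}"
    and eq: "app (ord_extend a b f) x = app (ord_extend a b f) y"
  consider "y \<le> a" | "a < y" "y \<le> a + n" | "a + n < y" by linarith
  note y_cases = this
  from nx consider "x \<le> a" | "a + n < x" unfolding ord_incl(6) by linarith
  then show "x = y"
  proof cases
    case 1
    note gx = lo[OF x 1]
    from y_cases show ?thesis
    proof cases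
      case 1
      then show ?thesis using lo[OF y] gx eq by simp
    next
      case 2
      then show ?thesis using mid[of y] gx eq 1 by linarith
    next
      case 3
      then show ?thesis using hi(2)[OF y] gx eq 1 by linarith
    qed
  next
    case 2
    note gx = hi[OF x 2]
    from y_cases show ?thesis
    proof cases
      case 1
      then show ?thesis using lo[OF y] gx eq by linarith
    next
      case 2
      then show ?thesis using mid[of y] gx eq by linarith
    next
      case 3
      then have "x - n + k = y - n + k" using hi(1)[OF y] gx eq by linarith
      then show ?thesis using 2 3 by linarith
    qed
  qed
qed

context poset_fibration
begin

lemma K_cocart_lifts:
  assumes m: "m \<in> Arr Ords"
  shows "cocart_lifts K Ords \<pi> m"
proof (unfold_locales)
  fix x assume x: "x \<in> Obj K" "FOb \<pi> x = Dom Ords m"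
  obtain e k \<phi> where x': "x = (e, k, \<phi>)" "(e, k, \<phi>) \<in> Obj K" using K_Obj_cases[OF x(1)] by blast
  then have "Dom Ords m = k" using x(2) by (simp del: K_simps(1))
  from K_push[OF x'(2) m this] show "\<exists>u. is_cocart_lift K Ords \<pi> m x u"
    unfolding is_cocart_lift_def x' by (intro exI conjI) (assumption+, simp)
qed (rule m)

lemma K_cart_lifts:
  assumes m: "m \<in> Arr Ords" "convex_ord m"
  shows "cart_lifts K Ords \<pi> m"
proof (unfold_locales)
  fix x assume x: "x \<in> Obj K" "FOb \<pi> x = Cod Ords m"
  obtain e k \<phi> where x': "x = (e, k, \<phi>)" "(e, k, \<phi>) \<in> Obj K" using K_Obj_cases[OF x(1)] by blast
  have k: "Cod Ords m = k" using x(2) x' by (simp del: K_simps(1))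
  obtain e' \<phi>' r where u: "((e', Dom Ords m, \<phi>'), (e, k, \<phi>), r, m) \<in> Arr K"
    "cartesian K Ords \<pi> ((e', Dom Ords m, \<phi>'), (e, k, \<phi>), r, m)"
    by (rule K_pull[OF x'(2) m(1) k m(2)])
  have "is_cart_lift K Ords \<pi> m x ((e', Dom Ords m, \<phi>'), (e, k, \<phi>), r, m)"
    unfolding is_cart_lift_def x' using u by (simp del: K_simps(2))
  then show "\<exists>u. is_cart_lift K Ords \<pi> m x u" by blast
qed (rule m)

lemma K_bc_square:
  assumes "\<tau> \<in> Arr Ords" "\<sigma>' \<in> Arr Ords" "\<sigma> \<in> Arr Ords" "\<tau>' \<in> Arr Ords" "convex_ord \<tau>" "convex_ord \<tau>'"
    "Dom Ords \<sigma>' = Dom Ords \<tau>'" "Cod Ords \<sigma>' = Dom Ords \<tau>" "Cod Ords \<tau>' = Dom Ords \<sigma>"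
    "Cod Ords \<tau> = Cod Ords \<sigma>" "\<tau> \<cdot>\<^bsub>Ords\<^esub> \<sigma>' = \<sigma> \<cdot>\<^bsub>Ords\<^esub> \<tau>'"
  shows "bc_square K Ords \<pi> \<tau> \<sigma>' \<sigma> \<tau>'"
  using assms K_cocart_lifts K_cart_lifts K.category_over_axioms
  by (auto simp: bc_square_def bc_square_axioms_def)

lemma K_Arr_app:
  assumes "((e, k, \<phi>), (e', k', \<phi>'), r, m) \<in> Arr K"
  shows "x \<in> pts e \<Longrightarrow> \<phi>' (ar r x) = app m (\<phi> x)" "x \<in> pts e \<Longrightarrow> ar r x \<in> pts e'"
    "x \<in> pts e \<Longrightarrow> \<phi> x \<in> {1..k}" "y \<in> pts e' \<Longrightarrow> \<phi>' y \<in> {1..k'}"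
    "(e, k, \<phi>) \<in> Obj K" "(e', k', \<phi>') \<in> Obj K" "r \<in> Arr E" "Dom E r = e" "Cod E r = e'"
    "m \<in> Arr Ords" "Dom Ords m = k" "Cod Ords m = k'"
  using assms by (auto simp: PiE_iff)

text \<open>The factorization is explicit: push the small object \<open>e\<close> forward along
  \<open>\<sigma>'\<close> and continue by \<open>r\<close> followed by \<open>r2\<close>. By
  \<open>pre\<close>, points missed by \<open>\<tau>'\<close> are sent outside the image of
  \<open>\<tau>\<close>; this identifies the image of that composite with the preimage required of a
  cartesian arrow.\<close>

lemma K_factor:
  assumes sq: "bc_square K Ords \<pi> \<tau> \<sigma>' \<sigma> \<tau>'" and c: "convex_ord \<tau>" "convex_ord \<tau>'"
    and pre: "\<And>i. \<lbrakk>i \<in> {1..Dom Ords \<sigma>}; app \<sigma> i \<in> app \<tau> ` {1..Dom Ords \<tau>}\<rbrakk> \<Longrightarrow> i \<in> app \<tau>' ` {1..Dom Ords \<tau>'}"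
  shows "bc_square.push_pull_factor K Ords \<pi> \<tau> \<sigma>' \<sigma> \<tau>'"
proof -
  interpret sq: bc_square K Ords \<pi> \<tau> \<sigma>' \<sigma> \<tau>' by (rule sq)
  have elt: "app \<tau> (app \<sigma>' i) = app \<sigma> (app \<tau>' i)" if "i \<in> {1..Dom Ords \<tau>'}" for i
    using Ords_app_Comp[of i \<sigma>' \<tau>] Ords_app_Comp[of i \<tau>' \<sigma>] sq.square that by simp
  show ?thesis unfolding sq.push_pull_factor_def
  proof (intro allI impI)
    fix u v assume uv: "cartesian K Ords \<pi> u \<and> FAr \<pi> u = \<tau>' \<and> cocartesian K Ords \<pi> v \<and> FAr \<pi> v = \<sigma> \<and> Dom K v = Cod K u"
    then have A: "u \<in> Arr K" "v \<in> Arr K" using K.cartesian_Arr K.cocartesian_Arr by auto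
    obtain e k \<phi> e1 k1 \<phi>1 r where u': "u = ((e, k, \<phi>), (e1, k1, \<phi>1), r, \<tau>')"
      and u: "((e, k, \<phi>), (e1, k1, \<phi>1), r, \<tau>') \<in> Arr K"
      using A(1) uv by - (erule K_Arr_cases, simp del: K_simps(2))
    obtain e2 k2 \<phi>2 r2 where v': "v = ((e1, k1, \<phi>1), (e2, k2, \<phi>2), r2, \<sigma>)"
      and v: "((e1, k1, \<phi>1), (e2, k2, \<phi>2), r2, \<sigma>) \<in> Arr K"
      using A(2) uv u' by - (erule K_Arr_cases, simp del: K_simps(2))
    have r2: "is_iso E r2" using uv K_cocartesian_iff[OF v] by (simp add: v')
    have im: "ar r ` pts e = {y \<in> pts e1. \<phi>1 y \<in> app \<tau>' ` {1..k}}" using uv K_cartesian_iff[OF u c(2)] by (simp add: u')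
    note U = K_Arr_app[OF u] and V = K_Arr_app[OF v]
    have d: "Dom Ords \<sigma>' = k" using U(11) by simp
    let ?\<phi> = "compose (pts e) (app \<sigma>') \<phi>"
    let ?v = "((e, k, \<phi>), (e, Cod Ords \<sigma>', ?\<phi>), Ident E e, \<sigma>')"
    let ?u = "((e, Cod Ords \<sigma>', ?\<phi>), (e2, k2, \<phi>2), r2 \<cdot>\<^bsub>E\<^esub> r, \<tau>)"
    note v0 = K_push[OF U(5) sq.base_Arrs(4) d]
    have phi: "\<phi>2 (ar r2 (ar r x)) = app \<tau> (app \<sigma>' (\<phi> x))" if x: "x \<in> pts e" for x
      using V(1)[OF U(2)[OF x]] U(1)[OF x] elt[of "\<phi> x"] U(3)[OF x] U(11) by simp
    have u0: "?u \<in> Arr K" using K_Arr_app(6)[OF v0(1)] V U phi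
      by (simp del: K_simps(1)) (simp add: compose_def)
    have "ar (r2 \<cdot>\<^bsub>E\<^esub> r) ` pts e = ar r2 ` (ar r ` pts e)"
      unfolding image_image using U V by (intro image_cong) auto
    also have "\<dots> = {z \<in> pts e2. \<phi>2 z \<in> app \<tau> ` {1..Dom Ords \<tau>}}" unfolding im
    proof (intro equalityI subsetI)
      fix z assume "z \<in> ar r2 ` {y \<in> pts e1. \<phi>1 y \<in> app \<tau>' ` {1..k}}"
      then obtain y i where yi: "z = ar r2 y" "y \<in> pts e1" "i \<in> {1..k}" "\<phi>1 y = app \<tau>' i" by auto
      have "app \<sigma>' i \<in> {1..Dom Ords \<tau>}" using Ords_app'(1)[OF sq.base_Arrs(4), of i] yi(3) d by simp
      moreover have "\<phi>2 z = app \<tau> (app \<sigma>' i)" using V(1)[OF yi(2)] yi elt[of i] U(11) by simp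
      ultimately show "z \<in> {z \<in> pts e2. \<phi>2 z \<in> app \<tau> ` {1..Dom Ords \<tau>}}" using V(2)[OF yi(2)] yi(1) by auto
    next
      \<comment> \<open>Since \<open>r2\<close> is invertible, every point of \<open>e2\<close>
        comes from \<open>e1\<close>, where \<open>pre\<close> decides whether its value lies in the
        image of \<open>\<tau>'\<close>.\<close>
      fix z assume z: "z \<in> {z \<in> pts e2. \<phi>2 z \<in> app \<tau> ` {1..Dom Ords \<tau>}}"
      then obtain y where y: "y \<in> pts e1" "z = ar r2 y" using E_iso_image[OF r2] V(8,9) by auto
      have "app \<sigma> (\<phi>1 y) \<in> app \<tau> ` {1..Dom Ords \<tau>}" using V(1)[OF y(1)] z y(2) by simp
      then have "\<phi>1 y \<in> app \<tau>' ` {1..Dom Ords \<tau>'}" using pre[of "\<phi>1 y"] V(3)[OF y(1)] V(11) by simp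
      then show "z \<in> ar r2 ` {y \<in> pts e1. \<phi>1 y \<in> app \<tau>' ` {1..k}}" using y U(11) by auto
    qed
    finally have u0c: "cartesian K Ords \<pi> ?u" using K_cartesianI[OF u0 c(1)] by simp
    show "\<exists>u0 v0. cartesian K Ords \<pi> u0 \<and> FAr \<pi> u0 = \<tau> \<and> cocartesian K Ords \<pi> v0 \<and> FAr \<pi> v0 = \<sigma>' \<and>
        Dom K v0 = Dom K u \<and> Cod K u0 = Cod K v \<and> Cod K v0 = Dom K u0 \<and> u0 \<cdot>\<^bsub>K\<^esub> v0 = v \<cdot>\<^bsub>K\<^esub> u"
      using u0 u0c v0 U V sq.square
      by (intro exI[where x = ?u] exI[where x = ?v]) (simp add: u' v' del: K_simps(1,2))
  qed
qed

lemma K_sesquicartesian: "sesquicartesian K \<pi>"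
  unfolding sesquicartesian_def cocartesian_fibration_def cartesian_fibration_over_def
proof (intro conjI ballI allI impI)
  show "\<exists>u. is_cocart_lift K Ords \<pi> \<sigma> x u" if "\<sigma> \<in> Arr Ords" "x \<in> Obj K" "FOb \<pi> x = Dom Ords \<sigma>" for \<sigma> x
    using cocart_lifts.lift_ex[OF K_cocart_lifts] that by blast
  show "\<exists>u. is_cart_lift K Ords \<pi> \<tau> x u" if "\<tau> \<in> Arr Ords" "x \<in> Obj K" "convex_ord \<tau> \<and> FOb \<pi> x = Cod Ords \<tau>" for \<tau> x
    using cart_lifts.lift_ex[OF K_cart_lifts] that by blast
  fix \<tau> \<sigma>' \<sigma> \<tau>' x
  assume pb: "pullback_square Ords \<tau> \<sigma>' \<sigma> \<tau>' \<and> convex_ord \<tau>" and x: "x \<in> Obj (fibre K Ords \<pi> (Dom Ords \<sigma>))"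
  have c: "convex_ord \<tau>'" using Ords_pullback_convex pb by blast
  have sq: "bc_square K Ords \<pi> \<tau> \<sigma>' \<sigma> \<tau>'"
    by (rule K_bc_square) (use pb c in \<open>auto simp: pullback_square_def\<close>)
  interpret sq: bc_square K Ords \<pi> \<tau> \<sigma>' \<sigma> \<tau>' by (rule sq)
  have "sq.push_pull_factor" using K_factor[OF sq _ c] Ords_pullback_convex(2) pb by blast
  then have "is_iso K (sq.bc x)" using x by (intro sq.bc_iso) auto
  then show "is_iso (fibre K Ords \<pi> (Dom Ords \<tau>)) (sq.bc x)"
    using x sq.bc(4)[of x] by (simp add: K.fibre_iso)
qed (rule K_functor)+

text \<open>A cocartesian arrow over the extended map has invertible \<open>E\<close>-component, so
  the object of \<open>E\<close> over \<open>a + n + b\<close> is known from its pushforward. Both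
  halves of the proof ask whether maps into \<open>a + n + b\<close> can be recovered from their
  restriction to the middle block together with their composite with the extended map.\<close>

lemma K_iesq: "iesq K \<pi>"
  unfolding iesq_def Let_def
proof (intro allI ballI)
  fix a b n k f assume "f \<in> hom Ords n k"
  then have f: "f \<in> Arr Ords" "Dom Ords f = n" "Cod Ords f = k" by (auto simp: hom_def)
  let ?g = "ord_extend a b f" and ?j = "ord_incl a n b" and ?i = "ord_incl a k b"
  note g = ord_extend[where a = a and b = b, OF f] and j = ord_incl[where a = a and n = n and b = b] and i = ord_incl[where a = a and n = k and b = b]
  have sq: "bc_square K Ords \<pi> ?i f ?g ?j"
    by (rule K_bc_square) (use f g(1-3,7) i(1-4) j(1-4) in simp_all)
  interpret sq: bc_square K Ords \<pi> ?i f ?g ?j by (rule sq)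
  have gij: "app ?g x \<in> app ?i ` {1..k} \<longleftrightarrow> x \<in> app ?j ` {1..n}" if "x \<in> {1..a + n + b}" for x
    by (rule ord_extend_cases(1)[OF f that])
  have ginj: "x = y" if "x \<in> {1..a + n + b}" "y \<in> {1..a + n + b}" "x \<notin> app ?j ` {1..n}" "app ?g x = app ?g y" for x y
    by (rule ord_extend_cases(2)[OF f that])
  have "homotopy_pullback (fibre K Ords \<pi> (Dom Ords ?g)) (fibre K Ords \<pi> (Dom Ords ?j)) (fibre K Ords \<pi> (Cod Ords ?g))
    (fibre K Ords \<pi> (Dom Ords ?i)) (pullback K Ords \<pi> ?j) (pushforward K Ords \<pi> ?g) (pushforward K Ords \<pi> f)
    (pullback K Ords \<pi> ?i) sq.bc"
  proof (rule sq.bc_homotopy_pullback)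
    show "sq.push_pull_factor" by (rule K_factor[OF sq]) (use i j g gij in simp_all)
  next
    fix c d c' d' u v
    assume c: "cartesian K Ords \<pi> c" "FAr \<pi> c = ?j" and d: "cocartesian K Ords \<pi> d" "FAr \<pi> d = ?g"
      and cd: "Dom K d = Cod K c" and c': "cartesian K Ords \<pi> c'" "FAr \<pi> c' = ?j"
      and d': "cocartesian K Ords \<pi> d'" "FAr \<pi> d' = ?g" and cd': "Dom K d' = Cod K c'"
      and u: "u \<in> Arr K" "FAr \<pi> u = Ident Ords (Dom Ords ?j)" and cu: "Dom K u = Dom K c" "Cod K u = Dom K c'"
      and v: "v \<in> Arr K" "FAr \<pi> v = Ident Ords (Cod Ords ?g)" and dv: "Dom K v = Cod K d" "Cod K v = Cod K d'"
      and eq: "d' \<cdot>\<^bsub>K\<^esub> (c' \<cdot>\<^bsub>K\<^esub> u) = v \<cdot>\<^bsub>K\<^esub> (d \<cdot>\<^bsub>K\<^esub> c)"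
    \<comment> \<open>Naming: \<open>rc\<close> embeds the restricted object \<open>e0\<close> into
      \<open>e\<close>, and \<open>rd\<close> is the isomorphism from \<open>e\<close> to its
      pushforward \<open>e2\<close>. Primes mark the second object, while \<open>ru\<close> and
      \<open>rv\<close> connect the restrictions and the pushforwards.\<close>
    obtain e0 k0 \<phi>0 e k1 \<phi> rc where C: "c = ((e0, k0, \<phi>0), (e, k1, \<phi>), rc, ?j)" "((e0, k0, \<phi>0), (e, k1, \<phi>), rc, ?j) \<in> Arr K"
      using K.cartesian_Arr[OF c(1)] c(2) by - (erule K_Arr_cases, simp del: K_simps(2))
    obtain e0' k0' \<phi>0' e' k1' \<phi>' rc' where C': "c' = ((e0', k0', \<phi>0'), (e', k1', \<phi>'), rc', ?j)" "((e0', k0', \<phi>0'), (e', k1', \<phi>'), rc', ?j) \<in> Arr K"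
      using K.cartesian_Arr[OF c'(1)] c'(2) by - (erule K_Arr_cases, simp del: K_simps(2))
    obtain e2 k2 \<phi>2 rd where D: "d = ((e, k1, \<phi>), (e2, k2, \<phi>2), rd, ?g)" "((e, k1, \<phi>), (e2, k2, \<phi>2), rd, ?g) \<in> Arr K"
      using K.cocartesian_Arr[OF d(1)] d(2) cd C by - (erule K_Arr_cases, simp del: K_simps(2))
    obtain e2' k2' \<phi>2' rd' where D': "d' = ((e', k1', \<phi>'), (e2', k2', \<phi>2'), rd', ?g)" "((e', k1', \<phi>'), (e2', k2', \<phi>2'), rd', ?g) \<in> Arr K"
      using K.cocartesian_Arr[OF d'(1)] d'(2) cd' C' by - (erule K_Arr_cases, simp del: K_simps(2))
    obtain ru where U: "u = ((e0, k0, \<phi>0), (e0', k0', \<phi>0'), ru, Ident Ords n)" "((e0, k0, \<phi>0), (e0', k0', \<phi>0'), ru, Ident Ords n) \<in> Arr K"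
      using u cu C C' j(2) by - (erule K_Arr_cases, simp del: K_simps(2))
    obtain rv where V: "v = ((e2, k2, \<phi>2), (e2', k2', \<phi>2'), rv, Ident Ords (a + k + b))" "((e2, k2, \<phi>2), (e2', k2', \<phi>2'), rv, Ident Ords (a + k + b)) \<in> Arr K"
      using v dv D D' g(3) by - (erule K_Arr_cases, simp del: K_simps(2))
    note cA = K_Arr_app[OF C(2)] and cA' = K_Arr_app[OF C'(2)] and dA = K_Arr_app[OF D(2)] and dA' = K_Arr_app[OF D'(2)]
      and uA = K_Arr_app[OF U(2)] and vA = K_Arr_app[OF V(2)]
    have N[simp]: "k0 = n" "k0' = n" "k1 = a + n + b" "k1' = a + n + b" "k2 = a + k + b" "k2' = a + k + b"
      using cA(11,12) cA'(11,12) dA(11,12) dA'(11,12) j(2,3) g(2,3) by simp_all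
    note A[simp] = cA(7-9) cA'(7-9) dA(7-9) dA'(7-9) uA(7-9) vA(7-9)
    have E[simp]: "e \<in> Obj E" "e' \<in> Obj E" using cA(6) cA'(6) by auto
    have [simp]: "is_iso E rd" "is_iso E rd'"
      using d d' K_cocartesian_iff[OF D(2)] K_cocartesian_iff[OF D'(2)] by (simp_all add: D(1) D'(1))
    have im: "ar rc ` pts e0 = {y \<in> pts e. \<phi> y \<in> app ?j ` {1..n}}"
      using c K_cartesian_iff[OF C(2) j(4)] by (simp add: C(1))
    \<comment> \<open>The \<open>E\<close>-component of the sought arrow is forced, since
      \<open>rd'\<close> is invertible.\<close>
    define s where "s = inv_arr E rd' \<cdot>\<^bsub>E\<^esub> (rv \<cdot>\<^bsub>E\<^esub> rd)"
    have s[simp]: "s \<in> Arr E" "Dom E s = e" "Cod E s = e'" by (simp_all add: s_def)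
    have s1: "rd' \<cdot>\<^bsub>E\<^esub> s = rv \<cdot>\<^bsub>E\<^esub> rd" by (simp add: s_def)
    have "rd' \<cdot>\<^bsub>E\<^esub> (rc' \<cdot>\<^bsub>E\<^esub> ru) = rv \<cdot>\<^bsub>E\<^esub> (rd \<cdot>\<^bsub>E\<^esub> rc)" using eq by (simp add: C D C' D' U V)
    also have "\<dots> = rd' \<cdot>\<^bsub>E\<^esub> (s \<cdot>\<^bsub>E\<^esub> rc)" by (rule X.Comp_reassoc[OF s1[symmetric], simplified X.Comp_assoc]) simp_all
    finally have s2: "rc' \<cdot>\<^bsub>E\<^esub> ru = s \<cdot>\<^bsub>E\<^esub> rc"
      by - (rule X.iso_cancel_left[of rd']; simp)
    \<comment> \<open>On points with value in the middle block the claim is inherited from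
      \<open>u\<close>, because the cartesian \<open>c\<close> reaches all of them. On the other
      points only the images under \<open>?g\<close> are known to agree, and there \<open>?g\<close>
      can be cancelled.\<close>
    have phi: "\<phi>' (ar s y) = \<phi> y" if y: "y \<in> pts e" for y
    proof (cases "\<phi> y \<in> app ?j ` {1..n}")
      case True
      then obtain y0 where y0: "y0 \<in> pts e0" "y = ar rc y0" using im y by blast
      have "ar s y = ar (s \<cdot>\<^bsub>E\<^esub> rc) y0" using y0 by simp
      also have "\<dots> = ar rc' (ar ru y0)" unfolding s2[symmetric] using y0 by simp
      finally have "\<phi>' (ar s y) = app ?j (\<phi>0' (ar ru y0))" using cA'(1)[OF uA(2)[OF y0(1)]] by simp
      also have "\<dots> = app ?j (\<phi>0 y0)" using uA(1,3)[OF y0(1)] by simp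
      also have "\<dots> = \<phi> y" using cA(1)[OF y0(1)] y0(2) by simp
      finally show ?thesis .
    next
      case False
      have sy: "ar s y \<in> pts e'" using ar(1)[OF s(1), of y] y by simp
      have "app ?g (\<phi>' (ar s y)) = \<phi>2' (ar rd' (ar s y))" using dA'(1)[OF sy] by simp
      also have "ar rd' (ar s y) = ar (rd' \<cdot>\<^bsub>E\<^esub> s) y" using y by simp
      also have "\<dots> = ar rv (ar rd y)" unfolding s1 using y by simp
      also have "\<phi>2' \<dots> = \<phi>2 (ar rd y)" using vA(1)[OF dA(2)[OF y]] dA(4)[OF dA(2)[OF y]] by simp
      also have "\<dots> = app ?g (\<phi> y)" by (rule dA(1)[OF y])
      finally show ?thesis using ginj[of "\<phi> y" "\<phi>' (ar s y)"] False dA(3)[OF y] dA'(3)[OF sy] by simp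
    qed
    let ?z = "((e, k1, \<phi>), (e', k1', \<phi>'), s, Ident Ords (a + n + b))"
    have z: "?z \<in> Arr K" using cA(6) cA'(6) phi cA(4) by simp
    show "\<exists>!z. z \<in> Arr K \<and> FAr \<pi> z = Ident Ords (Dom Ords ?g) \<and> Dom K z = Cod K c \<and> Cod K z = Cod K c' \<and>
         c' \<cdot>\<^bsub>K\<^esub> u = z \<cdot>\<^bsub>K\<^esub> c \<and> v \<cdot>\<^bsub>K\<^esub> d = d' \<cdot>\<^bsub>K\<^esub> z"
    proof (rule ex1I[where a = ?z])
      show "?z \<in> Arr K \<and> FAr \<pi> ?z = Ident Ords (Dom Ords ?g) \<and> Dom K ?z = Cod K c \<and> Cod K ?z = Cod K c' \<and>
         c' \<cdot>\<^bsub>K\<^esub> u = ?z \<cdot>\<^bsub>K\<^esub> c \<and> v \<cdot>\<^bsub>K\<^esub> d = d' \<cdot>\<^bsub>K\<^esub> ?z"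
        using z s1 s2 g(1-3) j(1-3) by (simp add: C(1) D(1) C'(1) D'(1) U(1) V(1) del: K_simps(1,2))
      fix y assume y: "y \<in> Arr K \<and> FAr \<pi> y = Ident Ords (Dom Ords ?g) \<and> Dom K y = Cod K c \<and> Cod K y = Cod K c' \<and>
         c' \<cdot>\<^bsub>K\<^esub> u = y \<cdot>\<^bsub>K\<^esub> c \<and> v \<cdot>\<^bsub>K\<^esub> d = d' \<cdot>\<^bsub>K\<^esub> y"
      obtain ry where Y: "y = ((e, k1, \<phi>), (e', k1', \<phi>'), ry, Ident Ords (a + n + b))" "((e, k1, \<phi>), (e', k1', \<phi>'), ry, Ident Ords (a + n + b)) \<in> Arr K"
        using y g(2) by - (erule conjE, erule K_Arr_cases, simp add: C(1) C'(1) del: K_simps(1,2))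
      have "rd' \<cdot>\<^bsub>E\<^esub> ry = rd' \<cdot>\<^bsub>E\<^esub> s" using y s1 by (simp add: Y(1) D(1) D'(1) V(1))
      then have "ry = s" using K_Arr_app(7-9)[OF Y(2)] by - (rule X.iso_cancel_left[of rd']; simp)
      then show "y = ?z" by (simp add: Y(1))
    qed
  next
    fix c l
    assume c: "cartesian K Ords \<pi> c" "FAr \<pi> c = ?i" and l: "cocartesian K Ords \<pi> l" "FAr \<pi> l = f" and cl: "Dom K c = Cod K l"
    obtain e1 k1 \<phi>1 e0 k0 \<phi>0 rl where L: "l = ((e1, k1, \<phi>1), (e0, k0, \<phi>0), rl, f)" "((e1, k1, \<phi>1), (e0, k0, \<phi>0), rl, f) \<in> Arr K"
      using K.cocartesian_Arr[OF l(1)] l(2) by - (erule K_Arr_cases, simp del: K_simps(2))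
    obtain e2 k2 \<phi>2 rc where C: "c = ((e0, k0, \<phi>0), (e2, k2, \<phi>2), rc, ?i)" "((e0, k0, \<phi>0), (e2, k2, \<phi>2), rc, ?i) \<in> Arr K"
      using K.cartesian_Arr[OF c(1)] c(2) cl L by - (erule K_Arr_cases, simp del: K_simps(2))
    note cA = K_Arr_app[OF C(2)] and lA = K_Arr_app[OF L(2)]
    have N[simp]: "k1 = n" "k0 = k" "k2 = a + k + b" using cA(11,12) lA(11,12) f(2,3) i(2,3) g(3) by simp_all
    note A[simp] = cA(7-9) lA(7-9)
    have e2[simp]: "e2 \<in> Obj E" and e1: "e1 \<in> Obj E" using cA(6) lA(5) by auto
    have rl: "is_iso E rl" using l K_cocartesian_iff[OF L(2)] by (simp add: L(1))
    have im0: "ar rc ` pts e0 = {y \<in> pts e2. \<phi>2 y \<in> app ?i ` {1..k}}"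
      using c K_cartesian_iff[OF C(2) i(4)] by (simp add: C(1))
    \<comment> \<open>The object of \<open>E\<close> over \<open>a + n + b\<close> will be
      \<open>e2\<close> itself, with \<open>l\<close> and \<open>c\<close> merged into the single
      arrow \<open>r\<close>. What remains to be built is a structure map from \<open>e2\<close> to
      \<open>{1..a + n + b}\<close>.\<close>
    define r where "r = rc \<cdot>\<^bsub>E\<^esub> rl"
    have r[simp]: "r \<in> Arr E" "Dom E r = e1" "Cod E r = e2" by (simp_all add: r_def)
    have "ar r ` pts e1 = ar rc ` (ar rl ` pts e1)" unfolding image_image by (intro image_cong) (simp_all add: r_def)
    then have im: "ar r ` pts e1 = {y \<in> pts e2. a < \<phi>2 y \<and> \<phi>2 y \<le> a + k}"
      using E_iso_image[OF rl] im0 i(6) by simp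
    have r\<phi>: "\<phi>2 (ar r x) = a + app f (\<phi>1 x)" "\<phi>1 x \<in> {1..n}" if x: "x \<in> pts e1" for x
      using cA(1)[OF lA(2)[OF x]] lA(1)[OF x] lA(3)[OF x] Ords_app'(1)[OF f(1), of "\<phi>1 x"] f x i(5) by (simp_all add: r_def)
    define h where "h y = inv_into (pts e1) (ar r) y" for y
    have h: "h y \<in> pts e1" "ar r (h y) = y" if "y \<in> pts e2" "a < \<phi>2 y" "\<phi>2 y \<le> a + k" for y
      unfolding h_def using inv_into_into[of y "ar r" "pts e1"] f_inv_into_f[of y "ar r" "pts e1"] that im by auto
    have hr: "h (ar r x) = x" if x: "x \<in> pts e1" for x
    proof -
      have rx: "ar r x \<in> pts e2" "a < \<phi>2 (ar r x)" "\<phi>2 (ar r x) \<le> a + k" using im x by blast+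
      show ?thesis using h[OF rx] ar(3)[OF r(1), of "h (ar r x)" x] x by simp
    qed
    \<comment> \<open>The structure map is glued from three pieces. Values up to \<open>a\<close>
      are kept, those in the middle block are replaced by the finer values of
      \<open>\<phi>1\<close>, transported along \<open>r\<close> and shifted by \<open>a\<close>,
      and those above move from after \<open>a + k\<close> to after \<open>a + n\<close>. In the
      last piece the value exceeds \<open>k\<close>, so the subtraction is exact.\<close>
    define \<phi> where "\<phi> = (\<lambda>y\<in>pts e2. if \<phi>2 y \<le> a then \<phi>2 y else if \<phi>2 y \<le> a + k then a + \<phi>1 (h y) else \<phi>2 y - k + n)"
    have phi2: "\<phi>2 y \<in> {1..a + k + b}" if "y \<in> pts e2" for y using cA(4)[OF that] by simp
    have \<phi>lo: "\<phi> y = \<phi>2 y" if "y \<in> pts e2" "\<phi>2 y \<le> a" for y using that by (simp add: \<phi>_def)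
    have \<phi>mid: "\<phi> (ar r x) = a + \<phi>1 x" if x: "x \<in> pts e1" for x
    proof -
      have rx: "ar r x \<in> pts e2" "a < \<phi>2 (ar r x)" "\<phi>2 (ar r x) \<le> a + k" using im x by blast+
      then show ?thesis using hr[OF x] by (simp add: \<phi>_def)
    qed
    have \<phi>hi: "\<phi> y = \<phi>2 y - k + n" if "y \<in> pts e2" "a + k < \<phi>2 y" for y using that by (simp add: \<phi>_def)
    have cases: "\<phi>2 y \<le> a \<or> (\<exists>x \<in> pts e1. y = ar r x) \<or> a + k < \<phi>2 y" if "y \<in> pts e2" for y
      using im that by force
    have \<phi>r: "\<phi> y \<in> {1..a + n + b}" if y: "y \<in> pts e2" for y
      using cases[OF y]
    proof (elim disjE bexE)
      fix x assume "x \<in> pts e1" "y = ar r x"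
      then show ?thesis using \<phi>mid[of x] r\<phi>(2)[of x] by simp
    qed (use \<phi>lo[OF y] \<phi>hi[OF y] phi2[OF y] in auto)
    have g\<phi>: "app ?g (\<phi> y) = \<phi>2 y" if y: "y \<in> pts e2" for y
      using cases[OF y]
    proof (elim disjE bexE)
      assume lo: "\<phi>2 y \<le> a"
      then show ?thesis using \<phi>lo[OF y lo] g(4)[of "\<phi> y"] \<phi>r[OF y] by simp
    next
      fix x assume "x \<in> pts e1" "y = ar r x"
      then show ?thesis using \<phi>mid[of x] r\<phi>[of x] g(5)[of "\<phi>1 x"] by simp
    next
      assume hi: "a + k < \<phi>2 y"
      then show ?thesis using \<phi>hi[OF y hi] g(6)[of "\<phi> y"] \<phi>r[OF y] phi2[OF y] by simp
    qed
    \<comment> \<open>Except for two points of the middle piece, the order of the values of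
      \<open>\<phi>2\<close> decides. In the middle piece \<open>\<phi>2\<close> may have merged
      values, and monotonicity comes from \<open>\<phi>1\<close>, as \<open>r\<close> reflects the
      order.\<close>
    have mono: "\<phi> y \<le> \<phi> y'" if yy: "le e2 y y'" for y y'
    proof -
      have y: "y \<in> pts e2" "y' \<in> pts e2" using finite_posetD(2,3)[OF pts_poset[OF e2] yy] by auto
      have le: "\<phi>2 y \<le> \<phi>2 y'" using cA(6) yy by simp
      show ?thesis
      proof (cases "\<exists>x \<in> pts e1. \<exists>x' \<in> pts e1. y = ar r x \<and> y' = ar r x'")
        case True
        then obtain x x' where x: "x \<in> pts e1" "x' \<in> pts e1" "y = ar r x" "y' = ar r x'" by blast
        then have "le e1 x x'" using ar(2)[OF r(1), of x x'] yy by simp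
        then have "\<phi>1 x \<le> \<phi>1 x'" using lA(5) by simp
        then show ?thesis using \<phi>mid x by simp
      next
        case False
        have mid: "a < \<phi> z \<and> \<phi> z \<le> a + n \<and> a < \<phi>2 z \<and> \<phi>2 z \<le> a + k" if "x \<in> pts e1" "z = ar r x" for x z
          using im \<phi>mid[of x] r\<phi>(2)[of x] that by auto
        have hi: "a + n < \<phi> z" if "z \<in> pts e2" "a + k < \<phi>2 z" for z using \<phi>hi[OF that] that(2) by linarith
        show ?thesis using cases[OF y(1)]
        proof (elim disjE bexE)
          assume lo: "\<phi>2 y \<le> a"
          show ?thesis using cases[OF y(2)]
          proof (elim disjE bexE)
            assume "\<phi>2 y' \<le> a"
            then show ?thesis using \<phi>lo[OF y(1) lo] \<phi>lo[OF y(2)] le by simp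
          next
            fix x assume "x \<in> pts e1" "y' = ar r x"
            then show ?thesis using \<phi>lo[OF y(1) lo] mid[of x y'] lo by linarith
          next
            assume "a + k < \<phi>2 y'"
            then show ?thesis using \<phi>lo[OF y(1) lo] hi[OF y(2)] lo by linarith
          qed
        next
          fix x assume x: "x \<in> pts e1" "y = ar r x"
          show ?thesis using cases[OF y(2)]
          proof (elim disjE bexE)
            assume "\<phi>2 y' \<le> a"
            then show ?thesis using mid[OF x] le by linarith
          next
            fix x' assume "x' \<in> pts e1" "y' = ar r x'"
            then show ?thesis using False x by blast
          next
            assume "a + k < \<phi>2 y'"
            then show ?thesis using mid[OF x] hi[OF y(2)] by linarith
          qed
        next
          assume h: "a + k < \<phi>2 y"
          then have h': "a + k < \<phi>2 y'" using le by linarith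
          show ?thesis unfolding \<phi>hi[OF y(1) h] \<phi>hi[OF y(2) h'] using le by simp
        qed
      qed
    qed
    have x: "(e2, a + n + b, \<phi>) \<in> Obj K" using \<phi>r mono by (simp add: PiE_iff) (simp add: \<phi>_def)
    let ?c = "((e1, n, \<phi>1), (e2, a + n + b, \<phi>), r, ?j)" and ?d = "((e2, a + n + b, \<phi>), (e2, k2, \<phi>2), Ident E e2, ?g)"
    have cK: "?c \<in> Arr K" using x lA(5) \<phi>mid j r\<phi>(2) by (simp del: K_simps(1))
    have dK: "?d \<in> Arr K" using x cA(6) g\<phi> g(1-3) by (simp del: K_simps(1))
    \<comment> \<open>A value of \<open>\<phi>\<close> lies in the middle block exactly when its
      image under \<open>?g\<close> does, and that image is the value of
      \<open>\<phi>2\<close>.\<close>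
    have "ar r ` pts e1 = {y \<in> pts e2. \<phi> y \<in> app ?j ` {1..n}}"
    proof -
      have "\<phi> y \<in> app ?j ` {1..n} \<longleftrightarrow> a < \<phi>2 y \<and> \<phi>2 y \<le> a + k" if y: "y \<in> pts e2" for y
        using gij[OF \<phi>r[OF y]] g\<phi>[OF y] i(6) by simp
      then show ?thesis unfolding im by blast
    qed
    then have "cartesian K Ords \<pi> ?c" by (rule K_cartesianI[OF cK j(4)])
    moreover have "cocartesian K Ords \<pi> ?d" by (rule K_cocartesianI[OF dK]) simp
    ultimately show "\<exists>a0 b0. cartesian K Ords \<pi> a0 \<and> FAr \<pi> a0 = ?j \<and> cocartesian K Ords \<pi> b0 \<and> FAr \<pi> b0 = ?g \<and>
         Dom K a0 = Dom K l \<and> Cod K b0 = Cod K c \<and> Dom K b0 = Cod K a0 \<and> b0 \<cdot>\<^bsub>K\<^esub> a0 = c \<cdot>\<^bsub>K\<^esub> l"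
      using cK dK g(7) by (intro exI[where x = ?c] exI[where x = ?d]) (simp add: C(1) L(1) r_def del: K_simps(1,2))
  qed
  then show "homotopy_pullback (fibre K Ords \<pi> (a + n + b)) (fibre K Ords \<pi> n) (fibre K Ords \<pi> (a + k + b))
    (fibre K Ords \<pi> k) (pullback K Ords \<pi> ?j) (pushforward K Ords \<pi> ?g) (pushforward K Ords \<pi> f)
    (pullback K Ords \<pi> ?i) (bc_comparison K Ords \<pi> ?i f ?g ?j)"
    using g(2,3) j(2) i(2) by simp
qed

end

section \<open>Functoriality of the comma category\<close>

locale poset_fibration_map = A: poset_fibration E p + B: poset_fibration E' q
  for E :: "('o, 'm) cat" and p :: "('o, 'm, 'a::infinite poset, 'a poset_map) func"
    and E' :: "('o, 'm) cat" and q :: "('o, 'm, 'a poset, 'a poset_map) func" +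
  fixes c
  assumes c_over: "functor_over (E, p) (E', q) c"
begin

lemmas c_functor = functor_over_functor[OF c_over, simplified]
lemmas c_simps [simp] = functor_overD(2,3)[OF c_over, simplified] functor_simps[OF c_functor]

abbreviation cm where "cm \<equiv> comma_map (E, p) c"

lemma cm_Ob [simp]: "(e, k, \<phi>) \<in> Obj A.K \<Longrightarrow> FOb cm (e, k, \<phi>) = (FOb c e, k, \<phi>)"
  unfolding comma_map_def Let_def by simp

lemma cm_Ar [simp]: "((e, k, \<phi>), (e', k', \<phi>'), r, m) \<in> Arr A.K \<Longrightarrow>
  FAr cm ((e, k, \<phi>), (e', k', \<phi>'), r, m) = ((FOb c e, k, \<phi>), (FOb c e', k', \<phi>'), FAr c r, m)"
  unfolding comma_map_def Let_def by simp

lemma cm_Obj: "(e, k, \<phi>) \<in> Obj A.K \<Longrightarrow> (FOb c e, k, \<phi>) \<in> Obj B.K"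
  by simp

lemma cm_Arr: "((e, k, \<phi>), (e', k', \<phi>'), r, m) \<in> Arr A.K \<Longrightarrow>
  ((FOb c e, k, \<phi>), (FOb c e', k', \<phi>'), FAr c r, m) \<in> Arr B.K"
  by auto

lemma cm_functor: "is_functor A.K B.K cm"
proof (rule is_functorI)
  show "FOb cm x \<in> Obj B.K" if "x \<in> Obj A.K" for x
    using that by - (erule A.K_Obj_cases, simp del: A.K_simps(1) B.K_simps(1) add: cm_Obj)
  show "FAr cm u \<in> Arr B.K \<and> Dom B.K (FAr cm u) = FOb cm (Dom A.K u) \<and> Cod B.K (FAr cm u) = FOb cm (Cod A.K u)"
    if "u \<in> Arr A.K" for u
    using that
    by - (erule A.K_Arr_cases, frule A.K_Arr_app(5), frule A.K_Arr_app(6),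
      simp del: A.K_simps(1,2) B.K_simps(1,2) add: cm_Arr)
  fix x assume x: "x \<in> Obj A.K"
  obtain e k \<phi> where x': "x = (e, k, \<phi>)" "(e, k, \<phi>) \<in> Obj A.K" using A.K_Obj_cases[OF x] by blast
  then have "e \<in> Obj E" by simp
  then show "FAr cm (Ident A.K x) = Ident B.K (FOb cm x)"
    using x' A.K.Ident_in[OF x] by (simp del: A.K_simps(1,2) B.K_simps(1,2))
next
  fix u v assume uv: "u \<in> Arr A.K" "v \<in> Arr A.K" "Cod A.K u = Dom A.K v"
  obtain e k \<phi> e' k' \<phi>' r m where u: "u = ((e, k, \<phi>), (e', k', \<phi>'), r, m)"
    "((e, k, \<phi>), (e', k', \<phi>'), r, m) \<in> Arr A.K" using A.K_Arr_cases[OF uv(1)] by blast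
  obtain e2 k2 \<phi>2 r' m' where v: "v = ((e', k', \<phi>'), (e2, k2, \<phi>2), r', m')"
    "((e', k', \<phi>'), (e2, k2, \<phi>2), r', m') \<in> Arr A.K" using uv(2,3) u
    by - (erule A.K_Arr_cases, simp del: A.K_simps(2))
  have "v \<cdot>\<^bsub>A.K\<^esub> u \<in> Arr A.K" using uv by simp
  then show "FAr cm (v \<cdot>\<^bsub>A.K\<^esub> u) = FAr cm v \<cdot>\<^bsub>B.K\<^esub> FAr cm u"
    using u v A.K_Arr_app(7-9)[OF u(2)] A.K_Arr_app(7-9)[OF v(2)]
    by (simp del: A.K_simps(1,2) B.K_simps(1,2))
qed (auto simp: comma_map_def Let_def A.K_category B.K_category)

lemma cm_over: "functor_over (A.K, A.\<pi>) (B.K, B.\<pi>) cm"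
proof (rule functor_overI[where B = Ords])
  fix x assume "x \<in> Obj (fst (A.K, A.\<pi>))"
  then have "x \<in> Obj A.K" by simp
  then show "FOb (snd (B.K, B.\<pi>)) (FOb cm x) = FOb (snd (A.K, A.\<pi>)) x"
    by - (erule A.K_Obj_cases, simp del: A.K_simps(1) B.K_simps(1) add: cm_Obj)
next
  fix u assume "u \<in> Arr (fst (A.K, A.\<pi>))"
  then have "u \<in> Arr A.K" by simp
  then show "FAr (snd (B.K, B.\<pi>)) (FAr cm u) = FAr (snd (A.K, A.\<pi>)) u"
    by - (erule A.K_Arr_cases, simp del: A.K_simps(1,2) B.K_simps(1,2) add: cm_Arr)
qed (use cm_functor A.K_functor B.K_functor in simp_all)

text \<open>Being cocartesian is invertibility of the \<open>E\<close>-component, which every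
  functor preserves.\<close>

lemma cm_cocartesian:
  assumes u: "cocartesian A.K Ords A.\<pi> u"
  shows "cocartesian B.K Ords B.\<pi> (FAr cm u)"
proof -
  obtain e k \<phi> e' k' \<phi>' r m where u': "u = ((e, k, \<phi>), (e', k', \<phi>'), r, m)"
    "((e, k, \<phi>), (e', k', \<phi>'), r, m) \<in> Arr A.K" using A.K_Arr_cases[OF A.K.cocartesian_Arr[OF u]] by blast
  have "is_iso E r" using u A.K_cocartesian_iff[OF u'(2)] by (simp add: u'(1))
  then have "is_iso E' (FAr c r)" by (rule functor_iso[OF c_functor])
  from B.K_cocartesianI[OF cm_Arr[OF u'(2)] this] show ?thesis unfolding u'(1) cm_Ar[OF u'(2)] .
qed

text \<open>The image criterion speaks of underlying posets and maps only, and these are unchanged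
  by a functor over the base.\<close>

lemma cm_cartesian:
  assumes u: "cartesian A.K Ords A.\<pi> u" and m: "convex_ord (FAr A.\<pi> u)"
  shows "cartesian B.K Ords B.\<pi> (FAr cm u)"
proof -
  obtain e k \<phi> e' k' \<phi>' r m where u': "u = ((e, k, \<phi>), (e', k', \<phi>'), r, m)"
    "((e, k, \<phi>), (e', k', \<phi>'), r, m) \<in> Arr A.K" using A.K_Arr_cases[OF A.K.cartesian_Arr[OF u]] by blast
  have m': "convex_ord m" using m u' by (simp del: A.K_simps(2))
  have e: "e \<in> Obj E" "e' \<in> Obj E" "r \<in> Arr E" using u'(2) by auto
  have "A.ar r ` A.pts e = {y \<in> A.pts e'. \<phi>' y \<in> app m ` {1..k}}"
    using u A.K_cartesian_iff[OF u'(2) m'] by (simp add: u'(1))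
  then have "B.ar (FAr c r) ` B.pts (FOb c e) = {y \<in> B.pts (FOb c e'). \<phi>' y \<in> app m ` {1..k}}"
    using e by simp
  from B.K_cartesianI[OF cm_Arr[OF u'(2)] m' this] show ?thesis unfolding u'(1) cm_Ar[OF u'(2)] .
qed

text \<open>Cocartesian arrows have invertible \<open>E\<close>-components. Hence an object over
  \<open>n\<close> on the side of \<open>E'\<close> whose pushforward is the image of an object over
  \<open>k\<close> has, up to isomorphism, the same underlying structure as that image, and the only
  datum left to transport is a map into the ordinal \<open>n\<close>.\<close>

lemma cm_morphism: "iesq_sesq_morphism (A.K, A.\<pi>) (B.K, B.\<pi>) cm"
proof -
  { fix n k f assume "f \<in> hom Ords n k"
    then have f: "f \<in> Arr Ords" "Dom Ords f = n" "Cod Ords f = k" by (auto simp: hom_def)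
    interpret push_square A.K Ords A.\<pi> B.K B.\<pi> cm f
      by (rule iesq_sesq_morphism_push_square[OF A.K_sesquicartesian B.K_sesquicartesian cm_over cm_cocartesian f(1)])
    have "homotopy_pullback (fibre A.K Ords A.\<pi> (Dom Ords f)) (fibre B.K Ords B.\<pi> (Dom Ords f))
      (fibre A.K Ords A.\<pi> (Cod Ords f)) (fibre B.K Ords B.\<pi> (Cod Ords f))
      (restrict_func (fibre A.K Ords A.\<pi> (Dom Ords f)) cm) (pushforward A.K Ords A.\<pi> f)
      (pushforward B.K Ords B.\<pi> f) (restrict_func (fibre A.K Ords A.\<pi> (Cod Ords f)) cm) cmp"
    proof (rule push_homotopy_pullback)
      fix d d' u v
      assume d: "cocartesian A.K Ords A.\<pi> d" "FAr A.\<pi> d = f" and d': "cocartesian A.K Ords A.\<pi> d'" "FAr A.\<pi> d' = f"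
        and u: "u \<in> Arr B.K" "FAr B.\<pi> u = Ident Ords (Dom Ords f)" "Dom B.K u = FOb cm (Dom A.K d)" "Cod B.K u = FOb cm (Dom A.K d')"
        and v: "v \<in> Arr A.K" "FAr A.\<pi> v = Ident Ords (Cod Ords f)" "Dom A.K v = Cod A.K d" "Cod A.K v = Cod A.K d'"
        and eq: "FAr cm d' \<cdot>\<^bsub>B.K\<^esub> u = FAr cm (v \<cdot>\<^bsub>A.K\<^esub> d)"
      obtain e k1 \<phi> e2 k2 \<phi>2 rd where D: "d = ((e, k1, \<phi>), (e2, k2, \<phi>2), rd, f)" "((e, k1, \<phi>), (e2, k2, \<phi>2), rd, f) \<in> Arr A.K"
        using A.K.cocartesian_Arr[OF d(1)] d(2) by - (erule A.K_Arr_cases, simp del: A.K_simps(2))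
      obtain e' k1' \<phi>' e2' k2' \<phi>2' rd' where D': "d' = ((e', k1', \<phi>'), (e2', k2', \<phi>2'), rd', f)" "((e', k1', \<phi>'), (e2', k2', \<phi>2'), rd', f) \<in> Arr A.K"
        using A.K.cocartesian_Arr[OF d'(1)] d'(2) by - (erule A.K_Arr_cases, simp del: A.K_simps(2))
      note dA = A.K_Arr_app[OF D(2)] and dA' = A.K_Arr_app[OF D'(2)]
      obtain ru where U: "u = ((FOb c e, k1, \<phi>), (FOb c e', k1', \<phi>'), ru, Ident Ords n)"
        "((FOb c e, k1, \<phi>), (FOb c e', k1', \<phi>'), ru, Ident Ords n) \<in> Arr B.K"
        using u D D' dA(5) dA'(5) f by - (erule B.K_Arr_cases, simp del: A.K_simps(1,2) B.K_simps(1,2))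
      obtain rv where V: "v = ((e2, k2, \<phi>2), (e2', k2', \<phi>2'), rv, Ident Ords k)" "((e2, k2, \<phi>2), (e2', k2', \<phi>2'), rv, Ident Ords k) \<in> Arr A.K"
        using v D D' f by - (erule A.K_Arr_cases, simp del: A.K_simps(1,2))
      note uA = B.K_Arr_app[OF U(2)] and vA = A.K_Arr_app[OF V(2)]
      have N[simp]: "k1 = n" "k1' = n" "k2 = k" "k2' = k" using dA(11,12) dA'(11,12) f by simp_all
      note A[simp] = dA(7-9) dA'(7-9) uA(7-9) vA(7-9)
      have E[simp]: "e \<in> Obj E" "e' \<in> Obj E" using dA(5) dA'(5) by auto
      have [simp]: "is_iso E rd" "is_iso E rd'"
        using d d' A.K_cocartesian_iff[OF D(2)] A.K_cocartesian_iff[OF D'(2)] by (simp_all add: D(1) D'(1))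
      have [simp]: "is_iso E' (FAr c rd')" by (rule functor_iso[OF c_functor]) simp
      \<comment> \<open>The component is forced by \<open>v\<close> because \<open>rd'\<close> is
        invertible. Cancelling the invertible \<open>FAr c rd'\<close> will show that
        \<open>c\<close> sends it to \<open>ru\<close>.\<close>
      define s where "s = inv_arr E rd' \<cdot>\<^bsub>E\<^esub> (rv \<cdot>\<^bsub>E\<^esub> rd)"
      have s[simp]: "s \<in> Arr E" "Dom E s = e" "Cod E s = e'" by (simp_all add: s_def)
      have s1: "rd' \<cdot>\<^bsub>E\<^esub> s = rv \<cdot>\<^bsub>E\<^esub> rd" by (simp add: s_def)
      have vd: "v \<cdot>\<^bsub>A.K\<^esub> d \<in> Arr A.K" using v A.K.cocartesian_Arr[OF d(1)] by simp
      have "FAr c rd' \<cdot>\<^bsub>E'\<^esub> ru = FAr c (rv \<cdot>\<^bsub>E\<^esub> rd)"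
        using eq vd D V D'(2) unfolding D(1) D'(1) U(1) V(1) by (simp del: A.K_simps(1,2) B.K_simps(1,2) c_simps)
      also have "\<dots> = FAr c rd' \<cdot>\<^bsub>E'\<^esub> FAr c s" unfolding s1[symmetric] by simp
      finally have s2: "FAr c s = ru"
        by - (rule B.X.iso_cancel_left[of "FAr c rd'"]; simp)
      \<comment> \<open>The underlying map of \<open>s\<close> is that of \<open>ru\<close>, for
        which compatibility with the structure maps is known.\<close>
      have phi: "\<phi>' (A.ar s y) = \<phi> y" if y: "y \<in> A.pts e" for y
      proof -
        have "\<phi>' (B.ar ru y) = \<phi> y" using uA(1)[of y] uA(3)[of y] y by simp
        then show ?thesis unfolding s2[symmetric] by simp
      qed
      let ?z = "((e, k1, \<phi>), (e', k1', \<phi>'), s, Ident Ords n)"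
      have z: "?z \<in> Arr A.K" using dA(5) dA'(5) phi dA(3) by simp
      show "\<exists>!z. z \<in> Arr A.K \<and> FAr A.\<pi> z = Ident Ords (Dom Ords f) \<and> Dom A.K z = Dom A.K d \<and> Cod A.K z = Dom A.K d' \<and>
         FAr cm z = u \<and> v \<cdot>\<^bsub>A.K\<^esub> d = d' \<cdot>\<^bsub>A.K\<^esub> z"
      proof (rule ex1I[where a = ?z])
        show "?z \<in> Arr A.K \<and> FAr A.\<pi> ?z = Ident Ords (Dom Ords f) \<and> Dom A.K ?z = Dom A.K d \<and> Cod A.K ?z = Dom A.K d' \<and>
          FAr cm ?z = u \<and> v \<cdot>\<^bsub>A.K\<^esub> d = d' \<cdot>\<^bsub>A.K\<^esub> ?z"
          using z s1 s2 f by (simp add: D(1) D'(1) U(1) V(1) del: A.K_simps(1,2) B.K_simps(1,2))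
        fix y assume y: "y \<in> Arr A.K \<and> FAr A.\<pi> y = Ident Ords (Dom Ords f) \<and> Dom A.K y = Dom A.K d \<and> Cod A.K y = Dom A.K d' \<and>
          FAr cm y = u \<and> v \<cdot>\<^bsub>A.K\<^esub> d = d' \<cdot>\<^bsub>A.K\<^esub> y"
        obtain ry where Y: "y = ((e, k1, \<phi>), (e', k1', \<phi>'), ry, Ident Ords n)" "((e, k1, \<phi>), (e', k1', \<phi>'), ry, Ident Ords n) \<in> Arr A.K"
          using y f by - (erule conjE, erule A.K_Arr_cases, simp add: D(1) D'(1) del: A.K_simps(1,2))
        have "rd' \<cdot>\<^bsub>E\<^esub> ry = rd' \<cdot>\<^bsub>E\<^esub> s" using y s1 by (simp add: Y(1) D(1) D'(1) V(1) del: A.K_simps(2))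
        then have "ry = s" using A.K_Arr_app(7-9)[OF Y(2)] by - (rule A.X.iso_cancel_left[of rd']; simp)
        then show "y = ?z" by (simp add: Y(1))
      qed
    next
      fix a x
      assume a: "cocartesian B.K Ords B.\<pi> a" "FAr B.\<pi> a = f" and x: "x \<in> Obj A.K" "FOb A.\<pi> x = Cod Ords f"
        and ax: "Cod B.K a = FOb cm x"
      obtain e k2 \<phi> where x': "x = (e, k2, \<phi>)" "(e, k2, \<phi>) \<in> Obj A.K" using A.K_Obj_cases[OF x(1)] by blast
      obtain e1 k1 \<phi>1 ra where A: "a = ((e1, k1, \<phi>1), (FOb c e, k2, \<phi>), ra, f)" "((e1, k1, \<phi>1), (FOb c e, k2, \<phi>), ra, f) \<in> Arr B.K"
        using B.K.cocartesian_Arr[OF a(1)] a(2) ax x' by - (erule B.K_Arr_cases, simp del: A.K_simps(1,2) B.K_simps(1,2))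
      note aA = B.K_Arr_app[OF A(2)]
      have N[simp]: "k1 = n" "k2 = k" using aA(11,12) f by simp_all
      have i[simp]: "is_iso E' ra" using a B.K_cocartesian_iff[OF A(2)] by (simp add: A(1))
      note [simp] = aA(7-9)
      have e[simp]: "e \<in> Obj E" "e1 \<in> Obj E'" using x'(2) aA(5) by auto
      let ?r = "inv_arr E' ra"
      have r: "B.ar ?r y \<in> B.pts e1" if "y \<in> A.pts e" for y
        using B.ar(1)[of ?r y] that by simp
      \<comment> \<open>The structure \<open>e\<close> of \<open>x\<close> is kept, and the map
        \<open>\<phi>1\<close> is transported to its points along the inverse of \<open>ra\<close>.
        The arrows \<open>?u\<close> and \<open>?w\<close> below are then mutually inverse over the
        identity of \<open>n\<close>.\<close>
      define \<phi>' where "\<phi>' = (\<lambda>y\<in>A.pts e. \<phi>1 (B.ar ?r y))"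
      have mono: "\<phi>' y \<le> \<phi>' y'" if yy: "A.le e y y'" for y y'
      proof -
        have y: "y \<in> A.pts e" "y' \<in> A.pts e" using finite_posetD(2,3)[OF A.pts_poset[OF e(1)] yy] by auto
        have "B.le e1 (B.ar ?r y) (B.ar ?r y')" using B.ar(2)[of ?r y y'] y yy by simp
        then show ?thesis using aA(5) y by (simp add: \<phi>'_def)
      qed
      have b: "(e, n, \<phi>') \<in> Obj A.K" using mono aA(3)[OF r] by (simp add: PiE_iff) (simp add: \<phi>'_def)
      have "\<phi> y = app f (\<phi>' y)" if "y \<in> A.pts e" for y
        using aA(1)[OF r[OF that]] that by (simp add: \<phi>'_def)
      then have bK: "((e, n, \<phi>'), (e, k, \<phi>), Ident E e, f) \<in> Arr A.K" (is "?b \<in> _") using b x'(2) f by simp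
      have uK: "((FOb c e, n, \<phi>'), (e1, n, \<phi>1), ?r, Ident Ords n) \<in> Arr B.K" (is "?u \<in> _")
        using cm_Obj[OF b] aA(5) r aA(3)[OF r] by (simp del: B.K_simps(1)) (simp add: \<phi>'_def)
      have wK: "((e1, n, \<phi>1), (FOb c e, n, \<phi>'), ra, Ident Ords n) \<in> Arr B.K" (is "?w \<in> _")
        using cm_Obj[OF b] aA(5) aA(2,3) by (simp del: B.K_simps(1)) (simp add: \<phi>'_def)
      have "is_iso B.K ?u"
        using uK wK by (intro B.K.is_isoI[where g = ?w]) (simp_all del: B.K_simps(1,2))
      moreover have "cocartesian A.K Ords A.\<pi> ?b" by (rule A.K_cocartesianI[OF bK]) simp
      moreover have "a \<cdot>\<^bsub>B.K\<^esub> ?u = FAr cm ?b"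
        using bK f by (simp add: A(1) del: A.K_simps(1,2) B.K_simps(1,2))
      ultimately show "\<exists>b u. cocartesian A.K Ords A.\<pi> b \<and> FAr A.\<pi> b = f \<and> Cod A.K b = x \<and> is_iso B.K u \<and>
        FAr B.\<pi> u = Ident Ords (Dom Ords f) \<and> Dom B.K u = FOb cm (Dom A.K b) \<and> Cod B.K u = Dom B.K a \<and> a \<cdot>\<^bsub>B.K\<^esub> u = FAr cm b"
        using bK uK f b by (intro exI[where x = ?b] exI[where x = ?u])
          (simp add: A(1) x'(1) del: A.K_simps(1,2) B.K_simps(1,2))
    qed
    then have "homotopy_pullback (fibre A.K Ords A.\<pi> n) (fibre B.K Ords B.\<pi> n)
      (fibre A.K Ords A.\<pi> k) (fibre B.K Ords B.\<pi> k)
      (restrict_func (fibre A.K Ords A.\<pi> n) cm) (pushforward A.K Ords A.\<pi> f)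
      (pushforward B.K Ords B.\<pi> f) (restrict_func (fibre A.K Ords A.\<pi> k) cm) cmp"
      by (simp add: f) }
  then show ?thesis unfolding iesq_sesq_morphism_def using cm_cocartesian cm_cartesian by auto
qed

end

lemma poset_fibrationI: "(E, p) \<in> Obj RFib \<Longrightarrow> poset_fibration E p"
  by (auto simp: RFib_simps poset_fibration_def poset_fibration_axioms_def category_over_def
      right_fibration_def cartesian_fibration_over_def)

lemma IesqSesq_simps:
  "(X, p) \<in> Obj IesqSesq \<longleftrightarrow> sesquicartesian X p \<and> iesq X p"
  "(S, T, c) \<in> Arr IesqSesq \<longleftrightarrow> S \<in> Obj IesqSesq \<and> T \<in> Obj IesqSesq \<and> functor_over S T c \<and>
     iesq_sesq_morphism S T c"
  "Dom IesqSesq (S, T, c) = S" "Cod IesqSesq (S, T, c) = T" "Ident IesqSesq S = (S, S, id_func (fst S))"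
  "(S', T', c') \<cdot>\<^bsub>IesqSesq\<^esub> (S, T, c) = (S, T', comp_func (fst S) c' c)"
  unfolding IesqSesq_def by (auto split: prod.splits)

lemma comma_Obj: "S \<in> Obj RFib \<Longrightarrow> (comma S, comma_proj S) \<in> Obj IesqSesq"
  by (cases S) (auto simp: IesqSesq_simps dest!: poset_fibrationI
      intro: poset_fibration.K_sesquicartesian poset_fibration.K_iesq)

lemma comma_functor_functor:
  "is_functor (RFib :: (('a::infinite, 'o, 'm) cover, ('a, 'o, 'm) cover_ar) cat) IesqSesq comma_functor"
proof (rule is_functorI)
  have map: "poset_fibration_map E p E' q c" if "((E, p), (E', q), c) \<in> Arr RFib"
    for E E' :: "('o, 'm) cat" and p q :: "('o, 'm, 'a poset, 'a poset_map) func" and c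
    using that poset_fibrationI[of E p] poset_fibrationI[of E' q]
    by (simp add: poset_fibration_map_def poset_fibration_map_axioms_def RFib_simps)
  show "FAr comma_functor f \<in> Arr IesqSesq \<and>
      Dom IesqSesq (FAr comma_functor f) = FOb comma_functor (Dom RFib f) \<and>
      Cod IesqSesq (FAr comma_functor f) = FOb comma_functor (Cod RFib f)"
    if f: "f \<in> Arr RFib" for f :: "('a, 'o, 'm) cover_ar"
  proof -
    obtain E p E' q c where f': "f = ((E, p), (E', q), c)" by (metis prod.collapse)
    interpret poset_fibration_map E p E' q c using map f f' by blast
    have ST: "(E, p) \<in> Obj RFib" "(E', q) \<in> Obj RFib" using f by (auto simp: f' RFib_simps)
    then have "((comma (E, p), comma_proj (E, p)), (comma (E', q), comma_proj (E', q)), comma_map (E, p) c) \<in> Arr IesqSesq"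
      using comma_Obj[OF ST(1)] comma_Obj[OF ST(2)] cm_over cm_morphism by (simp add: IesqSesq_simps)
    then show ?thesis using f ST by (simp add: f' comma_functor_def Let_def RFib_simps(3,4) IesqSesq_simps(3,4))
  qed
  show "FOb comma_functor S \<in> Obj IesqSesq" if "S \<in> Obj RFib" for S :: "('a, 'o, 'm) cover"
    using that comma_Obj by (simp add: comma_functor_def Let_def)
  show "FAr comma_functor (Ident RFib S) = Ident IesqSesq (FOb comma_functor S)"
    if S: "S \<in> Obj RFib" for S :: "('a, 'o, 'm) cover"
  proof -
    obtain E p where S': "S = (E, p)" by (cases S)
    have i: "((E, p), (E, p), id_func E) \<in> Arr RFib"
      using category.Ident_in[OF RFib_category S] by (simp add: S' RFib_simps(5))
    interpret poset_fibration_map E p E p "id_func E" using map i by blast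
    have "cm = id_func A.K"
    proof (rule functor_eqI[OF cm_functor id_functor[OF A.K_category]])
      show "FOb cm x = FOb (id_func A.K) x" if "x \<in> Obj A.K" for x
        using that by - (erule A.K_Obj_cases, simp)
      show "FAr cm u = FAr (id_func A.K) u" if "u \<in> Arr A.K" for u
        using that by - (erule A.K_Arr_cases, simp)
    qed
    then show ?thesis using S i by (simp add: S' comma_functor_def RFib_simps(5) IesqSesq_simps(5) Let_def)
  qed
  show "FAr comma_functor (g \<cdot>\<^bsub>RFib\<^esub> f) = FAr comma_functor g \<cdot>\<^bsub>IesqSesq\<^esub> FAr comma_functor f"
    if fg: "f \<in> Arr RFib" "g \<in> Arr RFib" "Cod RFib f = Dom RFib g" for f g :: "('a, 'o, 'm) cover_ar"
  proof -
    obtain E p E' q c where f: "f = ((E, p), (E', q), c)" by (metis prod.collapse)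
    obtain T E'' r d where "g = (T, (E'', r), d)" by (metis prod.collapse)
    then have g: "g = ((E', q), (E'', r), d)" using fg(3) by (simp add: f RFib_simps(3,4))
    have gf: "((E, p), (E'', r), comp_func E d c) \<in> Arr RFib"
      using category.Comp_in[OF RFib_category fg] by (simp add: f g RFib_simps(6))
    interpret c: poset_fibration_map E p E' q c using map fg(1) f by blast
    interpret d: poset_fibration_map E' q E'' r d using map fg(2) g by blast
    interpret dc: poset_fibration_map E p E'' r "comp_func E d c" using map gf by blast
    have "dc.cm = comp_func c.A.K d.cm c.cm"
    proof (rule functor_eqI[OF dc.cm_functor comp_functor[OF c.cm_functor d.cm_functor]])
      show "FOb dc.cm x = FOb (comp_func c.A.K d.cm c.cm) x" if "x \<in> Obj c.A.K" for x
        using that by - (erule c.A.K_Obj_cases, simp)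
      show "FAr dc.cm u = FAr (comp_func c.A.K d.cm c.cm) u" if "u \<in> Arr c.A.K" for u
        using that
        by - (erule c.A.K_Arr_cases, frule c.cm_Arr, simp del: c.A.K_simps(2) c.B.K_simps(2), simp)
    qed
    then show ?thesis using fg gf
      by (simp add: comma_functor_def f g RFib_simps(6) IesqSesq_simps(6) Let_def)
  qed
qed (auto simp: RFib_category IesqSesq_category comma_functor_def Let_def)

section \<open>The Grothendieck construction\<close>

locale pseudo_functor_on =
  fixes B :: "('b, 'k) cat" and R :: "('b, 'k, 'o, 'm) pseudo_func"
  assumes pseudo: "pseudo_functor B R"
begin

lemma base_category: "category B"
  using pseudo by (simp add: pseudo_functor_def)

sublocale B: category B by (rule base_category)

abbreviation C where "C P \<equiv> ROb R P"
lemma C_groupoid: "P \<in> Obj B \<Longrightarrow> groupoid (C P)"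
  using pseudo by (simp add: pseudo_functor_def)

lemma C_category [simp]: "P \<in> Obj B \<Longrightarrow> category (C P)"
  using C_groupoid by (simp add: groupoid_def)

lemma C_iso [simp]: "\<lbrakk>P \<in> Obj B; u \<in> Arr (C P)\<rbrakk> \<Longrightarrow> is_iso (C P) u"
  using C_groupoid by (simp add: groupoid_def)

lemma RAr_functor: "f \<in> Arr B \<Longrightarrow> is_functor (C (Cod B f)) (C (Dom B f)) (RAr R f)"
  using pseudo by (simp add: pseudo_functor_def)

lemma RAr_simps [simp]:
  assumes "f \<in> Arr B" "Dom B f = P"
  shows "X \<in> Obj (C (Cod B f)) \<Longrightarrow> FOb (RAr R f) X \<in> Obj (C P)"
    and "u \<in> Arr (C (Cod B f)) \<Longrightarrow> FAr (RAr R f) u \<in> Arr (C P)"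
    and "u \<in> Arr (C (Cod B f)) \<Longrightarrow> Dom (C P) (FAr (RAr R f) u) = FOb (RAr R f) (Dom (C (Cod B f)) u)"
    and "u \<in> Arr (C (Cod B f)) \<Longrightarrow> Cod (C P) (FAr (RAr R f) u) = FOb (RAr R f) (Cod (C (Cod B f)) u)"
    and "\<lbrakk>Cod B f = Q; X \<in> Obj (C Q)\<rbrakk> \<Longrightarrow> FAr (RAr R f) (Ident (C Q) X) = Ident (C (Dom B f)) (FOb (RAr R f) X)"
    and "\<lbrakk>Cod B f = Q; u \<in> Arr (C Q); v \<in> Arr (C Q); Cod (C Q) u = Dom (C Q) v\<rbrakk> \<Longrightarrow>
      FAr (RAr R f) (v \<cdot>\<^bsub>C Q\<^esub> u) = FAr (RAr R f) v \<cdot>\<^bsub>C (Dom B f)\<^esub> FAr (RAr R f) u"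
  using functor_simps(3-8)[OF RAr_functor[OF assms(1)]] assms(2) by auto

lemma RComp_nat_iso: "\<lbrakk>f \<in> Arr B; g \<in> Arr B; Cod B f = Dom B g\<rbrakk> \<Longrightarrow>
    nat_iso (C (Cod B g)) (C (Dom B f)) (comp_func (C (Cod B g)) (RAr R f) (RAr R g)) (RAr R (g \<cdot>\<^bsub>B\<^esub> f)) (RComp R g f)"
  using pseudo by (simp add: pseudo_functor_def)

lemma RComp [simp]:
  assumes "f \<in> Arr B" "g \<in> Arr B" "Cod B f = Dom B g" "X \<in> Obj (C (Cod B g))" "Dom B f = P"
  shows "RComp R g f X \<in> Arr (C P)" "Dom (C P) (RComp R g f X) = FOb (RAr R f) (FOb (RAr R g) X)"
    "Cod (C P) (RComp R g f X) = FOb (RAr R (g \<cdot>\<^bsub>B\<^esub> f)) X"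
  using nat_iso_simps[OF RComp_nat_iso[OF assms(1-3)] assms(4)] assms by auto

lemma RComp_nat:
  assumes "f \<in> Arr B" "g \<in> Arr B" "Cod B f = Dom B g" "u \<in> Arr (C (Cod B g))"
  shows "RComp R g f (Cod (C (Cod B g)) u) \<cdot>\<^bsub>C (Dom B f)\<^esub> FAr (RAr R f) (FAr (RAr R g) u) =
    FAr (RAr R (g \<cdot>\<^bsub>B\<^esub> f)) u \<cdot>\<^bsub>C (Dom B f)\<^esub> RComp R g f (Dom (C (Cod B g)) u)"
  using nat_iso_nat[OF RComp_nat_iso[OF assms(1-3)] assms(4)] assms by simp

lemma RUnit_nat_iso: "P \<in> Obj B \<Longrightarrow> nat_iso (C P) (C P) (id_func (C P)) (RAr R (Ident B P)) (RUnit R P)"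
  using pseudo by (simp add: pseudo_functor_def)

lemma RUnit [simp]:
  assumes "P \<in> Obj B" "X \<in> Obj (C P)"
  shows "RUnit R P X \<in> Arr (C P)" "Dom (C P) (RUnit R P X) = X"
    "Cod (C P) (RUnit R P X) = FOb (RAr R (Ident B P)) X"
  using nat_iso_simps[OF RUnit_nat_iso[OF assms(1)] assms(2)] assms by auto

lemma RUnit_nat:
  assumes "P \<in> Obj B" "u \<in> Arr (C P)"
  shows "RUnit R P (Cod (C P) u) \<cdot>\<^bsub>C P\<^esub> u = FAr (RAr R (Ident B P)) u \<cdot>\<^bsub>C P\<^esub> RUnit R P (Dom (C P) u)"
  using nat_iso_nat[OF RUnit_nat_iso[OF assms(1)] assms(2)] assms by simp

lemma RComp_assoc:
  assumes "f \<in> Arr B" "g \<in> Arr B" "h \<in> Arr B" "Cod B f = Dom B g" "Cod B g = Dom B h" "X \<in> Obj (C (Cod B h))"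
  shows "RComp R (h \<cdot>\<^bsub>B\<^esub> g) f X \<cdot>\<^bsub>C (Dom B f)\<^esub> FAr (RAr R f) (RComp R h g X) =
    RComp R h (g \<cdot>\<^bsub>B\<^esub> f) X \<cdot>\<^bsub>C (Dom B f)\<^esub> RComp R g f (FOb (RAr R h) X)"
  using pseudo assms by (simp add: pseudo_functor_def)

lemma RComp_unit:
  assumes "f \<in> Arr B" "X \<in> Obj (C (Cod B f))"
  shows "RComp R f (Ident B (Dom B f)) X \<cdot>\<^bsub>C (Dom B f)\<^esub> RUnit R (Dom B f) (FOb (RAr R f) X) =
      Ident (C (Dom B f)) (FOb (RAr R f) X)"
    "RComp R (Ident B (Cod B f)) f X \<cdot>\<^bsub>C (Dom B f)\<^esub> FAr (RAr R f) (RUnit R (Cod B f) X) =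
      Ident (C (Dom B f)) (FOb (RAr R f) X)"
  using pseudo assms by (simp_all add: pseudo_functor_def)

abbreviation el where "el \<equiv> elements B R"
abbreviation \<pi> where "\<pi> \<equiv> elements_proj B R"

lemma el_simps [simp]:
  "(P, X) \<in> Obj el \<longleftrightarrow> P \<in> Obj B \<and> X \<in> Obj (C P)"
  "((P', X'), (P, X), f, \<alpha>) \<in> Arr el \<longleftrightarrow> X' \<in> Obj (C P') \<and> X \<in> Obj (C P) \<and>
     f \<in> Arr B \<and> Dom B f = P' \<and> Cod B f = P \<and> \<alpha> \<in> Arr (C P') \<and> Dom (C P') \<alpha> = X' \<and> Cod (C P') \<alpha> = FOb (RAr R f) X"
  "Dom el (s, t, f, \<alpha>) = s" "Cod el (s, t, f, \<alpha>) = t"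
  "Ident el (P, X) = ((P, X), (P, X), Ident B P, RUnit R P X)"
  "(s', (Q, Y), g, \<beta>) \<cdot>\<^bsub>el\<^esub> ((P, X), t, f, \<alpha>) =
    ((P, X), (Q, Y), g \<cdot>\<^bsub>B\<^esub> f, RComp R g f Y \<cdot>\<^bsub>C P\<^esub> (FAr (RAr R f) \<beta> \<cdot>\<^bsub>C P\<^esub> \<alpha>))"
  by (auto simp: elements_def hom_def)

declare el_simps(5) [simp del]

lemma el_Obj_cases:
  assumes "x \<in> Obj el"
  obtains P X where "x = (P, X)" "P \<in> Obj B" "X \<in> Obj (C P)"
  using assms by (cases x) auto

text \<open>An arrow of the category of elements is known from \<open>f\<close>, its target object
  \<open>X\<close> and \<open>\<alpha>\<close>, the source being read off from
  \<open>\<alpha>\<close>. An arrow of \<open>C P\<close> has to be composed with the unit to become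
  an arrow over the identity, which gives \<open>vert\<close>; \<open>can\<close> is the lift of
  \<open>f\<close> whose fibre component is an identity.\<close>

definition arr :: "'k \<Rightarrow> 'o \<Rightarrow> 'm \<Rightarrow> ('b, 'k, 'o, 'm) el_ar" where
  "arr f X \<alpha> = ((Dom B f, Dom (C (Dom B f)) \<alpha>), (Cod B f, X), f, \<alpha>)"
definition vert where "vert P \<alpha> = arr (Ident B P) (Cod (C P) \<alpha>) (RUnit R P (Cod (C P) \<alpha>) \<cdot>\<^bsub>C P\<^esub> \<alpha>)"
definition can where "can f X = arr f X (Ident (C (Dom B f)) (FOb (RAr R f) X))"

lemma el_Arr_cases:
  assumes "u \<in> Arr el"
  obtains f X \<alpha> where "u = arr f X \<alpha>" "f \<in> Arr B" "X \<in> Obj (C (Cod B f))" "\<alpha> \<in> Arr (C (Dom B f))"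
    "Cod (C (Dom B f)) \<alpha> = FOb (RAr R f) X"
proof -
  obtain P' X' P X f \<alpha> where u: "u = ((P', X'), (P, X), f, \<alpha>)" by (metis prod.collapse)
  show ?thesis by (rule that[of f X \<alpha>]) (use assms in \<open>auto simp: u arr_def\<close>)
qed

lemmas C_simps = cat_simps'[OF C_category]

lemma arr [simp]:
  assumes "f \<in> Arr B" "X \<in> Obj (C (Cod B f))" "\<alpha> \<in> Arr (C (Dom B f))" "Cod (C (Dom B f)) \<alpha> = FOb (RAr R f) X"
  shows "arr f X \<alpha> \<in> Arr el"
  using assms by (auto simp: arr_def C_simps)

lemma arr_Dom_Cod [simp]: "Dom el (arr f X \<alpha>) = (Dom B f, Dom (C (Dom B f)) \<alpha>)" "Cod el (arr f X \<alpha>) = (Cod B f, X)"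
  by (auto simp: arr_def)

lemma arr_eq [simp]: "arr f X \<alpha> = arr f X \<beta> \<longleftrightarrow> \<alpha> = \<beta>"
  by (auto simp: arr_def)

lemma arr_Comp:
  assumes "f \<in> Arr B" "\<alpha> \<in> Arr (C (Dom B f))" "g \<in> Arr B" "Y \<in> Obj (C (Cod B g))" "\<beta> \<in> Arr (C (Dom B g))"
    "Cod (C (Dom B g)) \<beta> = FOb (RAr R g) Y" "Cod B f = Dom B g" "X = Dom (C (Dom B g)) \<beta>"
    "Cod (C (Dom B f)) \<alpha> = FOb (RAr R f) X"
  shows "arr g Y \<beta> \<cdot>\<^bsub>el\<^esub> arr f X \<alpha> = arr (g \<cdot>\<^bsub>B\<^esub> f) Y (RComp R g f Y \<cdot>\<^bsub>C (Dom B f)\<^esub> (FAr (RAr R f) \<beta> \<cdot>\<^bsub>C (Dom B f)\<^esub> \<alpha>))"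
  using assms by (simp add: arr_def C_simps)

lemma arr_Ident: "\<lbrakk>P \<in> Obj B; X \<in> Obj (C P)\<rbrakk> \<Longrightarrow> Ident el (P, X) = arr (Ident B P) X (RUnit R P X)"
  by (simp add: arr_def el_simps(5))

text \<open>An identity at the source is removed by naturality of the unit and the first unit axiom,
  one at the target by the second unit axiom. Associativity is the cocycle law for
  \<open>RComp\<close>, followed by naturality of \<open>RComp\<close> to bring the last arrow to
  its place.\<close>

lemma el_category: "category el"
proof
  fix u assume u: "u \<in> Arr el"
  obtain f X \<alpha> where u': "u = arr f X \<alpha>" and [simp]: "f \<in> Arr B" "X \<in> Obj (C (Cod B f))" "\<alpha> \<in> Arr (C (Dom B f))"
    "Cod (C (Dom B f)) \<alpha> = FOb (RAr R f) X" using el_Arr_cases[OF u] by blast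
  show "Dom el u \<in> Obj el" "Cod el u \<in> Obj el" by (auto simp: u' C_simps)
  have "RComp R f (Ident B (Dom B f)) X \<cdot>\<^bsub>C (Dom B f)\<^esub> (FAr (RAr R (Ident B (Dom B f))) \<alpha> \<cdot>\<^bsub>C (Dom B f)\<^esub>
      RUnit R (Dom B f) (Dom (C (Dom B f)) \<alpha>)) =
    RComp R f (Ident B (Dom B f)) X \<cdot>\<^bsub>C (Dom B f)\<^esub> (RUnit R (Dom B f) (FOb (RAr R f) X) \<cdot>\<^bsub>C (Dom B f)\<^esub> \<alpha>)"
    using RUnit_nat[of "Dom B f" \<alpha>] by simp
  also have "\<dots> = \<alpha>"
    by (subst category.Comp_reassoc'[OF _ RComp_unit(1)]) (simp_all add: C_simps)
  finally show "u \<cdot>\<^bsub>el\<^esub> Ident el (Dom el u) = u"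
    by (simp add: u' arr_Ident arr_Comp C_simps)
  have "RComp R (Ident B (Cod B f)) f X \<cdot>\<^bsub>C (Dom B f)\<^esub> (FAr (RAr R f) (RUnit R (Cod B f) X) \<cdot>\<^bsub>C (Dom B f)\<^esub> \<alpha>) = \<alpha>"
    by (subst category.Comp_reassoc'[OF _ RComp_unit(2)]) (simp_all add: C_simps)
  then show "Ident el (Cod el u) \<cdot>\<^bsub>el\<^esub> u = u"
    by (simp add: u' arr_Ident arr_Comp C_simps)
next
  fix x assume "x \<in> Obj el"
  then show "Ident el x \<in> Arr el" "Dom el (Ident el x) = x" "Cod el (Ident el x) = x"
    by (auto elim!: el_Obj_cases simp: C_simps arr_Ident)
next
  fix u v assume u: "u \<in> Arr el" and v: "v \<in> Arr el" and c: "Cod el u = Dom el v"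
  obtain f X \<alpha> where u': "u = arr f X \<alpha>" and [simp]: "f \<in> Arr B" "X \<in> Obj (C (Cod B f))" "\<alpha> \<in> Arr (C (Dom B f))"
    "Cod (C (Dom B f)) \<alpha> = FOb (RAr R f) X" using el_Arr_cases[OF u] by blast
  obtain g Y \<beta> where v': "v = arr g Y \<beta>" and [simp]: "g \<in> Arr B" "Y \<in> Obj (C (Cod B g))" "\<beta> \<in> Arr (C (Dom B g))"
    "Cod (C (Dom B g)) \<beta> = FOb (RAr R g) Y" using el_Arr_cases[OF v] by blast
  have [simp]: "Cod B f = Dom B g" "X = Dom (C (Dom B g)) \<beta>" using c by (auto simp: u' v')
  show "v \<cdot>\<^bsub>el\<^esub> u \<in> Arr el" "Dom el (v \<cdot>\<^bsub>el\<^esub> u) = Dom el u" "Cod el (v \<cdot>\<^bsub>el\<^esub> u) = Cod el v"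
    by (simp_all add: u' v' arr_Comp C_simps)
next
  fix u v w assume u: "u \<in> Arr el" and v: "v \<in> Arr el" and w: "w \<in> Arr el"
    and c: "Cod el u = Dom el v" "Cod el v = Dom el w"
  obtain f X \<alpha> where u': "u = arr f X \<alpha>" and [simp]: "f \<in> Arr B" "X \<in> Obj (C (Cod B f))" "\<alpha> \<in> Arr (C (Dom B f))"
    "Cod (C (Dom B f)) \<alpha> = FOb (RAr R f) X" using el_Arr_cases[OF u] by blast
  obtain g Y \<beta> where v': "v = arr g Y \<beta>" and [simp]: "g \<in> Arr B" "Y \<in> Obj (C (Cod B g))" "\<beta> \<in> Arr (C (Dom B g))"
    "Cod (C (Dom B g)) \<beta> = FOb (RAr R g) Y" using el_Arr_cases[OF v] by blast
  obtain h Z \<gamma> where w': "w = arr h Z \<gamma>" and [simp]: "h \<in> Arr B" "Z \<in> Obj (C (Cod B h))" "\<gamma> \<in> Arr (C (Dom B h))"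
    "Cod (C (Dom B h)) \<gamma> = FOb (RAr R h) Z" using el_Arr_cases[OF w] by blast
  have [simp]: "Cod B f = Dom B g" "X = Dom (C (Dom B g)) \<beta>" "Cod B g = Dom B h" "Y = Dom (C (Dom B h)) \<gamma>"
    using c by (auto simp: u' v' w')
  let ?C = "C (Dom B f)" and ?f = "FAr (RAr R f)" and ?g = "FAr (RAr R g)"
  let ?w = "?f \<beta> \<cdot>\<^bsub>?C\<^esub> \<alpha>"
  have "RComp R (h \<cdot>\<^bsub>B\<^esub> g) f Z \<cdot>\<^bsub>?C\<^esub> (?f (RComp R h g Z) \<cdot>\<^bsub>?C\<^esub> (?f (?g \<gamma>) \<cdot>\<^bsub>?C\<^esub> ?w)) =
    RComp R h (g \<cdot>\<^bsub>B\<^esub> f) Z \<cdot>\<^bsub>?C\<^esub> (RComp R g f (FOb (RAr R h) Z) \<cdot>\<^bsub>?C\<^esub> (?f (?g \<gamma>) \<cdot>\<^bsub>?C\<^esub> ?w))"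
    by (rule category.Comp_reassoc[OF _ RComp_assoc]) (simp_all add: C_simps)
  also have "RComp R g f (FOb (RAr R h) Z) \<cdot>\<^bsub>?C\<^esub> (?f (?g \<gamma>) \<cdot>\<^bsub>?C\<^esub> ?w) =
    FAr (RAr R (g \<cdot>\<^bsub>B\<^esub> f)) \<gamma> \<cdot>\<^bsub>?C\<^esub> (RComp R g f Y \<cdot>\<^bsub>?C\<^esub> ?w)"
    using RComp_nat[of f g \<gamma>] by (intro category.Comp_reassoc[of ?C]) (simp_all add: C_simps)
  finally show "(w \<cdot>\<^bsub>el\<^esub> v) \<cdot>\<^bsub>el\<^esub> u = w \<cdot>\<^bsub>el\<^esub> (v \<cdot>\<^bsub>el\<^esub> u)"
    by (simp add: u' v' w' arr_Comp C_simps)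
qed

sublocale el: category el by (rule el_category)

lemma proj_Ob [simp]: "\<lbrakk>P \<in> Obj B; X \<in> Obj (C P)\<rbrakk> \<Longrightarrow> FOb \<pi> (P, X) = P"
  by (simp add: elements_proj_def)

lemma proj_Ar [simp]: "arr f X \<alpha> \<in> Arr el \<Longrightarrow> FAr \<pi> (arr f X \<alpha>) = f"
  by (simp add: elements_proj_def arr_def)

lemma proj_functor: "is_functor el B \<pi>"
proof (rule is_functorI)
  fix u assume u: "u \<in> Arr el"
  then show "FAr \<pi> u \<in> Arr B \<and> Dom B (FAr \<pi> u) = FOb \<pi> (Dom el u) \<and> Cod B (FAr \<pi> u) = FOb \<pi> (Cod el u)"
    by - (erule el_Arr_cases, simp add: C_simps)
  fix v assume v: "v \<in> Arr el" and "Cod el u = Dom el v"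
  moreover obtain f X \<alpha> where "u = arr f X \<alpha>" "f \<in> Arr B" "X \<in> Obj (C (Cod B f))" "\<alpha> \<in> Arr (C (Dom B f))"
    "Cod (C (Dom B f)) \<alpha> = FOb (RAr R f) X" using el_Arr_cases[OF u] by blast
  moreover obtain g Y \<beta> where "v = arr g Y \<beta>" "g \<in> Arr B" "Y \<in> Obj (C (Cod B g))" "\<beta> \<in> Arr (C (Dom B g))"
    "Cod (C (Dom B g)) \<beta> = FOb (RAr R g) Y" using el_Arr_cases[OF v] by blast
  ultimately show "FAr \<pi> (v \<cdot>\<^bsub>el\<^esub> u) = FAr \<pi> v \<cdot>\<^bsub>B\<^esub> FAr \<pi> u"
    by (simp add: arr_Comp C_simps)
next
  fix x assume x: "x \<in> Obj el"
  then show "FAr \<pi> (Ident el x) = Ident B (FOb \<pi> x)"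
    by - (erule el_Obj_cases, simp add: arr_Ident C_simps)
qed (auto simp: el_category base_category elements_proj_def elim!: el_Obj_cases)

sublocale el: category_over el B \<pi> by unfold_locales (rule proj_functor)

text \<open>The composition equation can be solved for the missing component, because the
  restriction of \<open>\<alpha>\<close> and the composition isomorphism are invertible in the
  groupoid of the source.\<close>

lemma el_cartesian:
  assumes u: "u \<in> Arr el"
  shows "cartesian el B \<pi> u"
  unfolding cartesian_def
proof (intro conjI ballI impI)
  show "u \<in> Arr el" by fact
  fix v \<rho> assume v: "v \<in> Arr el" and r: "\<rho> \<in> hom B (FOb \<pi> (Dom el v)) (FOb \<pi> (Dom el u))"
    and c: "Cod el v = Cod el u \<and> FAr \<pi> u \<cdot>\<^bsub>B\<^esub> \<rho> = FAr \<pi> v"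
  obtain f X \<alpha> where u': "u = arr f X \<alpha>" and [simp]: "f \<in> Arr B" "X \<in> Obj (C (Cod B f))" "\<alpha> \<in> Arr (C (Dom B f))"
    "Cod (C (Dom B f)) \<alpha> = FOb (RAr R f) X" using el_Arr_cases[OF u] by blast
  obtain \<beta> where v': "v = arr (f \<cdot>\<^bsub>B\<^esub> \<rho>) X \<beta>" and [simp]: "\<rho> \<in> Arr B" "Cod B \<rho> = Dom B f"
    "\<beta> \<in> Arr (C (Dom B \<rho>))" "Cod (C (Dom B \<rho>)) \<beta> = FOb (RAr R (f \<cdot>\<^bsub>B\<^esub> \<rho>)) X"
  proof -
    obtain g Y \<beta> where v': "v = arr g Y \<beta>" and g: "g \<in> Arr B" "Y \<in> Obj (C (Cod B g))" "\<beta> \<in> Arr (C (Dom B g))"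
      "Cod (C (Dom B g)) \<beta> = FOb (RAr R g) Y" using el_Arr_cases[OF v] by blast
    have r': "\<rho> \<in> Arr B" "Dom B \<rho> = Dom B g" "Cod B \<rho> = Dom B f" using r g by (simp_all add: u' v' hom_def C_simps)
    have g': "g = f \<cdot>\<^bsub>B\<^esub> \<rho>" and "Y = X" using c g by (simp_all add: u' v')
    show ?thesis by (rule that[of \<beta>]) (use v' g r' \<open>Y = X\<close> in \<open>simp_all flip: g'\<close>)
  qed
  let ?C = "C (Dom B \<rho>)"
  interpret C: category ?C by simp
  define \<delta> where "\<delta> = inv_arr ?C (FAr (RAr R \<rho>) \<alpha>) \<cdot>\<^bsub>?C\<^esub> (inv_arr ?C (RComp R f \<rho> X) \<cdot>\<^bsub>?C\<^esub> \<beta>)"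
  have d[simp]: "\<delta> \<in> Arr ?C" "Dom ?C \<delta> = Dom ?C \<beta>" "Cod ?C \<delta> = FOb (RAr R \<rho>) (Dom (C (Dom B f)) \<alpha>)"
    by (simp_all add: \<delta>_def)
  have d': "RComp R f \<rho> X \<cdot>\<^bsub>?C\<^esub> (FAr (RAr R \<rho>) \<alpha> \<cdot>\<^bsub>?C\<^esub> \<delta>) = \<beta>" by (simp add: \<delta>_def)
  have comp: "u \<cdot>\<^bsub>el\<^esub> arr \<rho> (Dom (C (Dom B f)) \<alpha>) \<epsilon> = arr (f \<cdot>\<^bsub>B\<^esub> \<rho>) X (RComp R f \<rho> X \<cdot>\<^bsub>?C\<^esub> (FAr (RAr R \<rho>) \<alpha> \<cdot>\<^bsub>?C\<^esub> \<epsilon>))"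
    if "\<epsilon> \<in> Arr ?C" "Cod ?C \<epsilon> = FOb (RAr R \<rho>) (Dom (C (Dom B f)) \<alpha>)" for \<epsilon>
    using that unfolding u' by (simp add: arr_Comp)
  let ?w = "arr \<rho> (Dom (C (Dom B f)) \<alpha>) \<delta>"
  show "\<exists>!w. w \<in> hom el (Dom el v) (Dom el u) \<and> FAr \<pi> w = \<rho> \<and> u \<cdot>\<^bsub>el\<^esub> w = v"
  proof (rule ex1I[where a = ?w])
    show "?w \<in> hom el (Dom el v) (Dom el u) \<and> FAr \<pi> ?w = \<rho> \<and> u \<cdot>\<^bsub>el\<^esub> ?w = v"
      by (simp add: hom_def comp d') (simp add: u' v' C_simps)
    fix w assume w: "w \<in> hom el (Dom el v) (Dom el u) \<and> FAr \<pi> w = \<rho> \<and> u \<cdot>\<^bsub>el\<^esub> w = v"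
    then have w1: "w \<in> Arr el" "Dom el w = Dom el v" "Cod el w = Dom el u" "FAr \<pi> w = \<rho>" "u \<cdot>\<^bsub>el\<^esub> w = v"
      by (auto simp: hom_def)
    obtain f' X' \<epsilon> where w': "w = arr f' X' \<epsilon>" "f' \<in> Arr B" "X' \<in> Obj (C (Cod B f'))" "\<epsilon> \<in> Arr (C (Dom B f'))"
      "Cod (C (Dom B f')) \<epsilon> = FOb (RAr R f') X'" using el_Arr_cases[OF w1(1)] by blast
    have e: "f' = \<rho>" "X' = Dom (C (Dom B f)) \<alpha>" using w1 w' by (auto simp: u')
    have e'[simp]: "\<epsilon> \<in> Arr ?C" "Cod ?C \<epsilon> = FOb (RAr R \<rho>) (Dom (C (Dom B f)) \<alpha>)" "Dom ?C \<epsilon> = Dom ?C \<beta>"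
      using w1(2) w' e by (auto simp: v')
    have \<beta>: "RComp R f \<rho> X \<cdot>\<^bsub>?C\<^esub> (FAr (RAr R \<rho>) \<alpha> \<cdot>\<^bsub>?C\<^esub> \<epsilon>) = \<beta>"
      using w1(5) comp[of \<epsilon>] by (simp add: w'(1) e v')
    then have "\<delta> = \<epsilon>" by (simp add: \<delta>_def \<beta>[symmetric])
    then show "w = ?w" by (simp add: w'(1) e)
  qed
qed

lemma el_right_fibration: "right_fibration el B \<pi>"
proof (rule el.right_fibrationI)
  fix \<tau> x assume "\<tau> \<in> Arr B" "x \<in> Obj el" "FOb \<pi> x = Cod B \<tau>"
  then show "\<exists>u\<in>Arr el. FAr \<pi> u = \<tau> \<and> Cod el u = x"
    by (auto elim!: el_Obj_cases simp: C_simps can_def intro!: bexI[where x = "can \<tau> X" for X])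
qed (rule el_cartesian)

text \<open>Automorphisms in the fibre over \<open>P\<close> are automorphisms in \<open>C P\<close>
  followed by the unit, so finiteness carries over.\<close>

lemma el_locally_finite:
  assumes P: "P \<in> Obj B" and lf: "locally_finite_groupoid (C P)"
  shows "locally_finite_groupoid (fibre el B \<pi> P)"
  unfolding locally_finite_groupoid_def
proof (intro conjI ballI)
  show "groupoid (fibre el B \<pi> P)" using el_right_fibration P by (simp add: right_fibration_def)
  fix x assume "x \<in> Obj (fibre el B \<pi> P)"
  then obtain X where x: "x = (P, X)" "X \<in> Obj (C P)" by (auto elim!: el_Obj_cases)
  interpret C: category "C P" using P by simp
  have "automorphisms (fibre el B \<pi> P) x \<subseteq> (\<lambda>\<beta>. arr (Ident B P) X (RUnit R P X \<cdot>\<^bsub>C P\<^esub> \<beta>)) ` automorphisms (C P) X"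
  proof
    fix u assume "u \<in> automorphisms (fibre el B \<pi> P) x"
    then have u: "u \<in> Arr el" "FAr \<pi> u = Ident B P" "Dom el u = (P, X)" "Cod el u = (P, X)"
      by (auto simp: automorphisms_def hom_def x)
    obtain f Y \<alpha> where u': "u = arr f Y \<alpha>" "f \<in> Arr B" "Y \<in> Obj (C (Cod B f))" "\<alpha> \<in> Arr (C (Dom B f))"
      "Cod (C (Dom B f)) \<alpha> = FOb (RAr R f) Y" using el_Arr_cases[OF u(1)] by blast
    have e: "f = Ident B P" "Y = X" using u u' by auto
    have a[simp]: "\<alpha> \<in> Arr (C P)" "Dom (C P) \<alpha> = X" "Cod (C P) \<alpha> = FOb (RAr R (Ident B P)) X"
      using u u' P by (auto simp: e)
    note [simp] = P x
    have "inv_arr (C P) (RUnit R P X) \<cdot>\<^bsub>C P\<^esub> \<alpha> \<in> automorphisms (C P) X"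
      by (simp add: automorphisms_def hom_def)
    moreover have "u = arr (Ident B P) X (RUnit R P X \<cdot>\<^bsub>C P\<^esub> (inv_arr (C P) (RUnit R P X) \<cdot>\<^bsub>C P\<^esub> \<alpha>))"
      by (simp add: u' e)
    ultimately show "u \<in> (\<lambda>\<beta>. arr (Ident B P) X (RUnit R P X \<cdot>\<^bsub>C P\<^esub> \<beta>)) ` automorphisms (C P) X" by blast
  qed
  moreover have "finite (automorphisms (C P) X)" using lf x by (simp add: locally_finite_groupoid_def)
  ultimately show "finite (automorphisms (fibre el B \<pi> P) x)" by (meson finite_imageI finite_subset)
qed

lemma vert [simp]:
  assumes "P \<in> Obj B" "\<alpha> \<in> Arr (C P)"
  shows "vert P \<alpha> \<in> Arr el" "Dom el (vert P \<alpha>) = (P, Dom (C P) \<alpha>)" "Cod el (vert P \<alpha>) = (P, Cod (C P) \<alpha>)"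
  using assms by (auto simp: vert_def C_simps)

lemma can [simp]:
  assumes "f \<in> Arr B" "X \<in> Obj (C (Cod B f))"
  shows "can f X \<in> Arr el" "Dom el (can f X) = (Dom B f, FOb (RAr R f) X)" "Cod el (can f X) = (Cod B f, X)"
  using assms by (auto simp: can_def C_simps)

text \<open>Naturality moves the unit inside \<open>vert\<close> next to \<open>RComp\<close>, where
  the two cancel by the first unit axiom; precomposition with a vertical arrow thus takes place in
  the fibre.\<close>

lemma arr_vert:
  assumes [simp]: "f \<in> Arr B" "X \<in> Obj (C (Cod B f))" "\<beta> \<in> Arr (C (Dom B f))" "Cod (C (Dom B f)) \<beta> = FOb (RAr R f) X"
    "\<alpha> \<in> Arr (C (Dom B f))" "Cod (C (Dom B f)) \<alpha> = Dom (C (Dom B f)) \<beta>"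
  shows "arr f X \<beta> \<cdot>\<^bsub>el\<^esub> vert (Dom B f) \<alpha> = arr f X (\<beta> \<cdot>\<^bsub>C (Dom B f)\<^esub> \<alpha>)"
proof -
  let ?P = "Dom B f"
  let ?C = "C ?P"
  interpret C: category ?C by simp
  have "RComp R f (Ident B ?P) X \<cdot>\<^bsub>?C\<^esub> (FAr (RAr R (Ident B ?P)) \<beta> \<cdot>\<^bsub>?C\<^esub> (RUnit R ?P (Dom ?C \<beta>) \<cdot>\<^bsub>?C\<^esub> \<alpha>)) =
    RComp R f (Ident B ?P) X \<cdot>\<^bsub>?C\<^esub> (RUnit R ?P (FOb (RAr R f) X) \<cdot>\<^bsub>?C\<^esub> (\<beta> \<cdot>\<^bsub>?C\<^esub> \<alpha>))"
    using C.Comp_reassoc[OF RUnit_nat[of ?P \<beta>, symmetric], of \<alpha>] by simp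
  also have "\<dots> = \<beta> \<cdot>\<^bsub>?C\<^esub> \<alpha>"
    by (subst C.Comp_reassoc'[OF RComp_unit(1)]) simp_all
  finally show ?thesis by (simp add: vert_def arr_Comp)
qed

text \<open>Here the second unit axiom cancels the unit inside \<open>vert\<close>, and restriction
  along \<open>f\<close> acts on \<open>\<alpha>\<close>. This is how naturality of the structure
  isomorphisms becomes visible in the category of elements.\<close>

lemma vert_arr:
  assumes [simp]: "f \<in> Arr B" "\<alpha> \<in> Arr (C (Cod B f))" "\<gamma> \<in> Arr (C (Dom B f))"
    "Cod (C (Dom B f)) \<gamma> = FOb (RAr R f) (Dom (C (Cod B f)) \<alpha>)"
  shows "vert (Cod B f) \<alpha> \<cdot>\<^bsub>el\<^esub> arr f (Dom (C (Cod B f)) \<alpha>) \<gamma> =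
    arr f (Cod (C (Cod B f)) \<alpha>) (FAr (RAr R f) \<alpha> \<cdot>\<^bsub>C (Dom B f)\<^esub> \<gamma>)"
proof -
  let ?Q = "Cod B f" and ?C = "C (Dom B f)"
  let ?Y = "Cod (C ?Q) \<alpha>"
  interpret C: category ?C by simp
  interpret Q: category "C ?Q" by simp
  have "RComp R (Ident B ?Q) f ?Y \<cdot>\<^bsub>?C\<^esub> (FAr (RAr R f) (RUnit R ?Q ?Y) \<cdot>\<^bsub>?C\<^esub> (FAr (RAr R f) \<alpha> \<cdot>\<^bsub>?C\<^esub> \<gamma>)) =
    FAr (RAr R f) \<alpha> \<cdot>\<^bsub>?C\<^esub> \<gamma>"
    by (subst C.Comp_reassoc'[OF RComp_unit(2)]) simp_all
  then show ?thesis by (simp add: vert_def arr_Comp)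
qed

lemma vert_Ident: "\<lbrakk>P \<in> Obj B; X \<in> Obj (C P)\<rbrakk> \<Longrightarrow> vert P (Ident (C P) X) = Ident el (P, X)"
  by (simp add: vert_def arr_Ident C_simps)

lemma vert_Comp:
  assumes [simp]: "P \<in> Obj B" "\<alpha> \<in> Arr (C P)" "\<beta> \<in> Arr (C P)" "Cod (C P) \<alpha> = Dom (C P) \<beta>"
  shows "vert P (\<beta> \<cdot>\<^bsub>C P\<^esub> \<alpha>) = vert P \<beta> \<cdot>\<^bsub>el\<^esub> vert P \<alpha>"
proof -
  interpret C: category "C P" by simp
  show ?thesis
    using arr_vert[of "Ident B P" "Cod (C P) \<beta>" "RUnit R P (Cod (C P) \<beta>) \<cdot>\<^bsub>C P\<^esub> \<beta>" \<alpha>] by (simp add: vert_def)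
qed

text \<open>The unit is invertible, so \<open>vert\<close> loses nothing; equations in a fibre may
  be checked in the category of elements.\<close>

lemma vert_inj:
  assumes [simp]: "P \<in> Obj B" "\<alpha> \<in> Arr (C P)" "\<beta> \<in> Arr (C P)" and e: "vert P \<alpha> = vert P \<beta>"
  shows "\<alpha> = \<beta>"
proof -
  interpret C: category "C P" by simp
  have c: "Cod (C P) \<alpha> = Cod (C P) \<beta>" using e by (simp add: vert_def arr_def)
  then have "RUnit R P (Cod (C P) \<beta>) \<cdot>\<^bsub>C P\<^esub> \<alpha> = RUnit R P (Cod (C P) \<beta>) \<cdot>\<^bsub>C P\<^esub> \<beta>" using e by (simp add: vert_def)
  then show ?thesis using c by - (rule C.iso_cancel_left[of "RUnit R P (Cod (C P) \<beta>)"]; simp)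
qed

end

section \<open>From pseudo-natural transformations to functors over the base\<close>

locale pseudo_natural_on = R: pseudo_functor_on B R + S: pseudo_functor_on B S
  for B :: "('b, 'k) cat" and R S :: "('b, 'k, 'o, 'm) pseudo_func" +
  fixes \<eta> :: "('b, 'k, 'o, 'm) pseudo_nat"
  assumes natural: "pseudo_natural B R S \<eta>"
begin

lemma NOb_functor: "P \<in> Obj B \<Longrightarrow> is_functor (R.C P) (S.C P) (NOb \<eta> P)"
  using natural by (simp add: pseudo_natural_def)

lemmas NOb_simps [simp] = functor_simps(3-8)[OF NOb_functor]

lemma NAr_nat_iso: "f \<in> Arr B \<Longrightarrow> nat_iso (R.C (Cod B f)) (S.C (Dom B f))
    (comp_func (R.C (Cod B f)) (NOb \<eta> (Dom B f)) (RAr R f))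
    (comp_func (R.C (Cod B f)) (RAr S f) (NOb \<eta> (Cod B f))) (NAr \<eta> f)"
  using natural by (simp add: pseudo_natural_def)

lemma NAr [simp]:
  assumes "f \<in> Arr B" "X \<in> Obj (R.C (Cod B f))" "Dom B f = P"
  shows "NAr \<eta> f X \<in> Arr (S.C P)" "Dom (S.C P) (NAr \<eta> f X) = FOb (NOb \<eta> P) (FOb (RAr R f) X)"
    "Cod (S.C P) (NAr \<eta> f X) = FOb (RAr S f) (FOb (NOb \<eta> (Cod B f)) X)"
  using nat_iso_simps[OF NAr_nat_iso[OF assms(1)] assms(2)] assms by auto

lemma NAr_nat:
  assumes "f \<in> Arr B" "u \<in> Arr (R.C (Cod B f))"
  shows "NAr \<eta> f (Cod (R.C (Cod B f)) u) \<cdot>\<^bsub>S.C (Dom B f)\<^esub> FAr (NOb \<eta> (Dom B f)) (FAr (RAr R f) u) =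
    FAr (RAr S f) (FAr (NOb \<eta> (Cod B f)) u) \<cdot>\<^bsub>S.C (Dom B f)\<^esub> NAr \<eta> f (Dom (R.C (Cod B f)) u)"
  using nat_iso_nat[OF NAr_nat_iso[OF assms(1)] assms(2)] assms by simp

lemma NAr_comp:
  assumes "f \<in> Arr B" "g \<in> Arr B" "Cod B f = Dom B g" "X \<in> Obj (R.C (Cod B g))"
  shows "NAr \<eta> (g \<cdot>\<^bsub>B\<^esub> f) X \<cdot>\<^bsub>S.C (Dom B f)\<^esub> FAr (NOb \<eta> (Dom B f)) (RComp R g f X) =
           RComp S g f (FOb (NOb \<eta> (Cod B g)) X) \<cdot>\<^bsub>S.C (Dom B f)\<^esub>
             (FAr (RAr S f) (NAr \<eta> g X) \<cdot>\<^bsub>S.C (Dom B f)\<^esub> NAr \<eta> f (FOb (RAr R g) X))"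
  using natural assms by (simp add: pseudo_natural_def)

lemma NAr_unit:
  assumes "P \<in> Obj B" "X \<in> Obj (R.C P)"
  shows "NAr \<eta> (Ident B P) X \<cdot>\<^bsub>S.C P\<^esub> FAr (NOb \<eta> P) (RUnit R P X) = RUnit S P (FOb (NOb \<eta> P) X)"
  using natural assms by (simp add: pseudo_natural_def)

abbreviation em where "em \<equiv> elements_map B R S \<eta>"

lemma em_Ob [simp]: "\<lbrakk>P \<in> Obj B; X \<in> Obj (R.C P)\<rbrakk> \<Longrightarrow> FOb em (P, X) = (P, FOb (NOb \<eta> P) X)"
  by (simp add: elements_map_def Let_def)

lemma em_Ar [simp]:
  assumes "f \<in> Arr B" "X \<in> Obj (R.C (Cod B f))" "\<alpha> \<in> Arr (R.C (Dom B f))" "Cod (R.C (Dom B f)) \<alpha> = FOb (RAr R f) X"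
  shows "FAr em (R.arr f X \<alpha>) = S.arr f (FOb (NOb \<eta> (Cod B f)) X) (NAr \<eta> f X \<cdot>\<^bsub>S.C (Dom B f)\<^esub> FAr (NOb \<eta> (Dom B f)) \<alpha>)"
  using assms R.arr[OF assms] by (simp add: elements_map_def Let_def R.arr_def S.arr_def S.C_simps)

lemma em_functor: "is_functor R.el S.el em"
proof (rule is_functorI)
  fix x assume "x \<in> Obj R.el"
  then show "FOb em x \<in> Obj S.el" "FAr em (Ident R.el x) = Ident S.el (FOb em x)"
    by (auto elim!: R.el_Obj_cases simp: R.arr_Ident S.arr_Ident R.C_simps NAr_unit)
next
  fix u assume u: "u \<in> Arr R.el"
  obtain f X \<alpha> where u': "u = R.arr f X \<alpha>" and [simp]: "f \<in> Arr B" "X \<in> Obj (R.C (Cod B f))" "\<alpha> \<in> Arr (R.C (Dom B f))"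
    "Cod (R.C (Dom B f)) \<alpha> = FOb (RAr R f) X" using R.el_Arr_cases[OF u] by blast
  show "FAr em u \<in> Arr S.el \<and> Dom S.el (FAr em u) = FOb em (Dom R.el u) \<and> Cod S.el (FAr em u) = FOb em (Cod R.el u)"
    by (simp add: u' R.C_simps S.C_simps)
  fix v assume v: "v \<in> Arr R.el" and c: "Cod R.el u = Dom R.el v"
  obtain g Y \<beta> where v': "v = R.arr g Y \<beta>" and [simp]: "g \<in> Arr B" "Y \<in> Obj (R.C (Cod B g))" "\<beta> \<in> Arr (R.C (Dom B g))"
    "Cod (R.C (Dom B g)) \<beta> = FOb (RAr R g) Y" using R.el_Arr_cases[OF v] by blast
  have [simp]: "Cod B f = Dom B g" "X = Dom (R.C (Dom B g)) \<beta>" using c by (auto simp: u' v')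
  let ?C = "S.C (Dom B f)" and ?N = "FAr (NOb \<eta> (Dom B f))" and ?f = "FAr (RAr S f)"
  interpret S_dom: category ?C by simp
  \<comment> \<open>The composition law for \<open>\<eta>\<close>, followed by naturality of
    \<open>NAr \<eta> f\<close> at \<open>\<beta>\<close>, brings the expression into the form of a
    composite in the target.\<close>
  have "NAr \<eta> (g \<cdot>\<^bsub>B\<^esub> f) Y \<cdot>\<^bsub>?C\<^esub> (?N (RComp R g f Y) \<cdot>\<^bsub>?C\<^esub> (?N (FAr (RAr R f) \<beta>) \<cdot>\<^bsub>?C\<^esub> ?N \<alpha>)) =
    (RComp S g f (FOb (NOb \<eta> (Cod B g)) Y) \<cdot>\<^bsub>?C\<^esub> (?f (NAr \<eta> g Y) \<cdot>\<^bsub>?C\<^esub> NAr \<eta> f (FOb (RAr R g) Y))) \<cdot>\<^bsub>?C\<^esub>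
      (?N (FAr (RAr R f) \<beta>) \<cdot>\<^bsub>?C\<^esub> ?N \<alpha>)"
    by (rule S_dom.Comp_reassoc'[OF NAr_comp]) simp_all
  also have "\<dots> = RComp S g f (FOb (NOb \<eta> (Cod B g)) Y) \<cdot>\<^bsub>?C\<^esub> (?f (NAr \<eta> g Y) \<cdot>\<^bsub>?C\<^esub>
      (NAr \<eta> f (FOb (RAr R g) Y) \<cdot>\<^bsub>?C\<^esub> (?N (FAr (RAr R f) \<beta>) \<cdot>\<^bsub>?C\<^esub> ?N \<alpha>)))"
    by simp
  also have "NAr \<eta> f (FOb (RAr R g) Y) \<cdot>\<^bsub>?C\<^esub> (?N (FAr (RAr R f) \<beta>) \<cdot>\<^bsub>?C\<^esub> ?N \<alpha>) =
      ?f (FAr (NOb \<eta> (Dom B g)) \<beta>) \<cdot>\<^bsub>?C\<^esub> (NAr \<eta> f X \<cdot>\<^bsub>?C\<^esub> ?N \<alpha>)"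
    using NAr_nat[of f \<beta>] by (intro S_dom.Comp_reassoc) (simp_all add: R.C_simps)
  finally show "FAr em (v \<cdot>\<^bsub>R.el\<^esub> u) = FAr em v \<cdot>\<^bsub>S.el\<^esub> FAr em u"
    by (simp add: u' v' R.arr_Comp S.arr_Comp R.C_simps S.C_simps)
qed (auto simp: elements_map_def Let_def R.el_category S.el_category)

lemma em_over: "functor_over (R.el, R.\<pi>) (S.el, S.\<pi>) em"
proof (rule functor_overI[where B = B])
  fix x assume "x \<in> Obj (fst (R.el, R.\<pi>))"
  then show "FOb (snd (S.el, S.\<pi>)) (FOb em x) = FOb (snd (R.el, R.\<pi>)) x"
    by (auto elim!: R.el_Obj_cases)
next
  fix u assume "u \<in> Arr (fst (R.el, R.\<pi>))"
  then have "u \<in> Arr R.el" by simp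
  then show "FAr (snd (S.el, S.\<pi>)) (FAr em u) = FAr (snd (R.el, R.\<pi>)) u"
    by - (erule R.el_Arr_cases, simp add: S.C_simps)
qed (use em_functor R.proj_functor S.proj_functor in simp_all)

end

lemma pseudo_nat_eqI:
  assumes "pseudo_natural_on B R S \<eta>" "pseudo_natural_on B R S \<theta>"
    and "\<And>P. P \<in> Obj B \<Longrightarrow> NOb \<eta> P = NOb \<theta> P"
    and "\<And>f X. \<lbrakk>f \<in> Arr B; X \<in> Obj (ROb R (Cod B f))\<rbrakk> \<Longrightarrow> NAr \<eta> f X = NAr \<theta> f X"
  shows "\<eta> = \<theta>"
proof -
  interpret \<eta>: pseudo_natural_on B R S \<eta> by fact
  interpret \<theta>: pseudo_natural_on B R S \<theta> by fact
  have "NAr \<eta> f = NAr \<theta> f" if "f \<in> Arr B" for f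
    by (rule extensionalityI[OF nat_iso_ext[OF \<eta>.NAr_nat_iso[OF that]] nat_iso_ext[OF \<theta>.NAr_nat_iso[OF that]]])
       (rule assms(4)[OF that])
  moreover have "NOb \<eta> \<in> extensional (Obj B)" "NOb \<theta> \<in> extensional (Obj B)" "NAr \<eta> \<in> extensional (Arr B)" "NAr \<theta> \<in> extensional (Arr B)"
    using \<eta>.natural \<theta>.natural by (simp_all add: pseudo_natural_def)
  ultimately show "\<eta> = \<theta>"
    using assms(3) by (intro pseudo_nat.equality) (auto intro: extensionalityI)
qed

text \<open>The components are recovered from the induced functor: the isomorphisms
  \<open>NAr\<close> from its values on canonical lifts, the functors \<open>NOb\<close> from its
  values on vertical arrows after cancelling the unit.\<close>

lemma elements_map_inj:
  assumes "pseudo_natural_on B R S \<eta>" "pseudo_natural_on B R S \<theta>"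
    and eq: "elements_map B R S \<eta> = elements_map B R S \<theta>"
  shows "\<eta> = \<theta>"
proof -
  interpret \<eta>: pseudo_natural_on B R S \<eta> by fact
  interpret \<theta>: pseudo_natural_on B R S \<theta> by fact
  have Ob: "FOb (NOb \<eta> P) X = FOb (NOb \<theta> P) X" if "P \<in> Obj B" "X \<in> Obj (ROb R P)" for P X
    using \<eta>.em_Ob[OF that] \<theta>.em_Ob[OF that] eq by simp
  have Ar: "NAr \<eta> f X \<cdot>\<^bsub>ROb S (Dom B f)\<^esub> FAr (NOb \<eta> (Dom B f)) \<alpha> = NAr \<theta> f X \<cdot>\<^bsub>ROb S (Dom B f)\<^esub> FAr (NOb \<theta> (Dom B f)) \<alpha>"
    if "f \<in> Arr B" "X \<in> Obj (ROb R (Cod B f))" "\<alpha> \<in> Arr (ROb R (Dom B f))" "Cod (ROb R (Dom B f)) \<alpha> = FOb (RAr R f) X"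
    for f X \<alpha>
    using \<eta>.em_Ar[OF that] \<theta>.em_Ar[OF that] eq by (simp add: \<eta>.S.arr_def)
  have N: "NAr \<eta> f X = NAr \<theta> f X" if [simp]: "f \<in> Arr B" "X \<in> Obj (ROb R (Cod B f))" for f X
    using Ar[OF that, of "Ident (ROb R (Dom B f)) (FOb (RAr R f) X)"] Ob[of "Dom B f"]
    by (simp add: \<eta>.R.C_simps \<eta>.S.C_simps)
  have "NOb \<eta> P = NOb \<theta> P" if P[simp]: "P \<in> Obj B" for P
  proof (rule functor_eqI[OF \<eta>.NOb_functor[OF P] \<theta>.NOb_functor[OF P]])
    show "FOb (NOb \<eta> P) X = FOb (NOb \<theta> P) X" if "X \<in> Obj (ROb R P)" for X by (rule Ob[OF P that])
    fix u assume [simp]: "u \<in> Arr (ROb R P)"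
    interpret SP: category "ROb S P" by simp
    interpret RP: category "ROb R P" by simp
    let ?X = "Cod (ROb R P) u"
    \<comment> \<open>\<open>NAr_unit\<close> exhibits the unit composed with
      \<open>FAr (NOb \<eta> P) u\<close> as the value of the induced functor on the vertical arrow
      of \<open>u\<close>, and these values agree for \<open>\<eta>\<close> and
      \<open>\<theta>\<close>.\<close>
    have "RUnit S P (FOb (NOb \<eta> P) ?X) \<cdot>\<^bsub>ROb S P\<^esub> FAr (NOb \<eta> P) u =
      NAr \<eta> (Ident B P) ?X \<cdot>\<^bsub>ROb S P\<^esub> FAr (NOb \<eta> P) (RUnit R P ?X \<cdot>\<^bsub>ROb R P\<^esub> u)"
      by (subst \<eta>.NAr_unit[symmetric]) simp_all
    also have "\<dots> = NAr \<theta> (Ident B P) ?X \<cdot>\<^bsub>ROb S P\<^esub> FAr (NOb \<theta> P) (RUnit R P ?X \<cdot>\<^bsub>ROb R P\<^esub> u)"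
      using Ar[of "Ident B P" ?X "RUnit R P ?X \<cdot>\<^bsub>ROb R P\<^esub> u"] by simp
    also have "\<dots> = RUnit S P (FOb (NOb \<theta> P) ?X) \<cdot>\<^bsub>ROb S P\<^esub> FAr (NOb \<theta> P) u"
      by (subst \<theta>.NAr_unit[symmetric]) simp_all
    finally have "RUnit S P (FOb (NOb \<theta> P) ?X) \<cdot>\<^bsub>ROb S P\<^esub> FAr (NOb \<eta> P) u =
      RUnit S P (FOb (NOb \<theta> P) ?X) \<cdot>\<^bsub>ROb S P\<^esub> FAr (NOb \<theta> P) u" by (simp add: Ob)
    then show "FAr (NOb \<eta> P) u = FAr (NOb \<theta> P) u"
      by - (rule SP.iso_cancel_left[of "RUnit S P (FOb (NOb \<theta> P) ?X)"]; simp add: Ob)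
  qed
  then show "\<eta> = \<theta>" using pseudo_nat_eqI[OF assms(1,2)] N by blast
qed

section \<open>From functors over the base to pseudo-natural transformations\<close>

locale elements_functor = R: pseudo_functor_on B R + S: pseudo_functor_on B S
  for B :: "('b, 'k) cat" and R S :: "('b, 'k, 'o, 'm) pseudo_func" +
  fixes c
  assumes c_over: "functor_over (R.el, R.\<pi>) (S.el, S.\<pi>) c"
begin

lemmas c_functor = functor_over_functor[OF c_over, simplified]

definition cOb where "cOb P X = snd (FOb c (P, X))"
definition cAr where "cAr u = snd (snd (snd (FAr c u)))"

lemma c_Ob:
  assumes "P \<in> Obj B" "X \<in> Obj (R.C P)"
  shows "FOb c (P, X) = (P, cOb P X)" "cOb P X \<in> Obj (S.C P)"
proof -
  have x: "(P, X) \<in> Obj R.el" using assms by simp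
  obtain Q Y where e: "FOb c (P, X) = (Q, Y)" by fastforce
  have o: "(Q, Y) \<in> Obj S.el" using functor_Ob[OF c_functor x] e by simp
  then have "Q = P" using functor_over_Ob[OF c_over, of "(P, X)"] x e assms by simp
  then show "FOb c (P, X) = (P, cOb P X)" "cOb P X \<in> Obj (S.C P)" using e o by (auto simp: cOb_def)
qed

lemma c_Ar:
  assumes "f \<in> Arr B" "X \<in> Obj (R.C (Cod B f))" "\<alpha> \<in> Arr (R.C (Dom B f))" "Cod (R.C (Dom B f)) \<alpha> = FOb (RAr R f) X"
  shows "FAr c (R.arr f X \<alpha>) = S.arr f (cOb (Cod B f) X) (cAr (R.arr f X \<alpha>))"
    "cAr (R.arr f X \<alpha>) \<in> Arr (S.C (Dom B f))" "Dom (S.C (Dom B f)) (cAr (R.arr f X \<alpha>)) = cOb (Dom B f) (Dom (R.C (Dom B f)) \<alpha>)"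
    "Cod (S.C (Dom B f)) (cAr (R.arr f X \<alpha>)) = FOb (RAr S f) (cOb (Cod B f) X)"
proof -
  let ?u = "R.arr f X \<alpha>"
  have u: "?u \<in> Arr R.el" using assms by simp
  have cu: "FAr c ?u \<in> Arr S.el" by (rule functor_Ar[OF c_functor u])
  obtain g Y \<beta> where v': "FAr c ?u = S.arr g Y \<beta>" and g: "g \<in> Arr B" "Y \<in> Obj (S.C (Cod B g))" "\<beta> \<in> Arr (S.C (Dom B g))"
    "Cod (S.C (Dom B g)) \<beta> = FOb (RAr S g) Y" using S.el_Arr_cases[OF cu] by blast
  have gf: "g = f" using functor_over_Ar[OF c_over, of ?u] u cu by (simp add: v')
  have "cAr ?u = \<beta>" by (simp add: cAr_def v' S.arr_def)
  moreover have "Y = cOb (Cod B f) X" "Dom (S.C (Dom B f)) \<beta> = cOb (Dom B f) (Dom (R.C (Dom B f)) \<alpha>)"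
    using functor_Cod[OF c_functor u] functor_Dom[OF c_functor u] c_Ob(1) assms by (simp_all add: v' gf R.C_simps)
  ultimately show "FAr c ?u = S.arr f (cOb (Cod B f) X) (cAr ?u)" "cAr ?u \<in> Arr (S.C (Dom B f))"
    "Dom (S.C (Dom B f)) (cAr ?u) = cOb (Dom B f) (Dom (R.C (Dom B f)) \<alpha>)"
    "Cod (S.C (Dom B f)) (cAr ?u) = FOb (RAr S f) (cOb (Cod B f) X)"
    using v' g by (simp_all add: gf)
qed

text \<open>A right inverse of \<open>elements_map\<close>, as \<open>elements_map_\<eta>\<close>
  confirms. The image of a vertical arrow under \<open>c\<close> carries the unit of
  \<open>S\<close>, which the factor \<open>inv_arr\<close> removes; canonical lifts need no such
  correction.\<close>

definition \<eta> :: "('b, 'k, 'o, 'm) pseudo_nat" where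
  "\<eta> = \<lparr>NOb = \<lambda>P\<in>Obj B. \<lparr>FOb = \<lambda>X\<in>Obj (R.C P). cOb P X,
           FAr = \<lambda>\<alpha>\<in>Arr (R.C P). inv_arr (S.C P) (RUnit S P (cOb P (Cod (R.C P) \<alpha>))) \<cdot>\<^bsub>S.C P\<^esub> cAr (R.vert P \<alpha>)\<rparr>,
         NAr = \<lambda>f\<in>Arr B. \<lambda>X\<in>Obj (R.C (Cod B f)). cAr (R.can f X)\<rparr>"

lemma \<eta>_Ob [simp]: "\<lbrakk>P \<in> Obj B; X \<in> Obj (R.C P)\<rbrakk> \<Longrightarrow> FOb (NOb \<eta> P) X = cOb P X"
  by (simp add: \<eta>_def)

lemma cOb [simp]: "\<lbrakk>P \<in> Obj B; X \<in> Obj (R.C P)\<rbrakk> \<Longrightarrow> cOb P X \<in> Obj (S.C P)"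
  by (rule c_Ob)

lemma \<eta>_NAr:
  assumes [simp]: "f \<in> Arr B" "X \<in> Obj (R.C (Cod B f))" and P: "Dom B f = P"
  shows "NAr \<eta> f X \<in> Arr (S.C P)" "Dom (S.C P) (NAr \<eta> f X) = cOb P (FOb (RAr R f) X)"
    "Cod (S.C P) (NAr \<eta> f X) = FOb (RAr S f) (cOb (Cod B f) X)" "FAr c (R.can f X) = S.arr f (cOb (Cod B f) X) (NAr \<eta> f X)"
  using c_Ar[of f X "Ident (R.C (Dom B f)) (FOb (RAr R f) X)"]
  by (simp_all add: \<eta>_def R.can_def R.C_simps P[symmetric])

lemma \<eta>_Ar:
  assumes [simp]: "P \<in> Obj B" "\<alpha> \<in> Arr (R.C P)"
  shows "FAr (NOb \<eta> P) \<alpha> \<in> Arr (S.C P)" "Dom (S.C P) (FAr (NOb \<eta> P) \<alpha>) = cOb P (Dom (R.C P) \<alpha>)"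
    "Cod (S.C P) (FAr (NOb \<eta> P) \<alpha>) = cOb P (Cod (R.C P) \<alpha>)" "FAr c (R.vert P \<alpha>) = S.vert P (FAr (NOb \<eta> P) \<alpha>)"
proof -
  interpret SP: category "S.C P" by simp
  interpret RP: category "R.C P" by simp
  note a = c_Ar[of "Ident B P" "Cod (R.C P) \<alpha>" "RUnit R P (Cod (R.C P) \<alpha>) \<cdot>\<^bsub>R.C P\<^esub> \<alpha>", folded R.vert_def, simplified]
  note [simp] = a(2-4)
  have e: "FAr (NOb \<eta> P) \<alpha> = inv_arr (S.C P) (RUnit S P (cOb P (Cod (R.C P) \<alpha>))) \<cdot>\<^bsub>S.C P\<^esub> cAr (R.vert P \<alpha>)"
    by (simp add: \<eta>_def)
  show "FAr (NOb \<eta> P) \<alpha> \<in> Arr (S.C P)" "Dom (S.C P) (FAr (NOb \<eta> P) \<alpha>) = cOb P (Dom (R.C P) \<alpha>)"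
    and c: "Cod (S.C P) (FAr (NOb \<eta> P) \<alpha>) = cOb P (Cod (R.C P) \<alpha>)" by (simp_all add: e)
  show "FAr c (R.vert P \<alpha>) = S.vert P (FAr (NOb \<eta> P) \<alpha>)"
    unfolding S.vert_def c a(1) by (simp add: e)
qed

text \<open>Every arrow is a vertical arrow followed by a canonical lift, so \<open>c\<close> is
  determined by what \<open>\<eta>\<close> records.\<close>

lemma c_arr:
  assumes [simp]: "f \<in> Arr B" "X \<in> Obj (R.C (Cod B f))" "\<alpha> \<in> Arr (R.C (Dom B f))" "Cod (R.C (Dom B f)) \<alpha> = FOb (RAr R f) X"
  shows "FAr c (R.arr f X \<alpha>) = S.arr f (cOb (Cod B f) X) (NAr \<eta> f X \<cdot>\<^bsub>S.C (Dom B f)\<^esub> FAr (NOb \<eta> (Dom B f)) \<alpha>)"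
proof -
  interpret RP: category "R.C (Dom B f)" by simp
  have "R.arr f X \<alpha> = R.can f X \<cdot>\<^bsub>R.el\<^esub> R.vert (Dom B f) \<alpha>"
    using R.arr_vert[of f X "Ident (R.C (Dom B f)) (FOb (RAr R f) X)" \<alpha>] by (simp add: R.can_def)
  then have "FAr c (R.arr f X \<alpha>) = FAr c (R.can f X) \<cdot>\<^bsub>S.el\<^esub> FAr c (R.vert (Dom B f) \<alpha>)"
    by (simp add: functor_Comp[OF c_functor])
  then show ?thesis by (simp add: \<eta>_NAr \<eta>_Ar S.arr_vert)
qed

text \<open>\<open>vert\<close> is injective and respects identities and composites, so the functor
  laws are those of \<open>c\<close> on vertical arrows.\<close>

lemma \<eta>_functor:
  assumes P[simp]: "P \<in> Obj B"
  shows "is_functor (R.C P) (S.C P) (NOb \<eta> P)"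
proof (rule is_functorI)
  interpret SP: category "S.C P" by simp
  interpret RP: category "R.C P" by simp
  show "FAr (NOb \<eta> P) (Ident (R.C P) X) = Ident (S.C P) (FOb (NOb \<eta> P) X)" if [simp]: "X \<in> Obj (R.C P)" for X
  proof (rule S.vert_inj[OF P])
    have "S.vert P (FAr (NOb \<eta> P) (Ident (R.C P) X)) = FAr c (Ident R.el (P, X))"
      by (simp add: \<eta>_Ar(4)[symmetric] R.vert_Ident)
    also have "\<dots> = Ident S.el (P, cOb P X)" by (simp add: functor_Ident[OF c_functor] c_Ob)
    finally show "S.vert P (FAr (NOb \<eta> P) (Ident (R.C P) X)) = S.vert P (Ident (S.C P) (FOb (NOb \<eta> P) X))"
      by (simp add: S.vert_Ident)
  qed (simp_all add: \<eta>_Ar)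
  show "FAr (NOb \<eta> P) (\<beta> \<cdot>\<^bsub>R.C P\<^esub> \<alpha>) = FAr (NOb \<eta> P) \<beta> \<cdot>\<^bsub>S.C P\<^esub> FAr (NOb \<eta> P) \<alpha>"
    if [simp]: "\<alpha> \<in> Arr (R.C P)" "\<beta> \<in> Arr (R.C P)" "Cod (R.C P) \<alpha> = Dom (R.C P) \<beta>" for \<alpha> \<beta>
  proof (rule S.vert_inj[OF P])
    have "S.vert P (FAr (NOb \<eta> P) (\<beta> \<cdot>\<^bsub>R.C P\<^esub> \<alpha>)) = FAr c (R.vert P \<beta> \<cdot>\<^bsub>R.el\<^esub> R.vert P \<alpha>)"
      by (simp add: \<eta>_Ar(4)[symmetric] R.vert_Comp)
    also have "\<dots> = S.vert P (FAr (NOb \<eta> P) \<beta>) \<cdot>\<^bsub>S.el\<^esub> S.vert P (FAr (NOb \<eta> P) \<alpha>)"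
      by (simp add: functor_Comp[OF c_functor] \<eta>_Ar(4))
    finally show "S.vert P (FAr (NOb \<eta> P) (\<beta> \<cdot>\<^bsub>R.C P\<^esub> \<alpha>)) = S.vert P (FAr (NOb \<eta> P) \<beta> \<cdot>\<^bsub>S.C P\<^esub> FAr (NOb \<eta> P) \<alpha>)"
      by (simp add: S.vert_Comp \<eta>_Ar)
  qed (simp_all add: \<eta>_Ar)
qed (simp_all add: \<eta>_Ar R.C_simps, simp_all add: \<eta>_def)

text \<open>Each axiom is the image under \<open>c\<close> of an equation in the category of
  elements: a canonical lift followed by a vertical arrow for naturality, two successive canonical
  lifts for the composition law, an identity for the unit law.\<close>

lemma \<eta>_natural: "pseudo_natural B R S \<eta>"
  unfolding pseudo_natural_def
proof (intro conjI ballI impI)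
  show "NOb \<eta> \<in> extensional (Obj B)" "NAr \<eta> \<in> extensional (Arr B)" by (simp_all add: \<eta>_def)
  show "is_functor (R.C P) (S.C P) (NOb \<eta> P)" if "P \<in> Obj B" for P by (rule \<eta>_functor[OF that])
next
  fix f assume f[simp]: "f \<in> Arr B"
  show "nat_iso (R.C (Cod B f)) (S.C (Dom B f)) (comp_func (R.C (Cod B f)) (NOb \<eta> (Dom B f)) (RAr R f))
        (comp_func (R.C (Cod B f)) (RAr S f) (NOb \<eta> (Cod B f))) (NAr \<eta> f)"
  proof (rule nat_isoI)
    show "is_functor (R.C (Cod B f)) (S.C (Dom B f)) (comp_func (R.C (Cod B f)) (NOb \<eta> (Dom B f)) (RAr R f))"
      by (rule comp_functor[OF R.RAr_functor \<eta>_functor]) simp_all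
    show "is_functor (R.C (Cod B f)) (S.C (Dom B f)) (comp_func (R.C (Cod B f)) (RAr S f) (NOb \<eta> (Cod B f)))"
      by (rule comp_functor[OF \<eta>_functor S.RAr_functor]) simp_all
    show "NAr \<eta> f \<in> extensional (Obj (R.C (Cod B f)))" by (simp add: \<eta>_def)
    show "NAr \<eta> f X \<in> hom (S.C (Dom B f)) (FOb (comp_func (R.C (Cod B f)) (NOb \<eta> (Dom B f)) (RAr R f)) X)
        (FOb (comp_func (R.C (Cod B f)) (RAr S f) (NOb \<eta> (Cod B f))) X)" "is_iso (S.C (Dom B f)) (NAr \<eta> f X)"
      if "X \<in> Obj (R.C (Cod B f))" for X using that by (simp_all add: hom_def \<eta>_NAr)
    fix \<alpha> assume a[simp]: "\<alpha> \<in> Arr (R.C (Cod B f))"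
    interpret RP: category "R.C (Dom B f)" by simp
    interpret RQ: category "R.C (Cod B f)" by simp
    let ?X = "Dom (R.C (Cod B f)) \<alpha>" and ?Y = "Cod (R.C (Cod B f)) \<alpha>"
    have "R.vert (Cod B f) \<alpha> \<cdot>\<^bsub>R.el\<^esub> R.can f ?X = R.arr f ?Y (FAr (RAr R f) \<alpha>)"
      by (simp add: R.can_def R.vert_arr)
    then have "FAr c (R.arr f ?Y (FAr (RAr R f) \<alpha>)) = FAr c (R.vert (Cod B f) \<alpha>) \<cdot>\<^bsub>S.el\<^esub> FAr c (R.can f ?X)"
      by (simp add: functor_Comp[OF c_functor, symmetric])
    also have "\<dots> = S.arr f (cOb (Cod B f) ?Y) (FAr (RAr S f) (FAr (NOb \<eta> (Cod B f)) \<alpha>) \<cdot>\<^bsub>S.C (Dom B f)\<^esub> NAr \<eta> f ?X)"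
      using S.vert_arr[of f "FAr (NOb \<eta> (Cod B f)) \<alpha>" "NAr \<eta> f ?X"] by (simp add: \<eta>_NAr \<eta>_Ar)
    finally show "NAr \<eta> f (Cod (R.C (Cod B f)) \<alpha>) \<cdot>\<^bsub>S.C (Dom B f)\<^esub> FAr (comp_func (R.C (Cod B f)) (NOb \<eta> (Dom B f)) (RAr R f)) \<alpha> =
      FAr (comp_func (R.C (Cod B f)) (RAr S f) (NOb \<eta> (Cod B f))) \<alpha> \<cdot>\<^bsub>S.C (Dom B f)\<^esub> NAr \<eta> f (Dom (R.C (Cod B f)) \<alpha>)"
      by (simp add: c_arr)
  qed
next
  fix f g X assume [simp]: "f \<in> Arr B" "g \<in> Arr B" "Cod B f = Dom B g" "X \<in> Obj (R.C (Cod B g))"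
  interpret RP: category "R.C (Dom B f)" by simp
  interpret RQ: category "R.C (Dom B g)" by simp
  have "R.can g X \<cdot>\<^bsub>R.el\<^esub> R.can f (FOb (RAr R g) X) = R.arr (g \<cdot>\<^bsub>B\<^esub> f) X (RComp R g f X)"
    by (simp add: R.can_def R.arr_Comp)
  then have "FAr c (R.arr (g \<cdot>\<^bsub>B\<^esub> f) X (RComp R g f X)) = FAr c (R.can g X) \<cdot>\<^bsub>S.el\<^esub> FAr c (R.can f (FOb (RAr R g) X))"
    by (simp add: functor_Comp[OF c_functor, symmetric])
  also have "\<dots> = S.arr (g \<cdot>\<^bsub>B\<^esub> f) (cOb (Cod B g) X) (RComp S g f (cOb (Cod B g) X) \<cdot>\<^bsub>S.C (Dom B f)\<^esub>
      (FAr (RAr S f) (NAr \<eta> g X) \<cdot>\<^bsub>S.C (Dom B f)\<^esub> NAr \<eta> f (FOb (RAr R g) X)))"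
    by (simp add: \<eta>_NAr S.arr_Comp)
  finally show "NAr \<eta> (g \<cdot>\<^bsub>B\<^esub> f) X \<cdot>\<^bsub>S.C (Dom B f)\<^esub> FAr (NOb \<eta> (Dom B f)) (RComp R g f X) =
           RComp S g f (FOb (NOb \<eta> (Cod B g)) X) \<cdot>\<^bsub>S.C (Dom B f)\<^esub>
             (FAr (RAr S f) (NAr \<eta> g X) \<cdot>\<^bsub>S.C (Dom B f)\<^esub> NAr \<eta> f (FOb (RAr R g) X))"
    by (simp add: c_arr)
next
  fix P X assume [simp]: "P \<in> Obj B" "X \<in> Obj (R.C P)"
  have "S.arr (Ident B P) (cOb P X) (RUnit S P (cOb P X)) = FAr c (Ident R.el (P, X))"
    by (simp add: functor_Ident[OF c_functor] c_Ob S.arr_Ident)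
  also have "\<dots> = S.arr (Ident B P) (cOb P X) (NAr \<eta> (Ident B P) X \<cdot>\<^bsub>S.C P\<^esub> FAr (NOb \<eta> P) (RUnit R P X))"
    using c_arr[of "Ident B P" X "RUnit R P X"] by (simp add: R.arr_Ident)
  finally show "NAr \<eta> (Ident B P) X \<cdot>\<^bsub>S.C P\<^esub> FAr (NOb \<eta> P) (RUnit R P X) = RUnit S P (FOb (NOb \<eta> P) X)"
    by simp
qed

lemma elements_map_\<eta>: "elements_map B R S \<eta> = c"
proof -
  interpret \<eta>: pseudo_natural_on B R S \<eta> by unfold_locales (rule \<eta>_natural)
  show ?thesis
  proof (rule functor_eqI[OF \<eta>.em_functor c_functor])
    show "FOb (elements_map B R S \<eta>) x = FOb c x" if "x \<in> Obj R.el" for x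
      using that by - (erule R.el_Obj_cases, simp add: c_Ob)
    show "FAr (elements_map B R S \<eta>) u = FAr c u" if "u \<in> Arr R.el" for u
      using that by - (erule R.el_Arr_cases, simp add: c_arr)
  qed
qed

end

section \<open>Identities and composites of pseudo-natural transformations\<close>

lemma id_pseudo_nat_simps [simp]:
  "P \<in> Obj B \<Longrightarrow> NOb (id_pseudo_nat B R) P = id_func (ROb R P)"
  "\<lbrakk>f \<in> Arr B; X \<in> Obj (ROb R (Cod B f))\<rbrakk> \<Longrightarrow>
    NAr (id_pseudo_nat B R) f X = Ident (ROb R (Dom B f)) (FOb (RAr R f) X)"
  by (simp_all add: id_pseudo_nat_def)

lemma comp_pseudo_nat_simps [simp]:
  "P \<in> Obj B \<Longrightarrow> NOb (comp_pseudo_nat B R T \<theta> \<eta>) P = comp_func (ROb R P) (NOb \<theta> P) (NOb \<eta> P)"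
  "\<lbrakk>f \<in> Arr B; X \<in> Obj (ROb R (Cod B f))\<rbrakk> \<Longrightarrow> NAr (comp_pseudo_nat B R T \<theta> \<eta>) f X =
    NAr \<theta> f (FOb (NOb \<eta> (Cod B f)) X) \<cdot>\<^bsub>ROb T (Dom B f)\<^esub> FAr (NOb \<theta> (Dom B f)) (NAr \<eta> f X)"
  by (simp_all add: comp_pseudo_nat_def)

lemma (in pseudo_functor_on) id_natural: "pseudo_natural B R R (id_pseudo_nat B R)"
  unfolding pseudo_natural_def
proof (intro conjI ballI impI)
  fix f assume [simp]: "f \<in> Arr B"
  show "nat_iso (C (Cod B f)) (C (Dom B f)) (comp_func (C (Cod B f)) (NOb (id_pseudo_nat B R) (Dom B f)) (RAr R f))
     (comp_func (C (Cod B f)) (RAr R f) (NOb (id_pseudo_nat B R) (Cod B f))) (NAr (id_pseudo_nat B R) f)"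
    using comp_func_id_left[OF RAr_functor] comp_func_id_right[OF RAr_functor]
    by (simp, intro nat_isoI RAr_functor) (simp_all add: hom_def C_simps id_pseudo_nat_def)
qed (simp_all add: id_functor C_simps, simp_all add: id_pseudo_nat_def)

lemma comp_natural:
  assumes \<eta>: "pseudo_natural_on B R S \<eta>" and \<theta>: "pseudo_natural_on B S T \<theta>"
  shows "pseudo_natural_on B R T (comp_pseudo_nat B R T \<theta> \<eta>)" (is "pseudo_natural_on B R T ?c")
proof -
  interpret \<eta>: pseudo_natural_on B R S \<eta> by fact
  interpret \<theta>: pseudo_natural_on B S T \<theta> by fact
  note [simp] = \<eta>.R.C_simps \<eta>.S.C_simps \<theta>.S.C_simps
  have "pseudo_natural B R T ?c"
    unfolding pseudo_natural_def
  proof (intro conjI ballI impI)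
    show "NOb ?c \<in> extensional (Obj B)" "NAr ?c \<in> extensional (Arr B)" by (simp_all add: comp_pseudo_nat_def)
    show c: "is_functor (ROb R P) (ROb T P) (NOb ?c P)" if "P \<in> Obj B" for P
      using comp_functor[OF \<eta>.NOb_functor \<theta>.NOb_functor] that by simp
    fix f assume f[simp]: "f \<in> Arr B"
    show "nat_iso (ROb R (Cod B f)) (ROb T (Dom B f)) (comp_func (ROb R (Cod B f)) (NOb ?c (Dom B f)) (RAr R f))
        (comp_func (ROb R (Cod B f)) (RAr T f) (NOb ?c (Cod B f))) (NAr ?c f)"
    proof (rule nat_isoI)
      show "is_functor (ROb R (Cod B f)) (ROb T (Dom B f)) (comp_func (ROb R (Cod B f)) (NOb ?c (Dom B f)) (RAr R f))"
        by (rule comp_functor[OF \<eta>.R.RAr_functor c]) simp_all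
      show "is_functor (ROb R (Cod B f)) (ROb T (Dom B f)) (comp_func (ROb R (Cod B f)) (RAr T f) (NOb ?c (Cod B f)))"
        by (rule comp_functor[OF c \<theta>.S.RAr_functor]) simp_all
      show "NAr ?c f \<in> extensional (Obj (ROb R (Cod B f)))" by (simp add: comp_pseudo_nat_def)
      show "NAr ?c f X \<in> hom (ROb T (Dom B f)) (FOb (comp_func (ROb R (Cod B f)) (NOb ?c (Dom B f)) (RAr R f)) X)
        (FOb (comp_func (ROb R (Cod B f)) (RAr T f) (NOb ?c (Cod B f))) X)" "is_iso (ROb T (Dom B f)) (NAr ?c f X)"
        if "X \<in> Obj (ROb R (Cod B f))" for X using that by (simp_all add: hom_def)
      fix u assume [simp]: "u \<in> Arr (ROb R (Cod B f))"
      let ?X = "Dom (ROb R (Cod B f)) u" and ?Y = "Cod (ROb R (Cod B f)) u"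
      let ?C = "ROb T (Dom B f)"
      interpret T: category ?C by simp
      \<comment> \<open>Two naturality squares are pasted: the one of \<open>\<eta>\<close>
        transported by \<open>NOb \<theta>\<close>, and the one of \<open>\<theta>\<close>.\<close>
      have "NAr \<theta> f (FOb (NOb \<eta> (Cod B f)) ?Y) \<cdot>\<^bsub>?C\<^esub> (FAr (NOb \<theta> (Dom B f)) (NAr \<eta> f ?Y) \<cdot>\<^bsub>?C\<^esub>
          FAr (NOb \<theta> (Dom B f)) (FAr (NOb \<eta> (Dom B f)) (FAr (RAr R f) u))) =
        NAr \<theta> f (FOb (NOb \<eta> (Cod B f)) ?Y) \<cdot>\<^bsub>?C\<^esub> (FAr (NOb \<theta> (Dom B f)) (FAr (RAr S f) (FAr (NOb \<eta> (Cod B f)) u)) \<cdot>\<^bsub>?C\<^esub>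
          FAr (NOb \<theta> (Dom B f)) (NAr \<eta> f ?X))"
        by (simp add: \<eta>.NAr_nat flip: \<theta>.NOb_simps(6))
      also have "\<dots> = FAr (RAr T f) (FAr (NOb \<theta> (Cod B f)) (FAr (NOb \<eta> (Cod B f)) u)) \<cdot>\<^bsub>?C\<^esub>
        (NAr \<theta> f (FOb (NOb \<eta> (Cod B f)) ?X) \<cdot>\<^bsub>?C\<^esub> FAr (NOb \<theta> (Dom B f)) (NAr \<eta> f ?X))"
        using \<theta>.NAr_nat[of f "FAr (NOb \<eta> (Cod B f)) u"] by (intro T.Comp_reassoc) simp_all
      finally show "NAr ?c f (Cod (ROb R (Cod B f)) u) \<cdot>\<^bsub>?C\<^esub> FAr (comp_func (ROb R (Cod B f)) (NOb ?c (Dom B f)) (RAr R f)) u =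
        FAr (comp_func (ROb R (Cod B f)) (RAr T f) (NOb ?c (Cod B f))) u \<cdot>\<^bsub>?C\<^esub> NAr ?c f (Dom (ROb R (Cod B f)) u)"
        by simp
    qed
  next
    fix f g X assume [simp]: "f \<in> Arr B" "g \<in> Arr B" "Cod B f = Dom B g" "X \<in> Obj (ROb R (Cod B g))"
    let ?C = "ROb T (Dom B f)" and ?N = "FAr (NOb \<theta> (Dom B f))" and ?Y = "FOb (NOb \<eta> (Cod B g)) X"
    let ?gX = "FOb (RAr R g) X"
    interpret T: category ?C by simp
    \<comment> \<open>The composition law of \<open>\<eta>\<close> is applied inside
      \<open>NOb \<theta>\<close>, and that of \<open>\<theta>\<close> outside. Naturality of
      \<open>NAr \<theta> f\<close> at \<open>NAr \<eta> g X\<close> then exchanges the two inner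
      factors.\<close>
    have "NAr \<theta> (g \<cdot>\<^bsub>B\<^esub> f) ?Y \<cdot>\<^bsub>?C\<^esub> (?N (NAr \<eta> (g \<cdot>\<^bsub>B\<^esub> f) X) \<cdot>\<^bsub>?C\<^esub> ?N (FAr (NOb \<eta> (Dom B f)) (RComp R g f X))) =
      NAr \<theta> (g \<cdot>\<^bsub>B\<^esub> f) ?Y \<cdot>\<^bsub>?C\<^esub> (?N (RComp S g f ?Y) \<cdot>\<^bsub>?C\<^esub> (?N (FAr (RAr S f) (NAr \<eta> g X)) \<cdot>\<^bsub>?C\<^esub> ?N (NAr \<eta> f ?gX)))"
      by (simp add: \<eta>.NAr_comp flip: \<theta>.NOb_simps(6))
    also have "\<dots> = (RComp T g f (FOb (NOb \<theta> (Cod B g)) ?Y) \<cdot>\<^bsub>?C\<^esub> (FAr (RAr T f) (NAr \<theta> g ?Y) \<cdot>\<^bsub>?C\<^esub> NAr \<theta> f (FOb (RAr S g) ?Y))) \<cdot>\<^bsub>?C\<^esub>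
       (?N (FAr (RAr S f) (NAr \<eta> g X)) \<cdot>\<^bsub>?C\<^esub> ?N (NAr \<eta> f ?gX))"
      by (rule T.Comp_reassoc'[OF \<theta>.NAr_comp]) simp_all
    also have "\<dots> = RComp T g f (FOb (NOb \<theta> (Cod B g)) ?Y) \<cdot>\<^bsub>?C\<^esub> (FAr (RAr T f) (NAr \<theta> g ?Y) \<cdot>\<^bsub>?C\<^esub> (NAr \<theta> f (FOb (RAr S g) ?Y) \<cdot>\<^bsub>?C\<^esub>
       (?N (FAr (RAr S f) (NAr \<eta> g X)) \<cdot>\<^bsub>?C\<^esub> ?N (NAr \<eta> f ?gX))))"
      by simp
    also have "NAr \<theta> f (FOb (RAr S g) ?Y) \<cdot>\<^bsub>?C\<^esub> (?N (FAr (RAr S f) (NAr \<eta> g X)) \<cdot>\<^bsub>?C\<^esub> ?N (NAr \<eta> f ?gX)) =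
       FAr (RAr T f) (FAr (NOb \<theta> (Dom B g)) (NAr \<eta> g X)) \<cdot>\<^bsub>?C\<^esub> (NAr \<theta> f (FOb (NOb \<eta> (Dom B g)) ?gX) \<cdot>\<^bsub>?C\<^esub> ?N (NAr \<eta> f ?gX))"
      using \<theta>.NAr_nat[of f "NAr \<eta> g X"] by (intro T.Comp_reassoc) simp_all
    finally show "NAr ?c (g \<cdot>\<^bsub>B\<^esub> f) X \<cdot>\<^bsub>?C\<^esub> FAr (NOb ?c (Dom B f)) (RComp R g f X) =
           RComp T g f (FOb (NOb ?c (Cod B g)) X) \<cdot>\<^bsub>?C\<^esub>
             (FAr (RAr T f) (NAr ?c g X) \<cdot>\<^bsub>?C\<^esub> NAr ?c f (FOb (RAr R g) X))"
      by simp
  next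
    fix P X assume [simp]: "P \<in> Obj B" "X \<in> Obj (ROb R P)"
    have "FAr (NOb \<theta> P) (NAr \<eta> (Ident B P) X) \<cdot>\<^bsub>ROb T P\<^esub> FAr (NOb \<theta> P) (FAr (NOb \<eta> P) (RUnit R P X)) =
      FAr (NOb \<theta> P) (RUnit S P (FOb (NOb \<eta> P) X))"
      by (simp add: \<eta>.NAr_unit flip: \<theta>.NOb_simps(6))
    then show "NAr ?c (Ident B P) X \<cdot>\<^bsub>ROb T P\<^esub> FAr (NOb ?c P) (RUnit R P X) = RUnit T P (FOb (NOb ?c P) X)"
      by (simp add: \<theta>.NAr_unit)
  qed
  then show ?thesis by unfold_locales
qed

lemma elements_map_id:
  assumes "pseudo_functor_on B R"
  shows "elements_map B R R (id_pseudo_nat B R) = id_func (elements B R)"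
proof -
  interpret R: pseudo_functor_on B R by fact
  interpret i: pseudo_natural_on B R R "id_pseudo_nat B R" by unfold_locales (rule R.id_natural)
  show ?thesis
  proof (rule functor_eqI[OF i.em_functor id_functor[OF R.el_category]])
    show "FOb i.em x = FOb (id_func R.el) x" if "x \<in> Obj R.el" for x
      using that by - (erule R.el_Obj_cases, simp)
    show "FAr i.em u = FAr (id_func R.el) u" if "u \<in> Arr R.el" for u
      using that by - (erule R.el_Arr_cases, simp add: R.C_simps)
  qed
qed

lemma elements_map_comp:
  assumes \<eta>: "pseudo_natural_on B R S \<eta>" and \<theta>: "pseudo_natural_on B S T \<theta>"
  shows "elements_map B R T (comp_pseudo_nat B R T \<theta> \<eta>) =
    comp_func (elements B R) (elements_map B S T \<theta>) (elements_map B R S \<eta>)"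
proof -
  interpret \<eta>: pseudo_natural_on B R S \<eta> by fact
  interpret \<theta>: pseudo_natural_on B S T \<theta> by fact
  interpret c: pseudo_natural_on B R T "comp_pseudo_nat B R T \<theta> \<eta>" by (rule comp_natural[OF \<eta> \<theta>])
  show ?thesis
  proof (rule functor_eqI[OF c.em_functor comp_functor[OF \<eta>.em_functor \<theta>.em_functor]])
    show "FOb c.em x = FOb (comp_func \<eta>.R.el \<theta>.em \<eta>.em) x" if "x \<in> Obj \<eta>.R.el" for x
      using that by - (erule \<eta>.R.el_Obj_cases, simp)
    show "FAr c.em u = FAr (comp_func \<eta>.R.el \<theta>.em \<eta>.em) u" if "u \<in> Arr \<eta>.R.el" for u
      using that by - (erule \<eta>.R.el_Arr_cases, simp add: \<eta>.R.C_simps \<eta>.S.C_simps \<theta>.S.C_simps)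
  qed
qed

section \<open>The category of species and the Grothendieck functor\<close>

lemma DRSp_simps:
  "R \<in> Obj DRSp \<longleftrightarrow> directed_restriction_species R"
  "(R, S, \<eta>) \<in> Arr DRSp \<longleftrightarrow> directed_restriction_species R \<and> directed_restriction_species S \<and> pseudo_natural CPos R S \<eta>"
  "Dom DRSp (R, S, \<eta>) = R" "Cod DRSp (R, S, \<eta>) = S" "Ident DRSp R = (R, R, id_pseudo_nat CPos R)"
  "(S', T, \<theta>) \<cdot>\<^bsub>DRSp\<^esub> (R, S, \<eta>) = (R, T, comp_pseudo_nat CPos R T \<theta> \<eta>)"
  by (auto simp: DRSp_def)

lemma species_pseudo: "directed_restriction_species R \<Longrightarrow> pseudo_functor_on CPos R"
  by (simp add: directed_restriction_species_def pseudo_functor_on_def)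

lemma species_natural: "(R, S, \<eta>) \<in> Arr DRSp \<Longrightarrow> pseudo_natural_on CPos R S \<eta>"
  by (simp add: DRSp_simps species_pseudo pseudo_natural_on_def pseudo_natural_on_axioms_def)

lemma DRSp_category: "category (DRSp :: (('a::infinite, 'o, 'm) species, ('a, 'o, 'm) species_ar) cat)"
proof
  fix f :: "('a, 'o, 'm) species_ar" assume f: "f \<in> Arr DRSp"
  obtain R S \<eta> where f': "f = (R, S, \<eta>)" by (metis prod_cases3)
  show "Dom DRSp f \<in> Obj DRSp" "Cod DRSp f \<in> Obj DRSp" using f by (auto simp: f' DRSp_simps)
  interpret \<eta>: pseudo_natural_on CPos R S \<eta> using f species_natural by (simp add: f')
  interpret i: pseudo_natural_on CPos R R "id_pseudo_nat CPos R" by unfold_locales (rule \<eta>.R.id_natural)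
  interpret j: pseudo_natural_on CPos S S "id_pseudo_nat CPos S" by unfold_locales (rule \<eta>.S.id_natural)
  have "comp_pseudo_nat CPos R S \<eta> (id_pseudo_nat CPos R) = \<eta>"
    by (rule pseudo_nat_eqI[OF comp_natural[OF i.pseudo_natural_on_axioms \<eta>.pseudo_natural_on_axioms] \<eta>.pseudo_natural_on_axioms])
       (simp_all del: CPos_simps(1) add: comp_func_id_right[OF \<eta>.NOb_functor] \<eta>.S.C_simps)
  then show "f \<cdot>\<^bsub>DRSp\<^esub> Ident DRSp (Dom DRSp f) = f" by (simp add: f' DRSp_simps)
  have "comp_pseudo_nat CPos R S (id_pseudo_nat CPos S) \<eta> = \<eta>"
    by (rule pseudo_nat_eqI[OF comp_natural[OF \<eta>.pseudo_natural_on_axioms j.pseudo_natural_on_axioms] \<eta>.pseudo_natural_on_axioms])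
       (simp_all del: CPos_simps(1) add: comp_func_id_left[OF \<eta>.NOb_functor] \<eta>.S.C_simps)
  then show "Ident DRSp (Cod DRSp f) \<cdot>\<^bsub>DRSp\<^esub> f = f" by (simp add: f' DRSp_simps)
next
  fix R :: "('a, 'o, 'm) species" assume R: "R \<in> Obj DRSp"
  then interpret R: pseudo_functor_on CPos R using species_pseudo by (simp add: DRSp_simps)
  show "Ident DRSp R \<in> Arr DRSp" "Dom DRSp (Ident DRSp R) = R" "Cod DRSp (Ident DRSp R) = R"
    using R R.id_natural by (auto simp: DRSp_simps)
next
  fix f g :: "('a, 'o, 'm) species_ar" assume fg: "f \<in> Arr DRSp" "g \<in> Arr DRSp" "Cod DRSp f = Dom DRSp g"
  obtain R S \<eta> where f: "f = (R, S, \<eta>)" by (metis prod_cases3)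
  obtain S' T \<theta> where "g = (S', T, \<theta>)" by (metis prod_cases3)
  then have g: "g = (S, T, \<theta>)" using fg(3) by (simp add: f DRSp_simps)
  have "pseudo_natural CPos R T (comp_pseudo_nat CPos R T \<theta> \<eta>)"
    using comp_natural[OF species_natural species_natural, of R S \<eta> T \<theta>] fg
    by (simp add: f g pseudo_natural_on_def pseudo_natural_on_axioms_def)
  then show "g \<cdot>\<^bsub>DRSp\<^esub> f \<in> Arr DRSp" "Dom DRSp (g \<cdot>\<^bsub>DRSp\<^esub> f) = Dom DRSp f" "Cod DRSp (g \<cdot>\<^bsub>DRSp\<^esub> f) = Cod DRSp g"
    using fg by (auto simp: f g DRSp_simps)
next
  fix f g h :: "('a, 'o, 'm) species_ar"
  assume fgh: "f \<in> Arr DRSp" "g \<in> Arr DRSp" "h \<in> Arr DRSp" "Cod DRSp f = Dom DRSp g" "Cod DRSp g = Dom DRSp h"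
  obtain R S \<eta> where f: "f = (R, S, \<eta>)" by (metis prod_cases3)
  obtain S' T \<theta> where "g = (S', T, \<theta>)" by (metis prod_cases3)
  then have g: "g = (S, T, \<theta>)" using fgh(4) by (simp add: f DRSp_simps)
  obtain T' U \<psi> where "h = (T', U, \<psi>)" by (metis prod_cases3)
  then have h: "h = (T, U, \<psi>)" using fgh(5) by (simp add: g DRSp_simps)
  interpret \<eta>: pseudo_natural_on CPos R S \<eta> using fgh species_natural by (simp add: f)
  interpret \<theta>: pseudo_natural_on CPos S T \<theta> using fgh species_natural by (simp add: g)
  interpret \<psi>: pseudo_natural_on CPos T U \<psi> using fgh species_natural by (simp add: h)
  note a = \<eta>.pseudo_natural_on_axioms \<theta>.pseudo_natural_on_axioms \<psi>.pseudo_natural_on_axioms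
  have "comp_pseudo_nat CPos R U (comp_pseudo_nat CPos S U \<psi> \<theta>) \<eta> =
    comp_pseudo_nat CPos R U \<psi> (comp_pseudo_nat CPos R T \<theta> \<eta>)"
    by (rule pseudo_nat_eqI[OF comp_natural[OF a(1) comp_natural[OF a(2,3)]] comp_natural[OF comp_natural[OF a(1,2)] a(3)]])
       (simp_all del: CPos_simps(1) add: comp_func_assoc[OF \<eta>.NOb_functor \<theta>.NOb_functor \<psi>.NOb_functor] \<psi>.S.C_simps)
  then show "(h \<cdot>\<^bsub>DRSp\<^esub> g) \<cdot>\<^bsub>DRSp\<^esub> f = h \<cdot>\<^bsub>DRSp\<^esub> (g \<cdot>\<^bsub>DRSp\<^esub> f)"
    by (simp add: f g h DRSp_simps)
qed

lemma elements_RFib: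
  assumes "directed_restriction_species R"
  shows "(elements CPos R, elements_proj CPos R) \<in> Obj RFib"
proof -
  interpret R: pseudo_functor_on CPos R by (rule species_pseudo[OF assms])
  show ?thesis
    using R.el_right_fibration R.el_locally_finite assms
    by (simp add: RFib_simps directed_restriction_species_def)
qed

lemma grothendieck_simps [simp]:
  "directed_restriction_species R \<Longrightarrow> FOb grothendieck R = (elements CPos R, elements_proj CPos R)"
  "(R, S, \<eta>) \<in> Arr DRSp \<Longrightarrow> FAr grothendieck (R, S, \<eta>) =
    ((elements CPos R, elements_proj CPos R), (elements CPos S, elements_proj CPos S), elements_map CPos R S \<eta>)"
  by (auto simp: grothendieck_def Let_def DRSp_simps)

lemma grothendieck_functor:
  "is_functor (DRSp :: (('a::infinite, 'o, 'm) species, ('a, 'o, 'm) species_ar) cat) RFib grothendieck"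
proof (rule is_functorI)
  show "FOb grothendieck R \<in> Obj RFib" if "R \<in> Obj DRSp" for R :: "('a, 'o, 'm) species"
    using that elements_RFib by (simp add: DRSp_simps)
  fix f :: "('a, 'o, 'm) species_ar" assume f: "f \<in> Arr DRSp"
  obtain R S \<eta> where f': "f = (R, S, \<eta>)" by (metis prod_cases3)
  interpret \<eta>: pseudo_natural_on CPos R S \<eta> using f species_natural by (simp add: f')
  have RS: "directed_restriction_species R" "directed_restriction_species S" using f by (auto simp: f' DRSp_simps)
  show "FAr grothendieck f \<in> Arr RFib \<and> Dom RFib (FAr grothendieck f) = FOb grothendieck (Dom DRSp f) \<and>
    Cod RFib (FAr grothendieck f) = FOb grothendieck (Cod DRSp f)"
    using f RS \<eta>.em_over elements_RFib[OF RS(1)] elements_RFib[OF RS(2)]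
    by (simp add: f' RFib_simps(2-4) DRSp_simps(3,4))
  fix g :: "('a, 'o, 'm) species_ar" assume g: "g \<in> Arr DRSp" "Cod DRSp f = Dom DRSp g"
  obtain S' T \<theta> where "g = (S', T, \<theta>)" by (metis prod_cases3)
  then have g': "g = (S, T, \<theta>)" using g(2) by (simp add: f' DRSp_simps)
  have "g \<cdot>\<^bsub>DRSp\<^esub> f \<in> Arr DRSp" using category.Comp_in[OF DRSp_category f g] .
  moreover have "elements_map CPos R T (comp_pseudo_nat CPos R T \<theta> \<eta>) =
    comp_func (elements CPos R) (elements_map CPos S T \<theta>) (elements_map CPos R S \<eta>)"
    by (rule elements_map_comp[OF species_natural species_natural]) (use f g in \<open>simp_all add: f' g'\<close>)
  ultimately show "FAr grothendieck (g \<cdot>\<^bsub>DRSp\<^esub> f) = FAr grothendieck g \<cdot>\<^bsub>RFib\<^esub> FAr grothendieck f"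
    using f g by (simp add: f' g' DRSp_simps(6) RFib_simps(6))
next
  fix R :: "('a, 'o, 'm) species" assume R: "R \<in> Obj DRSp"
  then have "Ident DRSp R \<in> Arr DRSp" using category.Ident_in[OF DRSp_category] by blast
  then show "FAr grothendieck (Ident DRSp R) = Ident RFib (FOb grothendieck R)"
    using R elements_map_id[OF species_pseudo, of R] by (simp add: DRSp_simps(1,5) RFib_simps(5))
qed (auto simp: DRSp_category RFib_category grothendieck_def Let_def)

text \<open>Injectivity is the recovery of components in \<open>elements_map_inj\<close>;
  surjectivity is the construction of \<open>\<eta>\<close> from a functor over the base.\<close>

lemma grothendieck_fully_faithful:
  "fully_faithful (DRSp :: (('a::infinite, 'o, 'm) species, ('a, 'o, 'm) species_ar) cat) RFib grothendieck"
  unfolding fully_faithful_def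
proof (intro ballI)
  fix R S :: "('a, 'o, 'm) species" assume "R \<in> Obj DRSp" "S \<in> Obj DRSp"
  then have RS: "directed_restriction_species R" "directed_restriction_species S" by (auto simp: DRSp_simps)
  show "bij_betw (FAr grothendieck) (hom DRSp R S) (hom RFib (FOb grothendieck R) (FOb grothendieck S))"
  proof (rule bij_betwI')
    fix f g assume f: "f \<in> hom DRSp R S" and g: "g \<in> hom DRSp R S"
    obtain \<eta> where f': "f = (R, S, \<eta>)" using f by (cases f) (auto simp: hom_def DRSp_simps)
    obtain \<theta> where g': "g = (R, S, \<theta>)" using g by (cases g) (auto simp: hom_def DRSp_simps)
    have A: "(R, S, \<eta>) \<in> Arr DRSp" "(R, S, \<theta>) \<in> Arr DRSp" using f g by (auto simp: f' g' hom_def)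
    show "FAr grothendieck f = FAr grothendieck g \<longleftrightarrow> f = g"
      using elements_map_inj[OF species_natural[OF A(1)] species_natural[OF A(2)]] A by (auto simp: f' g')
  next
    fix f assume f: "f \<in> hom DRSp R S"
    then show "FAr grothendieck f \<in> hom RFib (FOb grothendieck R) (FOb grothendieck S)"
      by (rule functor_hom[OF grothendieck_functor])
  next
    fix h assume h: "h \<in> hom RFib (FOb grothendieck R) (FOb grothendieck S)"
    obtain c where h': "h = ((elements CPos R, elements_proj CPos R), (elements CPos S, elements_proj CPos S), c)"
      using h RS by (cases h) (auto simp: hom_def RFib_simps(3,4))
    have "functor_over (elements CPos R, elements_proj CPos R) (elements CPos S, elements_proj CPos S) c"
      using h by (simp add: h' hom_def RFib_simps(2))
    then interpret elements_functor CPos R S c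
      using species_pseudo[OF RS(1)] species_pseudo[OF RS(2)]
      by (simp add: elements_functor_def elements_functor_axioms_def)
    have A: "(R, S, \<eta>) \<in> Arr DRSp" using RS \<eta>_natural by (simp add: DRSp_simps)
    then have "h = FAr grothendieck (R, S, \<eta>)" by (simp add: h' elements_map_\<eta>)
    moreover have "(R, S, \<eta>) \<in> hom DRSp R S" using A by (simp add: hom_def DRSp_simps(3,4))
    ultimately show "\<exists>f \<in> hom DRSp R S. h = FAr grothendieck f" by blast
  qed
qed

text \<open>A functor that is bijective on objects and arrows has a strict inverse; injectivity of
  \<open>c\<close> reduces each law for the inverse to a law for \<open>c\<close>.\<close>

lemma isomorphic_overI:
  assumes S: "is_functor (fst S) B (snd S)" and T: "is_functor (fst T) B (snd T)"
    and c: "functor_over S T c" and ob: "bij_betw (FOb c) (Obj (fst S)) (Obj (fst T))"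
    and ar: "bij_betw (FAr c) (Arr (fst S)) (Arr (fst T))"
  shows "isomorphic_over S T"
proof -
  let ?C = "fst S" and ?D = "fst T"
  note c' = functor_over_functor[OF c]
  note [simp] = functor_simps[OF c'] cat_simps[OF functor_cat_dom[OF c']] cat_simps[OF functor_cat_cod[OF c']]
  define d where "d = \<lparr>FOb = restrict (inv_into (Obj ?C) (FOb c)) (Obj ?D), FAr = restrict (inv_into (Arr ?C) (FAr c)) (Arr ?D)\<rparr>"
  have d1: "FOb d y \<in> Obj ?C" "FOb c (FOb d y) = y" if "y \<in> Obj ?D" for y
    using that ob by (auto simp: d_def bij_betw_def intro!: inv_into_into f_inv_into_f)
  have d2: "FAr d y \<in> Arr ?C" "FAr c (FAr d y) = y" if "y \<in> Arr ?D" for y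
    using that ar by (auto simp: d_def bij_betw_def intro!: inv_into_into f_inv_into_f)
  have inj1: "x = y" if "FOb c x = FOb c y" "x \<in> Obj ?C" "y \<in> Obj ?C" for x y
    using ob that by (auto simp: bij_betw_def dest: inj_onD)
  have inj2: "x = y" if "FAr c x = FAr c y" "x \<in> Arr ?C" "y \<in> Arr ?C" for x y
    using ar that by (auto simp: bij_betw_def dest: inj_onD)
  have dc: "FOb d (FOb c x) = x" if "x \<in> Obj ?C" for x using that by (intro inj1) (simp_all add: d1)
  have dc': "FAr d (FAr c u) = u" if "u \<in> Arr ?C" for u using that by (intro inj2) (simp_all add: d2)
  have d_Dom: "Dom ?C (FAr d y) = FOb d (Dom ?D y)" if y: "y \<in> Arr ?D" for y
    by (rule inj1) (use y d1 d2[OF y] functor_Dom[OF c', of "FAr d y"] in simp_all)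
  have d_Cod: "Cod ?C (FAr d y) = FOb d (Cod ?D y)" if y: "y \<in> Arr ?D" for y
    by (rule inj1) (use y d1 d2[OF y] functor_Cod[OF c', of "FAr d y"] in simp_all)
  have d: "is_functor ?D ?C d"
  proof (rule is_functorI)
    show "FAr d (Ident ?D y) = Ident ?C (FOb d y)" if "y \<in> Obj ?D" for y
      by (rule inj2) (use that in \<open>simp_all add: d1 d2\<close>)
    show "FAr d (g \<cdot>\<^bsub>?D\<^esub> f) = FAr d g \<cdot>\<^bsub>?C\<^esub> FAr d f" if "f \<in> Arr ?D" "g \<in> Arr ?D" "Cod ?D f = Dom ?D g" for f g
      by (rule inj2) (use that in \<open>simp_all add: d2 d_Dom d_Cod\<close>)
  qed (simp_all add: d1 d2 d_Dom d_Cod, simp_all add: d_def)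
  have "functor_over T S d"
    by (rule functor_overI[OF T S d])
       (simp_all add: d1 d2 functor_over_Ob[OF c, symmetric] functor_over_Ar[OF c, symmetric])
  moreover have "comp_func ?C d c = id_func ?C"
    by (rule functor_eqI[OF comp_functor[OF c' d] id_functor]) (simp_all add: dc dc')
  moreover have "comp_func ?D c d = id_func ?D"
    by (rule functor_eqI[OF comp_functor[OF d c'] id_functor]) (simp_all add: d1 d2)
  ultimately show ?thesis using c unfolding isomorphic_over_def by blast
qed

section \<open>Reconstruction of a species from a right fibration\<close>

locale right_fibration_over = category_over X B p for X :: "('o, 'm) cat" and B :: "('b, 'k) cat" and p +
  assumes right_fib: "right_fibration X B p"
begin

lemma lifts: "f \<in> Arr B \<Longrightarrow> cart_lifts X B p f"
  using right_fib
  by unfold_locales (auto simp: right_fibration_def cartesian_fibration_over_def)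

abbreviation l where "l \<equiv> cart_lift X B p"

lemmas l = cart_lifts.lift[OF lifts]
lemmas pull = cart_lifts.pullback_Ob[OF lifts] cart_lifts.pullback_Ar(1-4)[OF lifts]
lemmas pull_lift = cart_lifts.pullback_Ar(5)[OF lifts]

definition vfill where
  "vfill u v = (THE w. w \<in> Arr X \<and> Dom X w = Dom X v \<and> Cod X w = Dom X u \<and>
     FAr p w = Ident B (FOb p (Dom X u)) \<and> u \<cdot>\<^bsub>X\<^esub> w = v)"

lemma vfill:
  assumes u: "cartesian X B p u" and v: "v \<in> Arr X" "Cod X v = Cod X u" "FAr p v = FAr p u"
  shows "vfill u v \<in> Arr X" "Dom X (vfill u v) = Dom X v" "Cod X (vfill u v) = Dom X u"
    "FAr p (vfill u v) = Ident B (FOb p (Dom X u))" "u \<cdot>\<^bsub>X\<^esub> vfill u v = v"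
proof -
  let ?P = "\<lambda>w. w \<in> Arr X \<and> Dom X w = Dom X v \<and> Cod X w = Dom X u \<and>
     FAr p w = Ident B (FOb p (Dom X u)) \<and> u \<cdot>\<^bsub>X\<^esub> w = v"
  have "\<exists>!w. ?P w"
  proof (rule ex_ex1I)
    show "\<exists>w. ?P w" using cartesian_fill_vert[OF assms] by metis
    fix w w' assume "?P w" "?P w'"
    then show "w = w'" by - (rule cartesian_unique[OF u]; simp)
  qed
  from theI'[OF this] show "vfill u v \<in> Arr X" "Dom X (vfill u v) = Dom X v" "Cod X (vfill u v) = Dom X u"
    "FAr p (vfill u v) = Ident B (FOb p (Dom X u))" "u \<cdot>\<^bsub>X\<^esub> vfill u v = v"
    by (simp_all add: vfill_def)
qed

text \<open>A composite of chosen lifts is merely isomorphic to the chosen lift of the composite;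
  \<open>RComp\<close> and \<open>RUnit\<close> record the vertical comparisons. The fibres keep the
  object and arrow types of \<open>X\<close>, so the species has the types of the given
  fibration.\<close>

definition straight :: "('b, 'k, 'o, 'm) pseudo_func" where
  "straight = \<lparr>ROb = fibre X B p, RAr = pullback X B p,
     RComp = \<lambda>g f. \<lambda>x\<in>Obj (fibre X B p (Cod B g)). vfill (l (g \<cdot>\<^bsub>B\<^esub> f) x) (l g x \<cdot>\<^bsub>X\<^esub> l f (Dom X (l g x))),
     RUnit = \<lambda>P. \<lambda>x\<in>Obj (fibre X B p P). vfill (l (Ident B P) x) (Ident X x)\<rparr>"

lemma straight_simps [simp]: "ROb straight = fibre X B p" "RAr straight = pullback X B p"
  by (simp_all add: straight_def)

lemma straight_RComp:
  assumes [simp]: "f \<in> Arr B" "g \<in> Arr B" "Cod B f = Dom B g" "x \<in> Obj X" "FOb p x = Cod B g"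
  shows "RComp straight g f x \<in> Arr X" "Dom X (RComp straight g f x) = Dom X (l f (Dom X (l g x)))"
    "Cod X (RComp straight g f x) = Dom X (l (g \<cdot>\<^bsub>B\<^esub> f) x)" "FAr p (RComp straight g f x) = Ident B (Dom B f)"
    "l (g \<cdot>\<^bsub>B\<^esub> f) x \<cdot>\<^bsub>X\<^esub> RComp straight g f x = l g x \<cdot>\<^bsub>X\<^esub> l f (Dom X (l g x))"
  using vfill[of "l (g \<cdot>\<^bsub>B\<^esub> f) x" "l g x \<cdot>\<^bsub>X\<^esub> l f (Dom X (l g x))"] by (simp_all add: straight_def l)

lemma straight_RUnit:
  assumes [simp]: "P \<in> Obj B" "x \<in> Obj X" "FOb p x = P"
  shows "RUnit straight P x \<in> Arr X" "Dom X (RUnit straight P x) = x" "Cod X (RUnit straight P x) = Dom X (l (Ident B P) x)"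
    "FAr p (RUnit straight P x) = Ident B P" "l (Ident B P) x \<cdot>\<^bsub>X\<^esub> RUnit straight P x = Ident X x"
  using vfill[of "l (Ident B P) x" "Ident X x"] by (simp_all add: straight_def l)

lemma fibre_groupoid: "P \<in> Obj B \<Longrightarrow> groupoid (fibre X B p P)"
  using right_fib by (simp add: right_fibration_def)

lemma vert_iso: "\<lbrakk>P \<in> Obj B; u \<in> Arr X; FAr p u = Ident B P\<rbrakk> \<Longrightarrow> is_iso (fibre X B p P) u"
  using fibre_groupoid by (simp add: groupoid_def)

text \<open>All coherence axioms are equations between vertical arrows ending at the source of a
  chosen lift. Such arrows agree once their composites with the lift agree, and these composites
  reduce by the defining equations of the pieces.\<close>

lemma straight_pseudo: "pseudo_functor B straight"
  unfolding pseudo_functor_def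
proof (intro conjI ballI impI)
  show "category B" by (rule B.category_axioms)
  show "groupoid (ROb straight P)" if "P \<in> Obj B" for P using fibre_groupoid[OF that] by simp
  show pf: "is_functor (ROb straight (Cod B f)) (ROb straight (Dom B f)) (RAr straight f)" if "f \<in> Arr B" for f
    using cart_lifts.pullback_functor[OF lifts[OF that]] by simp
next
  note pf = cart_lifts.pullback_functor[OF lifts]
  note [simp] = l straight_RComp(1-4) straight_RUnit(1-4) pull
  fix f g assume f[simp]: "f \<in> Arr B" and g[simp]: "g \<in> Arr B" and fg[simp]: "Cod B f = Dom B g"
  show "nat_iso (ROb straight (Cod B g)) (ROb straight (Dom B f))
      (comp_func (ROb straight (Cod B g)) (RAr straight f) (RAr straight g)) (RAr straight (g \<cdot>\<^bsub>B\<^esub> f)) (RComp straight g f)"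
  proof (rule nat_isoI)
    show "is_functor (ROb straight (Cod B g)) (ROb straight (Dom B f)) (comp_func (ROb straight (Cod B g)) (RAr straight f) (RAr straight g))"
      using comp_functor[OF pf[OF g], of "fibre X B p (Dom B f)" "pullback X B p f"] pf[OF f] by simp
    show "is_functor (ROb straight (Cod B g)) (ROb straight (Dom B f)) (RAr straight (g \<cdot>\<^bsub>B\<^esub> f))"
      using pf[of "g \<cdot>\<^bsub>B\<^esub> f"] by simp
    show "RComp straight g f \<in> extensional (Obj (ROb straight (Cod B g)))" by (simp add: straight_def)
    show "RComp straight g f x \<in> hom (ROb straight (Dom B f)) (FOb (comp_func (ROb straight (Cod B g)) (RAr straight f) (RAr straight g)) x)
      (FOb (RAr straight (g \<cdot>\<^bsub>B\<^esub> f)) x)" "is_iso (ROb straight (Dom B f)) (RComp straight g f x)"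
      if "x \<in> Obj (ROb straight (Cod B g))" for x
      using that vert_iso[of "Dom B f" "RComp straight g f x"] by (simp_all add: hom_def)
    fix u assume "u \<in> Arr (ROb straight (Cod B g))"
    then have u[simp]: "u \<in> Arr X" "FAr p u = Ident B (Cod B g)" by auto
    have [simp]: "FOb p (Dom X u) = Cod B g" "FOb p (Cod X u) = Cod B g" using vert_Ob[OF u] by auto
    let ?x = "Dom X u" and ?y = "Cod X u" and ?gu = "FAr (pullback X B p g) u"
    let ?fgu = "FAr (pullback X B p f) ?gu" and ?gfu = "FAr (pullback X B p (g \<cdot>\<^bsub>B\<^esub> f)) u"
    \<comment> \<open>Both sides become \<open>u\<close> preceded by the successive chosen lifts of
      \<open>f\<close> and \<open>g\<close>.\<close>
    have "l (g \<cdot>\<^bsub>B\<^esub> f) ?y \<cdot>\<^bsub>X\<^esub> (RComp straight g f ?y \<cdot>\<^bsub>X\<^esub> ?fgu) = l g ?y \<cdot>\<^bsub>X\<^esub> (l f (Dom X (l g ?y)) \<cdot>\<^bsub>X\<^esub> ?fgu)"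
      by (rule X.Comp_reassoc[OF straight_RComp(5)]) simp_all
    also have "\<dots> = l g ?y \<cdot>\<^bsub>X\<^esub> (?gu \<cdot>\<^bsub>X\<^esub> l f (Dom X (l g ?x)))" using pull_lift[OF f, of ?gu] by simp
    also have "\<dots> = u \<cdot>\<^bsub>X\<^esub> (l g ?x \<cdot>\<^bsub>X\<^esub> l f (Dom X (l g ?x)))" by (rule X.Comp_reassoc[OF pull_lift]) simp_all
    also have "\<dots> = u \<cdot>\<^bsub>X\<^esub> (l (g \<cdot>\<^bsub>B\<^esub> f) ?x \<cdot>\<^bsub>X\<^esub> RComp straight g f ?x)" by (simp add: straight_RComp(5))
    also have "\<dots> = l (g \<cdot>\<^bsub>B\<^esub> f) ?y \<cdot>\<^bsub>X\<^esub> (?gfu \<cdot>\<^bsub>X\<^esub> RComp straight g f ?x)"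
      by (rule X.Comp_reassoc[OF pull_lift[symmetric]]) simp_all
    finally have "RComp straight g f ?y \<cdot>\<^bsub>X\<^esub> ?fgu = ?gfu \<cdot>\<^bsub>X\<^esub> RComp straight g f ?x"
      by - (rule cartesian_unique[of "l (g \<cdot>\<^bsub>B\<^esub> f) ?y"]; simp)
    then show "RComp straight g f (Cod (ROb straight (Cod B g)) u) \<cdot>\<^bsub>ROb straight (Dom B f)\<^esub>
        FAr (comp_func (ROb straight (Cod B g)) (RAr straight f) (RAr straight g)) u =
      FAr (RAr straight (g \<cdot>\<^bsub>B\<^esub> f)) u \<cdot>\<^bsub>ROb straight (Dom B f)\<^esub> RComp straight g f (Dom (ROb straight (Cod B g)) u)"
      by simp
  qed
next
  note pf = cart_lifts.pullback_functor[OF lifts]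
  note [simp] = l straight_RComp(1-4) straight_RUnit(1-4) pull
  fix P assume P[simp]: "P \<in> Obj B"
  show "nat_iso (ROb straight P) (ROb straight P) (id_func (ROb straight P)) (RAr straight (Ident B P)) (RUnit straight P)"
  proof (rule nat_isoI)
    show "is_functor (ROb straight P) (ROb straight P) (id_func (ROb straight P))"
      using id_functor[OF fibre_category[OF P]] by simp
    show "is_functor (ROb straight P) (ROb straight P) (RAr straight (Ident B P))" using pf[of "Ident B P"] by simp
    show "RUnit straight P \<in> extensional (Obj (ROb straight P))" by (simp add: straight_def)
    show "RUnit straight P x \<in> hom (ROb straight P) (FOb (id_func (ROb straight P)) x) (FOb (RAr straight (Ident B P)) x)"
      "is_iso (ROb straight P) (RUnit straight P x)" if "x \<in> Obj (ROb straight P)" for x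
      using that vert_iso[of P "RUnit straight P x"] by (simp_all add: hom_def)
    fix u assume "u \<in> Arr (ROb straight P)"
    then have u[simp]: "u \<in> Arr X" "FAr p u = Ident B P" by auto
    have [simp]: "FOb p (Dom X u) = P" "FOb p (Cod X u) = P" using vert_Ob[OF u] by auto
    let ?x = "Dom X u" and ?y = "Cod X u" and ?u = "FAr (pullback X B p (Ident B P)) u"
    have "l (Ident B P) ?y \<cdot>\<^bsub>X\<^esub> (?u \<cdot>\<^bsub>X\<^esub> RUnit straight P ?x) = u \<cdot>\<^bsub>X\<^esub> (l (Ident B P) ?x \<cdot>\<^bsub>X\<^esub> RUnit straight P ?x)"
      by (rule X.Comp_reassoc[OF pull_lift]) simp_all
    also have "\<dots> = Ident X ?y \<cdot>\<^bsub>X\<^esub> u" by (simp add: straight_RUnit(5))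
    also have "\<dots> = l (Ident B P) ?y \<cdot>\<^bsub>X\<^esub> (RUnit straight P ?y \<cdot>\<^bsub>X\<^esub> u)"
      by (rule X.Comp_reassoc'[OF straight_RUnit(5), symmetric]) simp_all
    finally have "RUnit straight P ?y \<cdot>\<^bsub>X\<^esub> u = ?u \<cdot>\<^bsub>X\<^esub> RUnit straight P ?x"
      by - (rule cartesian_unique[of "l (Ident B P) ?y"]; simp)
    then show "RUnit straight P (Cod (ROb straight P) u) \<cdot>\<^bsub>ROb straight P\<^esub> FAr (id_func (ROb straight P)) u =
      FAr (RAr straight (Ident B P)) u \<cdot>\<^bsub>ROb straight P\<^esub> RUnit straight P (Dom (ROb straight P) u)"
      by simp
  qed
next
  note [simp] = l straight_RComp(1-4) straight_RUnit(1-4) pull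
  fix f g h x assume f[simp]: "f \<in> Arr B" "g \<in> Arr B" "h \<in> Arr B" and fgh: "Cod B f = Dom B g \<and> Cod B g = Dom B h"
    and "x \<in> Obj (ROb straight (Cod B h))"
  then have [simp]: "Cod B f = Dom B g" "Cod B g = Dom B h" "x \<in> Obj X" "FOb p x = Cod B h" by auto
  let ?hx = "Dom X (l h x)"
  let ?ghx = "Dom X (l g ?hx)"
  let ?c = "RComp straight h g x"
  \<comment> \<open>Both sides become the composite of the three successive chosen lifts of
    \<open>f\<close>, \<open>g\<close> and \<open>h\<close> ending at \<open>x\<close>.\<close>
  have "l (h \<cdot>\<^bsub>B\<^esub> g \<cdot>\<^bsub>B\<^esub> f) x \<cdot>\<^bsub>X\<^esub> (RComp straight (h \<cdot>\<^bsub>B\<^esub> g) f x \<cdot>\<^bsub>X\<^esub> FAr (pullback X B p f) ?c) =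
    l (h \<cdot>\<^bsub>B\<^esub> g) x \<cdot>\<^bsub>X\<^esub> (l f (Dom X (l (h \<cdot>\<^bsub>B\<^esub> g) x)) \<cdot>\<^bsub>X\<^esub> FAr (pullback X B p f) ?c)"
    using straight_RComp(5)[of f "h \<cdot>\<^bsub>B\<^esub> g" x] straight_RComp(1-4)[of f "h \<cdot>\<^bsub>B\<^esub> g" x] by (intro X.Comp_reassoc) simp_all
  also have "\<dots> = l (h \<cdot>\<^bsub>B\<^esub> g) x \<cdot>\<^bsub>X\<^esub> (?c \<cdot>\<^bsub>X\<^esub> l f ?ghx)" using pull_lift[of f ?c] by simp
  also have "\<dots> = l h x \<cdot>\<^bsub>X\<^esub> (l g ?hx \<cdot>\<^bsub>X\<^esub> l f ?ghx)" by (rule X.Comp_reassoc[OF straight_RComp(5)]) simp_all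
  also have "\<dots> = l h x \<cdot>\<^bsub>X\<^esub> (l (g \<cdot>\<^bsub>B\<^esub> f) ?hx \<cdot>\<^bsub>X\<^esub> RComp straight g f ?hx)" by (simp add: straight_RComp(5))
  also have "\<dots> = l (h \<cdot>\<^bsub>B\<^esub> g \<cdot>\<^bsub>B\<^esub> f) x \<cdot>\<^bsub>X\<^esub> (RComp straight h (g \<cdot>\<^bsub>B\<^esub> f) x \<cdot>\<^bsub>X\<^esub> RComp straight g f ?hx)"
    by (rule X.Comp_reassoc[OF straight_RComp(5)[symmetric]]) simp_all
  finally have "RComp straight (h \<cdot>\<^bsub>B\<^esub> g) f x \<cdot>\<^bsub>X\<^esub> FAr (pullback X B p f) ?c = RComp straight h (g \<cdot>\<^bsub>B\<^esub> f) x \<cdot>\<^bsub>X\<^esub> RComp straight g f ?hx"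
    using straight_RComp(1-4)[of f "h \<cdot>\<^bsub>B\<^esub> g" x]
    by - (rule cartesian_unique[of "l (h \<cdot>\<^bsub>B\<^esub> g \<cdot>\<^bsub>B\<^esub> f) x"]; simp)
  then show "RComp straight (h \<cdot>\<^bsub>B\<^esub> g) f x \<cdot>\<^bsub>ROb straight (Dom B f)\<^esub> FAr (RAr straight f) (RComp straight h g x) =
    RComp straight h (g \<cdot>\<^bsub>B\<^esub> f) x \<cdot>\<^bsub>ROb straight (Dom B f)\<^esub> RComp straight g f (FOb (RAr straight h) x)"
    by simp
next
  note [simp] = l pull
  fix f x assume f[simp]: "f \<in> Arr B" and "x \<in> Obj (ROb straight (Cod B f))"
  then have [simp]: "x \<in> Obj X" "FOb p x = Cod B f" by auto
  let ?fx = "Dom X (l f x)" and ?id = "Ident B (Dom B f)" and ?id' = "Ident B (Cod B f)"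
  let ?c = "RComp straight f ?id x" and ?c' = "RComp straight ?id' f x" and ?u = "RUnit straight (Cod B f) x"
  have c[simp]: "?c \<in> Arr X" "Dom X ?c = Dom X (l ?id ?fx)" "Cod X ?c = ?fx" "FAr p ?c = ?id"
    and c5: "l f x \<cdot>\<^bsub>X\<^esub> ?c = l f x \<cdot>\<^bsub>X\<^esub> l ?id ?fx"
    using straight_RComp[of ?id f x] by simp_all
  have c'[simp]: "?c' \<in> Arr X" "Dom X ?c' = Dom X (l f (Dom X (l ?id' x)))" "Cod X ?c' = ?fx" "FAr p ?c' = ?id"
    and c5': "l f x \<cdot>\<^bsub>X\<^esub> ?c' = l ?id' x \<cdot>\<^bsub>X\<^esub> l f (Dom X (l ?id' x))"
    using straight_RComp[of f ?id' x] by simp_all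
  have u[simp]: "?u \<in> Arr X" "Dom X ?u = x" "Cod X ?u = Dom X (l ?id' x)" "FAr p ?u = ?id'"
    and u5: "l ?id' x \<cdot>\<^bsub>X\<^esub> ?u = Ident X x" using straight_RUnit[of "Cod B f" x] by simp_all
  have v[simp]: "RUnit straight (Dom B f) ?fx \<in> Arr X" "Dom X (RUnit straight (Dom B f) ?fx) = ?fx"
    "Cod X (RUnit straight (Dom B f) ?fx) = Dom X (l ?id ?fx)" "FAr p (RUnit straight (Dom B f) ?fx) = ?id"
    and v5: "l ?id ?fx \<cdot>\<^bsub>X\<^esub> RUnit straight (Dom B f) ?fx = Ident X ?fx"
    using straight_RUnit[of "Dom B f" ?fx] by simp_all
  have "l f x \<cdot>\<^bsub>X\<^esub> (?c \<cdot>\<^bsub>X\<^esub> RUnit straight (Dom B f) ?fx) = l f x \<cdot>\<^bsub>X\<^esub> (l ?id ?fx \<cdot>\<^bsub>X\<^esub> RUnit straight (Dom B f) ?fx)"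
    by (rule X.Comp_reassoc[OF c5]) simp_all
  then have "?c \<cdot>\<^bsub>X\<^esub> RUnit straight (Dom B f) ?fx = Ident X ?fx"
    unfolding v5 by - (rule cartesian_unique[of "l f x"]; simp)
  then show "RComp straight f (Ident B (Dom B f)) x \<cdot>\<^bsub>ROb straight (Dom B f)\<^esub> RUnit straight (Dom B f) (FOb (RAr straight f) x) =
          Ident (ROb straight (Dom B f)) (FOb (RAr straight f) x)" by simp
  have "l f x \<cdot>\<^bsub>X\<^esub> (?c' \<cdot>\<^bsub>X\<^esub> FAr (pullback X B p f) ?u) = l ?id' x \<cdot>\<^bsub>X\<^esub> (l f (Dom X (l ?id' x)) \<cdot>\<^bsub>X\<^esub> FAr (pullback X B p f) ?u)"
    by (rule X.Comp_reassoc[OF c5']) simp_all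
  also have "\<dots> = l ?id' x \<cdot>\<^bsub>X\<^esub> (?u \<cdot>\<^bsub>X\<^esub> l f x)" using pull_lift[of f ?u] by simp
  also have "\<dots> = Ident X x \<cdot>\<^bsub>X\<^esub> l f x" by (rule X.Comp_reassoc'[OF u5]) simp_all
  finally have "?c' \<cdot>\<^bsub>X\<^esub> FAr (pullback X B p f) ?u = Ident X ?fx"
    by - (rule cartesian_unique[of "l f x"]; simp)
  then show "RComp straight (Ident B (Cod B f)) f x \<cdot>\<^bsub>ROb straight (Dom B f)\<^esub> FAr (RAr straight f) (RUnit straight (Cod B f) x) =
          Ident (ROb straight (Dom B f)) (FOb (RAr straight f) x)" by simp
qed

sublocale R: pseudo_functor_on B straight by unfold_locales (rule straight_pseudo)

definition total where
  "total = \<lparr>FOb = \<lambda>(P, x)\<in>Obj R.el. x, FAr = \<lambda>(s, t, f, \<alpha>)\<in>Arr R.el. l f (snd t) \<cdot>\<^bsub>X\<^esub> \<alpha>\<rparr>"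

lemma total_simps [simp]:
  "(P, x) \<in> Obj R.el \<Longrightarrow> FOb total (P, x) = x"
  "R.arr f x \<alpha> \<in> Arr R.el \<Longrightarrow> FAr total (R.arr f x \<alpha>) = l f x \<cdot>\<^bsub>X\<^esub> \<alpha>"
  by (simp_all add: total_def R.arr_def)

lemma R_Obj_cases:
  assumes "z \<in> Obj R.el"
  obtains P x where "z = (P, x)" "P \<in> Obj B" "x \<in> Obj X" "FOb p x = P"
  using R.el_Obj_cases[OF assms] by (metis (mono_tags, lifting) fibre_simps(1) mem_Collect_eq straight_simps(1))

lemma R_Arr_cases:
  assumes "u \<in> Arr R.el"
  obtains f x \<alpha> where "u = R.arr f x \<alpha>" "f \<in> Arr B" "x \<in> Obj X" "FOb p x = Cod B f" "\<alpha> \<in> Arr X"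
    "FAr p \<alpha> = Ident B (Dom B f)" "Cod X \<alpha> = Dom X (l f x)"
proof (rule R.el_Arr_cases[OF assms])
  fix f x \<alpha>
  assume "u = R.arr f x \<alpha>" "f \<in> Arr B" "x \<in> Obj (ROb straight (Cod B f))" "\<alpha> \<in> Arr (ROb straight (Dom B f))"
    "Cod (ROb straight (Dom B f)) \<alpha> = FOb (RAr straight f) x"
  then show thesis by (intro that[of f x \<alpha>]) (auto simp: pull)
qed

lemma total_over: "functor_over (R.el, R.\<pi>) (X, p) total"
proof (rule functor_overI[where B = B])
  show "is_functor (fst (R.el, R.\<pi>)) (fst (X, p)) total"
    unfolding fst_conv
  proof (rule is_functorI)
    note [simp] = l pull
    fix x assume x: "x \<in> Obj R.el"
    then show "FOb total x \<in> Obj X" by - (erule R.el_Obj_cases, simp)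
    obtain P y where x': "x = (P, y)" "P \<in> Obj B" "y \<in> Obj X" "FOb p y = P" using R_Obj_cases[OF x] by blast
    have "R.arr (Ident B P) y (RUnit straight P y) \<in> Arr R.el"
      using R.el.Ident_in[OF x] x' by (simp add: R.arr_Ident)
    then show "FAr total (Ident R.el x) = Ident X (FOb total x)"
      using x' straight_RUnit[of P y] by (simp add: R.arr_Ident)
  next
    note [simp] = l pull
    fix u assume u: "u \<in> Arr R.el"
    obtain f x \<alpha> where u': "u = R.arr f x \<alpha>" and f: "f \<in> Arr B" "x \<in> Obj X" "FOb p x = Cod B f" "\<alpha> \<in> Arr X" "FAr p \<alpha> = Ident B (Dom B f)"
      "Cod X \<alpha> = Dom X (l f x)" using R_Arr_cases[OF u] by blast
    note [simp] = f
    have [simp]: "FOb p (Dom X \<alpha>) = Dom B f" using vert_Ob[of \<alpha> "Dom B f"] by simp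
    show "FAr total u \<in> Arr X \<and> Dom X (FAr total u) = FOb total (Dom R.el u) \<and> Cod X (FAr total u) = FOb total (Cod R.el u)"
      using u by (simp add: u')
    fix v assume v: "v \<in> Arr R.el" and c: "Cod R.el u = Dom R.el v"
    obtain g y \<beta> where v': "v = R.arr g y \<beta>" and g: "g \<in> Arr B" "y \<in> Obj X" "FOb p y = Cod B g" "\<beta> \<in> Arr X" "FAr p \<beta> = Ident B (Dom B g)"
      "Cod X \<beta> = Dom X (l g y)" using R_Arr_cases[OF v] by blast
    note [simp] = g
    have [simp]: "Cod B f = Dom B g" and x[simp]: "Dom X \<beta> = x" using c by (auto simp: u' v')
    note [simp] = straight_RComp(1-4)[of f g y]
    have vu: "v \<cdot>\<^bsub>R.el\<^esub> u \<in> Arr R.el" using u v c by simp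
    have e: "v \<cdot>\<^bsub>R.el\<^esub> u = R.arr (g \<cdot>\<^bsub>B\<^esub> f) y (RComp straight g f y \<cdot>\<^bsub>X\<^esub> (FAr (pullback X B p f) \<beta> \<cdot>\<^bsub>X\<^esub> \<alpha>))"
      using u v unfolding u' v' by (subst R.arr_Comp) simp_all
    have "FAr total (v \<cdot>\<^bsub>R.el\<^esub> u) = l (g \<cdot>\<^bsub>B\<^esub> f) y \<cdot>\<^bsub>X\<^esub> (RComp straight g f y \<cdot>\<^bsub>X\<^esub> (FAr (pullback X B p f) \<beta> \<cdot>\<^bsub>X\<^esub> \<alpha>))"
      using vu unfolding e by (rule total_simps)
    also have "\<dots> = l g y \<cdot>\<^bsub>X\<^esub> (l f (Dom X (l g y)) \<cdot>\<^bsub>X\<^esub> (FAr (pullback X B p f) \<beta> \<cdot>\<^bsub>X\<^esub> \<alpha>))"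
      by (rule X.Comp_reassoc[OF straight_RComp(5)]) simp_all
    \<comment> \<open>The defining square of the pullback functor carries \<open>\<beta>\<close>
      past the lift of \<open>f\<close>.\<close>
    also have "l f (Dom X (l g y)) \<cdot>\<^bsub>X\<^esub> (FAr (pullback X B p f) \<beta> \<cdot>\<^bsub>X\<^esub> \<alpha>) = \<beta> \<cdot>\<^bsub>X\<^esub> (l f x \<cdot>\<^bsub>X\<^esub> \<alpha>)"
      using pull_lift[of f \<beta>] by (intro X.Comp_reassoc) simp_all
    finally show "FAr total (v \<cdot>\<^bsub>R.el\<^esub> u) = FAr total v \<cdot>\<^bsub>X\<^esub> FAr total u"
      using u v by (simp add: u' v')
  qed (auto simp: total_def R.el_category X.category_axioms)
next
  fix x assume "x \<in> Obj (fst (R.el, R.\<pi>))"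
  then show "FOb (snd (X, p)) (FOb total x) = FOb (snd (R.el, R.\<pi>)) x"
    by (auto elim!: R.el_Obj_cases)
next
  fix u assume "u \<in> Arr (fst (R.el, R.\<pi>))"
  then have u: "u \<in> Arr R.el" by simp
  then show "FAr (snd (X, p)) (FAr total u) = FAr (snd (R.el, R.\<pi>)) u"
    by - (frule R.el_Arr_cases, auto simp: l pull)
qed (use proj R.proj_functor in simp_all)

text \<open>An arrow of \<open>X\<close> is a vertical arrow followed by the chosen lift of its
  image in exactly one way, so \<open>total\<close> is bijective on arrows and the comparison is a
  strict isomorphism.\<close>

lemma straight_iso: "isomorphic_over (R.el, R.\<pi>) (X, p)"
proof (rule isomorphic_overI[OF _ _ total_over])
  show "is_functor (fst (R.el, R.\<pi>)) B (snd (R.el, R.\<pi>))" "is_functor (fst (X, p)) B (snd (X, p))"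
    using proj R.proj_functor by simp_all
  show "bij_betw (FOb total) (Obj (fst (R.el, R.\<pi>))) (Obj (fst (X, p)))"
    by (rule bij_betwI[where g = "\<lambda>x. (FOb p x, x)"]) (auto elim!: R.el_Obj_cases)
  note [simp] = l pull
  have inj: "inj_on (FAr total) (Arr R.el)"
  proof (rule inj_onI)
    fix u v assume u: "u \<in> Arr R.el" and v: "v \<in> Arr R.el" and e: "FAr total u = FAr total v"
    obtain f x \<alpha> where u': "u = R.arr f x \<alpha>" and f: "f \<in> Arr B" "x \<in> Obj X" "FOb p x = Cod B f" "\<alpha> \<in> Arr X" "FAr p \<alpha> = Ident B (Dom B f)"
      "Cod X \<alpha> = Dom X (l f x)" using R_Arr_cases[OF u] by blast
    obtain g y \<beta> where v': "v = R.arr g y \<beta>" and g: "g \<in> Arr B" "y \<in> Obj X" "FOb p y = Cod B g" "\<beta> \<in> Arr X" "FAr p \<beta> = Ident B (Dom B g)"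
      "Cod X \<beta> = Dom X (l g y)" using R_Arr_cases[OF v] by blast
    have e': "l f x \<cdot>\<^bsub>X\<^esub> \<alpha> = l g y \<cdot>\<^bsub>X\<^esub> \<beta>" using e u v by (simp add: u' v')
    \<comment> \<open>Base arrow, target and source of the composite reveal \<open>f\<close>,
      \<open>x\<close> and the source of \<open>\<alpha>\<close>. The lift being cartesian,
      \<open>\<alpha> = \<beta>\<close> follows.\<close>
    have fg: "f = g" using arg_cong[OF e', of "FAr p"] f g by simp
    have xy: "x = y" using arg_cong[OF e', of "Cod X"] f g by simp
    have d: "Dom X \<alpha> = Dom X \<beta>" using arg_cong[OF e', of "Dom X"] f g by simp
    have "\<alpha> = \<beta>" by (rule cartesian_unique[of "l f x"]) (use f g d fg xy e' in simp_all)
    then show "u = v" by (simp add: u' v' fg xy)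
  qed
  have "u \<in> FAr total ` Arr R.el" if u[simp]: "u \<in> Arr X" for u
  proof -
    let ?f = "FAr p u" and ?x = "Cod X u"
    note v = vfill[of "l ?f ?x" u]
    have "R.arr ?f ?x (vfill (l ?f ?x) u) \<in> Arr R.el" using v by simp
    moreover from this have "u = FAr total (R.arr ?f ?x (vfill (l ?f ?x) u))" using v by simp
    ultimately show ?thesis by blast
  qed
  moreover have "FAr total u \<in> Arr X" if "u \<in> Arr R.el" for u
    using functor_Ar[OF functor_over_functor[OF total_over]] that by simp
  ultimately show "bij_betw (FAr total) (Arr (fst (R.el, R.\<pi>))) (Arr (fst (X, p)))"
    using inj by (auto simp: bij_betw_def)
qed

end

lemma grothendieck_surjective:
  fixes S :: "('a::infinite, 'o, 'm) cover"
  assumes S: "S \<in> Obj RFib"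
  shows "\<exists>R \<in> Obj DRSp. isomorphic_over (FOb grothendieck (R :: ('a, 'o, 'm) species)) S"
proof -
  obtain E p where S': "S = (E, p)" by (cases S)
  interpret right_fibration_over E CPos p
    using S by (simp add: S' RFib_simps right_fibration_over_def right_fibration_over_axioms_def category_over_def
        right_fibration_def cartesian_fibration_over_def)
  have "directed_restriction_species straight"
    using S straight_pseudo by (simp add: S' RFib_simps directed_restriction_species_def)
  then show ?thesis using straight_iso by (auto simp: S' DRSp_simps intro!: bexI[where x = straight])
qed

text \<open>The equivalence of species and right fibrations is expressed by full faithfulness
  together with reaching every right fibration up to isomorphism over the base. As
  \<open>grothendieck\<close> enlarges the object and arrow types, that isomorphism compares
  fibrations of different types.\<close>

theorem proposition10p6:
  shows
    "is_functor (DRSp :: (('a::infinite, 'o, 'm) species, ('a, 'o, 'm) species_ar) cat) RFib grothendieck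
   \<and> fully_faithful (DRSp :: (('a, 'o, 'm) species, ('a, 'o, 'm) species_ar) cat) RFib grothendieck
   \<and> (\<forall>S \<in> Obj (RFib :: (('a, 'o, 'm) cover, ('a, 'o, 'm) cover_ar) cat).
        \<exists>R \<in> Obj (DRSp :: (('a, 'o, 'm) species, ('a, 'o, 'm) species_ar) cat).
          isomorphic_over (FOb grothendieck R) S)
   \<and> is_functor (RFib :: (('a, 'o, 'm) cover, ('a, 'o, 'm) cover_ar) cat) IesqSesq comma_functor
   \<and> is_functor (DRSp :: (('a, 'o, 'm) species, ('a, 'o, 'm) species_ar) cat) IesqSesq
       (comp_func DRSp comma_functor grothendieck)
   \<and> (\<forall>R. directed_restriction_species (R :: ('a, 'o, 'm) species) \<longrightarrow>
        (let S = (elements CPos R, elements_proj CPos R) in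
           FOb (comp_func DRSp comma_functor grothendieck) R = (comma S, comma_proj S)
         \<and> sesquicartesian (comma S) (comma_proj S) \<and> iesq (comma S) (comma_proj S)))"
proof (intro conjI ballI allI impI)
  show "is_functor (DRSp :: (('a, 'o, 'm) species, ('a, 'o, 'm) species_ar) cat) IesqSesq
       (comp_func DRSp comma_functor grothendieck)"
    by (rule comp_functor[OF grothendieck_functor comma_functor_functor])
  fix R :: "('a, 'o, 'm) species" assume R: "directed_restriction_species R"
  have "FOb (comp_func DRSp comma_functor grothendieck) R =
    (comma (elements CPos R, elements_proj CPos R), comma_proj (elements CPos R, elements_proj CPos R))"
    using R elements_RFib[OF R] by (simp add: DRSp_simps(1) comma_functor_def Let_def)
  then show "let S = (elements CPos R, elements_proj CPos R) in
           FOb (comp_func DRSp comma_functor grothendieck) R = (comma S, comma_proj S)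
         \<and> sesquicartesian (comma S) (comma_proj S) \<and> iesq (comma S) (comma_proj S)"
    using comma_Obj[OF elements_RFib[OF R]] by (simp add: IesqSesq_simps(1))
qed (fact grothendieck_functor grothendieck_fully_faithful grothendieck_surjective comma_functor_functor)+

end
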